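(* Let $\mu\in\mathcal I(E)$ and let $\nu\in\mathcal M(E)$ be its corresponding Lévy measure. The following assertions are equivalent. (1) $\mu$ is locally reducible. (2) $\widetilde{\mathrm e}(\nu|_K)(E_K)=1$ for some $K\in\mathcal K_0^s(E)$ with $\nu(K^c)<\infty$, i.e. $\nu$ is locally reducible. (3) The function $$\varphi(a)=\exp\Big(\int_{E_K}\big(e^{i\langle x,a\rangle}-1-i\langle x,a\rangle\mathbf 1_K(x)\big)\,d\nu(x)\Big),\quad a\in E',$$ is the Fourier transform of some probability measure on $\mathcal B(E_K)$ for some $K\in\mathcal K_0^s(E)$ with $\nu(K^c)<\infty$. (4) The restriction of $\nu|_K$ to the subspace $(E_K,\|\cdot\|_K)$ is a Lévy measure for some $K\in\mathcal K_0^s(E)$ with $\nu(K^c)<\infty$. (5) The restriction of $\nu|_K$ to the subspace $(E_K,\tau)$ is a Lévy measure for some $K\in\mathcal K_0^s(E)$ with $\nu(K^c)<\infty$. (6) For some $K\in\mathcal K_0^s(E)$ with $\nu(K^c)<\infty$ the following holds: there are $x_\varrho\in E$ such that for every $\varepsilon>0$ there exists $n\in\mathbb N$ such that for all finite measures $\varrho\le\nu|_K$ one has $$\mathrm e(\varrho)*\delta_{x_\varrho}(n\cdot K)>1-\varepsilon.$$ Furthermore, if there is $K\in\mathcal K_0^s(E)$ such that one of the assertions (2)–(6) holds (with this $K$), one can take the same set $K$ also in all the other assertions (2)–(6).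
   Context: Standing assumptions: $E$ is a real complete locally convex space, with topology $\tau$, which is a Suslin space (a Hausdorff space that is a continuous image of a Polish space). $E'$ is its topological dual, $\mathcal B(E)$ its Borel $\sigma$-algebra, $\langle x,a\rangle=a(x)$. $\mathcal M(E)$, $\mathcal M^b(E)$, $\mathcal M^1(E)$ are the nonnegative, the finite nonnegative, and the probability Borel measures on $E$. $\mu|_A(B):=\mu(A\cap B)$. $\widehat\mu(a)=\int_E e^{i\langle x,a\rangle}\,d\mu(x)$. $\delta_x$ is the Dirac measure, $*$ is convolution. Infinite divisibility. $\mathcal I(E)$ is the set of $\mu\in\mathcal M^1(E)$ such that for each $n\in\mathbb N$ there is $\mu_n\in\mathcal M^1(E)$ with $\mu=\mu_n^{*n}$. Every $\mu\in\mathcal I(E)$ has Fourier transform $\exp\big(i\langle\gamma,a\rangle-\frac12\langle Qa,a\rangle+\int_E(e^{i\langle x,a\rangle}-1-i\langle x,a\rangle\mathbf 1_H(x))\,d\nu(x)\big)$ with $\gamma\in E$, $Q:E'\to E$ linear symmetric positive definite, $H$ an absolutely convex compact set, and a Lévy measure $\nu$ uniquely determined by $\mu$ (the corresponding Lévy measure). Lévy measures. For $\mu\in\mathcal M^b(E)$, $\mathrm e(\mu):=e^{-\mu(E)}\sum_{n\ge0}\mu^{*n}/n!$. A family of finite measures is uniformly tight if their total masses are bounded and for every $\varepsilon>0$ there is a compact $C$ whose complement has measure $<\varepsilon$ for all members; it is shift tight if suitable translates $\mu*\delta_{x_\mu}$ form a uniformly tight family. A Borel measure $\nu$ on $E$ (or,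 likewise, on another locally convex Suslin space such as $(E_K,\|\cdot\|_K)$ or $E_K$ with the topology induced by $\tau$) is a Lévy measure if $\nu(\{0\})=0$ and there is an upwards directed family $(\mu_i)$ of finite measures with $\mu_i\le\nu$, $\sup_i\mu_i=\nu$ setwise, and $(\mathrm e(\mu_i))_i$ shift tight. A generalised Poisson exponential $\widetilde{\mathrm e}(\nu)$ of a Lévy measure $\nu$ is a weak accumulation point of the family $(\mathrm e(\mu)*\delta_{x_\mu})_{\mu\le\nu}$ ($\mu$ finite, directed by $\le$), where the $x_\mu\in E$ are chosen so that this family is uniformly tight; it is unique up to translations, and "$\widetilde{\mathrm e}(\nu|_K)(E_K)=1$" means that this holds for some generalised Poisson exponential of $\nu|_K$. Disks. A disk is a bounded absolutely convex set. For a closed disk $B$, $E_B=\bigcup_n nB$ is a Banach space with the gauge norm $\|x\|_B=\inf\{\rho>0:x\in\rho B\}$. $\mathcal K_0^s(E)$ is the set of compact disks $B$ for which $(E_B,\|\cdot\|_B)$ is separable; for such $B$ the Borel sets of $(E_B,\|\cdot\|_B)$ and of $(E_B,\tau)$ coincide and are denoted $\mathcal B(E_B)$. Local reducibility. A Lévy measure $\nu$ is locally reducible if there is $K\in\mathcal K_0^s(E)$ with $\nu(K^c)<\infty$ such that there is a generalised Poisson exponential of $\nu|_K$ with $\widetilde{\mathrm e}(\nu|_K)(E_K)=1$. An infinitely divisible distribution is locally reducible if its corresponding Lévy measure is. *)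

theory Defs
  imports "HOL-Probability.Probability"
begin

section \<open>Locally convex spaces\<close>

text \<open>Hausdorff real locally convex spaces. The class \<open>uniform_topological_group_add\<close> forces the
  uniformity to be the translation-invariant one of the topology, so that the library class
  \<open>complete_uniform_space\<close> expresses completeness (of Cauchy filters).\<close>

class locally_convex_space = real_vector + uniform_topological_group_add + t2_space +
  assumes tendsto_scaleR_Pair_lc:
    "((\<lambda>p. fst p *\<^sub>R snd p) \<longlongrightarrow> r *\<^sub>R x) (nhds r \<times>\<^sub>F nhds x)"
  and convex_nhds_0:
    "open U \<Longrightarrow> 0 \<in> U \<Longrightarrow> \<exists>V. open V \<and> 0 \<in> V \<and> V \<subseteq> U \<and>
       (\<forall>x\<in>V. \<forall>y\<in>V. \<forall>u\<ge>0. \<forall>v\<ge>0. u + v = 1 \<longrightarrow> u *\<^sub>R x + v *\<^sub>R y \<in> V)"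

definition dual_space :: "('a::locally_convex_space \<Rightarrow> real) set" where
  "dual_space = {a. linear a \<and> continuous_on UNIV a}"

definition absolutely_convex :: "'a::real_vector set \<Rightarrow> bool" where
  "absolutely_convex B \<longleftrightarrow> B \<noteq> {} \<and>
     (\<forall>x\<in>B. \<forall>y\<in>B. \<forall>s t. \<bar>s\<bar> + \<bar>t\<bar> \<le> 1 \<longrightarrow> s *\<^sub>R x + t *\<^sub>R y \<in> B)"

definition tvs_bounded :: "'a::locally_convex_space set \<Rightarrow> bool" where
  "tvs_bounded B \<longleftrightarrow>
     (\<forall>U. open U \<and> 0 \<in> U \<longrightarrow> (\<exists>t>0. \<forall>s\<ge>t. B \<subseteq> (*\<^sub>R) s ` U))"

definition disk :: "'a::locally_convex_space set \<Rightarrow> bool" where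
  "disk B \<longleftrightarrow> tvs_bounded B \<and> absolutely_convex B"

definition disk_span :: "'a::real_vector set \<Rightarrow> 'a set" where
  "disk_span B = (\<Union>n::nat. (*\<^sub>R) (real n) ` B)"

text \<open>The value 0 off \<open>disk_span B\<close> is a dummy; the locale \<open>Metric_space\<close> wants the distance
  to be nonnegative on the whole type.\<close>

definition gauge_norm :: "'a::real_vector set \<Rightarrow> 'a \<Rightarrow> real" where
  "gauge_norm B x = (if x \<in> disk_span B then Inf {\<rho>. 0 < \<rho> \<and> x \<in> (*\<^sub>R) \<rho> ` B} else 0)"

definition gauge_topology :: "'a::real_vector set \<Rightarrow> 'a topology" where
  "gauge_topology B = Metric_space.mtopology (disk_span B) (\<lambda>x y. gauge_norm B (x - y))"

definition separable_compact_disks :: "'a::locally_convex_space set set" where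
  "separable_compact_disks = {B. disk B \<and> compact B \<and> separable_space (gauge_topology B)}"


section \<open>Borel measures on a topological subspace of a vector space\<close>

text \<open>The notions below are relative to a topology \<open>T\<close> whose carrier is a linear subspace of
  \<open>'a\<close>. They are used for \<open>euclidean\<close> (the space \<open>E\<close> itself, with its own topology), for
  \<open>gauge_topology K\<close> and for \<open>subtopology euclidean (disk_span K)\<close>.\<close>

definition borel_of :: "'a topology \<Rightarrow> 'a measure" where
  "borel_of T = sigma (topspace T) {U. openin T U}"

lemma space_borel_of [simp]: "space (borel_of T) = topspace T"
  by (simp add: borel_of_def space_measure_of_conv)

lemma borel_of_euclidean [simp]: "borel_of euclidean = borel"
  by (simp add: borel_of_def borel_def)

definition finite_borel_measures :: "'a topology \<Rightarrow> 'a measure set" where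
  "finite_borel_measures T = {M. sets M = sets (borel_of T) \<and> finite_measure M}"

definition prob_borel_measures :: "'a topology \<Rightarrow> 'a measure set" where
  "prob_borel_measures T = {M. sets M = sets (borel_of T) \<and> prob_space M}"

text \<open>For measures on the same sigma-algebra, \<open>\<le>\<close> is the setwise order.\<close>

definition finite_minorants :: "'a topology \<Rightarrow> 'a measure \<Rightarrow> 'a measure set" where
  "finite_minorants T \<nu> = {M \<in> finite_borel_measures T. sets M = sets \<nu> \<and> M \<le> \<nu>}"

definition meas_restr :: "'a measure \<Rightarrow> 'a set \<Rightarrow> 'a measure" where
  "meas_restr \<mu> A = density \<mu> (indicator A)"

lemma emeasure_meas_restr:
  "A \<in> sets \<mu> \<Longrightarrow> B \<in> sets \<mu> \<Longrightarrow> emeasure (meas_restr \<mu> A) B = emeasure \<mu> (A \<inter> B)"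
  unfolding meas_restr_def by (subst emeasure_density) (auto simp flip: indicator_inter_arith)

text \<open>The library's \<open>convolution\<close> is confined to ordered Euclidean spaces. In the spaces considered
  here, being Suslin, the product of the Borel sigma-algebras is the Borel sigma-algebra of the
  product, so addition is measurable.\<close>

definition conv_meas :: "'a topology \<Rightarrow> 'a::real_vector measure \<Rightarrow> 'a measure \<Rightarrow> 'a measure" where
  "conv_meas T M N = distr (M \<Otimes>\<^sub>M N) (borel_of T) (\<lambda>(x, y). x + y)"

primrec conv_power :: "'a topology \<Rightarrow> 'a::real_vector measure \<Rightarrow> nat \<Rightarrow> 'a measure" where
  "conv_power T M 0 = return (borel_of T) 0"
| "conv_power T M (Suc n) = conv_meas T M (conv_power T M n)"

definition translate_meas :: "'a topology \<Rightarrow> 'a::real_vector measure \<Rightarrow> 'a \<Rightarrow> 'a measure" where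
  "translate_meas T M x = conv_meas T M (return (borel_of T) x)"

definition poisson_exp :: "'a topology \<Rightarrow> 'a::real_vector measure \<Rightarrow> 'a measure" where
  "poisson_exp T M = measure_of (topspace T) (sets (borel_of T))
     (\<lambda>A. \<Sum>n. ennreal (exp (- measure M (topspace T)) / fact n) * emeasure (conv_power T M n) A)"

definition uniformly_tight :: "'a topology \<Rightarrow> 'a measure set \<Rightarrow> bool" where
  "uniformly_tight T F \<longleftrightarrow> F \<subseteq> finite_borel_measures T \<and>
     (\<exists>c. \<forall>M\<in>F. measure M (topspace T) \<le> c) \<and>
     (\<forall>\<epsilon>>0. \<exists>C. compactin T C \<and> (\<forall>M\<in>F. measure M (topspace T - C) < \<epsilon>))"

definition shift_tight :: "'a topology \<Rightarrow> 'a::real_vector measure set \<Rightarrow> bool" where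
  "shift_tight T F \<longleftrightarrow> (\<exists>x. (\<forall>M\<in>F. x M \<in> topspace T) \<and>
     uniformly_tight T ((\<lambda>M. translate_meas T M (x M)) ` F))"

definition levy_measure :: "'a topology \<Rightarrow> 'a::real_vector measure \<Rightarrow> bool" where
  "levy_measure T \<nu> \<longleftrightarrow> sets \<nu> = sets (borel_of T) \<and> emeasure \<nu> {0} = 0 \<and>
     (\<exists>F. F \<noteq> {} \<and> F \<subseteq> finite_minorants T \<nu> \<and>
        (\<forall>M\<in>F. \<forall>N\<in>F. \<exists>L\<in>F. M \<le> L \<and> N \<le> L) \<and>
        (\<forall>A\<in>sets \<nu>. emeasure \<nu> A = (SUP M\<in>F. emeasure M A)) \<and>
        shift_tight T (poisson_exp T ` F))"

definition weak_topology :: "'a topology \<Rightarrow> 'a measure topology" where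
  "weak_topology T = topology_generated_by
     {{M \<in> finite_borel_measures T. (\<integral>x. f x \<partial>M) \<in> U} | f U.
        continuous_map T euclideanreal f \<and> bounded (f ` topspace T) \<and> open U}"

text \<open>\<open>gen_poisson_exp T \<nu> \<rho>\<close>: \<open>\<rho>\<close> is one of the generalised Poisson exponentials of \<open>\<nu>\<close>, i.e.
  a weak cluster point of a uniformly tight net of translates indexed by the finite minorants.\<close>

definition gen_poisson_exp ::
    "'a topology \<Rightarrow> 'a::real_vector measure \<Rightarrow> 'a measure \<Rightarrow> bool" where
  "gen_poisson_exp T \<nu> \<rho> \<longleftrightarrow> levy_measure T \<nu> \<and> \<rho> \<in> finite_borel_measures T \<and>
     (\<exists>x. (\<forall>M\<in>finite_minorants T \<nu>. x M \<in> topspace T) \<and>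
        uniformly_tight T
          ((\<lambda>M. translate_meas T (poisson_exp T M) (x M)) ` finite_minorants T \<nu>) \<and>
        (\<forall>U. openin (weak_topology T) U \<and> \<rho> \<in> U \<longrightarrow>
           (\<forall>M\<in>finite_minorants T \<nu>. \<exists>N\<in>finite_minorants T \<nu>.
              M \<le> N \<and> translate_meas T (poisson_exp T N) (x N) \<in> U)))"

definition fourier :: "'a measure \<Rightarrow> ('a \<Rightarrow> real) \<Rightarrow> complex" where
  "fourier \<mu> a = (CLINT x|\<mu>. iexp (a x))"


section \<open>Infinite divisibility and local reducibility\<close>

definition infinitely_divisible :: "'a::locally_convex_space measure set" where
  "infinitely_divisible = {\<mu> \<in> prob_borel_measures euclidean.
     \<forall>n\<ge>1. \<exists>M\<in>prob_borel_measures euclidean. \<mu> = conv_power euclidean M n}"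

definition symmetric_positive :: "(('a::locally_convex_space \<Rightarrow> real) \<Rightarrow> 'a) \<Rightarrow> bool" where
  "symmetric_positive Q \<longleftrightarrow>
     (\<forall>a\<in>dual_space. \<forall>b\<in>dual_space. Q (\<lambda>x. a x + b x) = Q a + Q b) \<and>
     (\<forall>a\<in>dual_space. \<forall>c. Q (\<lambda>x. c * a x) = c *\<^sub>R Q a) \<and>
     (\<forall>a\<in>dual_space. \<forall>b\<in>dual_space. b (Q a) = a (Q b)) \<and>
     (\<forall>a\<in>dual_space. 0 \<le> a (Q a))"

definition compensated :: "'a set \<Rightarrow> ('a \<Rightarrow> real) \<Rightarrow> 'a \<Rightarrow> complex" where
  "compensated H a x = iexp (a x) - 1 - \<i> * of_real (a x) * indicator H x"

text \<open>\<open>\<nu>\<close> is the Levy measure in a Levy-Khinchin representation of \<open>\<mu>\<close>. Integrability is spelled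
  out because the Bochner integral of a non-integrable function is 0.\<close>

definition corresponding_levy_measure ::
    "'a::locally_convex_space measure \<Rightarrow> 'a measure \<Rightarrow> bool" where
  "corresponding_levy_measure \<mu> \<nu> \<longleftrightarrow> levy_measure euclidean \<nu> \<and>
     (\<exists>\<gamma> Q H. symmetric_positive Q \<and> absolutely_convex H \<and> compact H \<and>
        (\<forall>a\<in>dual_space. integrable \<nu> (compensated H a) \<and>
           fourier \<mu> a = exp (\<i> * of_real (a \<gamma>) - of_real (a (Q a)) / 2
                               + (CLINT x|\<nu>. compensated H a x))))"

definition locally_reducible_levy :: "'a::locally_convex_space measure \<Rightarrow> bool" where
  "locally_reducible_levy \<nu> \<longleftrightarrow> levy_measure euclidean \<nu> \<and>
     (\<exists>K\<in>separable_compact_disks. emeasure \<nu> (- K) < \<infinity> \<and>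
        (\<exists>\<rho>. gen_poisson_exp euclidean (meas_restr \<nu> K) \<rho> \<and> emeasure \<rho> (disk_span K) = 1))"

definition locally_reducible :: "'a::locally_convex_space measure \<Rightarrow> bool" where
  "locally_reducible \<mu> \<longleftrightarrow> \<mu> \<in> infinitely_divisible \<and>
     (\<exists>\<nu>. corresponding_levy_measure \<mu> \<nu> \<and> locally_reducible_levy \<nu>)"

end

theory Submission
  imports Defs "HOL-Real_Asymp.Real_Asymp"
begin

text \<open>For fixed \<open>K\<close>, all assertions are equivalent to one condition: the Poisson exponentials of the
  finite minorants \<open>M\<close> of \<open>\<nu>|\<^sub>K\<close>, centred at the barycentre of \<open>M\<close>, have mass \<open>> 1 - \<epsilon>\<close> on \<open>n K\<close>,
  with \<open>n\<close> independent of \<open>M\<close>. Functionals \<open>a\<^sub>k\<close> separating points, scaled so that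
  \<open>\<Sum>\<^sub>k a\<^sub>k\<^sup>2\<close> is \<open>\<nu>|\<^sub>K\<close>-integrable, map \<open>E\<close> injectively into the sequence space.
  There the independent sum of centred Poisson exponentials of the pieces of \<open>\<nu>|\<^sub>K - M\<close> converges almost surely,
  so a law with the Fourier transform belonging to \<open>\<nu>|\<^sub>K\<close> has the centred exponential of \<open>M\<close> as a factor.
  A factor inherits tightness up to a shift; since the modulus of a Fourier transform ignores shifts, it bounds
  this shift in every direction of the dual, hence by Hahn--Banach by a multiple of \<open>K\<close>. Conversely, the condition
  yields a limit law carried by \<open>E\<^sub>K\<close>, and Ulam's argument in the separable Banach space \<open>E\<^sub>K\<close> makes it, and
  then its factors, tight for the gauge norm. Finally, \<open>\<nu>|\<^sub>K\<close> depends only on \<open>\<mu>\<close>: fourth differences of the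
  Levy exponent are Fourier transforms of finite measures, which are continuous, so the ambiguity of the complex
  logarithm disappears.\<close>

section \<open>Trigonometric polynomials and weak convergence\<close>

text \<open>\<open>E\<close> need be neither metrizable nor Polish, so no limit law is formed there
  directly. The sequence space is Polish, and the countably many characters given by
  \<open>rcomb\<close> separate its points; laws are built and identified there and pulled back to
  \<open>E\<close> only from multiples of \<open>K\<close>, on which the continuous injection
  \<open>T\<close> is a homeomorphism onto its image by compactness. A shift found in the sequence
  space is therefore shown to be some \<open>T y\<close> before the geometry of \<open>K\<close> is
  used. Barycentres are the right centring for two reasons: they lie in the span of
  \<open>K\<close>, and they turn the exponent into the integral of
  \<open>iexp u - 1 - \<i> * u\<close>, which is quadratic at 0 and keeps its meaning for an
  infinite measure. Convergence of minorants is measured by one number, the integral of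
  \<open>sq_sum\<close>, so that sequences can replace the net of all minorants. The definition of
  local reducibility admits any Levy measure corresponding to \<open>\<mu>\<close>; this is why
  uniqueness enters, and only on \<open>K\<close> and for the mass off \<open>K\<close>.\<close>

inductive_set trig_polynomials :: "('x \<Rightarrow> real) set \<Rightarrow> ('x \<Rightarrow> real) set" for G where
  base: "g \<in> G \<Longrightarrow> (\<lambda>x. c * cos (g x + d)) \<in> trig_polynomials G"
| add: "p \<in> trig_polynomials G \<Longrightarrow> q \<in> trig_polynomials G \<Longrightarrow> (\<lambda>x. p x + q x) \<in> trig_polynomials G"

lemma trig_polynomials_continuous:
  fixes G :: "('x::t2_space \<Rightarrow> real) set"
  assumes "\<And>g. g \<in> G \<Longrightarrow> continuous_on UNIV g" "p \<in> trig_polynomials G"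
  shows "continuous_on UNIV p"
  using assms(2)
proof induction
  case (base g c d)
  have "continuous_on UNIV g" by (rule assms(1)[OF base])
  then show ?case by (intro continuous_intros)
qed (intro continuous_intros)

lemma trig_polynomials_bounded:
  assumes "p \<in> trig_polynomials G"
  shows "\<exists>B>0. \<forall>x. \<bar>p x\<bar> \<le> B"
  using assms
proof induction
  case (base g c d)
  have "\<bar>c * cos (g x + d)\<bar> \<le> \<bar>c\<bar> + 1" for x
    using mult_left_mono[OF abs_cos_le_one[of "g x + d"], of "\<bar>c\<bar>"] by (simp add: abs_mult)
  then show ?case by (intro exI[of _ "\<bar>c\<bar> + 1"]) auto
next
  case (add p q)
  then obtain B C where "B > 0" "C > 0" "\<forall>x. \<bar>p x\<bar> \<le> B" "\<forall>x. \<bar>q x\<bar> \<le> C" by auto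
  then have "\<bar>p x + q x\<bar> \<le> B + C" for x
    using abs_triangle_ineq[of "p x" "q x"] by (metis add_mono order_trans)
  with \<open>B > 0\<close> \<open>C > 0\<close> show ?case by (intro exI[of _ "B + C"]) auto
qed

text \<open>The product-to-sum formula turns a product of two generators into generators for
  \<open>g + h\<close> and \<open>g - h\<close>; this is what closure of \<open>G\<close> under
  addition and negation is for. The free phase \<open>d\<close> in the generators keeps the formula
  inside the set.\<close>

lemma trig_polynomials_mult:
  fixes G :: "('x \<Rightarrow> real) set"
  assumes add: "\<And>g h. g \<in> G \<Longrightarrow> h \<in> G \<Longrightarrow> (\<lambda>x. g x + h x) \<in> G"
    and minus: "\<And>g. g \<in> G \<Longrightarrow> (\<lambda>x. - g x) \<in> G"
    and "p \<in> trig_polynomials G" "q \<in> trig_polynomials G"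
  shows "(\<lambda>x. p x * q x) \<in> trig_polynomials G"
  using assms(3)
proof (induction)
  case (base g c d)
  note g = base
  show ?case using assms(4)
  proof induction
    case (base h c' d')
    have *: "(\<lambda>x. c * cos (g x + d) * (c' * cos (h x + d')))
      = (\<lambda>x. (c * c' / 2) * cos ((g x + h x) + (d + d')) + (c * c' / 2) * cos ((g x + - h x) + (d - d')))"
    proof
      fix x
      have "cos (g x + d) * cos (h x + d') = (cos ((g x + d) - (h x + d')) + cos ((g x + d) + (h x + d'))) / 2"
        by (rule cos_times_cos)
      moreover have "(g x + d) - (h x + d') = (g x + - h x) + (d - d')" "(g x + d) + (h x + d') = (g x + h x) + (d + d')"
        by auto
      ultimately have "cos (g x + d) * cos (h x + d') = (cos ((g x + - h x) + (d - d')) + cos ((g x + h x) + (d + d'))) / 2"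
        by simp
      moreover have "c * cos (g x + d) * (c' * cos (h x + d')) = (c * c') * (cos (g x + d) * cos (h x + d'))" by simp
      ultimately show "c * cos (g x + d) * (c' * cos (h x + d'))
        = (c * c' / 2) * cos ((g x + h x) + (d + d')) + (c * c' / 2) * cos ((g x + - h x) + (d - d'))"
        by (simp add: field_simps)
    qed
    show ?case unfolding * 
      by (intro trig_polynomials.add trig_polynomials.base add minus g base)
  next
    case (add p q)
    then show ?case by (auto simp: distrib_left intro: trig_polynomials.add)
  qed
next
  case (add p q)
  then show ?case by (auto simp: distrib_right intro: trig_polynomials.add)
qed

lemma trig_polynomials_const:
  assumes add: "\<And>g h. g \<in> G \<Longrightarrow> h \<in> G \<Longrightarrow> (\<lambda>x. g x + h x) \<in> G"
    and minus: "\<And>g. g \<in> G \<Longrightarrow> (\<lambda>x. - g x) \<in> G" and "G \<noteq> {}"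
  shows "(\<lambda>x. c) \<in> trig_polynomials G"
proof -
  obtain g where "g \<in> G" using assms by auto
  then have "(\<lambda>x. g x + - g x) \<in> G" by (intro add minus)
  from trig_polynomials.base[OF this, of c 0] show ?thesis by simp
qed

lemma trig_polynomials_poly:
  assumes add: "\<And>g h. g \<in> G \<Longrightarrow> h \<in> G \<Longrightarrow> (\<lambda>x. g x + h x) \<in> G"
    and minus: "\<And>g. g \<in> G \<Longrightarrow> (\<lambda>x. - g x) \<in> G" and ne: "G \<noteq> {}"
    and p: "p \<in> trig_polynomials G" and "real_polynomial_function (q :: real \<Rightarrow> real)"
  shows "(\<lambda>x. q (p x)) \<in> trig_polynomials G"
  using assms(5)
proof induction
  case (linear f)
  have "f (p x) = f 1 * p x" for x using linear_scale[OF bounded_linear.linear[OF linear], of "p x" 1] by simp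
  moreover have "(\<lambda>x. f 1) \<in> trig_polynomials G" by (rule trig_polynomials_const[OF add minus ne])
  then have "(\<lambda>x. f 1 * p x) \<in> trig_polynomials G" using p by (auto intro!: trig_polynomials_mult[of G "\<lambda>x. f 1"] simp: add minus)
  ultimately show ?case by simp
next
  case (const c) show ?case by (rule trig_polynomials_const[OF add minus ne])
next
  case (add f g) then show ?case by (auto intro: trig_polynomials.add)
next
  case (mult f g)
  show ?case using mult.IH by (auto intro!: trig_polynomials_mult[of G "\<lambda>x. f (p x)"] simp: assms(1,2))
qed

text \<open>Both cosines are generators, with phases 0 and \<open>- (pi / 2)\<close>, so
  trigonometric polynomials separate whatever the characters \<open>iexp\<close> of members of
  \<open>G\<close> separate.\<close>

lemma cis_eq_iff_cos: "iexp a = iexp b \<longleftrightarrow> cos a = cos b \<and> cos (a - pi / 2) = cos (b - pi / 2)"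
proof -
  have "cos (x - pi / 2) = sin x" for x :: real by (simp add: cos_diff)
  then show ?thesis by (simp add: complex_eq_iff Re_exp Im_exp)
qed

text \<open>Stone--Weierstrass yields a trigonometric polynomial close to \<open>f\<close> on a compact set; composing
  it with a polynomial approximation of a truncation makes it bounded by (almost) the bound of
  \<open>f\<close> on the whole space.\<close>

lemma trig_approximation:
  fixes G :: "('x::t2_space \<Rightarrow> real) set"
  assumes cont: "\<And>g. g \<in> G \<Longrightarrow> continuous_on UNIV g"
    and add: "\<And>g h. g \<in> G \<Longrightarrow> h \<in> G \<Longrightarrow> (\<lambda>x. g x + h x) \<in> G"
    and minus: "\<And>g. g \<in> G \<Longrightarrow> (\<lambda>x. - g x) \<in> G" and ne: "G \<noteq> {}"
    and sep: "\<And>x y. x \<noteq> y \<Longrightarrow> \<exists>g\<in>G. iexp (g x) \<noteq> iexp (g y)"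
    and C: "compact C" and f: "continuous_on UNIV (f :: _ \<Rightarrow> real)" and B: "\<And>x. \<bar>f x\<bar> \<le> B" and e: "e > 0"
  obtains p where "p \<in> trig_polynomials G" "\<And>x. x \<in> C \<Longrightarrow> \<bar>f x - p x\<bar> \<le> e" "\<And>x. \<bar>p x\<bar> \<le> B + e"
proof -
  have B0: "B \<ge> 0" using B[of undefined] by linarith
  have "\<exists>g. g \<in> trig_polynomials G \<and> (\<forall>x \<in> C. \<bar>f x - g x\<bar> < e / 2)"
  proof (rule Stone_Weierstrass_HOL[OF C])
    show "(\<lambda>x. c) \<in> trig_polynomials G" for c by (rule trig_polynomials_const[OF add minus ne])
    show "continuous_on C p" if "p \<in> trig_polynomials G" for p
      using trig_polynomials_continuous[of G p] cont that continuous_on_subset by blast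
    show "(\<lambda>x. p x + q x) \<in> trig_polynomials G" if "p \<in> trig_polynomials G \<and> q \<in> trig_polynomials G" for p q
      using that by (auto intro: trig_polynomials.add)
    show "(\<lambda>x. p x * q x) \<in> trig_polynomials G" if "p \<in> trig_polynomials G \<and> q \<in> trig_polynomials G" for p q
      using trig_polynomials_mult[OF add minus] that by blast
    show "\<exists>p. p \<in> trig_polynomials G \<and> p x \<noteq> p y" if xy: "x \<in> C \<and> y \<in> C \<and> x \<noteq> y" for x y
    proof -
      obtain g where g: "g \<in> G" "iexp (g x) \<noteq> iexp (g y)" using sep xy by blast
      then have "cos (g x) \<noteq> cos (g y) \<or> cos (g x - pi / 2) \<noteq> cos (g y - pi / 2)"
        using cis_eq_iff_cos by blast
      then show ?thesis
      proof
        assume "cos (g x) \<noteq> cos (g y)"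
        then show ?thesis using trig_polynomials.base[OF g(1), of 1 0] by (intro exI[of _ "\<lambda>x. 1 * cos (g x + 0)"]) auto
      next
        assume "cos (g x - pi / 2) \<noteq> cos (g y - pi / 2)"
        then show ?thesis using trig_polynomials.base[OF g(1), of 1 "- (pi / 2)"]
          by (intro exI[of _ "\<lambda>x. 1 * cos (g x + - (pi / 2))"]) auto
      qed
    qed
    show "continuous_on C f" using f continuous_on_subset by blast
  qed (use e in auto)
  then obtain p where p: "p \<in> trig_polynomials G" "\<And>x. x \<in> C \<Longrightarrow> \<bar>f x - p x\<bar> < e / 2" by auto
  obtain m where m: "m > 0" "\<And>x. \<bar>p x\<bar> \<le> m" using trig_polynomials_bounded[OF p(1)] by auto
  have "continuous_on {-m..m} (\<lambda>t. max (- B) (min B t))" by (intro continuous_intros)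
  then obtain q where q: "real_polynomial_function q" "\<And>t. t \<in> {-m..m} \<Longrightarrow> \<bar>max (- B) (min B t) - q t\<bar> < e / 2"
    using Stone_Weierstrass_real_polynomial_function[of "{-m..m}" "\<lambda>t. max (- B) (min B t)" "e / 2"] e by auto
  have q': "\<bar>max (- B) (min B (p x)) - q (p x)\<bar> < e / 2" for x
    using q(2)[of "p x"] m(2)[of x] by (auto simp: abs_le_iff)
  show ?thesis
  proof (rule that)
    show "(\<lambda>x. q (p x)) \<in> trig_polynomials G" by (rule trig_polynomials_poly[OF add minus ne p(1) q(1)])
    show "\<bar>q (p x)\<bar> \<le> B + e" for x using q'[of x] B0 e by linarith
    show "\<bar>f x - q (p x)\<bar> \<le> e" if "x \<in> C" for x
      using q'[of x] p(2)[OF that] B[of x] by linarith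
  qed
qed

lemma (in finite_measure) integrable_bounded_real:
  fixes f :: "'a \<Rightarrow> real"
  assumes "f \<in> borel_measurable M" "\<And>x. x \<in> space M \<Longrightarrow> \<bar>f x\<bar> \<le> B"
  shows "integrable M f"
  by (rule integrable_const_bound[of _ B]) (use assms in auto)

lemma (in finite_measure) integrable_iexp:
  assumes "f \<in> borel_measurable M"
  shows "integrable M (\<lambda>x. iexp (f x))"
  by (rule integrable_const_bound[of _ 1]) (use assms in auto)

lemma Re_fourier: "finite_measure M \<Longrightarrow> f \<in> borel_measurable M \<Longrightarrow> Re (fourier M f) = (\<integral>x. cos (f x) \<partial>M)"
  unfolding fourier_def by (subst integral_Re[symmetric]) (auto intro: finite_measure.integrable_iexp simp: Re_exp)

lemma Im_fourier: "finite_measure M \<Longrightarrow> f \<in> borel_measurable M \<Longrightarrow> Im (fourier M f) = (\<integral>x. sin (f x) \<partial>M)"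
  unfolding fourier_def by (subst integral_Im[symmetric]) (auto intro: finite_measure.integrable_iexp simp: Im_exp)

lemma borel_measurable_continuous_sets:
  "sets M = sets borel \<Longrightarrow> continuous_on UNIV f \<Longrightarrow> f \<in> borel_measurable M"
  using borel_measurable_continuous_onI measurable_cong_sets by blast

text \<open>On a compact set that carries almost all mass of every member, \<open>f\<close> is close
  to a trigonometric polynomial, for which convergence is the hypothesis on Fourier transforms; off
  that set the global bound of the polynomial controls the error. The limit \<open>\<rho>\<close> is
  given in advance, so no relative compactness of measures enters.\<close>

theorem fourier_convergence_imp_weak:
  fixes \<mu> :: "nat \<Rightarrow> 'x::t2_space measure" and G :: "('x \<Rightarrow> real) set" and f :: "'x \<Rightarrow> real"
  assumes fin: "\<And>n. finite_measure (\<mu> n)" and sets: "\<And>n. sets (\<mu> n) = sets borel"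
    and fin': "finite_measure \<rho>" and sets': "sets \<rho> = sets borel"
    and cont: "\<And>g. g \<in> G \<Longrightarrow> continuous_on UNIV g"
    and add: "\<And>g h. g \<in> G \<Longrightarrow> h \<in> G \<Longrightarrow> (\<lambda>x. g x + h x) \<in> G"
    and minus: "\<And>g. g \<in> G \<Longrightarrow> (\<lambda>x. - g x) \<in> G" and ne: "G \<noteq> {}"
    and sep: "\<And>x y. x \<noteq> y \<Longrightarrow> \<exists>g\<in>G. iexp (g x) \<noteq> iexp (g y)"
    and FT: "\<And>g. g \<in> G \<Longrightarrow> (\<lambda>n. fourier (\<mu> n) g) \<longlonglongrightarrow> fourier \<rho> g"
    and mass: "\<And>n. measure (\<mu> n) UNIV \<le> m"
    and tight: "\<And>e. e > 0 \<Longrightarrow> \<exists>C. compact C \<and> (\<forall>n. measure (\<mu> n) (- C) \<le> e) \<and> measure \<rho> (- C) \<le> e"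
    and f: "continuous_on UNIV f" and B: "\<And>x. \<bar>f x\<bar> \<le> B"
  shows "(\<lambda>n. \<integral>x. f x \<partial>\<mu> n) \<longlonglongrightarrow> (\<integral>x. f x \<partial>\<rho>)"
proof -
  have trig: "(\<lambda>n. \<integral>x. p x \<partial>\<mu> n) \<longlonglongrightarrow> (\<integral>x. p x \<partial>\<rho>)" if "p \<in> trig_polynomials G" for p
    using that
  proof induction
    case (base g c d)
    have g: "g \<in> borel_measurable M" if "sets M = sets borel" for M :: "'x measure"
      using borel_measurable_continuous_sets[OF that cont[OF base]] .
    have *: "(\<integral>x. c * cos (g x + d) \<partial>M) = c * (cos d * Re (fourier M g) - sin d * Im (fourier M g))"
      if M: "finite_measure M" "sets M = sets borel" for M :: "'x measure"
    proof -
      have i: "integrable M (\<lambda>x. cos (g x))" "integrable M (\<lambda>x. sin (g x))"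
        by (rule finite_measure.integrable_bounded_real[OF M(1), of _ 1]; use g[OF M(2)] in simp)+
      have "(\<integral>x. c * cos (g x + d) \<partial>M) = (\<integral>x. c * (cos d * cos (g x) - sin d * sin (g x)) \<partial>M)"
        by (simp add: cos_add mult.commute)
      also have "\<dots> = c * (cos d * (\<integral>x. cos (g x) \<partial>M) - sin d * (\<integral>x. sin (g x) \<partial>M))"
        using i by simp
      finally show ?thesis using Re_fourier[OF M(1) g[OF M(2)]] Im_fourier[OF M(1) g[OF M(2)]] by simp
    qed
    show ?case unfolding *[OF fin sets] *[OF fin' sets']
      by (intro tendsto_intros tendsto_Re tendsto_Im FT base)
  next
    case (add p q)
    have i: "integrable M r" if M: "finite_measure M" "sets M = sets borel" and r: "r \<in> trig_polynomials G" 
      for M :: "'x measure" and r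
    proof -
      obtain b where "\<forall>x. \<bar>r x\<bar> \<le> b" using trig_polynomials_bounded[OF r] by auto
      then show ?thesis
        using finite_measure.integrable_bounded_real[OF M(1) borel_measurable_continuous_sets[OF M(2)
          trig_polynomials_continuous[of G r, OF cont r]]] by blast
    qed
    show ?case using add i[OF fin sets] i[OF fin' sets'] by (simp add: tendsto_add)
  qed
  have B0: "B \<ge> 0" using B[of undefined] by linarith
  have m0: "m \<ge> 0" using mass[of 0] measure_nonneg[of "\<mu> 0" UNIV] by linarith
  show ?thesis
  proof (rule metric_LIMSEQ_I)
    fix r :: real assume r: "r > 0"
    define m' where "m' = max m (measure \<rho> UNIV) + 1"
    have m': "m' > 0" "\<And>n. measure (\<mu> n) UNIV \<le> m'" "measure \<rho> UNIV \<le> m'"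
      using mass m0 unfolding m'_def by (auto simp: le_max_iff_disj add.commute add_increasing)
    \<comment> \<open>The cap 1 on \<open>d\<close> bounds \<open>f - p\<close> by
      \<open>2 * B + 1\<close> off \<open>C\<close>. The two error terms are then at most
      \<open>r / 8\<close> each, and the replacement of \<open>f\<close> by \<open>p\<close> costs
      at most \<open>r / 4\<close> for \<open>\<mu> n\<close> and for \<open>\<rho>\<close>.\<close>
    define d where "d = min 1 (r / (8 * m'))"
    have d: "d > 0" "d * m' \<le> r / 8" using r m' by (auto simp: d_def min_def field_simps)
    define e where "e = r / (8 * (2 * B + 1))"
    have e: "e > 0" "(2 * B + 1) * e \<le> r / 8" using r B0 by (auto simp: e_def field_simps)
    obtain C where C: "compact C" "\<And>n. measure (\<mu> n) (- C) \<le> e" "measure \<rho> (- C) \<le> e" using tight[OF e(1)] by auto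
    obtain p where p: "p \<in> trig_polynomials G" "\<And>x. x \<in> C \<Longrightarrow> \<bar>f x - p x\<bar> \<le> d" "\<And>x. \<bar>p x\<bar> \<le> B + d"
      using trig_approximation[of G C f B d, OF cont add minus ne sep C(1) f B d(1)] by blast
    have indi: "integrable M (indicat_real A)" if "finite_measure M" "A \<in> sets M" for M :: "'x measure" and A
      using that finite_measure.emeasure_finite[OF that(1), of A]
      by (intro integrable_real_indicator) (auto simp: less_top[symmetric])
    have est: "\<bar>(\<integral>x. f x \<partial>M) - (\<integral>x. p x \<partial>M)\<bar> \<le> r / 4"
      if M: "finite_measure M" "sets M = sets borel" "measure M UNIV \<le> m'" "measure M (- C) \<le> e" for M :: "'x measure"
    proof -
      interpret finite_measure M by fact
      have sp: "space M = UNIV" using M(2) sets_eq_imp_space_eq by fastforce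
      have mf: "f \<in> borel_measurable M" "p \<in> borel_measurable M"
        using borel_measurable_continuous_sets[OF M(2)] f trig_polynomials_continuous[of G p, OF cont p(1)] by auto
      have i: "integrable M f" "integrable M p" 
        using integrable_bounded_real[OF mf(1)] integrable_bounded_real[OF mf(2)] B p(3) by blast+
      have CM: "- C \<in> sets M" using M(2) compact_imp_closed[OF C(1)] by auto
      have "\<bar>(\<integral>x. f x \<partial>M) - (\<integral>x. p x \<partial>M)\<bar> = \<bar>\<integral>x. f x - p x \<partial>M\<bar>" using i by simp
      also have "\<dots> \<le> (\<integral>x. \<bar>f x - p x\<bar> \<partial>M)" by (rule integral_abs_bound)
      also have "\<dots> \<le> (\<integral>x. d + (2 * B + 1) * indicator (- C) x \<partial>M)"
      proof (rule integral_mono)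
        show "integrable M (\<lambda>x. d + (2 * B + 1) * indicator (- C) x)"
          using CM by (intro Bochner_Integration.integrable_add integrable_mult_right indi[OF M(1)]) auto
        show "\<bar>f x - p x\<bar> \<le> d + (2 * B + 1) * indicator (- C) x" for x
        proof (cases "x \<in> C")
          case False
          have "d \<le> 1" by (simp add: d_def)
          then show ?thesis using False B[of x] p(3)[of x] d(1) by auto
        qed (use p(2) in auto)
      qed (use i in auto)
      also have "\<dots> = d * measure M UNIV + (2 * B + 1) * measure M (- C)"
        using CM indi[OF M(1) CM] by (subst Bochner_Integration.integral_add) (auto simp: sp)
      also have "\<dots> \<le> d * m' + (2 * B + 1) * e"
        using d(1) B0 M(3,4) by (intro add_mono mult_left_mono) auto
      also have "\<dots> \<le> r / 4" using d e by simp
      finally show ?thesis .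
    qed
    obtain N where N: "\<And>n. n \<ge> N \<Longrightarrow> dist (\<integral>x. p x \<partial>\<mu> n) (\<integral>x. p x \<partial>\<rho>) < r / 4"
      using metric_LIMSEQ_D[OF trig[OF p(1)], of "r / 4"] r by auto
    have "dist (\<integral>x. f x \<partial>\<mu> n) (\<integral>x. f x \<partial>\<rho>) < r" if "n \<ge> N" for n
      using N[OF that] est[OF fin sets m'(2) C(2), of n] est[OF fin' sets' m'(3) C(3)] r
      unfolding dist_real_def by linarith
    then show "\<exists>N. \<forall>n\<ge>N. dist (\<integral>x. f x \<partial>\<mu> n) (\<integral>x. f x \<partial>\<rho>) < r" by blast
  qed
qed

section \<open>Fourier transforms on the sequence space\<close>

text \<open>Finitely supported functionals on the sequence space. Rational coefficients make the
  family countable while it remains an additive group, and lists serve as indices that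
  \<open>from_nat\<close> can enumerate.\<close>

definition rcomb :: "rat list \<Rightarrow> (nat \<Rightarrow> real) \<Rightarrow> real" where
  "rcomb c z = (\<Sum>i<length c. of_rat (c ! i) * z i)"

lemma rcomb_continuous: "continuous_on UNIV (rcomb c)"
  unfolding rcomb_def[abs_def] by (intro continuous_intros continuous_on_product_coordinates)

lemma rcomb_continuous_comp:
  assumes "continuous_on UNIV T" shows "continuous_on UNIV (\<lambda>x. rcomb c (T x))"
  using continuous_on_compose2[OF rcomb_continuous assms] by simp

lemma rcomb_measurable [measurable]: "rcomb c \<in> borel_measurable borel"
  by (rule borel_measurable_continuous_onI[OF rcomb_continuous])

lemma rcomb_Nil [simp]: "rcomb [] z = 0"
  by (simp add: rcomb_def)

lemma rcomb_scale: "rcomb (map ((*) q) c) z = of_rat q * rcomb c z"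
  by (simp add: rcomb_def of_rat_mult sum_distrib_left mult.assoc)

lemma rcomb_coordinate: "rcomb (replicate k 0 @ [q]) z = of_rat q * z k"
proof -
  have "rcomb (replicate k 0 @ [q]) z = (\<Sum>i<k. of_rat ((replicate k 0 @ [q]) ! i) * z i) + of_rat q * z k"
    by (simp add: rcomb_def nth_append)
  also have "(\<Sum>i<k. of_rat ((replicate k 0 @ [q]) ! i) * z i) = 0"
    by (intro sum.neutral) (auto simp: nth_append)
  finally show ?thesis by simp
qed

lemma rcomb_add_arg: "rcomb c (\<lambda>k. z k + w k) = rcomb c z + rcomb c w"
  by (simp add: rcomb_def distrib_left sum.distrib)

text \<open>Lists of different lengths are padded with zeros. The witness is existential because
  many lists induce the same functional and only the functional matters.\<close>

lemma rcomb_add: "\<exists>e. \<forall>z. rcomb e z = rcomb c z + rcomb d z"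
proof -
  define n where "n = max (length c) (length d)"
  define pad where "pad c i = (if i < length c then c ! i else 0)" for c :: "rat list" and i
  have pad: "rcomb c z = (\<Sum>i<n. of_rat (pad c i) * z i)" if "length c \<le> n" for c z
    unfolding rcomb_def pad_def using that by (intro sum.mono_neutral_cong_left) auto
  have "rcomb (map (\<lambda>i. pad c i + pad d i) [0..<n]) z = rcomb c z + rcomb d z" for z
  proof -
    have "rcomb (map (\<lambda>i. pad c i + pad d i) [0..<n]) z = (\<Sum>i<n. of_rat (pad c i + pad d i) * z i)"
      by (simp add: rcomb_def)
    also have "\<dots> = (\<Sum>i<n. of_rat (pad c i) * z i) + (\<Sum>i<n. of_rat (pad d i) * z i)"
      by (simp add: of_rat_add distrib_right sum.distrib)
    finally show ?thesis using pad[of c z] pad[of d z] by (simp add: n_def)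
  qed
  then show ?thesis by blast
qed

text \<open>Equal values would make \<open>a - b\<close> a nonzero multiple of
  \<open>2 * pi\<close>, and \<open>pi > 3\<close>.\<close>

lemma iexp_neqI:
  assumes "0 < \<bar>a - b\<bar>" "\<bar>a - b\<bar> < 3" shows "iexp a \<noteq> iexp b"
proof
  assume "iexp a = iexp b"
  then have "cos a = cos b" "sin a = sin b" by (simp_all add: complex_eq_iff Re_exp Im_exp)
  then have "cos (a - b) = 1" by (simp add: cos_diff flip: power2_eq_square)
  then obtain n :: int where n: "a - b = of_int n * 2 * pi" using cos_one_2pi_int by blast
  have "n \<noteq> 0" using n assms by auto
  then have "1 \<le> \<bar>real_of_int n\<bar>" by linarith
  then have "2 * pi \<le> \<bar>a - b\<bar>" unfolding n by (simp add: abs_mult)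
  then show False using assms pi_gt3 by linarith
qed

text \<open>The rational factor \<open>1 / n\<close> brings the difference in a distinguishing
  coordinate below 1, away from the other periods of \<open>iexp\<close>.\<close>

lemma rcomb_separates:
  assumes "z \<noteq> w" shows "\<exists>c. iexp (rcomb c z) \<noteq> iexp (rcomb c w)"
proof -
  obtain k where k: "z k \<noteq> w k" using assms by blast
  define d where "d = z k - w k"
  obtain n :: nat where n: "\<bar>d\<bar> < real n" using reals_Archimedean2 by blast
  have "n > 0" using n by (cases n) auto
  then have "\<bar>d\<bar> / real n < 1" "\<bar>d\<bar> / real n > 0" using n k by (auto simp: d_def)
  moreover have "rcomb (replicate k 0 @ [1 / of_nat n]) z - rcomb (replicate k 0 @ [1 / of_nat n]) w = d / real n"
    by (simp add: rcomb_coordinate d_def of_rat_divide diff_divide_distrib)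
  ultimately show ?thesis by (intro exI[of _ "replicate k 0 @ [1 / of_nat n]"] iexp_neqI) auto
qed

text \<open>Pulled back along an injective \<open>T\<close>, the combinations form an additive group
  of continuous functions whose characters separate points, as the general criterion demands. It
  serves both for the identity of the sequence space and for the embedding of
  \<open>E\<close>.\<close>

lemma rcomb_fourier_weak:
  fixes \<mu> :: "nat \<Rightarrow> 'x::t2_space measure" and T :: "'x \<Rightarrow> nat \<Rightarrow> real" and f :: "'x \<Rightarrow> real"
  assumes T: "continuous_on UNIV T" "inj T"
    and fin: "\<And>n. finite_measure (\<mu> n)" and sets: "\<And>n. sets (\<mu> n) = sets borel"
    and fin': "finite_measure \<rho>" and sets': "sets \<rho> = sets borel"
    and FT: "\<And>c. (\<lambda>n. fourier (\<mu> n) (\<lambda>x. rcomb c (T x))) \<longlonglongrightarrow> fourier \<rho> (\<lambda>x. rcomb c (T x))"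
    and mass: "\<And>n. measure (\<mu> n) UNIV \<le> m"
    and tight: "\<And>e. e > 0 \<Longrightarrow> \<exists>C. compact C \<and> (\<forall>n. measure (\<mu> n) (- C) \<le> e) \<and> measure \<rho> (- C) \<le> e"
    and f: "continuous_on UNIV f" "\<And>x. \<bar>f x\<bar> \<le> B"
  shows "(\<lambda>n. \<integral>x. f x \<partial>\<mu> n) \<longlonglongrightarrow> (\<integral>x. f x \<partial>\<rho>)"
proof -
  define G where "G = range (\<lambda>c x. rcomb c (T x))"
  have 1: "continuous_on UNIV g" if "g \<in> G" for g
    using that rcomb_continuous_comp[OF T(1)] unfolding G_def by blast
  have 2: "(\<lambda>x. g x + h x) \<in> G" if gh: "g \<in> G" "h \<in> G" for g h
  proof -
    obtain c d where cd: "g = (\<lambda>x. rcomb c (T x))" "h = (\<lambda>x. rcomb d (T x))" using gh unfolding G_def by blast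
    obtain e where "\<forall>z. rcomb e z = rcomb c z + rcomb d z" using rcomb_add by blast
    then have "(\<lambda>x. g x + h x) = (\<lambda>x. rcomb e (T x))" unfolding cd by simp
    then show ?thesis unfolding G_def by blast
  qed
  have 3: "(\<lambda>x. - g x) \<in> G" if g: "g \<in> G" for g
  proof -
    obtain c where c: "g = (\<lambda>x. rcomb c (T x))" using g unfolding G_def by blast
    have "(\<lambda>x. - g x) = (\<lambda>x. rcomb (map ((*) (- 1)) c) (T x))" unfolding c rcomb_scale by (simp add: of_rat_minus)
    then show ?thesis unfolding G_def by blast
  qed
  have 4: "G \<noteq> {}" unfolding G_def by blast
  have 5: "\<exists>g\<in>G. iexp (g x) \<noteq> iexp (g y)" if xy: "x \<noteq> y" for x y
  proof -
    have "T x \<noteq> T y" using xy T(2) by (auto dest: injD)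
    from rcomb_separates[OF this] obtain c where "iexp (rcomb c (T x)) \<noteq> iexp (rcomb c (T y))" by blast
    then show ?thesis unfolding G_def by (intro bexI[of _ "\<lambda>x. rcomb c (T x)"]) auto
  qed
  have 6: "(\<lambda>n. fourier (\<mu> n) g) \<longlonglongrightarrow> fourier \<rho> g" if "g \<in> G" for g
    using that FT unfolding G_def by blast
  show ?thesis
    by (rule fourier_convergence_imp_weak[OF fin sets fin' sets' 1 2 3 4 5 6 mass tight f])
qed

lemma compact_exhaustion_polish:
  fixes \<sigma> :: "'x::polish_space measure"
  assumes fin: "finite_measure \<sigma>" and sets: "sets \<sigma> = sets borel" and e: "e > 0"
  obtains C where "compact C" "measure \<sigma> (- C) \<le> e"
proof -
  interpret finite_measure \<sigma> by fact
  have sp: "space \<sigma> = UNIV" using sets sets_eq_imp_space_eq by fastforce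
  have "emeasure \<sigma> UNIV = (SUP K\<in>{K. K \<subseteq> UNIV \<and> compact K}. emeasure \<sigma> K)"
    by (rule inner_regular) (use sets sp emeasure_finite in auto)
  then have sup: "emeasure \<sigma> UNIV = (SUP K\<in>{K. compact K}. emeasure \<sigma> K)" by simp
  show thesis
  proof (cases "measure \<sigma> UNIV < e")
    case True
    show ?thesis by (rule that[of "{}"]) (use True in auto)
  next
    case False
    then have "ennreal (measure \<sigma> UNIV - e) < emeasure \<sigma> UNIV"
      using e by (simp add: emeasure_eq_measure ennreal_less_iff)
    then obtain K where K: "compact K" "ennreal (measure \<sigma> UNIV - e) < emeasure \<sigma> K"
      unfolding sup by (auto simp: less_SUP_iff)
    have KM: "K \<in> sets \<sigma>" unfolding sets by (rule borel_closed[OF compact_imp_closed[OF K(1)]])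
    have "measure \<sigma> UNIV - e < measure \<sigma> K"
      using K(2) False e by (simp add: emeasure_eq_measure ennreal_less_iff)
    moreover have "measure \<sigma> (- K) = measure \<sigma> UNIV - measure \<sigma> K"
      using finite_measure_compl[OF KM] by (simp add: sp Compl_eq_Diff_UNIV)
    ultimately show ?thesis using K(1) by (intro that[of K]) auto
  qed
qed

text \<open>Half of the portmanteau theorem: continuous functions decrease to the indicator of the
  closed set \<open>C\<close>. Tightness is assumed for the sequence only; the limit is tight
  because the space is Polish. This is how mass on compact sets survives the passage to a limit
  law.\<close>

lemma fourier_limit_compact:
  fixes \<mu> :: "nat \<Rightarrow> 'x::polish_space measure" and T :: "'x \<Rightarrow> nat \<Rightarrow> real"
  assumes T: "continuous_on UNIV T" "inj T"
    and fin: "\<And>n. finite_measure (\<mu> n)" and sets: "\<And>n. sets (\<mu> n) = sets borel"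
    and fin': "finite_measure \<sigma>" and sets': "sets \<sigma> = sets borel"
    and FT: "\<And>c. (\<lambda>n. fourier (\<mu> n) (\<lambda>x. rcomb c (T x))) \<longlonglongrightarrow> fourier \<sigma> (\<lambda>x. rcomb c (T x))"
    and mass: "\<And>n. measure (\<mu> n) UNIV \<le> m"
    and tight: "\<And>e. e > 0 \<Longrightarrow> \<exists>C. compact C \<and> (\<forall>n. measure (\<mu> n) (- C) \<le> e)"
    and C: "compact C" and b: "\<And>n. b \<le> measure (\<mu> n) C"
  shows "b \<le> measure \<sigma> C"
\<comment> \<open>\<open>infdist\<close> to the empty set is 0 by convention, so the functions
  \<open>f\<close> below would be constantly 1.\<close>
proof (cases "C = {}")
  case True then show ?thesis using b[of 0] by simp
next
  case ne: False
  interpret \<sigma>: finite_measure \<sigma> by fact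
  have sp: "space \<sigma> = UNIV" using sets' sets_eq_imp_space_eq by fastforce
  define f where "f j z = max 0 (1 - real j * infdist z C)" for j z
  have f: "continuous_on UNIV (f j)" "\<bar>f j z\<bar> \<le> 1" for j z
    using mult_nonneg_nonneg[OF of_nat_0_le_iff infdist_nonneg[of z C], of j]
    unfolding f_def by (intro continuous_intros, simp add: max_def)
  have fC: "indicator C z \<le> f j z" for j z unfolding f_def by (auto simp: indicator_def)
  have tight': "\<exists>C. compact C \<and> (\<forall>n. measure (\<mu> n) (- C) \<le> e) \<and> measure \<sigma> (- C) \<le> e" if e: "e > 0" for e
  proof -
    obtain C1 where C1: "compact C1" "\<And>n. measure (\<mu> n) (- C1) \<le> e" using tight[OF e] by blast
    obtain C2 where C2: "compact C2" "measure \<sigma> (- C2) \<le> e" using compact_exhaustion_polish[OF fin' sets' e] .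
    have cl: "closed C1" "closed C2" using C1 C2 compact_imp_closed by auto
    have "measure (\<mu> n) (- (C1 \<union> C2)) \<le> measure (\<mu> n) (- C1)" for n
      using cl sets by (intro finite_measure.finite_measure_mono[OF fin]) auto
    moreover have "measure \<sigma> (- (C1 \<union> C2)) \<le> measure \<sigma> (- C2)"
      using cl sets' by (intro finite_measure.finite_measure_mono[OF fin']) auto
    ultimately show ?thesis using C1 C2 compact_Un order_trans by (intro exI[of _ "C1 \<union> C2"]) blast
  qed
  have lim: "(\<lambda>n. \<integral>x. f j x \<partial>\<mu> n) \<longlonglongrightarrow> (\<integral>x. f j x \<partial>\<sigma>)" for j
    by (rule rcomb_fourier_weak[OF T fin sets fin' sets' FT mass tight' f])
  have CM: "C \<in> sets borel" by (rule borel_closed[OF compact_imp_closed[OF C]])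
  have ge: "b \<le> (\<integral>x. f j x \<partial>\<sigma>)" for j
  proof (rule LIMSEQ_le_const[OF lim])
    have "b \<le> (\<integral>x. f j x \<partial>\<mu> n)" for n
    proof -
      interpret finite_measure "\<mu> n" by (rule fin)
      have "space (\<mu> n) = UNIV" using sets[of n] sets_eq_imp_space_eq by fastforce
      then have "measure (\<mu> n) C = (\<integral>x. indicator C x \<partial>\<mu> n)" by simp
      also have "\<dots> \<le> (\<integral>x. f j x \<partial>\<mu> n)"
      proof (rule integral_mono)
        show "integrable (\<mu> n) (indicat_real C)" using CM sets[of n]
          by (intro integrable_real_indicator) (auto simp: less_top[symmetric])
        show "integrable (\<mu> n) (f j)"
          by (rule integrable_bounded_real[of _ 1, OF borel_measurable_continuous_sets[OF sets f(1)] f(2)])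
      qed (rule fC)
      finally show ?thesis using b[of n] by linarith
    qed
    then show "\<exists>N. \<forall>n\<ge>N. b \<le> (\<integral>x. f j x \<partial>\<mu> n)" by blast
  qed
  have "(\<lambda>j. \<integral>x. f j x \<partial>\<sigma>) \<longlonglongrightarrow> (\<integral>x. indicator C x \<partial>\<sigma>)"
  proof (rule integral_dominated_convergence[where w="\<lambda>_. 1"])
    show "indicat_real C \<in> borel_measurable \<sigma>" using CM sets' by simp
    show "f j \<in> borel_measurable \<sigma>" for j by (rule borel_measurable_continuous_sets[OF sets' f(1)])
    show "AE x in \<sigma>. norm (f j x) \<le> 1" for j using f by simp
    show "AE x in \<sigma>. (\<lambda>j. f j x) \<longlonglongrightarrow> indicat_real C x"
    proof (rule AE_I2)
      fix x
      show "(\<lambda>j. f j x) \<longlonglongrightarrow> indicat_real C x"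
      proof (cases "x \<in> C")
        case True then show ?thesis by (simp add: f_def)
      next
        case False
        then have pos: "infdist x C > 0"
          using in_closed_iff_infdist_zero[OF compact_imp_closed[OF C] ne, of x] infdist_nonneg[of x C] by auto
        obtain N :: nat where N: "1 < real N * infdist x C" using ex_less_of_nat_mult[OF pos, of 1] by auto
        have "f j x = 0" if "j \<ge> N" for j
        proof -
          have "real N * infdist x C \<le> real j * infdist x C" using that pos by (intro mult_right_mono) auto
          then show ?thesis using N by (simp add: f_def)
        qed
        then have "eventually (\<lambda>j. f j x = 0) sequentially" unfolding eventually_sequentially by blast
        then show ?thesis using False by (simp add: tendsto_eventually)
      qed
    qed
  qed auto
  then have "b \<le> (\<integral>x. indicator C x \<partial>\<sigma>)" using ge by (intro LIMSEQ_le_const) auto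
  then show ?thesis by (simp add: sp)
qed

text \<open>The previous inequality for a constant sequence, in both directions, gives equality on
  compact sets; inner regularity does the rest.\<close>

lemma fourier_inject:
  fixes \<sigma> \<sigma>' :: "(nat \<Rightarrow> real) measure"
  assumes fin: "finite_measure \<sigma>" "finite_measure \<sigma>'" and sets: "sets \<sigma> = sets borel" "sets \<sigma>' = sets borel"
    and FT: "\<And>c. fourier \<sigma> (rcomb c) = fourier \<sigma>' (rcomb c)"
  shows "\<sigma> = \<sigma>'"
proof -
  have le: "measure \<sigma> C \<le> measure \<sigma>' C" if "finite_measure \<sigma>" "finite_measure \<sigma>'" "sets \<sigma> = sets borel" "sets \<sigma>' = sets borel"
     "\<And>c. fourier \<sigma> (rcomb c) = fourier \<sigma>' (rcomb c)" and C: "compact C" for \<sigma> \<sigma>' :: "(nat \<Rightarrow> real) measure" and C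
  proof (rule fourier_limit_compact[where \<mu>="\<lambda>_. \<sigma>" and T="\<lambda>x. x", OF _ _ _ _ _ _ _ order_refl _ C order_refl])
    show "\<exists>C. compact C \<and> (\<forall>n::nat. measure \<sigma> (- C) \<le> e)" if e: "e > 0" for e
      using compact_exhaustion_polish[OF \<open>finite_measure \<sigma>\<close> \<open>sets \<sigma> = sets borel\<close> e] by metis
  qed (use that in \<open>auto simp: inj_def eta_contract_eq intro!: continuous_intros\<close>)
  have eq: "measure \<sigma> C = measure \<sigma>' C" if C: "compact C" for C
    using le[OF fin sets FT C] le[OF fin(2,1) sets(2,1) FT[symmetric] C] by simp
  show ?thesis
  proof (rule measure_eqI)
    fix A assume A: "A \<in> sets \<sigma>"
    have e: "emeasure \<sigma> K = emeasure \<sigma>' K" if "compact K" for K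
      using eq[OF that] finite_measure.emeasure_eq_measure fin by metis
    have "emeasure \<sigma> A = (SUP K\<in>{K. K \<subseteq> A \<and> compact K}. emeasure \<sigma> K)"
      by (rule inner_regular) (use sets A finite_measure.emeasure_finite[OF fin(1)] in auto)
    also have "\<dots> = (SUP K\<in>{K. K \<subseteq> A \<and> compact K}. emeasure \<sigma>' K)"
      by (intro SUP_cong) (auto simp: e)
    also have "\<dots> = emeasure \<sigma>' A"
      by (rule inner_regular[symmetric]) (use sets A finite_measure.emeasure_finite[OF fin(2)] in auto)
    finally show "emeasure \<sigma> A = emeasure \<sigma>' A" .
  qed (use sets in simp)
qed

section \<open>Levy exponents on the real line\<close>

definition levy_kernel :: "real \<Rightarrow> complex" where
  "levy_kernel u = iexp u - 1 - \<i> * of_real u"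

lemma levy_kernel_measurable [measurable]: "levy_kernel \<in> borel_measurable borel"
  unfolding levy_kernel_def[abs_def] by measurable

lemma levy_kernel_0 [simp]: "levy_kernel 0 = 0"
  by (simp add: levy_kernel_def)

lemma Re_levy_kernel: "Re (levy_kernel u) = cos u - 1"
  by (simp add: levy_kernel_def Re_exp)

lemma norm_levy_kernel: "norm (levy_kernel u) \<le> u\<^sup>2 / 2"
  using iexp_approx1[of u 1] by (simp add: levy_kernel_def numeral_2_eq_2 algebra_simps)

lemma norm_iexp_minus_1: "norm (iexp u - 1) \<le> \<bar>u\<bar>"
  using iexp_approx1[of u 0] by simp

lemma norm_exp_minus_1: "norm (exp z - 1) \<le> exp \<bar>Re z\<bar> * norm z" for z :: complex
  using Taylor_exp[of z 0] by simp

text \<open>The Taylor remainder \<open>v^4 / 24\<close> is at most \<open>v^2 / 4\<close> for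
  \<open>\<bar>v\<bar> \<le> 1\<close>. This converse to the quadratic upper bound lets the modulus
  of a Fourier transform bound a variance, and it makes squares of functionals integrable on
  \<open>K\<close>.\<close>

lemma one_minus_cos_ge:
  assumes "\<bar>v\<bar> \<le> 1" shows "v\<^sup>2 / 4 \<le> 1 - cos (v :: real)"
proof -
  have "cmod (iexp v - (\<Sum>k \<le> 3. (\<i> * v)^k / fact k)) \<le> \<bar>v\<bar>^4 / fact 4"
    using iexp_approx1[of v 3] by simp
  moreover have "Re (iexp v - (\<Sum>k \<le> 3. (\<i> * v)^k / fact k)) = cos v - 1 + v\<^sup>2 / 2"
    by (simp add: numeral_3_eq_3 Re_exp fact_numeral power2_eq_square)
  ultimately have "cos v - 1 + v\<^sup>2 / 2 \<le> \<bar>v\<bar>^4 / 24"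
    using complex_Re_le_cmod[of "iexp v - (\<Sum>k \<le> 3. (\<i> * v)^k / fact k)"] by (simp add: fact_numeral)
  moreover have "\<bar>v\<bar>^4 \<le> v\<^sup>2"
    using power_decreasing[of 2 4 "\<bar>v\<bar>"] assms by simp
  ultimately show ?thesis using zero_le_power2[of v] by linarith
qed

text \<open>A centred compound Poisson variable \<open>X\<close> with small jumps which, shifted by \<open>w\<close>, mostly
  stays in \<open>[-R, R]\<close>: the modulus of its Fourier transform controls the variance, so
  that \<open>exp(i t w)\<close> stays away from \<open>-1\<close> for all small \<open>t\<close>.\<close>

lemma shift_bound:
  assumes P: "prob_space P" and X: "X \<in> borel_measurable P"
    and M: "finite_measure M" and Y: "Y \<in> borel_measurable M" and Y1: "AE y in M. \<bar>Y y\<bar> \<le> 1"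
    and FT: "\<And>t. fourier P (\<lambda>x. t * X x) = exp (\<integral>y. levy_kernel (t * Y y) \<partial>M)"
    and R: "R \<ge> 1" and pr: "measure P {x\<in>space P. \<bar>X x + w\<bar> \<le> R} \<ge> 15/16"
  shows "\<bar>w\<bar> \<le> 64 * R"
proof -
  interpret P: prob_space P by fact
  interpret M: finite_measure M by fact
  note [measurable] = X Y
  \<comment> \<open>For \<open>0 \<le> u \<le> s\<close> the phase \<open>u * (X + w)\<close> is at
    most \<open>s * R = 1 / 16\<close> in modulus on \<open>A\<close>, and the complement, of mass
    at most \<open>1 / 16\<close>, contributes at most \<open>2 / 16\<close>: hence the bound
    \<open>3 / 16\<close> below.\<close>
  define s where "s = 1 / (16 * R)"
  have s: "s > 0" "s \<le> 1 / 16" "s * R = 1 / 16" using R by (auto simp: s_def field_simps)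
  define A where "A = {x\<in>space P. \<bar>X x + w\<bar> \<le> R}"
  have A[measurable]: "A \<in> sets P" unfolding A_def by measurable
  have 1: "norm (fourier P (\<lambda>x. u * (X x + w)) - 1) \<le> 3/16" if u: "0 \<le> u" "u \<le> s" for u
  proof -
    have "fourier P (\<lambda>x. u * (X x + w)) - 1 = (CLINT x|P. iexp (u * (X x + w)) - 1)"
      unfolding fourier_def by (subst Bochner_Integration.integral_diff) (auto intro!: P.integrable_iexp simp: P.prob_space)
    also have "norm \<dots> \<le> (\<integral>x. norm (iexp (u * (X x + w)) - 1) \<partial>P)"
      by (rule integral_norm_bound)
    also have "\<dots> \<le> (\<integral>x. 1/16 + 2 * indicator (space P - A) x \<partial>P)"
    proof (rule integral_mono_AE')
      show "integrable P (\<lambda>x. 1/16 + 2 * indicat_real (space P - A) x)"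
        by (intro Bochner_Integration.integrable_add integrable_mult_right integrable_real_indicator)
          (auto simp: less_top[symmetric])
      show "AE x in P. norm (iexp (u * (X x + w)) - 1) \<le> 1/16 + 2 * indicator (space P - A) x"
      proof (rule AE_I2)
        fix x assume x: "x \<in> space P"
        show "norm (iexp (u * (X x + w)) - 1) \<le> 1/16 + 2 * indicator (space P - A) x"
        proof (cases "x \<in> A")
          case True
          have "norm (iexp (u * (X x + w)) - 1) \<le> \<bar>u * (X x + w)\<bar>" by (rule norm_iexp_minus_1)
          also have "\<dots> = u * \<bar>X x + w\<bar>" using u by (simp add: abs_mult)
          also have "\<dots> \<le> s * R" using True u s by (intro mult_mono) (auto simp: A_def)
          finally show ?thesis using s True by simp
        next
          case False
          have "norm (iexp (u * (X x + w)) - 1) \<le> norm (iexp (u * (X x + w))) + norm (1 :: complex)"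
            by (rule norm_triangle_ineq4)
          then show ?thesis using False x by simp
        qed
      qed
    qed auto
    also have "\<dots> = 1/16 + 2 * measure P (space P - A)"
      by (subst Bochner_Integration.integral_add) (auto simp: P.prob_space less_top[symmetric] intro!: integrable_real_indicator)
    also have "measure P (space P - A) \<le> 1/16" using pr P.prob_compl[OF A] by (simp add: A_def)
    finally show ?thesis by simp
  qed
  have 2: "fourier P (\<lambda>x. u * (X x + w)) = iexp (u * w) * fourier P (\<lambda>x. u * X x)" for u
  proof -
    have "fourier P (\<lambda>x. u * (X x + w)) = (CLINT x|P. iexp (u * w) * iexp (u * X x))"
      unfolding fourier_def by (intro Bochner_Integration.integral_cong) (auto simp: distrib_left exp_add mult.commute)
    then show ?thesis by (simp add: fourier_def)
  qed
  have ilk: "integrable M (\<lambda>y. levy_kernel (u * Y y))" for u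
  proof (rule M.integrable_const_bound[of _ "u\<^sup>2 / 2"])
    show "AE y in M. norm (levy_kernel (u * Y y)) \<le> u\<^sup>2 / 2"
      using Y1
    proof eventually_elim
      case (elim y)
      have "norm (levy_kernel (u * Y y)) \<le> (u * Y y)\<^sup>2 / 2" by (rule norm_levy_kernel)
      also have "(u * Y y)\<^sup>2 \<le> u\<^sup>2 * 1" unfolding power_mult_distrib
        using elim by (intro mult_left_mono) (auto simp: power2_le_iff_abs_le[of 1, simplified] abs_square_le_1)
      finally show ?case by simp
    qed
  qed measurable
  have iY: "integrable M (\<lambda>y. (Y y)\<^sup>2)"
    by (rule M.integrable_const_bound[of _ 1]) (use Y1 in \<open>auto simp: abs_square_le_1\<close>)
  \<comment> \<open>Since \<open>\<bar>s * Y\<bar> \<le> 1\<close>, the variance can be read off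
    from the single frequency \<open>s\<close>. The bound \<open>1 / 4\<close> that results comes
    from \<open>exp (- (1 / 4)) \<le> 4 / 5 < 13 / 16\<close>.\<close>
  have "(\<integral>y. (s * Y y)\<^sup>2 / 4 \<partial>M) \<le> (\<integral>y. 1 - cos (s * Y y) \<partial>M)"
  proof (rule integral_mono_AE)
    show "integrable M (\<lambda>y. (s * Y y)\<^sup>2 / 4)" using iY by (simp add: power_mult_distrib)
    show "integrable M (\<lambda>y. 1 - cos (s * Y y))"
      by (intro Bochner_Integration.integrable_diff M.integrable_bounded_real[of _ 1]) auto
    show "AE y in M. (s * Y y)\<^sup>2 / 4 \<le> 1 - cos (s * Y y)"
      using Y1
    proof eventually_elim
      case (elim y)
      have "\<bar>s * Y y\<bar> \<le> 1 * 1" unfolding abs_mult using elim s by (intro mult_mono) auto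
      then show ?case by (intro one_minus_cos_ge) simp
    qed
  qed
  also have "(\<integral>y. 1 - cos (s * Y y) \<partial>M) = - Re (\<integral>y. levy_kernel (s * Y y) \<partial>M)"
    by (subst integral_Re[OF ilk, symmetric]) (simp add: Re_levy_kernel flip: integral_minus)
  also have "\<dots> \<le> 1 / 4"
  proof -
    have "norm (fourier P (\<lambda>x. s * (X x + w)) - 1) \<le> 3/16" using s by (intro 1) auto
    then have "13 / 16 \<le> norm (fourier P (\<lambda>x. s * (X x + w)))"
      using norm_triangle_ineq2[of 1 "1 - fourier P (\<lambda>x. s * (X x + w))"] by (simp add: norm_minus_commute)
    then have "13 / 16 \<le> exp (Re (\<integral>y. levy_kernel (s * Y y) \<partial>M))"
      unfolding 2 norm_mult FT by simp
    moreover have "exp (- (1/4)) < (13 / 16 :: real)"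
    proof -
      have "(5/4 :: real) \<le> exp (1/4)" using exp_ge_add_one_self[of "1/4 :: real"] by simp
      then show ?thesis by (simp add: exp_minus field_simps)
    qed
    ultimately have "exp (- (1/4)) < exp (Re (\<integral>y. levy_kernel (s * Y y) \<partial>M))" by linarith
    then show ?thesis by simp
  qed
  finally have sY: "s\<^sup>2 * (\<integral>y. (Y y)\<^sup>2 \<partial>M) \<le> 1" by (simp add: power_mult_distrib)
  have 4: "norm (fourier P (\<lambda>x. u * X x) - 1) \<le> 1" if u: "0 \<le> u" "u \<le> s" for u
  proof -
    let ?z = "\<integral>y. levy_kernel (u * Y y) \<partial>M"
    have "norm ?z \<le> (\<integral>y. norm (levy_kernel (u * Y y)) \<partial>M)" by (rule integral_norm_bound)
    also have "\<dots> \<le> (\<integral>y. u\<^sup>2 * (Y y)\<^sup>2 / 2 \<partial>M)"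
      using ilk iY norm_levy_kernel[of "u * Y _"] by (intro integral_mono) (auto simp: power_mult_distrib)
    also have "\<dots> = u\<^sup>2 * (\<integral>y. (Y y)\<^sup>2 \<partial>M) / 2" by simp
    also have "\<dots> \<le> s\<^sup>2 * (\<integral>y. (Y y)\<^sup>2 \<partial>M) / 2"
      using u by (intro divide_right_mono mult_right_mono power_mono) auto
    finally have z: "norm ?z \<le> 1 / 2" using sY by simp
    then have "\<bar>Re ?z\<bar> \<le> 1 / 2" using abs_Re_le_cmod[of ?z] by linarith
    then have e: "exp \<bar>Re ?z\<bar> \<le> 2" using real_exp_bound_lemma[of "\<bar>Re ?z\<bar>"] by linarith
    have "norm (exp ?z - 1) \<le> exp \<bar>Re ?z\<bar> * norm ?z" by (rule norm_exp_minus_1)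
    also have "\<dots> \<le> 2 * (1 / 2)" using e z by (intro mult_mono) auto
    finally show ?thesis by (simp add: FT)
  qed
  have 5: "norm (iexp (u * w) - 1) < 2" if u: "0 \<le> u" "u \<le> s" for u
  proof -
    let ?f = "fourier P (\<lambda>x. u * X x)"
    have "iexp (u * w) - 1 = (iexp (u * w) * ?f - 1) - iexp (u * w) * (?f - 1)" by (simp add: algebra_simps)
    also have "norm \<dots> \<le> norm (iexp (u * w) * ?f - 1) + norm (iexp (u * w) * (?f - 1))" by (rule norm_triangle_ineq4)
    also have "\<dots> \<le> 3 / 16 + 1" using 1[OF u] 4[OF u] by (intro add_mono) (auto simp: 2 norm_mult)
    finally show ?thesis by simp
  qed
  show ?thesis
  proof (rule ccontr)
    assume "\<not> \<bar>w\<bar> \<le> 64 * R"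
    then have w: "\<bar>w\<bar> > 64 * R" "\<bar>w\<bar> > 0" using R by auto
    \<comment> \<open>At this \<open>u\<close> the factor \<open>iexp (u * w)\<close> equals -1, at
      distance 2 from 1. It is admissible because \<open>s * (64 * R) = 4 > pi\<close>, which is the
      origin of the constant 64.\<close>
    define u where "u = pi / \<bar>w\<bar>"
    have "pi \<le> s * \<bar>w\<bar>"
    proof -
      have "s * (64 * R) \<le> s * \<bar>w\<bar>" using w s by (intro mult_left_mono) auto
      moreover have "s * (64 * R) = 64 * (s * R)" by simp
      then have "s * (64 * R) = 4" unfolding s(3) by simp
      ultimately show ?thesis using pi_less_4 by linarith
    qed
    then have u: "0 \<le> u" "u \<le> s" using w pi_gt_zero by (auto simp: u_def field_simps)
    have "u * w = pi \<or> u * w = - pi" using w by (cases "w > 0") (auto simp: u_def)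
    then have "cos (u * w) = -1" by auto
    then have "Re (iexp (u * w) - 1) = -2" by (simp add: Re_exp)
    then have "2 \<le> norm (iexp (u * w) - 1)" using abs_Re_le_cmod[of "iexp (u * w) - 1"] by linarith
    then show False using 5[OF u] by linarith
  qed
qed

text \<open>\<open>2 * n^2 * (1 - cos (X / n))\<close> tends to \<open>X^2\<close>, and its
  expectation is controlled by the Fourier transform at \<open>1 / n\<close>; Fatou's lemma gives
  the bound in the limit, so finiteness of the moment is part of the conclusion.\<close>

lemma second_moment_le:
  assumes P: "prob_space P" and X: "X \<in> borel_measurable P" and v: "v \<ge> 0"
    and FT: "\<And>t. norm (fourier P (\<lambda>x. t * X x) - 1) \<le> exp (t\<^sup>2 * v / 2) * (t\<^sup>2 * v / 2)"
  shows "(\<integral>\<^sup>+x. ennreal ((X x)\<^sup>2) \<partial>P) \<le> ennreal v"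
proof -
  interpret P: prob_space P by fact
  note [measurable] = X
  define f where "f n x = 2 * real n ^ 2 * (1 - cos (X x / real n))" for n x
  have lim: "(\<lambda>n. f n x) \<longlonglongrightarrow> (X x)\<^sup>2" for x
    unfolding f_def power2_eq_square by real_asymp
  have m[measurable]: "f n \<in> borel_measurable P" for n unfolding f_def[abs_def] by measurable
  have f0: "f n x \<ge> 0" for n x unfolding f_def by simp
  have int: "(\<integral>\<^sup>+x. ennreal (f n x) \<partial>P) \<le> ennreal (exp (v / (2 * real n ^ 2)) * v)" if n: "n > 0" for n
  proof -
    have i: "integrable P (\<lambda>x. cos (X x / real n))" by (rule P.integrable_bounded_real[of _ 1]) auto
    have "integrable P (f n)" unfolding f_def using i by auto
    then have "(\<integral>\<^sup>+x. ennreal (f n x) \<partial>P) = ennreal (\<integral>x. f n x \<partial>P)"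
      using f0 by (intro nn_integral_eq_integral) auto
    also have "(\<integral>x. f n x \<partial>P) = 2 * real n ^ 2 * (1 - Re (fourier P (\<lambda>x. (1 / real n) * X x)))"
      unfolding f_def using i by (subst Re_fourier) (auto simp: P.prob_space P.finite_measure_axioms)
    also have "\<dots> \<le> 2 * real n ^ 2 * norm (fourier P (\<lambda>x. (1 / real n) * X x) - 1)"
      using abs_Re_le_cmod[of "fourier P (\<lambda>x. (1 / real n) * X x) - 1"] by (intro mult_left_mono) auto
    also have "\<dots> \<le> 2 * real n ^ 2 * (exp ((1 / real n)\<^sup>2 * v / 2) * ((1 / real n)\<^sup>2 * v / 2))"
      by (intro mult_left_mono FT) auto
    also have "\<dots> = exp (v / (2 * real n ^ 2)) * v" using n by (simp add: field_simps)
    finally show ?thesis by (simp add: ennreal_leI)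
  qed
  have "(\<integral>\<^sup>+x. ennreal ((X x)\<^sup>2) \<partial>P) = (\<integral>\<^sup>+x. liminf (\<lambda>n. ennreal (f n x)) \<partial>P)"
    by (intro nn_integral_cong lim_imp_Liminf[symmetric] tendsto_ennrealI lim) auto
  also have "\<dots> \<le> liminf (\<lambda>n. \<integral>\<^sup>+x. ennreal (f n x) \<partial>P)"
    by (rule nn_integral_liminf) measurable
  also have "\<dots> \<le> liminf (\<lambda>n. ennreal (exp (v / (2 * real n ^ 2)) * v))"
    by (intro Liminf_mono eventually_sequentiallyI[of 1] int) auto
  also have "\<dots> = ennreal v"
  proof (intro lim_imp_Liminf tendsto_ennrealI)
    show "(\<lambda>n. exp (v / (2 * real n ^ 2)) * v) \<longlonglongrightarrow> v" by real_asymp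
  qed auto
  finally show ?thesis .
qed

section \<open>Linear functionals and disks\<close>

definition sublinear :: "('a::real_vector \<Rightarrow> real) \<Rightarrow> bool" where
  "sublinear p \<longleftrightarrow> (\<forall>x y. p (x + y) \<le> p x + p y) \<and> (\<forall>t\<ge>0. \<forall>x. p (t *\<^sub>R x) = t * p x)"

lemma sublinear_add: "sublinear p \<Longrightarrow> p (x + y) \<le> p x + p y"
  by (simp add: sublinear_def)

lemma sublinear_scale: "sublinear p \<Longrightarrow> t \<ge> 0 \<Longrightarrow> p (t *\<^sub>R x) = t * p x"
  by (simp add: sublinear_def)

lemma sublinear_0: "sublinear p \<Longrightarrow> p 0 = 0"
  using sublinear_scale[of p 0 0] by simp

lemma sublinear_minus: "sublinear p \<Longrightarrow> - p (- x) \<le> p x"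
  using sublinear_add[of p x "- x"] sublinear_0[of p] by simp

text \<open>The infimum of \<open>p (x + t *\<^sub>R y) - t * p y\<close> over
  \<open>t \<ge> 0\<close> is again sublinear, lies below \<open>p\<close>, and is at most
  \<open>- p y\<close> at \<open>- y\<close> (take \<open>t = 1\<close>). For a minimal
  \<open>p\<close> this forces \<open>p (- y) = - p y\<close>.\<close>

lemma sublinear_reduce:
  assumes p: "sublinear p"
  shows "\<exists>q. sublinear q \<and> (\<forall>x. q x \<le> p x) \<and> q (- y) \<le> - p y"
proof -
  define S where "S x = (\<lambda>t. p (x + t *\<^sub>R y) - t * p y) ` {0..}" for x
  define q where "q x = Inf (S x)" for x
  have bdd: "bdd_below (S x)" for x
  proof (rule bdd_belowI)
    fix s assume "s \<in> S x"
    then obtain t where t: "t \<ge> 0" "s = p (x + t *\<^sub>R y) - t * p y" unfolding S_def by auto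
    have "p (t *\<^sub>R y) \<le> p (x + t *\<^sub>R y) + p (- x)" using sublinear_add[OF p, of "x + t *\<^sub>R y" "- x"] by simp
    then show "- p (- x) \<le> s" using t sublinear_scale[OF p t(1)] by simp
  qed
  have le: "q x \<le> p (x + t *\<^sub>R y) - t * p y" if "t \<ge> 0" for x t
    unfolding q_def by (rule cInf_lower[OF _ bdd]) (use that in \<open>auto simp: S_def\<close>)
  have ge: "c \<le> q x" if "\<And>t. t \<ge> 0 \<Longrightarrow> c \<le> p (x + t *\<^sub>R y) - t * p y" for c x
    unfolding q_def by (rule cInf_greatest) (use that in \<open>auto simp: S_def\<close>)
  have "q (x + z) \<le> q x + q z" for x z
  proof -
    have "q (x + z) - (p (z + s *\<^sub>R y) - s * p y) \<le> q x" if s: "s \<ge> 0" for s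
    proof (rule ge)
      fix t :: real assume t: "t \<ge> 0"
      have "q (x + z) \<le> p ((x + z) + (t + s) *\<^sub>R y) - (t + s) * p y" using s t by (intro le) auto
      also have "(x + z) + (t + s) *\<^sub>R y = (x + t *\<^sub>R y) + (z + s *\<^sub>R y)" by (simp add: algebra_simps)
      also have "p \<dots> \<le> p (x + t *\<^sub>R y) + p (z + s *\<^sub>R y)" by (rule sublinear_add[OF p])
      finally show "q (x + z) - (p (z + s *\<^sub>R y) - s * p y) \<le> p (x + t *\<^sub>R y) - t * p y"
        by (simp add: algebra_simps)
    qed
    then have "q (x + z) - q x \<le> q z" by (intro ge) (simp add: algebra_simps)
    then show ?thesis by simp
  qed
  moreover have "q (t *\<^sub>R x) = t * q x" if t0: "t \<ge> 0" for t x
  proof (cases "t = 0")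
    case True
    have "q 0 \<le> 0" using le[of 0 0] sublinear_0[OF p] by simp
    moreover have "0 \<le> q 0" by (rule ge) (simp add: sublinear_scale[OF p])
    ultimately show ?thesis using True by simp
  next
    case False
    then have t: "t > 0" using t0 by simp
    have *: "q (r *\<^sub>R x) \<le> r * q x" if r: "r > 0" for r x
    proof -
      have "q (r *\<^sub>R x) / r \<le> q x"
      proof (rule ge)
        fix s :: real assume s: "s \<ge> 0"
        have "q (r *\<^sub>R x) \<le> p (r *\<^sub>R x + (r * s) *\<^sub>R y) - r * s * p y" using r s by (intro le) auto
        also have "r *\<^sub>R x + (r * s) *\<^sub>R y = r *\<^sub>R (x + s *\<^sub>R y)" by (simp add: algebra_simps)
        also have "p \<dots> = r * p (x + s *\<^sub>R y)" using r by (intro sublinear_scale[OF p]) simp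
        finally show "q (r *\<^sub>R x) / r \<le> p (x + s *\<^sub>R y) - s * p y" using r by (simp add: field_simps)
      qed
      then show ?thesis using r by (simp add: field_simps)
    qed
    have "q x \<le> (1 / t) * q (t *\<^sub>R x)" using *[of "1 / t" "t *\<^sub>R x"] t by simp
    then show ?thesis using *[OF t, of x] t by (simp add: field_simps)
  qed
  moreover have "q x \<le> p x" for x using le[of 0 x] by simp
  moreover have "q (- y) \<le> - p y" using le[of 1 "- y"] sublinear_0[OF p] by simp
  ultimately show ?thesis unfolding sublinear_def by blast
qed

text \<open>Minimal sublinear functionals are linear.\<close>

theorem hahn_banach_sublinear:
  fixes p :: "'a::real_vector \<Rightarrow> real"
  assumes p: "sublinear p"
  obtains f where "linear f" "\<And>x. f x \<le> p x" "f z = p z"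
proof -
  \<comment> \<open>One reduction at \<open>z\<close> before minimising secures equality there:
    every \<open>f\<close> below \<open>p0\<close> has \<open>f (- z) \<le> - p z\<close>.\<close>
  obtain p0 where p0: "sublinear p0" "\<And>x. p0 x \<le> p x" "p0 (- z) \<le> - p z"
    using sublinear_reduce[OF p] by blast
  define A where "A = {q. sublinear q \<and> q \<le> p0}"
  \<comment> \<open>A common lower bound, so that pointwise infima over chains are finite.\<close>
  have lower: "- p0 (- x) \<le> q x" if q: "q \<in> A" for q x
  proof -
    have "- p0 (- x) \<le> - q (- x)" using q by (simp add: A_def le_fun_def)
    also have "\<dots> \<le> q x" using q by (intro sublinear_minus) (simp add: A_def)
    finally show ?thesis .
  qed
  have "\<exists>m\<in>A. \<forall>a\<in>A. m \<ge> a \<longrightarrow> a = m"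
  proof (rule predicate_Zorn)
    show "partial_order_on A (relation_of (\<ge>) A)"
      by (rule partial_order_on_relation_ofI) auto
    fix C assume "C \<in> Chains (relation_of (\<ge>) A)"
    then have C: "C \<subseteq> A" and chain: "\<And>q r. q \<in> C \<Longrightarrow> r \<in> C \<Longrightarrow> q \<le> r \<or> r \<le> q"
      unfolding Chains_def relation_of_def by auto
    show "\<exists>u\<in>A. \<forall>a\<in>C. u \<le> a"
    proof (cases "C = {}")
      case True then show ?thesis using p0(1) by (auto simp: A_def)
    next
      case ne: False
      define u where "u x = Inf ((\<lambda>q. q x) ` C)" for x
      have bdd: "bdd_below ((\<lambda>q. q x) ` C)" for x
        using lower C by (intro bdd_belowI2[of _ "- p0 (- x)"]) auto
      have le: "u x \<le> q x" if "q \<in> C" for q x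
        unfolding u_def by (rule cInf_lower[OF _ bdd]) (use that in auto)
      have ge: "c \<le> u x" if "\<And>q. q \<in> C \<Longrightarrow> c \<le> q x" for c x
        unfolding u_def by (rule cInf_greatest) (use that ne in auto)
      have sub: "sublinear q" if "q \<in> C" for q using that C by (auto simp: A_def)
      have "u (x + y) \<le> u x + u y" for x y
      proof -
        have "u (x + y) - r y \<le> u x" if r: "r \<in> C" for r
        proof (rule ge)
          fix q assume q: "q \<in> C"
          from chain[OF q r] obtain m where m: "m \<in> C" "m \<le> q" "m \<le> r" using q r by auto
          have "u (x + y) \<le> m (x + y)" by (rule le[OF m(1)])
          also have "\<dots> \<le> m x + m y" by (rule sublinear_add[OF sub[OF m(1)]])
          also have "\<dots> \<le> q x + r y" using m by (intro add_mono) (auto simp: le_fun_def)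
          finally show "u (x + y) - r y \<le> q x" by simp
        qed
        then have "u (x + y) - u x \<le> u y" by (intro ge) (simp add: algebra_simps)
        then show ?thesis by simp
      qed
      moreover have "u (t *\<^sub>R x) = t * u x" if t0: "t \<ge> 0" for t x
      proof (cases "t = 0")
        case True
        obtain q where q: "q \<in> C" using ne by auto
        have "u 0 \<le> 0" using le[OF q, of 0] sublinear_0[OF sub[OF q]] by simp
        moreover have "0 \<le> u 0" by (rule ge) (simp add: sublinear_0[OF sub])
        ultimately show ?thesis using True by simp
      next
        case False
        then have t: "t > 0" using t0 by simp
        have "u (t *\<^sub>R x) / t \<le> u x"
        proof (rule ge)
          fix q assume q: "q \<in> C"
          show "u (t *\<^sub>R x) / t \<le> q x"
            using le[OF q, of "t *\<^sub>R x"] sublinear_scale[OF sub[OF q] t0, of x] t by (simp add: field_simps)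
        qed
        moreover have "t * u x \<le> u (t *\<^sub>R x)"
        proof (rule ge)
          fix q assume q: "q \<in> C"
          show "t * u x \<le> q (t *\<^sub>R x)"
            using le[OF q, of x] sublinear_scale[OF sub[OF q] t0, of x] t by simp
        qed
        ultimately show ?thesis using t by (simp add: field_simps)
      qed
      ultimately have "sublinear u" unfolding sublinear_def by blast
      moreover have "u \<le> p0"
      proof -
        obtain q where q: "q \<in> C" using ne by auto
        have "q \<le> p0" using q C by (auto simp: A_def)
        then show ?thesis using le[OF q] by (metis le_fun_def order_trans)
      qed
      ultimately have "u \<in> A" by (simp add: A_def)
      then show ?thesis using le by (intro bexI[of _ u]) (auto simp: le_fun_def)
    qed
  qed
  then obtain f where f: "f \<in> A" and min: "\<And>q. q \<in> A \<Longrightarrow> q \<le> f \<Longrightarrow> q = f" by blast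
  have fs: "sublinear f" and fp0: "\<And>x. f x \<le> p0 x" using f by (auto simp: A_def le_fun_def)
  have odd: "f (- y) = - f y" for y
  proof -
    obtain q where q: "sublinear q" "\<And>x. q x \<le> f x" "q (- y) \<le> - f y" using sublinear_reduce[OF fs] by blast
    have "q \<in> A" using q fp0 by (auto simp: A_def le_fun_def intro: order_trans)
    then have "q = f" using min q by (auto simp: le_fun_def)
    then have "f (- y) \<le> - f y" using q by simp
    moreover have "- f (- y) \<le> f y" by (rule sublinear_minus[OF fs])
    ultimately show ?thesis by simp
  qed
  have add: "f (x + y) = f x + f y" for x y
  proof (rule antisym[OF sublinear_add[OF fs]])
    have "f (- (x + y)) \<le> f (- x) + f (- y)" using sublinear_add[OF fs, of "- x" "- y"] by simp
    then show "f x + f y \<le> f (x + y)" unfolding odd by simp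
  qed
  have scale: "f (t *\<^sub>R x) = t * f x" for t x
  proof (cases "t \<ge> 0")
    case False
    then have "f ((- t) *\<^sub>R x) = - t * f x" by (intro sublinear_scale[OF fs]) simp
    moreover have "f ((- t) *\<^sub>R x) = - f (t *\<^sub>R x)" using odd by simp
    ultimately show ?thesis by simp
  qed (rule sublinear_scale[OF fs])
  show thesis
  proof (rule that)
    show "linear f" by (rule linearI) (auto simp: add scale)
    show "f x \<le> p x" for x using fp0[of x] p0(2)[of x] by simp
    have "f (- z) \<le> - p z" using fp0[of "- z"] p0(3) by linarith
    then show "f z = p z" using odd fp0[of z] p0(2)[of z] by (simp add: antisym)
  qed
qed

section \<open>Absolutely convex sets and their gauges\<close>

lemma absolutely_convexD:
  "absolutely_convex B \<Longrightarrow> x \<in> B \<Longrightarrow> y \<in> B \<Longrightarrow> \<bar>s\<bar> + \<bar>t\<bar> \<le> 1 \<Longrightarrow> s *\<^sub>R x + t *\<^sub>R y \<in> B"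
  by (simp add: absolutely_convex_def)

lemma absolutely_convex_uminus: "absolutely_convex B \<Longrightarrow> x \<in> B \<Longrightarrow> - x \<in> B"
  using absolutely_convexD[of B x x "-1" 0] by simp

lemma absolutely_convex_scale_le:
  assumes B: "absolutely_convex B" and "0 \<le> r" "r \<le> s" and x: "x \<in> (*\<^sub>R) r ` B"
  shows "x \<in> (*\<^sub>R) s ` B"
proof (cases "s = 0")
  case False
  obtain y where y: "y \<in> B" "x = r *\<^sub>R y" using x by blast
  have "(r / s) *\<^sub>R y + 0 *\<^sub>R y \<in> B"
    using assms False by (intro absolutely_convexD[OF B y(1) y(1)]) (simp add: field_simps)
  moreover have "x = s *\<^sub>R ((r / s) *\<^sub>R y + 0 *\<^sub>R y)" using y False by simp
  ultimately show ?thesis by blast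
qed (use assms in auto)

lemma absolutely_convex_0:
  assumes "absolutely_convex B" shows "0 \<in> B"
proof -
  obtain x where "x \<in> B" using assms by (auto simp: absolutely_convex_def)
  then have "0 *\<^sub>R x + 0 *\<^sub>R x \<in> B" using assms by (intro absolutely_convexD) auto
  then show ?thesis by simp
qed

lemma absolutely_convex_scale_abs:
  assumes "absolutely_convex B" "\<bar>t\<bar> \<le> r" "x \<in> B" shows "t *\<^sub>R x \<in> (*\<^sub>R) r ` B"
proof -
  have "t *\<^sub>R x \<in> (*\<^sub>R) \<bar>t\<bar> ` B"
  proof (cases "t \<ge> 0")
    case True then show ?thesis using assms by auto
  next
    case False
    have "(- 1) *\<^sub>R x + 0 *\<^sub>R x \<in> B" using assms by (intro absolutely_convexD) auto
    moreover have "t *\<^sub>R x = \<bar>t\<bar> *\<^sub>R ((- 1) *\<^sub>R x + 0 *\<^sub>R x)" using False by simp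
    ultimately show ?thesis by blast
  qed
  then show ?thesis using absolutely_convex_scale_le[OF assms(1) _ assms(2)] by simp
qed

lemma absolutely_convex_add:
  assumes B: "absolutely_convex B" and "0 \<le> r" "0 \<le> s" and x: "x \<in> (*\<^sub>R) r ` B" and y: "y \<in> (*\<^sub>R) s ` B"
  shows "x + y \<in> (*\<^sub>R) (r + s) ` B"
proof (cases "r + s = 0")
  case True
  then have "r = 0" "s = 0" using assms by auto
  then show ?thesis using x y by auto
next
  case False
  obtain x' y' where *: "x' \<in> B" "x = r *\<^sub>R x'" "y' \<in> B" "y = s *\<^sub>R y'" using x y by blast
  have "(r / (r + s)) *\<^sub>R x' + (s / (r + s)) *\<^sub>R y' \<in> B"
    using assms False by (intro absolutely_convexD[OF B *(1,3)]) (simp flip: add_divide_distrib)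
  moreover have "x + y = (r + s) *\<^sub>R ((r / (r + s)) *\<^sub>R x' + (s / (r + s)) *\<^sub>R y')"
    using * False by (simp add: scaleR_add_right)
  ultimately show ?thesis by blast
qed

lemma absolutely_convex_scaled:
  assumes B: "absolutely_convex B" shows "absolutely_convex ((*\<^sub>R) r ` B)"
proof -
  have "s *\<^sub>R x + t *\<^sub>R y \<in> (*\<^sub>R) r ` B"
    if "x \<in> (*\<^sub>R) r ` B" "y \<in> (*\<^sub>R) r ` B" "\<bar>s\<bar> + \<bar>t\<bar> \<le> 1" for x y s t
  proof -
    obtain x' y' where *: "x' \<in> B" "x = r *\<^sub>R x'" "y' \<in> B" "y = r *\<^sub>R y'" using \<open>x \<in> _\<close> \<open>y \<in> _\<close> by blast
    have "s *\<^sub>R x' + t *\<^sub>R y' \<in> B" using \<open>\<bar>s\<bar> + \<bar>t\<bar> \<le> 1\<close> by (rule absolutely_convexD[OF B *(1,3)])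
    moreover have "s *\<^sub>R x + t *\<^sub>R y = r *\<^sub>R (s *\<^sub>R x' + t *\<^sub>R y')" using * by (simp add: algebra_simps)
    ultimately show ?thesis by blast
  qed
  moreover have "(*\<^sub>R) r ` B \<noteq> {}" using B by (auto simp: absolutely_convex_def)
  ultimately show ?thesis unfolding absolutely_convex_def by blast
qed

lemma disk_span_iff:
  assumes B: "absolutely_convex B"
  shows "x \<in> disk_span B \<longleftrightarrow> (\<exists>r>0. x \<in> (*\<^sub>R) r ` B)"
proof
  assume "x \<in> disk_span B"
  then obtain n :: nat where "x \<in> (*\<^sub>R) (real n) ` B" by (auto simp: disk_span_def)
  then have "x \<in> (*\<^sub>R) (real n + 1) ` B" by (rule absolutely_convex_scale_le[OF B, rotated 2]) auto
  moreover have "real n + 1 > 0" by simp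
  ultimately show "\<exists>r>0. x \<in> (*\<^sub>R) r ` B" by blast
next
  assume "\<exists>r>0. x \<in> (*\<^sub>R) r ` B"
  then obtain r where r: "r > 0" "x \<in> (*\<^sub>R) r ` B" by blast
  obtain n :: nat where n: "r \<le> real n" using real_arch_simple by blast
  have "x \<in> (*\<^sub>R) (real n) ` B" using absolutely_convex_scale_le[OF B _ n r(2)] r(1) by simp
  then show "x \<in> disk_span B" by (auto simp: disk_span_def)
qed

lemma disk_span_0: "absolutely_convex B \<Longrightarrow> 0 \<in> disk_span B"
  using absolutely_convex_0[of B] by (force simp: disk_span_def)

lemma disk_span_add:
  assumes B: "absolutely_convex B" and "x \<in> disk_span B" "y \<in> disk_span B" shows "x + y \<in> disk_span B"
proof -
  obtain r s where "r > 0" "s > 0" "x \<in> (*\<^sub>R) r ` B" "y \<in> (*\<^sub>R) s ` B" using assms disk_span_iff by metis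
  then have "x + y \<in> (*\<^sub>R) (r + s) ` B" "r + s > 0" using absolutely_convex_add[OF B, of r s x y] by auto
  then show ?thesis using disk_span_iff[OF B] by blast
qed

lemma disk_span_scale:
  assumes B: "absolutely_convex B" and "x \<in> disk_span B" shows "t *\<^sub>R x \<in> disk_span B"
proof -
  obtain r where r: "r > 0" "x \<in> (*\<^sub>R) r ` B" using assms disk_span_iff by metis
  then obtain y where y: "y \<in> B" "x = r *\<^sub>R y" by blast
  have "(t * r) *\<^sub>R y \<in> (*\<^sub>R) (\<bar>t * r\<bar> + 1) ` B" by (rule absolutely_convex_scale_abs[OF B _ y(1)]) simp
  then have "t *\<^sub>R x \<in> (*\<^sub>R) (\<bar>t * r\<bar> + 1) ` B" using y by simp
  moreover have "\<bar>t * r\<bar> + 1 > 0" by simp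
  ultimately show ?thesis using disk_span_iff[OF B] by blast
qed

lemma disk_span_minus: "absolutely_convex B \<Longrightarrow> x \<in> disk_span B \<Longrightarrow> - x \<in> disk_span B"
  using disk_span_scale[of B x "-1"] by simp

lemma disk_span_diff: "absolutely_convex B \<Longrightarrow> x \<in> disk_span B \<Longrightarrow> y \<in> disk_span B \<Longrightarrow> x - y \<in> disk_span B"
  using disk_span_add[of B x "- y"] disk_span_minus[of B y] by simp

lemma subset_disk_span: "absolutely_convex B \<Longrightarrow> B \<subseteq> disk_span B"
  using disk_span_iff[of B] by (force intro!: exI[of _ 1])

lemma gauge_norm_lower:
  "0 < r \<Longrightarrow> x \<in> (*\<^sub>R) r ` B \<Longrightarrow> absolutely_convex B \<Longrightarrow> gauge_norm B x \<le> r"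
  using disk_span_iff[of B x] unfolding gauge_norm_def
  by (auto intro!: cInf_lower bdd_belowI[of _ 0])

lemma gauge_norm_greatest:
  assumes "absolutely_convex B" "x \<in> disk_span B" "\<And>r. 0 < r \<Longrightarrow> x \<in> (*\<^sub>R) r ` B \<Longrightarrow> c \<le> r"
  shows "c \<le> gauge_norm B x"
  using assms disk_span_iff[of B x] unfolding gauge_norm_def by (auto intro!: cInf_greatest)

lemma gauge_norm_nonneg: "absolutely_convex B \<Longrightarrow> 0 \<le> gauge_norm B x"
  using gauge_norm_greatest[of B x 0] by (cases "x \<in> disk_span B") (auto simp: gauge_norm_def[of B x])

text \<open>For a general absolutely convex set the infimum in the gauge need not be attained, hence
  the strict inequality; for compact \<open>K\<close> the sharp form is
  \<open>gauge_le_iff\<close>.\<close>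

lemma gauge_norm_less:
  assumes B: "absolutely_convex B" and x: "x \<in> disk_span B" and less: "gauge_norm B x < r"
  shows "x \<in> (*\<^sub>R) r ` B"
proof (rule ccontr)
  assume n: "x \<notin> (*\<^sub>R) r ` B"
  have "r \<le> gauge_norm B x"
  proof (rule gauge_norm_greatest[OF B x])
    fix s assume s: "0 < s" "x \<in> (*\<^sub>R) s ` B"
    show "r \<le> s"
    proof (rule ccontr)
      assume "\<not> r \<le> s"
      then show False using n absolutely_convex_scale_le[OF B _ _ s(2), of r] s(1) by simp
    qed
  qed
  then show False using less by simp
qed

lemma gauge_norm_triangle:
  assumes B: "absolutely_convex B" and x: "x \<in> disk_span B" and y: "y \<in> disk_span B"
  shows "gauge_norm B (x + y) \<le> gauge_norm B x + gauge_norm B y"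
proof (rule field_le_epsilon)
  fix e :: real assume e: "e > 0"
  let ?r = "gauge_norm B x + e / 2" and ?s = "gauge_norm B y + e / 2"
  have rs: "?r > 0" "?s > 0" using e gauge_norm_nonneg[OF B, of x] gauge_norm_nonneg[OF B, of y] by linarith+
  have "x + y \<in> (*\<^sub>R) (?r + ?s) ` B"
    using rs e by (intro absolutely_convex_add[OF B] gauge_norm_less[OF B] x y) auto
  then have "gauge_norm B (x + y) \<le> ?r + ?s" using rs by (intro gauge_norm_lower[OF _ _ B]) auto
  then show "gauge_norm B (x + y) \<le> gauge_norm B x + gauge_norm B y + e" by simp
qed

lemma gauge_norm_0: "absolutely_convex B \<Longrightarrow> gauge_norm B 0 = 0"
proof (rule antisym[OF _ gauge_norm_nonneg])
  assume B: "absolutely_convex B"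
  have "gauge_norm B 0 \<le> 0 + e" if "e > 0" for e
    using gauge_norm_lower[OF that _ B, of 0] absolutely_convex_0[OF B] by force
  then show "gauge_norm B 0 \<le> 0" by (rule field_le_epsilon)
qed

lemma gauge_norm_scale_le:
  assumes B: "absolutely_convex B" and x: "x \<in> disk_span B"
  shows "gauge_norm B (t *\<^sub>R x) \<le> \<bar>t\<bar> * gauge_norm B x"
proof (cases "t = 0")
  case True then show ?thesis using gauge_norm_0[OF B] by simp
next
  case False
  have "gauge_norm B (t *\<^sub>R x) / \<bar>t\<bar> \<le> gauge_norm B x"
  proof (rule gauge_norm_greatest[OF B x])
    fix r assume r: "0 < r" "x \<in> (*\<^sub>R) r ` B"
    then obtain y where y: "y \<in> B" "x = r *\<^sub>R y" by blast
    have "(t * r) *\<^sub>R y \<in> (*\<^sub>R) (\<bar>t\<bar> * r) ` B" using r by (intro absolutely_convex_scale_abs[OF B _ y(1)]) (simp add: abs_mult)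
    then have "gauge_norm B (t *\<^sub>R x) \<le> \<bar>t\<bar> * r" using y r False by (intro gauge_norm_lower[OF _ _ B]) auto
    then show "gauge_norm B (t *\<^sub>R x) / \<bar>t\<bar> \<le> r" using False by (simp add: field_simps)
  qed
  then show ?thesis using False by (simp add: field_simps)
qed

lemma gauge_norm_scale:
  assumes B: "absolutely_convex B" and x: "x \<in> disk_span B"
  shows "gauge_norm B (t *\<^sub>R x) = \<bar>t\<bar> * gauge_norm B x"
proof (cases "t = 0")
  case True then show ?thesis using gauge_norm_0[OF B] by simp
next
  case False
  have "gauge_norm B ((1 / t) *\<^sub>R (t *\<^sub>R x)) \<le> \<bar>1 / t\<bar> * gauge_norm B (t *\<^sub>R x)"
    by (rule gauge_norm_scale_le[OF B disk_span_scale[OF B x]])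
  then show ?thesis using gauge_norm_scale_le[OF B x, of t] False by (simp add: field_simps)
qed

section \<open>Continuous functionals and separation of points\<close>

lemma tendsto_scaleR_lc:
  fixes g :: "_ \<Rightarrow> 'a::locally_convex_space"
  assumes "(f \<longlongrightarrow> r) F" "(g \<longlongrightarrow> x) F"
  shows "((\<lambda>i. f i *\<^sub>R g i) \<longlongrightarrow> r *\<^sub>R x) F"
proof -
  have "filterlim (\<lambda>i. (f i, g i)) (nhds r \<times>\<^sub>F nhds x) F" using assms by (rule filterlim_Pair)
  from filterlim_compose[OF tendsto_scaleR_Pair_lc this] show ?thesis by simp
qed

lemma continuous_on_scaleR_lc:
  fixes g :: "_ \<Rightarrow> 'a::locally_convex_space"
  assumes "continuous_on S f" "continuous_on S g"
  shows "continuous_on S (\<lambda>i. f i *\<^sub>R g i)"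
  using assms unfolding continuous_on_def by (auto intro: tendsto_scaleR_lc)

lemma open_scaled_preimage:
  fixes U :: "'a::locally_convex_space set"
  assumes "open U" shows "open {x. r *\<^sub>R x + z \<in> U}"
proof -
  have "continuous_on UNIV (\<lambda>x. r *\<^sub>R x + z)"
    by (intro continuous_on_add continuous_on_scaleR_lc continuous_on_const continuous_on_id)
  from open_vimage[OF assms this] show ?thesis by (simp add: vimage_def)
qed

lemma dual_space_scale: "a \<in> dual_space \<Longrightarrow> (\<lambda>x. c * a x) \<in> dual_space"
  unfolding dual_space_def
  by (auto intro!: continuous_intros linearI simp: linear_add linear_scale distrib_left)

lemma dual_space_continuous: "a \<in> dual_space \<Longrightarrow> continuous_on S a"
  unfolding dual_space_def using continuous_on_subset by blast

lemma dual_space_linear: "a \<in> dual_space \<Longrightarrow> linear a"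
  by (simp add: dual_space_def)

lemma dual_space_measurable: "a \<in> dual_space \<Longrightarrow> a \<in> borel_measurable borel"
  by (auto simp: dual_space_def intro: borel_measurable_continuous_onI)

text \<open>Thicken \<open>A\<close> by an absolutely convex neighbourhood \<open>U\<close> of 0 so
  that \<open>z\<close> stays outside \<open>B = A + U\<close>. The gauge of \<open>B\<close> is
  finite everywhere because \<open>U\<close> absorbs, and a linear functional below it that agrees
  with it at \<open>z\<close> is at most 1 on \<open>B\<close> and at least 1 at \<open>z\<close>;
  boundedness on \<open>U\<close> makes it continuous.\<close>

theorem separate_absolutely_convex:
  fixes A :: "'a::locally_convex_space set"
  assumes A: "absolutely_convex A" "closed A" and z: "z \<notin> A"
  obtains a where "a \<in> dual_space" "\<And>x. x \<in> A \<Longrightarrow> \<bar>a x\<bar> \<le> 1" "a z > 1"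
proof -
  have "open {x. (-1) *\<^sub>R x + z \<in> - A}" using A by (intro open_scaled_preimage) auto
  moreover have "0 \<in> {x. (-1) *\<^sub>R x + z \<in> - A}" using z by simp
  ultimately obtain V where V: "open V" "0 \<in> V" "V \<subseteq> {x. (-1) *\<^sub>R x + z \<in> - A}"
    "\<And>x y u v. x \<in> V \<Longrightarrow> y \<in> V \<Longrightarrow> u \<ge> 0 \<Longrightarrow> v \<ge> 0 \<Longrightarrow> u + v = 1 \<Longrightarrow> u *\<^sub>R x + v *\<^sub>R y \<in> V"
    using convex_nhds_0 by metis
  \<comment> \<open>\<open>V\<close> is only convex; its symmetric part is absolutely convex, which
    is \<open>Uc\<close> below.\<close>
  define U where "U = {x\<in>V. - x \<in> V}"
  have "open {x. (-1) *\<^sub>R x + 0 \<in> V}" using V by (intro open_scaled_preimage) auto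
  then have Uo: "open U" using V(1) by (simp add: U_def Collect_conj_eq Int_def open_Int flip: Int_def)
  have U0: "0 \<in> U" using V by (simp add: U_def)
  have Uc: "s *\<^sub>R x + t *\<^sub>R y \<in> U" if xy: "x \<in> U" "y \<in> U" and st: "\<bar>s\<bar> + \<bar>t\<bar> \<le> 1" for x y s t
  proof -
    have *: "\<bar>r\<bar> *\<^sub>R (sgn r *\<^sub>R x) = r *\<^sub>R x" for r and x :: 'a by (simp only: scaleR_scaleR abs_mult_sgn)
    have V': "s *\<^sub>R x + t *\<^sub>R y \<in> V" if xy: "x \<in> V" "- x \<in> V" "y \<in> V" "- y \<in> V" for x y
    proof -
      have sx: "sgn s *\<^sub>R x \<in> V" "sgn t *\<^sub>R y \<in> V" using xy V(2) by (auto simp: sgn_if)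
      define q where "q = \<bar>s\<bar> + \<bar>t\<bar>"
      show ?thesis
      proof (cases "q = 0")
        case True then have "s = 0" "t = 0" unfolding q_def by auto then show ?thesis using V(2) by simp
      next
        case False
        then have q: "q > 0" "q \<le> 1" using st unfolding q_def by auto
        have w: "(\<bar>s\<bar> / q) *\<^sub>R (sgn s *\<^sub>R x) + (\<bar>t\<bar> / q) *\<^sub>R (sgn t *\<^sub>R y) \<in> V"
        proof (rule V(4)[OF sx])
          show "\<bar>s\<bar> / q + \<bar>t\<bar> / q = 1" using q(1) unfolding q_def by (simp flip: add_divide_distrib)
        qed (use q in auto)
        have "q *\<^sub>R ((\<bar>s\<bar> / q) *\<^sub>R (sgn s *\<^sub>R x) + (\<bar>t\<bar> / q) *\<^sub>R (sgn t *\<^sub>R y)) + (1 - q) *\<^sub>R 0 \<in> V"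
          using q by (intro V(4)[OF w V(2)]) auto
        moreover have "q *\<^sub>R ((\<bar>s\<bar> / q) *\<^sub>R (sgn s *\<^sub>R x) + (\<bar>t\<bar> / q) *\<^sub>R (sgn t *\<^sub>R y)) + (1 - q) *\<^sub>R 0
           = s *\<^sub>R x + t *\<^sub>R y"
          using q by (simp add: scaleR_add_right abs_mult_sgn)
        ultimately show ?thesis by simp
      qed
    qed
    have "s *\<^sub>R (- x) + t *\<^sub>R (- y) \<in> V" using xy by (intro V') (auto simp: U_def)
    moreover have "s *\<^sub>R (- x) + t *\<^sub>R (- y) = - (s *\<^sub>R x + t *\<^sub>R y)" by simp
    ultimately show ?thesis using V'[of x y] xy by (auto simp: U_def)
  qed
  define B where "B = {x + u |x u. x \<in> A \<and> u \<in> U}"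
  have UB: "U \<subseteq> B"
    unfolding B_def using absolutely_convex_0[OF A(1)] by force
  have zB: "z \<notin> B"
  proof
    assume "z \<in> B"
    then obtain x u where xu: "z = x + u" "x \<in> A" "u \<in> U" by (auto simp: B_def)
    then have "(-1) *\<^sub>R u + z \<in> - A" using V(3) by (auto simp: U_def)
    then show False using xu by simp
  qed
  have B: "absolutely_convex B"
    unfolding absolutely_convex_def
  proof (intro conjI ballI allI impI)
    show "B \<noteq> {}" using UB U0 by auto
    fix x y s t assume "x \<in> B" "y \<in> B" and st: "\<bar>s\<bar> + \<bar>t\<bar> \<le> (1::real)"
    then obtain x' u y' v where *: "x = x' + u" "x' \<in> A" "u \<in> U" "y = y' + v" "y' \<in> A" "v \<in> U" by (auto simp: B_def)
    have "s *\<^sub>R x + t *\<^sub>R y = (s *\<^sub>R x' + t *\<^sub>R y') + (s *\<^sub>R u + t *\<^sub>R v)" using * by (simp add: algebra_simps)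
    moreover have "s *\<^sub>R x' + t *\<^sub>R y' \<in> A" by (rule absolutely_convexD[OF A(1) *(2,5) st])
    ultimately show "s *\<^sub>R x + t *\<^sub>R y \<in> B" using Uc[OF *(3,6) st] unfolding B_def by blast
  qed
  have absorb: "\<exists>r>0. r *\<^sub>R x \<in> U" for x
  proof -
    have "((\<lambda>n. (1 / real (Suc n)) *\<^sub>R x) \<longlongrightarrow> 0 *\<^sub>R x) sequentially"
      by (intro tendsto_scaleR_lc tendsto_const) (use LIMSEQ_inverse_real_of_nat in \<open>simp add: inverse_eq_divide\<close>)
    then have "eventually (\<lambda>n. (1 / real (Suc n)) *\<^sub>R x \<in> U) sequentially"
      using topological_tendstoD[OF _ Uo] U0 by fastforce
    then obtain n where "(1 / real (Suc n)) *\<^sub>R x \<in> U" unfolding eventually_sequentially by auto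
    then show ?thesis by (intro exI[of _ "1 / real (Suc n)"]) simp
  qed
  have span: "disk_span B = UNIV"
  proof -
    have "x \<in> disk_span B" for x
    proof -
      obtain r where r: "r > 0" "r *\<^sub>R x \<in> U" using absorb by blast
      then have "(1 / r) *\<^sub>R (r *\<^sub>R x) \<in> disk_span B" using disk_span_scale[OF B] subset_disk_span[OF B] UB by blast
      then show ?thesis using r by simp
    qed
    then show ?thesis by auto
  qed
  have "sublinear (gauge_norm B)"
    unfolding sublinear_def using gauge_norm_triangle[OF B] gauge_norm_scale[OF B] span by auto
  then obtain f where f: "linear f" "\<And>x. f x \<le> gauge_norm B x" "f z = gauge_norm B z"
    using hahn_banach_sublinear[of "gauge_norm B" z] by metis
  note fl = linear_add[OF f(1)] linear_diff[OF f(1)] linear_scale[OF f(1)] linear_neg[OF f(1)] linear_0[OF f(1)]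
  have fB: "f x \<le> 1" if "x \<in> B" for x
  proof -
    have "gauge_norm B x \<le> 1" using that by (intro gauge_norm_lower[OF _ _ B]) auto
    then show ?thesis using f(2)[of x] by simp
  qed
  have fz: "f z \<ge> 1"
  proof (rule ccontr)
    assume "\<not> f z \<ge> 1"
    then have "z \<in> (*\<^sub>R) 1 ` B" using gauge_norm_less[OF B, of z 1] f(3) span by simp
    then show False using zB by auto
  qed
  have mU: "- u \<in> U" if "u \<in> U" for u using that by (simp add: U_def)
  have fU: "\<bar>f u\<bar> \<le> 1" if "u \<in> U" for u
    using fB[of u] fB[of "- u"] that mU[OF that] UB by (auto simp: fl abs_le_iff)
  have cont: "continuous_on UNIV f"
    unfolding continuous_on_def
  proof (intro ballI tendstoI)
    fix x and e :: real assume e: "e > 0"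
    have o: "open {y. (2 / e) *\<^sub>R y + - ((2 / e) *\<^sub>R x) \<in> U}" by (rule open_scaled_preimage[OF Uo])
    have "eventually (\<lambda>y. y \<in> {y. (2 / e) *\<^sub>R y + - ((2 / e) *\<^sub>R x) \<in> U}) (nhds x)"
      using U0 by (intro eventually_nhds_in_open[OF o]) simp
    then show "eventually (\<lambda>y. dist (f y) (f x) < e) (at x within UNIV)"
      unfolding eventually_at_filter
    proof eventually_elim
      case (elim y)
      then have "\<bar>f ((2 / e) *\<^sub>R y + - ((2 / e) *\<^sub>R x))\<bar> \<le> 1" by (intro fU) simp
      also have "f ((2 / e) *\<^sub>R y + - ((2 / e) *\<^sub>R x)) = (2 / e) * (f y - f x)"
        by (simp add: fl fl right_diff_distrib)
      finally have "(2 / e) * \<bar>f y - f x\<bar> \<le> 1" unfolding abs_mult using e by simp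
      then have "2 * \<bar>f y - f x\<bar> \<le> e" using e by (simp add: field_simps)
      then show ?case using e by (simp add: dist_real_def)
    qed
  qed
  \<comment> \<open>So far only \<open>f \<le> 1\<close> on \<open>A\<close> and
    \<open>1 \<le> f z\<close>. Moving from \<open>A\<close> by a small multiple of \<open>z\<close>
    stays inside \<open>B\<close> and leaves a gap \<open>d\<close>, which division by
    \<open>c\<close> turns into strict separation; the maximum with \<open>1 / 2\<close> keeps
    \<open>c\<close> positive.\<close>
  obtain r where r: "r > 0" "r *\<^sub>R z \<in> U" using absorb by blast
  define d where "d = r * f z"
  have d: "d > 0" using r fz by (simp add: d_def)
  have fA: "f x \<le> 1 - d" if "x \<in> A" for x
  proof -
    have "x + r *\<^sub>R z \<in> B" using that r by (auto simp: B_def)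
    from fB[OF this] show ?thesis by (simp add: fl d_def)
  qed
  define c where "c = max (1 - d) (1 / 2)"
  have c: "0 < c" "c < 1" "1 - d \<le> c" using d by (auto simp: c_def)
  show thesis
  proof (rule that)
    show "(\<lambda>x. (1 / c) * f x) \<in> dual_space" using cont f(1) by (intro dual_space_scale) (simp add: dual_space_def)
    show "\<bar>1 / c * f x\<bar> \<le> 1" if x: "x \<in> A" for x
    proof -
      have "- x \<in> A" by (rule absolutely_convex_uminus[OF A(1) x])
      then have "\<bar>f x\<bar> \<le> c" using fA[OF x] fA[of "- x"] c by (auto simp: fl abs_le_iff)
      then show ?thesis using c by (simp add: abs_mult)
    qed
    show "1 / c * f z > 1" using c fz by (simp add: field_simps)
  qed
qed

lemma dual_space_separates:
  fixes x y :: "'a::locally_convex_space"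
  assumes "x \<noteq> y" obtains a where "a \<in> dual_space" "a x \<noteq> a y"
proof -
  have "absolutely_convex {0 :: 'a}" "closed {0 :: 'a}" by (auto simp: absolutely_convex_def)
  then obtain a where "a \<in> dual_space" "a (x - y) > 1"
    using separate_absolutely_convex[of "{0}" "x - y"] assms by auto
  then show thesis using that[of a] linear_diff[OF dual_space_linear, of a x y] by auto
qed

section \<open>Consequences of the Suslin property\<close>

lemma Lindelof_continuous_image:
  fixes h :: "'p::second_countable_topology \<Rightarrow> 'x::topological_space"
  assumes h: "continuous_on UNIV h" "surj h" and F: "\<And>U :: 'x set. U \<in> F \<Longrightarrow> open U"
  obtains F' :: "'x set set" where "F' \<subseteq> F" "countable F'" "\<Union>F' = \<Union>F"
proof -
  have "open S" if "S \<in> (\<lambda>U. h -` U) ` F" for S using that F open_vimage[OF _ h(1)] by blast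
  then obtain G where G: "G \<subseteq> (\<lambda>U. h -` U) ` F" "countable G" "\<Union>G = \<Union>((\<lambda>U. h -` U) ` F)"
    using Lindelof by blast
  then obtain F' where F': "F' \<subseteq> F" "countable F'" "G = (\<lambda>U. h -` U) ` F'"
    using countable_subset_image by metis
  have "h -` (\<Union>F') = h -` (\<Union>F)" using G(3) F'(3) by (auto simp: vimage_Union)
  then have "\<Union>F' = \<Union>F" using h(2) surj_image_vimage_eq by metis
  then show thesis using F' that by blast
qed

lemma suslin_pair:
  fixes g :: "'p::second_countable_topology \<Rightarrow> 'a::topological_space"
  assumes "continuous_on UNIV g" "surj g"
  shows "continuous_on UNIV (\<lambda>p. (g (fst p), g (snd p)))" "surj (\<lambda>p. (g (fst p), g (snd p)))"
proof -
  show "continuous_on UNIV (\<lambda>p. (g (fst p), g (snd p)))"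
    by (intro continuous_on_Pair continuous_on_compose2[OF assms(1)] continuous_intros) auto
  have "\<exists>p. z = (g (fst p), g (snd p))" for z
  proof -
    obtain u v where "fst z = g u" "snd z = g v" using assms(2) by (metis surjD)
    then show ?thesis by (intro exI[of _ "(u, v)"]) (simp add: prod_eq_iff)
  qed
  then show "surj (\<lambda>p. (g (fst p), g (snd p)))" unfolding surj_def by blast
qed

text \<open>For each functional the set of pairs it distinguishes is open, and these sets cover all
  pairs of distinct points. As a continuous image of a second countable space the square has the
  Lindelof property for every family of open sets, so countably many functionals do.\<close>

lemma suslin_separating_sequence:
  fixes g :: "'p::second_countable_topology \<Rightarrow> 'a::locally_convex_space"
  assumes g: "continuous_on UNIV g" "surj g"
  obtains \<xi> :: "nat \<Rightarrow> 'a \<Rightarrow> real"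
  where "\<And>k. \<xi> k \<in> dual_space" "\<And>x y. x \<noteq> y \<Longrightarrow> \<exists>k. \<xi> k x \<noteq> \<xi> k y"
proof -
  define W where "W a = {p :: 'a \<times> 'a. a (fst p) \<noteq> a (snd p)}" for a :: "'a \<Rightarrow> real"
  have W: "open (W a)" if a: "a \<in> dual_space" for a
  proof -
    have "continuous_on UNIV (\<lambda>p :: 'a \<times> 'a. a (fst p))" "continuous_on UNIV (\<lambda>p :: 'a \<times> 'a. a (snd p))"
      by (rule continuous_on_compose2[OF dual_space_continuous[OF a, of UNIV]]; auto intro!: continuous_intros)+
    then show ?thesis unfolding W_def by (rule open_Collect_neq)
  qed
  obtain F where F: "F \<subseteq> W ` dual_space" "countable F" "\<Union>F = \<Union>(W ` dual_space)"
    using Lindelof_continuous_image[OF suslin_pair[OF g], of "W ` dual_space"] W by blast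
  then obtain G where G: "G \<subseteq> dual_space" "countable G" "F = W ` G"
    using countable_subset_image by metis
  \<comment> \<open>The zero functional is added so that the set is nonempty and
    \<open>from_nat_into\<close> enumerates it even if the space is trivial.\<close>
  define G' where "G' = insert (\<lambda>_. 0) G"
  have "(\<lambda>_. 0 :: real) \<in> (dual_space :: ('a \<Rightarrow> real) set)" by (auto simp: dual_space_def linear_zero)
  then have G': "G' \<subseteq> dual_space" "countable G'" "G' \<noteq> {}" using G by (auto simp: G'_def)
  show thesis
  proof (rule that[of "from_nat_into G'"])
    show "from_nat_into G' k \<in> dual_space" for k using from_nat_into[OF G'(3)] G'(1) by blast
    show "\<exists>k. from_nat_into G' k x \<noteq> from_nat_into G' k y" if xy: "x \<noteq> y" for x y
    proof -
      obtain a where "a \<in> dual_space" "a x \<noteq> a y" using dual_space_separates[OF xy] .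
      then have "(x, y) \<in> \<Union>(W ` dual_space)" by (auto simp: W_def)
      then have "(x, y) \<in> \<Union>(W ` G)" unfolding F(3)[symmetric] G(3) .
      then obtain b where "b \<in> G" "b x \<noteq> b y" unfolding W_def by auto
      then show ?thesis using from_nat_into_surj[OF G'(2), of b] by (auto simp: G'_def)
    qed
  qed
qed

text \<open>The preimage of an open set is a union of open rectangles, and the Lindelof property of
  the square reduces it to countably many. This places it in the product of the Borel
  sigma-algebras, not merely among the Borel sets of the product.\<close>

lemma suslin_add_measurable:
  fixes g :: "'p::second_countable_topology \<Rightarrow> 'a::topological_monoid_add"
  assumes g: "continuous_on UNIV g" "surj g"
  shows "(\<lambda>(x, y). x + y :: 'a) \<in> borel \<Otimes>\<^sub>M borel \<rightarrow>\<^sub>M borel"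
proof (rule borel_measurableI)
  fix S :: "'a set" assume S: "open S"
  have "open {p :: 'a \<times> 'a. fst p + snd p \<in> S}"
    using open_vimage[OF S, of "\<lambda>p. fst p + snd p"] by (simp add: vimage_def continuous_intros)
  define F where "F = {U \<times> V |U V. open U \<and> open V \<and> U \<times> V \<subseteq> {p :: 'a \<times> 'a. fst p + snd p \<in> S}}"
  have UF: "\<Union>F = {p :: 'a \<times> 'a. fst p + snd p \<in> S}"
  proof
    show "{p. fst p + snd p \<in> S} \<subseteq> \<Union>F"
    proof
      fix p :: "'a \<times> 'a" assume "p \<in> {p. fst p + snd p \<in> S}"
      then obtain U V where "open U" "open V" "p \<in> U \<times> V" "U \<times> V \<subseteq> {p. fst p + snd p \<in> S}"
        using open_prod_elim[OF \<open>open {p. fst p + snd p \<in> S}\<close>] by blast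
      then show "p \<in> \<Union>F" unfolding F_def by blast
    qed
  qed (auto simp: F_def)
  have "open R" if "R \<in> F" for R using that by (auto simp: F_def open_Times)
  then obtain F' where F': "F' \<subseteq> F" "countable F'" "\<Union>F' = \<Union>F"
    using Lindelof_continuous_image[OF suslin_pair[OF g]] by blast
  have "\<Union>F' \<in> sets (borel \<Otimes>\<^sub>M borel)"
  proof (rule sets.countable_Union[OF F'(2)])
    show "F' \<subseteq> sets (borel \<Otimes>\<^sub>M borel)"
      using F'(1) unfolding F_def by (auto intro!: pair_measureI borel_open)
  qed
  moreover have "(\<lambda>(x, y). x + y) -` S \<inter> space (borel \<Otimes>\<^sub>M borel) = \<Union>F'"
    unfolding F'(3) UF by (auto simp: space_pair_measure)
  ultimately show "(\<lambda>(x, y). x + y) -` S \<inter> space (borel \<Otimes>\<^sub>M borel) \<in> sets (borel \<Otimes>\<^sub>M borel)" by simp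
qed

section \<open>Convolution and Poisson exponentials\<close>

lemma fourier_pair:
  assumes "finite_measure M" "finite_measure N" "f \<in> borel_measurable M" "g \<in> borel_measurable N"
  shows "fourier (M \<Otimes>\<^sub>M N) (\<lambda>p. f (fst p) + g (snd p)) = fourier M f * fourier N g"
proof -
  interpret M: finite_measure M by fact
  interpret N: finite_measure N by fact
  interpret MN: pair_sigma_finite M N ..
  interpret P: finite_measure "M \<Otimes>\<^sub>M N" by (rule finite_measure_pair_measure) fact+
  note [measurable] = assms(3,4)
  have "fourier (M \<Otimes>\<^sub>M N) (\<lambda>p. f (fst p) + g (snd p)) = (CLINT x|M. CLINT y|N. iexp (f x + g y))"
    unfolding fourier_def
    using P.integrable_iexp[of "\<lambda>p. f (fst p) + g (snd p)"] by (subst MN.integral_fst'[symmetric]) auto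
  also have "\<dots> = (CLINT x|M. CLINT y|N. iexp (f x) * iexp (g y))"
    by (simp add: distrib_left exp_add)
  finally show ?thesis by (simp add: fourier_def)
qed

lemma fourier_distr:
  assumes "h \<in> M \<rightarrow>\<^sub>M N" "a \<in> borel_measurable N"
  shows "fourier (distr M N h) a = fourier M (\<lambda>x. a (h x))"
  unfolding fourier_def using assms by (subst integral_distr) auto

lemma fourier_cong: "(\<And>x. x \<in> space M \<Longrightarrow> a x = b x) \<Longrightarrow> fourier M a = fourier M b"
  unfolding fourier_def by (intro Bochner_Integration.integral_cong) auto

lemma fourier_return:
  "x \<in> space M \<Longrightarrow> a \<in> borel_measurable M \<Longrightarrow> fourier (return M x) a = iexp (a x)"
  unfolding fourier_def by (subst integral_return) auto

lemma finite_borel_measures_iff: "M \<in> finite_borel_measures T \<longleftrightarrow> sets M = sets (borel_of T) \<and> finite_measure M"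
  by (simp add: finite_borel_measures_def)

lemma prob_borel_measures_iff: "M \<in> prob_borel_measures T \<longleftrightarrow> sets M = sets (borel_of T) \<and> prob_space M"
  by (simp add: prob_borel_measures_def)

lemma prob_borel_imp_finite: "M \<in> prob_borel_measures T \<Longrightarrow> M \<in> finite_borel_measures T"
  by (simp add: finite_borel_measures_iff prob_borel_measures_iff prob_space.finite_measure)

lemma finite_borel_measures_space: "M \<in> finite_borel_measures T \<Longrightarrow> space M = topspace T"
  unfolding finite_borel_measures_iff by (metis sets_eq_imp_space_eq space_borel_of)

lemma prob_borel_measuresI:
  assumes "M \<in> finite_borel_measures T" "measure M (topspace T) = 1"
  shows "M \<in> prob_borel_measures T"
  using assms finite_borel_measures_space[OF assms(1)]
  by (auto simp: prob_borel_measures_iff finite_borel_measures_iff finite_measure.emeasure_eq_measure intro!: prob_spaceI)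

lemma prob_borel_measures_measure: "M \<in> prob_borel_measures T \<Longrightarrow> measure M (topspace T) = 1"
  using prob_space.prob_space[of M] finite_borel_measures_space[OF prob_borel_imp_finite, of M T]
  by (simp add: prob_borel_measures_iff)

text \<open>All that the calculus of convolutions asks of a topology. It is verified for
  \<open>E\<close> and for \<open>disk_span K\<close> with the induced topology; closure of the
  carrier under addition is contained in the measurability, see \<open>topspace_add\<close>.\<close>

definition additive_space :: "'a::real_vector topology \<Rightarrow> bool" where
  "additive_space T \<longleftrightarrow> 0 \<in> topspace T \<and>
     (\<lambda>(x, y). x + y) \<in> borel_of T \<Otimes>\<^sub>M borel_of T \<rightarrow>\<^sub>M borel_of T"

text \<open>Covers functionals, for which Fourier transforms multiply, as well as the inclusion of
  \<open>disk_span K\<close> into \<open>E\<close>, along which measures are transported.\<close>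

definition additive_map :: "'a::real_vector topology \<Rightarrow> ('a \<Rightarrow> 'b::ab_group_add) \<Rightarrow> bool" where
  "additive_map T h \<longleftrightarrow> (\<forall>x\<in>topspace T. \<forall>y\<in>topspace T. h (x + y) = h x + h y)"

lemma additive_map_0:
  assumes "additive_space T" "additive_map T h" shows "h 0 = 0"
proof -
  have "h (0 + 0) = h 0 + h 0" using assms unfolding additive_space_def additive_map_def by blast
  then show ?thesis by simp
qed

context
  fixes T :: "'a::real_vector topology"
  assumes T: "additive_space T"
begin

lemma add_measurable_pair:
  assumes "M \<in> finite_borel_measures T" "N \<in> finite_borel_measures T"
  shows "(\<lambda>(x, y). x + y) \<in> M \<Otimes>\<^sub>M N \<rightarrow>\<^sub>M borel_of T"
  using T assms measurable_cong_sets[OF sets_pair_measure_cong refl, of M "borel_of T" N "borel_of T" "borel_of T"]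
  unfolding additive_space_def finite_borel_measures_iff by blast

lemma return_0_finite: "return (borel_of T) 0 \<in> finite_borel_measures T"
  using T prob_space.finite_measure[OF prob_space_return[of 0 "borel_of T"]]
  by (auto simp: finite_borel_measures_iff additive_space_def)

lemma return_finite: "x \<in> topspace T \<Longrightarrow> return (borel_of T) x \<in> finite_borel_measures T"
  using prob_space.finite_measure[OF prob_space_return[of x "borel_of T"]] by (auto simp: finite_borel_measures_iff)

lemma conv_meas_finite:
  assumes "M \<in> finite_borel_measures T" "N \<in> finite_borel_measures T"
  shows "conv_meas T M N \<in> finite_borel_measures T"
proof -
  have "finite_measure (M \<Otimes>\<^sub>M N)" using assms by (intro finite_measure_pair_measure) (auto simp: finite_borel_measures_iff)
  then have "finite_measure (conv_meas T M N)" unfolding conv_meas_def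
    by (intro finite_measure.finite_measure_distr add_measurable_pair assms)
  then show ?thesis by (simp add: finite_borel_measures_iff conv_meas_def)
qed

lemma emeasure_conv_meas:
  assumes M: "M \<in> finite_borel_measures T" and N: "N \<in> finite_borel_measures T" and A: "A \<in> sets (borel_of T)"
  shows "emeasure (conv_meas T M N) A = (\<integral>\<^sup>+y. emeasure M {x \<in> topspace T. x + y \<in> A} \<partial>N)"
proof -
  interpret M: finite_measure M using M by (simp add: finite_borel_measures_iff)
  interpret N: finite_measure N using N by (simp add: finite_borel_measures_iff)
  interpret MN: pair_sigma_finite M N ..
  note m = add_measurable_pair[OF M N]
  have "emeasure (conv_meas T M N) A = emeasure (M \<Otimes>\<^sub>M N) ((\<lambda>(x, y). x + y) -` A \<inter> space (M \<Otimes>\<^sub>M N))"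
    unfolding conv_meas_def by (rule emeasure_distr[OF m A])
  also have "\<dots> = (\<integral>\<^sup>+y. emeasure M ((\<lambda>x. (x, y)) -` ((\<lambda>(x, y). x + y) -` A \<inter> space (M \<Otimes>\<^sub>M N))) \<partial>N)"
    by (intro MN.emeasure_pair_measure_alt2 measurable_sets[OF m A])
  also have "\<dots> = (\<integral>\<^sup>+y. emeasure M {x \<in> topspace T. x + y \<in> A} \<partial>N)"
  proof (rule nn_integral_cong)
    fix y assume "y \<in> space N"
    then have "(\<lambda>x. (x, y)) -` ((\<lambda>(x, y). x + y) -` A \<inter> space (M \<Otimes>\<^sub>M N)) = {x \<in> topspace T. x + y \<in> A}"
      using finite_borel_measures_space[OF M] by (auto simp: space_pair_measure)
    then show "emeasure M ((\<lambda>x. (x, y)) -` ((\<lambda>(x, y). x + y) -` A \<inter> space (M \<Otimes>\<^sub>M N))) = emeasure M {x \<in> topspace T. x + y \<in> A}"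
      by simp
  qed
  finally show ?thesis .
qed

lemma topspace_add: 
  assumes "x \<in> topspace T" "y \<in> topspace T" shows "x + y \<in> topspace T"
proof -
  have "(\<lambda>(x, y). x + y) \<in> borel_of T \<Otimes>\<^sub>M borel_of T \<rightarrow>\<^sub>M borel_of T" using T by (simp add: additive_space_def)
  from measurable_space[OF this, of "(x, y)"] show ?thesis using assms by (simp add: space_pair_measure)
qed

lemma measure_conv_meas_space:
  assumes M: "M \<in> finite_borel_measures T" and N: "N \<in> finite_borel_measures T"
  shows "measure (conv_meas T M N) (topspace T) = measure M (topspace T) * measure N (topspace T)"
proof -
  have s: "space M = topspace T" "space N = topspace T" using M N finite_borel_measures_space by auto
  have "emeasure (conv_meas T M N) (topspace T) = (\<integral>\<^sup>+y. emeasure M {x \<in> topspace T. x + y \<in> topspace T} \<partial>N)"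
    using sets.top[of "borel_of T"] by (intro emeasure_conv_meas[OF M N]) simp
  also have "\<dots> = (\<integral>\<^sup>+y. emeasure M (topspace T) \<partial>N)"
  proof (rule nn_integral_cong)
    fix y assume "y \<in> space N"
    then have "{x \<in> topspace T. x + y \<in> topspace T} = topspace T" using topspace_add s by auto
    then show "emeasure M {x \<in> topspace T. x + y \<in> topspace T} = emeasure M (topspace T)" by simp
  qed
  finally show ?thesis by (simp add: measure_def s enn2real_mult)
qed

lemma conv_power_finite:
  assumes "M \<in> finite_borel_measures T"
  shows "conv_power T M n \<in> finite_borel_measures T"
  by (induction n) (auto intro: return_0_finite conv_meas_finite assms)

lemma measure_conv_power_space:
  assumes "M \<in> finite_borel_measures T"
  shows "measure (conv_power T M n) (topspace T) = measure M (topspace T) ^ n"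
proof (induction n)
  case 0
  have "measure (return (borel_of T) 0) (topspace T) = 1"
    using T sets.top[of "borel_of T"] by (simp add: measure_return additive_space_def)
  then show ?case by simp
next
  case (Suc n)
  then show ?case by (simp add: measure_conv_meas_space assms conv_power_finite)
qed

lemma fourier_conv_meas:
  assumes M: "M \<in> finite_borel_measures T" and N: "N \<in> finite_borel_measures T"
    and a: "a \<in> borel_measurable (borel_of T)" "additive_map T a"
  shows "fourier (conv_meas T M N) a = fourier M a * fourier N a"
proof -
  have s: "space M = topspace T" "space N = topspace T" using M N finite_borel_measures_space by auto
  have "fourier (conv_meas T M N) a = fourier (M \<Otimes>\<^sub>M N) (\<lambda>p. a (case p of (x, y) \<Rightarrow> x + y))"
    unfolding conv_meas_def by (rule fourier_distr[OF add_measurable_pair[OF M N] a(1)])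
  also have "\<dots> = fourier (M \<Otimes>\<^sub>M N) (\<lambda>p. a (fst p) + a (snd p))"
    using a(2) by (intro fourier_cong) (auto simp: space_pair_measure s additive_map_def)
  also have "\<dots> = fourier M a * fourier N a"
    using M N a measurable_cong_sets[of M "borel_of T" borel borel] measurable_cong_sets[of N "borel_of T" borel borel]
    by (intro fourier_pair) (auto simp: finite_borel_measures_iff)
  finally show ?thesis .
qed

lemma fourier_conv_power:
  assumes M: "M \<in> finite_borel_measures T"
    and a: "a \<in> borel_measurable (borel_of T)" "additive_map T a"
  shows "fourier (conv_power T M n) a = fourier M a ^ n"
proof (induction n)
  case 0
  have "fourier (return (borel_of T) 0) a = iexp (a 0)" using T a by (intro fourier_return) (auto simp: additive_space_def)
  then show ?case using additive_map_0[OF T a(2)] by simp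
next
  case (Suc n)
  then show ?case by (simp add: fourier_conv_meas[OF M conv_power_finite[OF M] a])
qed

lemma translate_meas_finite:
  "M \<in> finite_borel_measures T \<Longrightarrow> x \<in> topspace T \<Longrightarrow> translate_meas T M x \<in> finite_borel_measures T"
  unfolding translate_meas_def by (intro conv_meas_finite return_finite)

lemma fourier_translate_meas:
  assumes "M \<in> finite_borel_measures T" "x \<in> topspace T"
    and a: "a \<in> borel_measurable (borel_of T)" "additive_map T a"
  shows "fourier (translate_meas T M x) a = fourier M a * iexp (a x)"
  unfolding translate_meas_def using assms
  by (simp add: fourier_conv_meas[OF _ return_finite] fourier_return)

lemma emeasure_translate_meas:
  assumes M: "M \<in> finite_borel_measures T" and x: "x \<in> topspace T" and A: "A \<in> sets (borel_of T)"
  shows "emeasure (translate_meas T M x) A = emeasure M {y \<in> topspace T. y + x \<in> A}"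
proof -
  interpret finite_measure M using M by (simp add: finite_borel_measures_iff)
  interpret N: finite_measure "return (borel_of T) x" using return_finite[OF x] by (simp add: finite_borel_measures_iff)
  interpret pair_sigma_finite M "return (borel_of T) x" ..
  note m = add_measurable_pair[OF M return_finite[OF x]]
  have "(\<lambda>y. emeasure M ((\<lambda>z. (z, y)) -` ((\<lambda>(x, y). x + y) -` A \<inter> space (M \<Otimes>\<^sub>M return (borel_of T) x))))
      \<in> borel_measurable (return (borel_of T) x)"
    by (rule measurable_emeasure_Pair2[OF measurable_sets[OF m A]])
  then have "(\<lambda>y. emeasure M {z \<in> topspace T. z + y \<in> A}) \<in> borel_measurable (return (borel_of T) x)"
    by (rule measurable_cong[THEN iffD1, rotated])
       (auto intro!: arg_cong[where f="emeasure M"] simp: space_pair_measure finite_borel_measures_space[OF M])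
  then show ?thesis
    unfolding translate_meas_def emeasure_conv_meas[OF M return_finite[OF x] A]
    using x by (subst nn_integral_return) auto
qed

lemma measure_translate_meas:
  assumes "M \<in> finite_borel_measures T" "x \<in> topspace T" "A \<in> sets (borel_of T)"
  shows "measure (translate_meas T M x) A = measure M {y \<in> topspace T. y + x \<in> A}"
  using emeasure_translate_meas[OF assms] by (simp add: measure_def)

text \<open>Viewing the exponential series as a bind over the counting measure of the naturals
  provides countable additivity of \<open>poisson_exp\<close> and integration against it. Each term
  has mass at most 1, since \<open>m^n / n! \<le> exp m\<close>.\<close>

definition poisson_kernel :: "'a measure \<Rightarrow> nat \<Rightarrow> 'a measure" where
  "poisson_kernel M n = scale_measure (ennreal (exp (- measure M (topspace T)) / fact n)) (conv_power T M n)"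

lemma poisson_kernel_subprob:
  assumes M: "M \<in> finite_borel_measures T"
  shows "poisson_kernel M \<in> count_space UNIV \<rightarrow>\<^sub>M subprob_algebra (borel_of T)"
proof -
  have "poisson_kernel M n \<in> space (subprob_algebra (borel_of T))" for n
  proof -
    let ?m = "measure M (topspace T)"
    let ?N = "conv_power T M n"
    have N: "?N \<in> finite_borel_measures T" by (rule conv_power_finite[OF M])
    have s: "space ?N = topspace T" by (rule finite_borel_measures_space[OF N])
    interpret finite_measure ?N using N by (simp add: finite_borel_measures_iff)
    have "(\<lambda>k. ?m ^ k / fact k) sums exp ?m" using exp_converges[of ?m] by (simp add: divide_inverse mult.commute)
    then have "(\<Sum>k\<in>{n}. ?m ^ k / fact k) \<le> exp ?m"
      using sum_le_suminf[of "\<lambda>k. ?m ^ k / fact k" "{n}"] by (auto simp: sums_iff)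
    then have "exp (- ?m) / fact n * ?m ^ n \<le> 1" by (simp add: exp_minus field_simps)
    then have "emeasure (poisson_kernel M n) (topspace T) \<le> 1"
      unfolding poisson_kernel_def emeasure_scale_measure emeasure_eq_measure measure_conv_power_space[OF M]
      by (simp flip: ennreal_mult)
    moreover have "0 \<in> topspace T" using T by (auto simp: additive_space_def)
    moreover have "space (poisson_kernel M n) = topspace T" "sets (poisson_kernel M n) = sets (borel_of T)"
      using s N by (auto simp: poisson_kernel_def finite_borel_measures_iff space_scale_measure)
    ultimately show ?thesis by (auto simp: space_subprob_algebra intro!: subprob_spaceI)
  qed
  then show ?thesis by simp
qed

lemma poisson_exp_eq_bind:
  assumes M: "M \<in> finite_borel_measures T"
  shows "poisson_exp T M = count_space UNIV \<bind> poisson_kernel M"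
proof -
  let ?P = "count_space UNIV \<bind> poisson_kernel M"
  have s: "sets ?P = sets (borel_of T)"
    by (rule sets_bind[OF sets_kernel[OF poisson_kernel_subprob[OF M]]]) auto
  then have sp: "space ?P = topspace T" by (metis sets_eq_imp_space_eq space_borel_of)
  have e: "emeasure ?P A = (\<Sum>n. ennreal (exp (- measure M (topspace T)) / fact n) * emeasure (conv_power T M n) A)"
    if A: "A \<in> sets (borel_of T)" for A
    using emeasure_bind[OF _ poisson_kernel_subprob[OF M] A]
    by (simp add: nn_integral_count_space_nat poisson_kernel_def)
  have "?P = measure_of (space ?P) (sets ?P) (emeasure ?P)" by (rule measure_of_of_measure[symmetric])
  also have "\<dots> = poisson_exp T M"
    unfolding poisson_exp_def s sp
    using e sets.sets_measure_of_eq[of "borel_of T"] sets.sigma_sets_eq[of "borel_of T"] 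
    by (intro measure_of_eq sets.space_closed[of "borel_of T", simplified]) auto
  finally show ?thesis by simp
qed

lemma sets_poisson_exp:
  assumes M: "M \<in> finite_borel_measures T"
  shows "sets (poisson_exp T M) = sets (borel_of T)"
  unfolding poisson_exp_eq_bind[OF M]
  by (rule sets_bind[OF sets_kernel[OF poisson_kernel_subprob[OF M]]]) auto

lemma emeasure_poisson_exp:
  assumes M: "M \<in> finite_borel_measures T" and A: "A \<in> sets (borel_of T)"
  shows "emeasure (poisson_exp T M) A
    = (\<Sum>n. ennreal (exp (- measure M (topspace T)) / fact n) * emeasure (conv_power T M n) A)"
  unfolding poisson_exp_eq_bind[OF M]
  using emeasure_bind[OF _ poisson_kernel_subprob[OF M] A]
  by (simp add: nn_integral_count_space_nat poisson_kernel_def)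

lemma nn_integral_poisson_exp:
  assumes M: "M \<in> finite_borel_measures T" and f: "f \<in> borel_measurable (borel_of T)"
  shows "(\<integral>\<^sup>+x. f x \<partial>poisson_exp T M)
    = (\<Sum>n. ennreal (exp (- measure M (topspace T)) / fact n) * (\<integral>\<^sup>+x. f x \<partial>conv_power T M n))"
proof -
  have m: "f \<in> borel_measurable (conv_power T M n)" for n
    using conv_power_finite[OF M, of n] f measurable_cong_sets[of "conv_power T M n" "borel_of T" borel borel]
    by (auto simp: finite_borel_measures_iff)
  show ?thesis
    unfolding poisson_exp_eq_bind[OF M] nn_integral_bind[OF f poisson_kernel_subprob[OF M]]
    by (simp add: nn_integral_count_space_nat poisson_kernel_def nn_integral_scale_measure m)
qed

lemma poisson_exp_prob:
  assumes M: "M \<in> finite_borel_measures T"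
  shows "poisson_exp T M \<in> prob_borel_measures T"
proof -
  let ?m = "measure M (topspace T)"
  have s: "sets (poisson_exp T M) = sets (borel_of T)" by (rule sets_poisson_exp[OF M])
  then have sp: "space (poisson_exp T M) = topspace T" by (metis sets_eq_imp_space_eq space_borel_of)
  have sums: "(\<lambda>n. exp (- ?m) / fact n * ?m ^ n) sums (exp (- ?m) * exp ?m)"
    using sums_mult[OF exp_converges[of ?m], of "exp (- ?m)"] by (simp add: divide_inverse mult_ac)
  have "emeasure (poisson_exp T M) (topspace T) = (\<Sum>n. ennreal (exp (- ?m) / fact n) * emeasure (conv_power T M n) (topspace T))"
    using sets.top[of "borel_of T"] by (intro emeasure_poisson_exp[OF M]) simp
  also have "\<dots> = (\<Sum>n. ennreal (exp (- ?m) / fact n * ?m ^ n))"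
  proof (intro arg_cong[where f=suminf] ext)
    fix n
    interpret finite_measure "conv_power T M n" using conv_power_finite[OF M, of n] by (simp add: finite_borel_measures_iff)
    show "ennreal (exp (- ?m) / fact n) * emeasure (conv_power T M n) (topspace T) = ennreal (exp (- ?m) / fact n * ?m ^ n)"
      by (simp add: emeasure_eq_measure measure_conv_power_space[OF M] flip: ennreal_mult)
  qed
  also have "\<dots> = ennreal (exp (- ?m) * exp ?m)" by (rule suminf_ennreal_eq[OF _ sums]) simp
  finally have "emeasure (poisson_exp T M) (topspace T) = 1" by (simp flip: exp_add)
  then have "prob_space (poisson_exp T M)" by (intro prob_spaceI) (simp add: sp)
  then show ?thesis using s by (simp add: prob_borel_measures_iff)
qed

lemma integral_poisson_exp:
  fixes f :: "'a \<Rightarrow> real"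
  assumes M: "M \<in> finite_borel_measures T" and f: "f \<in> borel_measurable (borel_of T)" "\<And>x. 0 \<le> f x" "\<And>x. f x \<le> B"
    and s: "(\<lambda>n. exp (- measure M (topspace T)) / fact n * (\<integral>x. f x \<partial>conv_power T M n)) sums S"
  shows "(\<integral>x. f x \<partial>poisson_exp T M) = S"
proof -
  let ?m = "measure M (topspace T)"
  have i: "integrable N f" if "N \<in> finite_borel_measures T" for N
    using that f measurable_cong_sets[of N "borel_of T" borel borel]
    by (intro finite_measure.integrable_bounded_real[of N f B]) (auto simp: finite_borel_measures_iff)
  have "(\<integral>\<^sup>+x. f x \<partial>poisson_exp T M) = (\<Sum>n. ennreal (exp (- ?m) / fact n) * (\<integral>\<^sup>+x. f x \<partial>conv_power T M n))"
    using f by (intro nn_integral_poisson_exp[OF M]) auto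
  also have "\<dots> = (\<Sum>n. ennreal (exp (- ?m) / fact n * (\<integral>x. f x \<partial>conv_power T M n)))"
    using f i[OF conv_power_finite[OF M]]
    by (subst nn_integral_eq_integral) (auto simp: integral_nonneg_AE ennreal_mult[symmetric] simp del: times_divide_eq_left)
  also have "\<dots> = ennreal S"
    using f by (intro suminf_ennreal_eq[OF _ s]) (auto intro!: mult_nonneg_nonneg integral_nonneg_AE)
  finally have "(\<integral>\<^sup>+x. f x \<partial>poisson_exp T M) = ennreal S" .
  moreover have "(\<integral>\<^sup>+x. f x \<partial>poisson_exp T M) = ennreal (\<integral>x. f x \<partial>poisson_exp T M)"
    using f i[OF prob_borel_imp_finite[OF poisson_exp_prob[OF M]]] by (intro nn_integral_eq_integral) auto
  moreover have "S \<ge> 0" using f by (intro sums_le[OF _ sums_zero s]) (auto intro!: mult_nonneg_nonneg integral_nonneg_AE)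
  moreover have "(\<integral>x. f x \<partial>poisson_exp T M) \<ge> 0" using f by (intro integral_nonneg_AE) auto
  ultimately show ?thesis by simp
qed

text \<open>Termwise integration is done for nonnegative functions, so real and imaginary parts are
  treated through \<open>1 + cos\<close> and \<open>1 + sin\<close>; the added constant integrates
  to 1 and is removed at the end. The powers of \<open>fourier M a\<close> then form the exponential
  series.\<close>

lemma fourier_poisson_exp:
  assumes M: "M \<in> finite_borel_measures T" and a: "a \<in> borel_measurable (borel_of T)" "additive_map T a"
  shows "fourier (poisson_exp T M) a = exp (fourier M a - of_real (measure M (topspace T)))"
proof -
  let ?m = "measure M (topspace T)" and ?\<phi> = "fourier M a" and ?P = "poisson_exp T M"
  have am: "a \<in> borel_measurable N" if "N \<in> finite_borel_measures T" for N
    using that a measurable_cong_sets[of N "borel_of T" borel borel] by (auto simp: finite_borel_measures_iff)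
  have fin: "finite_measure N" if "N \<in> finite_borel_measures T" for N using that by (simp add: finite_borel_measures_iff)
  have sp: "space N = topspace T" if "N \<in> finite_borel_measures T" for N using that by (rule finite_borel_measures_space)
  have P: "?P \<in> finite_borel_measures T" by (rule prob_borel_imp_finite[OF poisson_exp_prob[OF M]])
  have ic: "integrable N (\<lambda>x. cos (a x))" "integrable N (\<lambda>x. sin (a x))" if "N \<in> finite_borel_measures T" for N
    using fin[OF that] am[OF that] by (auto intro!: finite_measure.integrable_bounded_real[of N _ 1])
  have m1: "(\<lambda>n. exp (- ?m) / fact n * ?m ^ n) sums 1"
    using sums_mult[OF exp_converges[of ?m], of "exp (- ?m)"] by (simp add: divide_inverse mult_ac flip: exp_add)
  have e: "(\<lambda>n. of_real (exp (- ?m)) * (?\<phi> ^ n /\<^sub>R fact n)) sums (of_real (exp (- ?m)) * exp ?\<phi>)"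
    by (intro sums_mult exp_converges)
  have E: "of_real (exp (- ?m)) * exp ?\<phi> = exp (?\<phi> - of_real ?m)" by (simp add: exp_diff exp_minus exp_of_real field_simps)
  have Pm: "measure ?P (topspace T) = 1" by (rule prob_borel_measures_measure[OF poisson_exp_prob[OF M]])
  have s1: "(\<lambda>n. exp (- ?m) / fact n * ?m ^ n + Re (of_real (exp (- ?m)) * (?\<phi> ^ n /\<^sub>R fact n))) sums (1 + Re (exp (?\<phi> - of_real ?m)))"
    using sums_add[OF m1 sums_Re[OF e]] unfolding E .
  have e1: "exp (- ?m) / fact n * ?m ^ n + Re (of_real (exp (- ?m)) * (?\<phi> ^ n /\<^sub>R fact n))
      = exp (- ?m) / fact n * (\<integral>x. 1 + cos (a x) \<partial>conv_power T M n)" for n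
    using ic[OF conv_power_finite[OF M, of n]] Re_fourier[OF fin am, OF conv_power_finite[OF M, of n] conv_power_finite[OF M, of n]] 
      fin[OF conv_power_finite[OF M, of n]]
    by (simp add: finite_measure.integrable_const fourier_conv_power[OF M a] sp[OF conv_power_finite[OF M]] measure_conv_power_space[OF M] field_simps)
  have "(\<integral>x. 1 + cos (a x) \<partial>?P) = 1 + Re (exp (?\<phi> - of_real ?m))"
  proof (rule integral_poisson_exp[OF M _ _ _ s1[unfolded e1], where B=2])
    show "0 \<le> 1 + cos (a x)" "1 + cos (a x) \<le> 2" for x using cos_ge_minus_one[of "a x"] cos_le_one[of "a x"] by linarith+
  qed (use a in measurable)
  then have 1: "Re (fourier ?P a) = Re (exp (?\<phi> - of_real ?m))"
    using ic[OF P] Re_fourier[OF fin am, OF P P] fin[OF P] by (simp add: finite_measure.integrable_const sp[OF P] Pm)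
  have s2: "(\<lambda>n. exp (- ?m) / fact n * ?m ^ n + Im (of_real (exp (- ?m)) * (?\<phi> ^ n /\<^sub>R fact n))) sums (1 + Im (exp (?\<phi> - of_real ?m)))"
    using sums_add[OF m1 sums_Im[OF e]] unfolding E .
  have e2: "exp (- ?m) / fact n * ?m ^ n + Im (of_real (exp (- ?m)) * (?\<phi> ^ n /\<^sub>R fact n))
      = exp (- ?m) / fact n * (\<integral>x. 1 + sin (a x) \<partial>conv_power T M n)" for n
    using ic[OF conv_power_finite[OF M, of n]] Im_fourier[OF fin am, OF conv_power_finite[OF M, of n] conv_power_finite[OF M, of n]]
      fin[OF conv_power_finite[OF M, of n]]
    by (simp add: finite_measure.integrable_const fourier_conv_power[OF M a] sp[OF conv_power_finite[OF M]] measure_conv_power_space[OF M] field_simps)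
  have "(\<integral>x. 1 + sin (a x) \<partial>?P) = 1 + Im (exp (?\<phi> - of_real ?m))"
  proof (rule integral_poisson_exp[OF M _ _ _ s2[unfolded e2], where B=2])
    show "0 \<le> 1 + sin (a x)" "1 + sin (a x) \<le> 2" for x using sin_ge_minus_one[of "a x"] sin_le_one[of "a x"] by linarith+
  qed (use a in measurable)
  then have 2: "Im (fourier ?P a) = Im (exp (?\<phi> - of_real ?m))"
    using ic[OF P] Im_fourier[OF fin am, OF P P] fin[OF P] by (simp add: finite_measure.integrable_const sp[OF P] Pm)
  show ?thesis using 1 2 by (simp add: complex_eq_iff)
qed

end

section \<open>Transport along measurable additive maps\<close>

context
  fixes T :: "'a::real_vector topology" and T' :: "'b::real_vector topology" and h :: "'a \<Rightarrow> 'b"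
  assumes T: "additive_space T" and T': "additive_space T'"
    and h: "h \<in> borel_of T \<rightarrow>\<^sub>M borel_of T'" "additive_map T h"
begin

lemma hom_measurable: "M \<in> finite_borel_measures T \<Longrightarrow> h \<in> M \<rightarrow>\<^sub>M borel_of T'"
  using h(1) measurable_cong_sets[of M "borel_of T" "borel_of T'" "borel_of T'"] by (auto simp: finite_borel_measures_iff)

lemma distr_hom_finite: "M \<in> finite_borel_measures T \<Longrightarrow> distr M (borel_of T') h \<in> finite_borel_measures T'"
  using finite_measure.finite_measure_distr[OF _ hom_measurable] by (auto simp: finite_borel_measures_iff)

lemma distr_hom_return: "x \<in> topspace T \<Longrightarrow> distr (return (borel_of T) x) (borel_of T') h = return (borel_of T') (h x)"
  using h(1) by (intro distr_return) auto

lemma distr_hom_conv_meas: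
  assumes M: "M \<in> finite_borel_measures T" and N: "N \<in> finite_borel_measures T"
  shows "distr (conv_meas T M N) (borel_of T') h = conv_meas T' (distr M (borel_of T') h) (distr N (borel_of T') h)"
proof -
  let ?M = "distr M (borel_of T') h" and ?N = "distr N (borel_of T') h"
  note hm = hom_measurable
  interpret N: finite_measure "?N" using distr_hom_finite[OF N] by (simp add: finite_borel_measures_iff)
  have s: "space M = topspace T" "space N = topspace T" using M N finite_borel_measures_space by auto
  have "conv_meas T' ?M ?N = distr (distr (M \<Otimes>\<^sub>M N) (borel_of T' \<Otimes>\<^sub>M borel_of T') (\<lambda>(x, y). (h x, h y))) (borel_of T') (\<lambda>(x, y). x + y)"
    unfolding conv_meas_def by (subst pair_measure_distr[OF hm[OF M] hm[OF N] N.sigma_finite_measure_axioms]) simp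
  also have "\<dots> = distr (M \<Otimes>\<^sub>M N) (borel_of T') ((\<lambda>(x, y). x + y) \<circ> (\<lambda>(x, y). (h x, h y)))"
  proof (rule distr_distr)
    show "(\<lambda>(x, y). x + y) \<in> borel_of T' \<Otimes>\<^sub>M borel_of T' \<rightarrow>\<^sub>M borel_of T'" using T' by (simp add: additive_space_def)
    show "(\<lambda>(x, y). (h x, h y)) \<in> M \<Otimes>\<^sub>M N \<rightarrow>\<^sub>M borel_of T' \<Otimes>\<^sub>M borel_of T'"
      using hm[OF M] hm[OF N] by measurable
  qed
  also have "\<dots> = distr (M \<Otimes>\<^sub>M N) (borel_of T') (h \<circ> (\<lambda>(x, y). x + y))"
    using h(2) by (intro distr_cong) (auto simp: space_pair_measure s additive_map_def)
  also have "\<dots> = distr (conv_meas T M N) (borel_of T') h"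
    unfolding conv_meas_def by (rule distr_distr[OF h(1) add_measurable_pair[OF T M N], symmetric])
  finally show ?thesis by simp
qed

lemma distr_hom_conv_power:
  assumes M: "M \<in> finite_borel_measures T"
  shows "distr (conv_power T M n) (borel_of T') h = conv_power T' (distr M (borel_of T') h) n"
proof (induction n)
  case 0
  have "0 \<in> topspace T" using T by (simp add: additive_space_def)
  then show ?case using distr_hom_return[of 0] additive_map_0[OF T h(2)] by simp
next
  case (Suc n)
  then show ?case by (simp add: distr_hom_conv_meas[OF M conv_power_finite[OF T M]])
qed

text \<open>Images commute with every convolution power and preserve the total mass in the
  normalising factor, so they commute with the series term by term.\<close>

lemma distr_hom_poisson_exp:
  assumes M: "M \<in> finite_borel_measures T"
  shows "distr (poisson_exp T M) (borel_of T') h = poisson_exp T' (distr M (borel_of T') h)"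
proof (rule measure_eqI)
  let ?M = "distr M (borel_of T') h"
  note M' = distr_hom_finite[OF M]
  have hm: "h \<in> poisson_exp T M \<rightarrow>\<^sub>M borel_of T'" by (rule hom_measurable[OF prob_borel_imp_finite[OF poisson_exp_prob[OF T M]]])
  show "sets (distr (poisson_exp T M) (borel_of T') h) = sets (poisson_exp T' ?M)"
    by (simp add: sets_poisson_exp[OF T' M'])
  fix A assume "A \<in> sets (distr (poisson_exp T M) (borel_of T') h)"
  then have A: "A \<in> sets (borel_of T')" by simp
  have sp: "space (poisson_exp T M) = topspace T"
    by (rule finite_borel_measures_space[OF prob_borel_imp_finite[OF poisson_exp_prob[OF T M]]])
  have hA: "h -` A \<inter> topspace T \<in> sets (borel_of T)" using measurable_sets[OF h(1) A] by simp
  have mass: "measure ?M (topspace T') = measure M (topspace T)"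
    using measurable_space[OF h(1)] sets.top[of "borel_of T'"]
    by (subst measure_distr[OF hom_measurable[OF M]])
       (auto simp: finite_borel_measures_space[OF M] intro!: arg_cong[where f="measure M"])
  have "emeasure (distr (poisson_exp T M) (borel_of T') h) A = emeasure (poisson_exp T M) (h -` A \<inter> topspace T)"
    using emeasure_distr[OF hm A] sp by simp
  also have "\<dots> = (\<Sum>n. ennreal (exp (- measure M (topspace T)) / fact n) * emeasure (conv_power T M n) (h -` A \<inter> topspace T))"
    by (rule emeasure_poisson_exp[OF T M hA])
  also have "\<dots> = (\<Sum>n. ennreal (exp (- measure ?M (topspace T')) / fact n) * emeasure (conv_power T' ?M n) A)"
  proof (intro arg_cong[where f=suminf] ext)
    fix n
    have "emeasure (conv_power T' ?M n) A = emeasure (conv_power T M n) (h -` A \<inter> topspace T)"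
      unfolding distr_hom_conv_power[OF M, symmetric]
      using emeasure_distr[OF hom_measurable[OF conv_power_finite[OF T M]] A] finite_borel_measures_space[OF conv_power_finite[OF T M]]
      by simp
    then show "ennreal (exp (- measure M (topspace T)) / fact n) * emeasure (conv_power T M n) (h -` A \<inter> topspace T)
      = ennreal (exp (- measure ?M (topspace T')) / fact n) * emeasure (conv_power T' ?M n) A"
      by (simp add: mass)
  qed
  also have "\<dots> = emeasure (poisson_exp T' ?M) A" by (rule emeasure_poisson_exp[OF T' M' A, symmetric])
  finally show "emeasure (distr (poisson_exp T M) (borel_of T') h) A = emeasure (poisson_exp T' ?M) A" .
qed

lemma distr_hom_translate_meas:
  assumes M: "M \<in> finite_borel_measures T" and x: "x \<in> topspace T"
  shows "distr (translate_meas T M x) (borel_of T') h = translate_meas T' (distr M (borel_of T') h) (h x)"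
  unfolding translate_meas_def distr_hom_conv_meas[OF M return_finite[OF T x]] distr_hom_return[OF x] ..

end

section \<open>Levy measures on a compact disk\<close>

text \<open>\<open>\<Lambda>\<close> stands for the restriction of the Levy measure to
  \<open>K\<close>. The Suslin property enters only through \<open>a_sep\<close> and
  \<open>add_meas\<close>, the Levy-Khinchin representation only through the two integrability
  assumptions; the functionals \<open>a k\<close> are already scaled for the first of these.\<close>

locale disk_levy =
  fixes a :: "nat \<Rightarrow> 'a::locally_convex_space \<Rightarrow> real" and K :: "'a set" and \<Lambda> :: "'a measure"
  assumes a_dual: "a k \<in> dual_space"
    and a_sep: "x \<noteq> y \<Longrightarrow> \<exists>k. a k x \<noteq> a k y"
    and add_meas: "(\<lambda>(x, y). x + y :: 'a) \<in> borel \<Otimes>\<^sub>M borel \<rightarrow>\<^sub>M borel"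
    and K: "absolutely_convex K" "compact K"
    and sets_\<Lambda>: "sets \<Lambda> = sets borel" and \<Lambda>_K: "emeasure \<Lambda> (- K) = 0" and \<Lambda>_0: "emeasure \<Lambda> {0} = 0"
    and sq_sum_int: "(\<integral>\<^sup>+x. (\<Sum>k. ennreal ((a k x)\<^sup>2)) \<partial>\<Lambda>) < \<infinity>"
    and sq_int: "b \<in> dual_space \<Longrightarrow> (\<integral>\<^sup>+x. ennreal ((b x)\<^sup>2) \<partial>\<Lambda>) < \<infinity>"
begin

definition T :: "'a \<Rightarrow> nat \<Rightarrow> real" where "T x = (\<lambda>k. a k x)"

definition sq_sum :: "'a \<Rightarrow> ennreal" where "sq_sum x = (\<Sum>k. ennreal ((a k x)\<^sup>2))"

lemma a_measurable [measurable]: "a k \<in> borel_measurable borel"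
  by (rule dual_space_measurable[OF a_dual])

lemma sq_sum_measurable [measurable]: "sq_sum \<in> borel_measurable borel"
  unfolding sq_sum_def by measurable

lemma T_cont: "continuous_on UNIV T"
  unfolding T_def by (intro continuous_on_coordinatewise_then_product dual_space_continuous a_dual)

lemma T_measurable [measurable]: "T \<in> borel \<rightarrow>\<^sub>M borel"
  by (rule borel_measurable_continuous_onI[OF T_cont])

lemma T_inj: "inj T"
proof (rule injI, rule ccontr)
  fix x y assume "T x = T y" "x \<noteq> y"
  then show False using a_sep[of x y] unfolding T_def by metis
qed

lemma rcomb_T_dual: "(\<lambda>x. rcomb c (T x)) \<in> dual_space"
proof -
  have "linear (\<lambda>x. rcomb c (T x))"
    unfolding rcomb_def T_def
    by (intro linear_compose_sum ballI) (use dual_space_linear[OF dual_space_scale[OF a_dual]] in auto)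
  then show ?thesis using rcomb_continuous_comp[OF T_cont] by (simp add: dual_space_def)
qed

lemma rcomb_T_sq:
  obtains C where "C \<ge> 0" "\<And>x. ennreal ((rcomb c (T x))\<^sup>2) \<le> ennreal C * sq_sum x"
proof
  let ?n = "length c"
  let ?C = "\<Sum>i<?n. (of_rat (c ! i) :: real)\<^sup>2"
  show C0: "?C \<ge> 0" by (intro sum_nonneg) auto
  fix x
  have "(rcomb c (T x))\<^sup>2 \<le> ?C * (\<Sum>i<?n. (a i x)\<^sup>2)"
    unfolding rcomb_def T_def by (rule Cauchy_Schwarz_ineq_sum)
  then have "ennreal ((rcomb c (T x))\<^sup>2) \<le> ennreal (?C * (\<Sum>i<?n. (a i x)\<^sup>2))" by (rule ennreal_leI)
  also have "\<dots> = ennreal ?C * (\<Sum>i<?n. ennreal ((a i x)\<^sup>2))"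
    using C0 by (simp add: ennreal_mult sum_nonneg flip: sum_ennreal)
  also have "\<dots> \<le> ennreal ?C * sq_sum x"
    unfolding sq_sum_def by (intro mult_left_mono sum_le_suminf) auto
  finally show "ennreal ((rcomb c (T x))\<^sup>2) \<le> ennreal ?C * sq_sum x" .
qed

lemma additive_space_E: "additive_space (euclidean :: 'a topology)"
  unfolding additive_space_def using add_meas by simp

lemma additive_map_dual: "b \<in> dual_space \<Longrightarrow> additive_map euclidean b"
  unfolding additive_map_def using linear_add[OF dual_space_linear] by blast

lemma compact_scaled: "compact ((*\<^sub>R) r ` K)"
  by (rule compact_continuous_image[OF _ K(2)]) (intro continuous_on_scaleR_lc continuous_on_const continuous_on_id)

lemma scaled_borel [measurable]: "(*\<^sub>R) r ` K \<in> sets borel"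
  by (rule borel_closed[OF compact_imp_closed[OF compact_scaled]])

lemma K_borel [measurable]: "K \<in> sets borel"
  by (rule borel_closed[OF compact_imp_closed[OF K(2)]])

lemma D_borel [measurable]: "disk_span K \<in> sets borel"
  unfolding disk_span_def by measurable

lemma dual_bounded_K:
  assumes "b \<in> dual_space" obtains B where "B > 0" "\<And>x. x \<in> K \<Longrightarrow> \<bar>b x\<bar> \<le> B"
proof -
  have "compact (b ` K)" by (rule compact_continuous_image[OF dual_space_continuous[OF assms] K(2)])
  then have "bounded (b ` K)" by (rule compact_imp_bounded)
  then obtain B where "\<And>x. x \<in> K \<Longrightarrow> norm (b x) \<le> B" unfolding bounded_iff by auto
  then show thesis by (intro that[of "max 1 B"]) (auto simp: le_max_iff_disj)
qed

definition on_K :: "'a measure \<Rightarrow> bool" where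
  "on_K M \<longleftrightarrow> M \<in> finite_borel_measures euclidean \<and> emeasure M (- K) = 0"

lemma on_K_sets: "on_K M \<Longrightarrow> sets M = sets borel"
  by (simp add: on_K_def finite_borel_measures_iff)

lemma on_K_finite: "on_K M \<Longrightarrow> finite_measure M"
  by (simp add: on_K_def finite_borel_measures_iff)

lemma on_K_space: "on_K M \<Longrightarrow> space M = UNIV"
  using sets_eq_imp_space_eq[OF on_K_sets] by simp

lemma on_K_measurable: "on_K M \<Longrightarrow> b \<in> borel_measurable borel \<Longrightarrow> b \<in> borel_measurable M"
  using measurable_cong_sets[OF on_K_sets refl] by blast

lemma on_K_AE: "on_K M \<Longrightarrow> AE x in M. x \<in> K"
  by (rule AE_I[of _ _ "- K"]) (auto simp: on_K_sets on_K_def)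

lemma on_K_integrable:
  assumes M: "on_K M" and b: "b \<in> dual_space"
  shows "integrable M b"
proof -
  obtain B where B: "B > 0" "\<And>x. x \<in> K \<Longrightarrow> \<bar>b x\<bar> \<le> B" using dual_bounded_K[OF b] by blast
  show ?thesis
  proof (rule finite_measure.integrable_const_bound[OF on_K_finite[OF M]])
    show "AE x in M. norm (b x) \<le> B" using on_K_AE[OF M] by eventually_elim (use B in auto)
  qed (rule on_K_measurable[OF M dual_space_measurable[OF b]])
qed

lemma finite_partition_sum_in_disk:
  assumes "finite I" "\<And>i. i \<in> I \<Longrightarrow> w i \<ge> 0" "\<And>i. i \<in> I \<Longrightarrow> x i \<in> K"
  shows "(\<Sum>i\<in>I. w i *\<^sub>R x i) \<in> (*\<^sub>R) (\<Sum>i\<in>I. w i) ` K"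
  using assms
proof (induction I rule: finite_induct)
  case empty
  then show ?case using absolutely_convex_0[OF K(1)] by auto
next
  case (insert i I)
  have "w i *\<^sub>R x i + (\<Sum>i\<in>I. w i *\<^sub>R x i) \<in> (*\<^sub>R) (w i + (\<Sum>i\<in>I. w i)) ` K"
    using insert by (intro absolutely_convex_add[OF K(1)] sum_nonneg) auto
  then show ?case using insert by simp
qed

text \<open>Approximate barycentres come from finite Borel partitions; compactness of \<open>K\<close> gives an
  exact one.\<close>

lemma barycentre_approx:
  assumes M: "on_K M" and F: "finite F" "F \<subseteq> dual_space" and e: "e > 0"
  shows "\<exists>z\<in>(*\<^sub>R) (measure M UNIV) ` K. \<forall>b\<in>F. \<bar>b z - (\<integral>x. b x \<partial>M)\<bar> \<le> e * measure M UNIV"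
proof -
  interpret finite_measure M by (rule on_K_finite[OF M])
  define U where "U x = {y. \<forall>b\<in>F. \<bar>b y - b x\<bar> < e}" for x
  have Uo: "open (U x)" for x
  proof -
    have "U x = (\<Inter>b\<in>F. {y. \<bar>b y - b x\<bar> < e})" by (auto simp: U_def)
    moreover have "open {y. \<bar>b y - b x\<bar> < e}" if "b \<in> F" for b
    proof -
      have "continuous_on UNIV b" using F that by (auto intro: dual_space_continuous)
      then show ?thesis by (intro open_Collect_less continuous_intros)
    qed
    ultimately show ?thesis using F(1) by (auto intro!: open_INT)
  qed
  have xU: "x \<in> U x" for x using e by (simp add: U_def)
  obtain X where X: "X \<subseteq> K" "finite X" "K \<subseteq> (\<Union>x\<in>X. U x)"
    using compactE_image[OF K(2), of K U] Uo xU by (metis UN_I subsetI)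
  obtain xs where xs: "set xs = X" using finite_list[OF X(2)] by blast
  define n where "n = length xs"
  define A where "A i = K \<inter> (U (xs ! i) - (\<Union>j<i. U (xs ! j)))" for i
  have KA: "K = (\<Union>i<n. A i)"
  proof
    show "K \<subseteq> (\<Union>i<n. A i)"
    proof
      fix y assume y: "y \<in> K"
      then obtain u where "u \<in> set xs" "y \<in> U u" using X(3) xs by blast
      then obtain i where "i < n" "y \<in> U (xs ! i)" unfolding n_def in_set_conv_nth by blast
      define k where "k = (LEAST i. y \<in> U (xs ! i))"
      have "y \<in> U (xs ! k)" "k \<le> i" unfolding k_def using \<open>y \<in> U (xs ! i)\<close> by (auto intro: LeastI Least_le)
      moreover have "y \<notin> U (xs ! j)" if "j < k" for j using that not_less_Least unfolding k_def by blast
      ultimately show "y \<in> (\<Union>i<n. A i)" using y \<open>i < n\<close> by (auto simp: A_def intro!: bexI[of _ k])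
    qed
  qed (auto simp: A_def)
  have disj: "disjoint_family_on A {..<n}"
    unfolding disjoint_family_on_def
  proof (intro ballI impI)
    fix i j :: nat assume "i \<noteq> j"
    then show "A i \<inter> A j = {}" by (cases i j rule: linorder_cases) (auto simp: A_def)
  qed
  have AM [measurable]: "A i \<in> sets M" for i
  proof -
    have "A i \<in> sets borel" unfolding A_def using Uo by (intro sets.Int sets.Diff sets.finite_UN K_borel) auto
    then show ?thesis by (simp add: on_K_sets[OF M])
  qed
  have mK: "measure M UNIV = (\<Sum>i<n. measure M (A i))"
  proof -
    have "measure M UNIV = measure M K"
      using on_K_AE[OF M] M by (intro measure_eq_AE) (auto simp: on_K_sets)
    also have "\<dots> = (\<Sum>i<n. measure M (A i))"
      unfolding KA using disj by (intro finite_measure_finite_Union) auto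
    finally show ?thesis .
  qed
  define z where "z = (\<Sum>i<n. measure M (A i) *\<^sub>R (xs ! i))"
  have "z \<in> (*\<^sub>R) (measure M UNIV) ` K"
    unfolding z_def mK using X xs by (intro finite_partition_sum_in_disk) (auto simp: n_def)
  moreover have "\<bar>b z - (\<integral>x. b x \<partial>M)\<bar> \<le> e * measure M UNIV" if b: "b \<in> F" for b
  proof -
    have bd: "b \<in> dual_space" using b F by auto
    have ib: "integrable M b" by (rule on_K_integrable[OF M bd])
    define s where "s x = (\<Sum>i<n. indicator (A i) x * b (xs ! i))" for x
    have isn: "integrable M s" unfolding s_def
      by (intro Bochner_Integration.integrable_sum integrable_mult_left integrable_real_indicator) (auto simp: less_top[symmetric])
    have "b z = (\<Sum>i<n. measure M (A i) * b (xs ! i))"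
      unfolding z_def using dual_space_linear[OF bd] by (simp add: linear_sum linear_scale)
    also have "\<dots> = (\<integral>x. s x \<partial>M)"
      unfolding s_def using AM
      by (subst Bochner_Integration.integral_sum) (auto simp: less_top[symmetric] on_K_space[OF M] intro!: integrable_real_indicator)
    finally have "\<bar>b z - (\<integral>x. b x \<partial>M)\<bar> = \<bar>\<integral>x. s x - b x \<partial>M\<bar>" using isn ib by simp
    also have "\<dots> \<le> (\<integral>x. \<bar>s x - b x\<bar> \<partial>M)" by (rule integral_abs_bound)
    also have "\<dots> \<le> (\<integral>x. e \<partial>M)"
    proof (rule integral_mono_AE)
      show "AE x in M. \<bar>s x - b x\<bar> \<le> e"
        using on_K_AE[OF M]
      proof eventually_elim
        case (elim x)
        then obtain i where i: "i < n" "x \<in> A i" using KA by auto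
        have "s x = (\<Sum>j\<in>{i}. indicator (A j) x * b (xs ! j))"
          unfolding s_def
        proof (rule sum.mono_neutral_right)
          show "\<forall>j\<in>{..<n} - {i}. indicator (A j) x * b (xs ! j) = 0"
            using disjoint_family_onD[OF disj] i by (fastforce simp: indicator_def)
        qed (use i in auto)
        then have "s x = b (xs ! i)" using i by simp
        then show ?case using i b by (auto simp: A_def U_def abs_minus_commute less_imp_le)
      qed
    qed (use isn ib in auto)
    finally show ?thesis by (simp add: on_K_space[OF M] mult.commute)
  qed
  ultimately show ?thesis by blast
qed

lemma barycentre_ex:
  assumes M: "on_K M"
  shows "\<exists>z\<in>disk_span K. \<forall>b\<in>dual_space. b z = (\<integral>x. b x \<partial>M)"
proof -
  let ?m = "measure M UNIV"
  define Q where "Q = (*\<^sub>R) ?m ` K"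
  have Q: "compact Q" unfolding Q_def by (rule compact_scaled)
  define C where "C p = {z. \<bar>fst p z - (\<integral>x. fst p x \<partial>M)\<bar> \<le> snd p}" for p :: "('a \<Rightarrow> real) \<times> real"
  have "Q \<inter> (\<Inter>p\<in>dual_space \<times> {0<..}. C p) \<noteq> {}"
  proof (rule compact_imp_fip_image[OF Q])
    fix p :: "('a \<Rightarrow> real) \<times> real" assume "p \<in> dual_space \<times> {0<..}"
    then have "continuous_on UNIV (fst p)" by (auto intro: dual_space_continuous)
    then show "closed (C p)" unfolding C_def by (intro closed_Collect_le continuous_intros)
  next
    fix I :: "(('a \<Rightarrow> real) \<times> real) set" assume I: "finite I" "I \<subseteq> dual_space \<times> {0<..}"
    \<comment> \<open>The approximate barycentre errs by \<open>e * ?m\<close>. The denominator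
      \<open>?m + 1\<close> covers \<open>?m = 0\<close>, and the inserted 1 covers an empty
      \<open>I\<close>.\<close>
    define e where "e = Min (insert 1 (snd ` I)) / (?m + 1)"
    have m0: "?m \<ge> 0" by simp
    have mpos: "Min (insert 1 (snd ` I)) > 0" using I by (subst Min_gr_iff) auto
    have e: "e > 0" using mpos m0 by (simp add: e_def divide_pos_pos add_nonneg_pos)
    have em: "e * ?m \<le> Min (insert 1 (snd ` I))" unfolding e_def using mult_left_mono[of ?m "?m + 1" "Min (insert 1 (snd ` I))"] mpos m0
      by (simp add: divide_le_eq not_less add_nonneg_nonneg)
    have "finite (fst ` I)" "fst ` I \<subseteq> dual_space" using I by auto
    then obtain z where z: "z \<in> Q" "\<forall>b\<in>fst ` I. \<bar>b z - (\<integral>x. b x \<partial>M)\<bar> \<le> e * ?m"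
      using barycentre_approx[OF M _ _ e] unfolding Q_def by blast
    have "z \<in> C p" if p: "p \<in> I" for p
    proof -
      have "Min (insert 1 (snd ` I)) \<le> snd p" using I p by (intro Min_le) auto
      moreover have "\<bar>fst p z - (\<integral>x. fst p x \<partial>M)\<bar> \<le> e * ?m" using z p by auto
      ultimately show ?thesis unfolding C_def using em by simp
    qed
    then show "Q \<inter> (\<Inter>p\<in>I. C p) \<noteq> {}" using z by blast
  qed
  then obtain z where z: "z \<in> Q" "\<And>b e. b \<in> dual_space \<Longrightarrow> e > 0 \<Longrightarrow> \<bar>b z - (\<integral>x. b x \<partial>M)\<bar> \<le> e"
    unfolding C_def by fastforce
  have "z \<in> disk_span K"
    using z(1) disk_span_scale[OF K(1)] subset_disk_span[OF K(1)] unfolding Q_def by blast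
  moreover have "b z = (\<integral>x. b x \<partial>M)" if "b \<in> dual_space" for b
    using z(2)[OF that] dense_ge[of 0 "\<bar>b z - (\<integral>x. b x \<partial>M)\<bar>"] by fastforce
  ultimately show ?thesis by blast
qed

definition barycentre :: "'a measure \<Rightarrow> 'a" where
  "barycentre M = (SOME z. z \<in> disk_span K \<and> (\<forall>b\<in>dual_space. b z = (\<integral>x. b x \<partial>M)))"

lemma barycentre: 
  assumes "on_K M" shows "barycentre M \<in> disk_span K" "b \<in> dual_space \<Longrightarrow> b (barycentre M) = (\<integral>x. b x \<partial>M)"
proof -
  have "\<exists>z. z \<in> disk_span K \<and> (\<forall>b\<in>dual_space. b z = (\<integral>x. b x \<partial>M))" using barycentre_ex[OF assms] by blast
  from someI_ex[OF this] show "barycentre M \<in> disk_span K" "b \<in> dual_space \<Longrightarrow> b (barycentre M) = (\<integral>x. b x \<partial>M)"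
    unfolding barycentre_def by auto
qed

text \<open>One shift subtracts the linear term \<open>\<i> * b\<close> under the integral for all
  functionals \<open>b\<close> simultaneously. What remains, \<open>levy_kernel\<close>, is
  integrable for \<open>\<Lambda>\<close> too, although \<open>\<Lambda>\<close> may be infinite and
  have no barycentre.\<close>

definition centred_exp :: "'a measure \<Rightarrow> 'a measure" where
  "centred_exp M = translate_meas euclidean (poisson_exp euclidean M) (- barycentre M)"

lemma translate_prob:
  assumes "P \<in> prob_borel_measures euclidean" shows "translate_meas euclidean P (x :: 'a) \<in> prob_borel_measures euclidean"
proof (rule prob_borel_measuresI)
  show "translate_meas euclidean P x \<in> finite_borel_measures euclidean"
    by (rule translate_meas_finite[OF additive_space_E prob_borel_imp_finite[OF assms]]) simp
  have "measure (translate_meas euclidean P x) UNIV = measure P {y \<in> topspace euclidean. y + x \<in> UNIV}"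
    by (rule measure_translate_meas[OF additive_space_E prob_borel_imp_finite[OF assms]]) auto
  then show "measure (translate_meas euclidean P x) (topspace euclidean) = 1"
    using prob_borel_measures_measure[OF assms] by simp
qed

lemma poisson_prob: "on_K M \<Longrightarrow> poisson_exp euclidean M \<in> prob_borel_measures euclidean"
  by (rule poisson_exp_prob[OF additive_space_E]) (simp add: on_K_def)

lemma centred_exp_prob: "on_K M \<Longrightarrow> centred_exp M \<in> prob_borel_measures euclidean"
  unfolding centred_exp_def by (intro translate_prob poisson_prob)

lemma centred_exp_sets: "on_K M \<Longrightarrow> sets (centred_exp M) = sets borel"
  using centred_exp_prob by (simp add: prob_borel_measures_iff)

lemma centred_exp_prob_space: "on_K M \<Longrightarrow> prob_space (centred_exp M)"
  using centred_exp_prob by (simp add: prob_borel_measures_iff)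

lemma centred_exp_space: "on_K M \<Longrightarrow> space (centred_exp M) = UNIV"
  using sets_eq_imp_space_eq[OF centred_exp_sets] by simp

lemma centred_exp_measurable: "on_K M \<Longrightarrow> b \<in> borel_measurable borel \<Longrightarrow> b \<in> borel_measurable (centred_exp M)"
  using measurable_cong_sets[OF centred_exp_sets refl] by blast

lemma on_K_levy_integrable:
  assumes M: "on_K M" and b: "b \<in> dual_space"
  shows "integrable M (\<lambda>x. levy_kernel (b x))"
proof -
  have [measurable]: "b \<in> borel_measurable M" by (rule on_K_measurable[OF M dual_space_measurable[OF b]])
  obtain B where B: "B > 0" "\<And>x. x \<in> K \<Longrightarrow> \<bar>b x\<bar> \<le> B" using dual_bounded_K[OF b] by blast
  show ?thesis
  proof (rule finite_measure.integrable_const_bound[OF on_K_finite[OF M]])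
    show "AE x in M. norm (levy_kernel (b x)) \<le> B\<^sup>2 / 2" using on_K_AE[OF M]
    proof eventually_elim
      case (elim x)
      have "norm (levy_kernel (b x)) \<le> (b x)\<^sup>2 / 2" by (rule norm_levy_kernel)
      also have "(b x)\<^sup>2 \<le> B\<^sup>2" using B(1) B(2)[OF elim] by (simp add: abs_le_square_iff[symmetric])
      finally show ?case by simp
    qed
  qed measurable
qed

lemma fourier_poisson_E:
  assumes M: "(M :: 'a measure) \<in> finite_borel_measures euclidean" and b: "b \<in> dual_space"
  shows "fourier (poisson_exp euclidean M) b = exp (\<integral>x. iexp (b x) - 1 \<partial>M)"
proof -
  have f: "finite_measure M" and s: "sets M = sets borel" using M by (auto simp: finite_borel_measures_iff)
  have [measurable]: "b \<in> borel_measurable M" using dual_space_measurable[OF b] measurable_cong_sets[OF s refl] by blast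
  have "(\<integral>x. iexp (b x) - 1 \<partial>M) = fourier M b - of_real (measure M UNIV)"
    unfolding fourier_def using finite_measure.integrable_iexp[OF f] finite_measure.integrable_const[OF f] sets_eq_imp_space_eq[OF s]
    by (subst Bochner_Integration.integral_diff) (auto simp: scaleR_conv_of_real)
  then show ?thesis
    using fourier_poisson_exp[OF additive_space_E M, of b] additive_map_dual[OF b] dual_space_measurable[OF b] by simp
qed

lemma fourier_centred_exp:
  assumes M: "on_K M" and b: "b \<in> dual_space"
  shows "fourier (centred_exp M) b = exp (\<integral>x. levy_kernel (b x) \<partial>M)"
proof -
  interpret finite_measure M by (rule on_K_finite[OF M])
  have [measurable]: "b \<in> borel_measurable M" by (rule on_K_measurable[OF M dual_space_measurable[OF b]])
  have M': "M \<in> finite_borel_measures euclidean" using M by (simp add: on_K_def)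
  have P: "poisson_exp euclidean M \<in> finite_borel_measures euclidean" by (rule prob_borel_imp_finite[OF poisson_prob[OF M]])
  have ib: "integrable M (\<lambda>x. complex_of_real (b x))" using on_K_integrable[OF M b] by (simp add: integrable_of_real)
  have "(\<integral>x. levy_kernel (b x) \<partial>M) = (\<integral>x. iexp (b x) - 1 \<partial>M) - \<i> * (\<integral>x. complex_of_real (b x) \<partial>M)"
    unfolding levy_kernel_def using ib integrable_iexp[of b]
    by (subst Bochner_Integration.integral_diff) auto
  also have "(\<integral>x. complex_of_real (b x) \<partial>M) = complex_of_real (b (barycentre M))"
    using barycentre(2)[OF M b] by simp
  finally have e: "exp (\<integral>x. levy_kernel (b x) \<partial>M) = exp (\<integral>x. iexp (b x) - 1 \<partial>M) * iexp (b (- barycentre M))"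
    using linear_neg[OF dual_space_linear[OF b], of "barycentre M"] by (simp add: exp_add[symmetric])
  show ?thesis
    unfolding centred_exp_def e fourier_poisson_E[OF M' b, symmetric]
    by (rule fourier_translate_meas[OF additive_space_E P]) (use dual_space_measurable[OF b] additive_map_dual[OF b] in auto)
qed

text \<open>The variance of a centred compound Poisson variable is the second moment of its jump
  measure; the bound from above comes from the quadratic bound on \<open>levy_kernel\<close>,
  applied to all multiples \<open>t * b\<close>.\<close>

lemma centred_exp_second_moment:
  assumes M: "on_K M" and b: "b \<in> dual_space"
  shows "(\<integral>\<^sup>+x. ennreal ((b x)\<^sup>2) \<partial>centred_exp M) \<le> (\<integral>\<^sup>+x. ennreal ((b x)\<^sup>2) \<partial>M)"
proof -
  interpret finite_measure M by (rule on_K_finite[OF M])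
  have [measurable]: "b \<in> borel_measurable M" by (rule on_K_measurable[OF M dual_space_measurable[OF b]])
  obtain B where B: "B > 0" "\<And>x. x \<in> K \<Longrightarrow> \<bar>b x\<bar> \<le> B" using dual_bounded_K[OF b] by blast
  have ib: "integrable M (\<lambda>x. (b x)\<^sup>2)"
  proof (rule integrable_const_bound)
    show "AE x in M. norm ((b x)\<^sup>2) \<le> B\<^sup>2" using on_K_AE[OF M]
      by eventually_elim (use B in \<open>simp add: abs_le_square_iff[symmetric]\<close>)
  qed measurable
  let ?v = "\<integral>x. (b x)\<^sup>2 \<partial>M"
  have v0: "?v \<ge> 0" by (intro integral_nonneg_AE) auto
  have "(\<integral>\<^sup>+x. ennreal ((b x)\<^sup>2) \<partial>centred_exp M) \<le> ennreal ?v"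
  proof (rule second_moment_le[OF centred_exp_prob_space[OF M] centred_exp_measurable[OF M dual_space_measurable[OF b]] v0])
    fix t :: real
    let ?z = "\<integral>x. levy_kernel (t * b x) \<partial>M"
    have "norm ?z \<le> (\<integral>x. norm (levy_kernel (t * b x)) \<partial>M)" by (rule integral_norm_bound)
    also have "\<dots> \<le> (\<integral>x. t\<^sup>2 * (b x)\<^sup>2 / 2 \<partial>M)"
      using ib on_K_levy_integrable[OF M dual_space_scale[OF b, of t]] norm_levy_kernel[of "t * b _"]
      by (intro integral_mono) (auto simp: power_mult_distrib)
    also have "\<dots> = t\<^sup>2 * ?v / 2" by simp
    finally have z: "norm ?z \<le> t\<^sup>2 * ?v / 2" .
    have "norm (exp ?z - 1) \<le> exp \<bar>Re ?z\<bar> * norm ?z" by (rule norm_exp_minus_1)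
    also have "\<dots> \<le> exp (t\<^sup>2 * ?v / 2) * (t\<^sup>2 * ?v / 2)"
      using z abs_Re_le_cmod[of ?z] by (intro mult_mono) auto
    finally show "norm (fourier (centred_exp M) (\<lambda>x. t * b x) - 1) \<le> exp (t\<^sup>2 * ?v / 2) * (t\<^sup>2 * ?v / 2)"
      unfolding fourier_centred_exp[OF M dual_space_scale[OF b]] .
  qed
  also have "ennreal ?v = (\<integral>\<^sup>+x. ennreal ((b x)\<^sup>2) \<partial>M)"
    using ib by (intro nn_integral_eq_integral[symmetric]) auto
  finally show ?thesis .
qed

lemma centred_exp_shift_bound:
  assumes M: "on_K M" and R: "R \<ge> 1" and b: "b \<in> dual_space" and b1: "\<And>x. x \<in> K \<Longrightarrow> \<bar>b x\<bar> \<le> 1"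
    and pr: "measure (centred_exp M) {x. \<bar>b x + w\<bar> \<le> R} \<ge> 15/16"
  shows "\<bar>w\<bar> \<le> 64 * R"
proof (rule shift_bound[OF centred_exp_prob_space[OF M] _ on_K_finite[OF M] _ _ _ R])
  show "b \<in> borel_measurable (centred_exp M)" by (rule centred_exp_measurable[OF M dual_space_measurable[OF b]])
  show "b \<in> borel_measurable M" by (rule on_K_measurable[OF M dual_space_measurable[OF b]])
  show "AE y in M. \<bar>b y\<bar> \<le> 1" using on_K_AE[OF M] by eventually_elim (use b1 in auto)
  show "fourier (centred_exp M) (\<lambda>x. t * b x) = exp (\<integral>y. levy_kernel (t * b y) \<partial>M)" for t
    by (rule fourier_centred_exp[OF M dual_space_scale[OF b]])
  show "measure (centred_exp M) {x \<in> space (centred_exp M). \<bar>b x + w\<bar> \<le> R} \<ge> 15/16" using pr by (simp add: centred_exp_space[OF M])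
qed

text \<open>A point outside \<open>64 * R\<close> times \<open>K\<close> is separated from that set
  by a functional. Rescaled to be bounded by 1 on \<open>K\<close>, this functional would exceed
  \<open>64 * R\<close> at the point, contrary to the one-dimensional bound.\<close>

lemma centred_exp_shift_in_disk:
  assumes M: "on_K M" and R: "R \<ge> 1"
    and pr: "measure (centred_exp M) {x. x + y \<in> (*\<^sub>R) R ` K} \<ge> 15/16"
  shows "y \<in> (*\<^sub>R) (64 * R) ` K"
proof (rule ccontr)
  assume n: "y \<notin> (*\<^sub>R) (64 * R) ` K"
  obtain b where b: "b \<in> dual_space" "\<And>x. x \<in> (*\<^sub>R) (64 * R) ` K \<Longrightarrow> \<bar>b x\<bar> \<le> 1" "b y > 1"
    using separate_absolutely_convex[OF absolutely_convex_scaled[OF K(1)] compact_imp_closed[OF compact_scaled] n] by blast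
  note bl = linear_scale[OF dual_space_linear[OF b(1)]]  linear_add[OF dual_space_linear[OF b(1)]]
  let ?b = "\<lambda>x. (64 * R) * b x"
  have 1: "\<bar>?b x\<bar> \<le> 1" if "x \<in> K" for x
  proof -
    have "\<bar>b ((64 * R) *\<^sub>R x)\<bar> \<le> 1" using that by (intro b(2)) auto
    then show ?thesis by (simp add: bl)
  qed
  have bd: "?b \<in> dual_space" by (rule dual_space_scale[OF b(1)])
  have "\<bar>?b y\<bar> \<le> 64 * R"
  proof (rule centred_exp_shift_bound[OF M R bd 1])
    interpret prob_space "centred_exp M" by (rule centred_exp_prob_space[OF M])
    have [measurable]: "b \<in> borel_measurable (centred_exp M)" by (rule centred_exp_measurable[OF M dual_space_measurable[OF b(1)]])
    have "measure (centred_exp M) {x. x + y \<in> (*\<^sub>R) R ` K} \<le> measure (centred_exp M) {x\<in>space (centred_exp M). \<bar>?b x + ?b y\<bar> \<le> R}"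
    proof (rule finite_measure_mono)
      show "{x. x + y \<in> (*\<^sub>R) R ` K} \<subseteq> {x\<in>space (centred_exp M). \<bar>?b x + ?b y\<bar> \<le> R}"
      proof
        fix x assume "x \<in> {x. x + y \<in> (*\<^sub>R) R ` K}"
        then obtain k where k: "k \<in> K" "x + y = R *\<^sub>R k" by auto
        have "?b x + ?b y = R * ?b k" using bl(2)[of x y] k(2) by (simp add: bl(1) distrib_left[symmetric])
        then have "\<bar>?b x + ?b y\<bar> = R * \<bar>?b k\<bar>" by (simp only: abs_mult[of R]) (use R in simp)
        also have "\<dots> \<le> R * 1" using mult_left_mono[OF 1[OF k(1)], of R] R by linarith
        finally have "\<bar>?b x + ?b y\<bar> \<le> R * 1" .
        then show "x \<in> {x\<in>space (centred_exp M). \<bar>?b x + ?b y\<bar> \<le> R}" by (simp add: centred_exp_space[OF M])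
      qed
    qed measurable
    then show "measure (centred_exp M) {x. \<bar>?b x + ?b y\<bar> \<le> R} \<ge> 15/16" using pr by (simp add: centred_exp_space[OF M])
  qed
  moreover have "\<bar>?b y\<bar> = 64 * R * b y" using R b(3) by (simp add: abs_mult)
  ultimately show False using b(3) R by (simp add: mult_le_cancel_left1)
qed

text \<open>With \<open>y\<close> in \<open>64 * R\<close> times \<open>K\<close>, writing
  \<open>x = (x + y) - y\<close> costs one more \<open>R\<close>: hence 65.\<close>

lemma centred_exp_disk_mass:
  assumes M: "on_K M" and R: "R \<ge> 1"
    and pr: "measure (centred_exp M) {x. x + y \<in> (*\<^sub>R) R ` K} \<ge> c" and c: "c \<ge> 15/16"
  shows "measure (centred_exp M) ((*\<^sub>R) (65 * R) ` K) \<ge> c"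
proof -
  interpret prob_space "centred_exp M" by (rule centred_exp_prob_space[OF M])
  have y: "y \<in> (*\<^sub>R) (64 * R) ` K" using centred_exp_shift_in_disk[OF M R, of y] pr c by simp
  have "measure (centred_exp M) {x. x + y \<in> (*\<^sub>R) R ` K} \<le> measure (centred_exp M) ((*\<^sub>R) (65 * R) ` K)"
  proof (rule finite_measure_mono)
    show "{x. x + y \<in> (*\<^sub>R) R ` K} \<subseteq> (*\<^sub>R) (65 * R) ` K"
    proof
      fix x assume "x \<in> {x. x + y \<in> (*\<^sub>R) R ` K}"
      then have "(x + y) + - y \<in> (*\<^sub>R) (R + 64 * R) ` K"
        using R y by (intro absolutely_convex_add[OF K(1)] absolutely_convex_uminus[OF absolutely_convex_scaled[OF K(1)]]) auto
      then show "x \<in> (*\<^sub>R) (65 * R) ` K" by simp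
    qed
  qed (simp add: centred_exp_sets[OF M])
  then show ?thesis using pr by simp
qed

end

section \<open>Independent sums on the sequence space\<close>

lemma rcomb_zero [simp]: "rcomb c (\<lambda>_. 0) = 0"
  by (simp add: rcomb_def)

lemma rcomb_sum: "rcomb c (\<lambda>k. \<Sum>j<n. f j k) = (\<Sum>j<(n::nat). rcomb c (f j))"
  by (induction n) (simp_all add: rcomb_add_arg)

lemma exp_sum_prod: "iexp (\<Sum>j<(n::nat). f j) = (\<Prod>j<n. iexp (f j))"
  by (induction n) (simp_all add: distrib_left exp_add)

text \<open>The law of an independent sum whose second summand is a random sequence. It is not a
  convolution on \<open>E\<close>, since the complementary factor of a centred exponential is
  constructed only on the sequence space.\<close>

definition add_law :: "'x measure \<Rightarrow> (nat \<Rightarrow> real) measure \<Rightarrow> ('x \<Rightarrow> nat \<Rightarrow> real) \<Rightarrow> (nat \<Rightarrow> real) measure" where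
  "add_law P \<tau> h = distr (P \<Otimes>\<^sub>M \<tau>) borel (\<lambda>p k. h (fst p) k + snd p k)"

lemma add_law_measurable:
  fixes h :: "'x \<Rightarrow> nat \<Rightarrow> real"
  assumes h: "h \<in> P \<rightarrow>\<^sub>M borel" and \<tau>: "sets \<tau> = sets borel"
  shows "(\<lambda>p k. h (fst p) k + snd p k) \<in> P \<Otimes>\<^sub>M \<tau> \<rightarrow>\<^sub>M borel"
proof (rule measurable_coordinatewise_then_product)
  fix k :: nat
  have "continuous_on UNIV (\<lambda>z :: nat \<Rightarrow> real. z k)" by (rule continuous_on_product_coordinates)
  then have c[measurable]: "(\<lambda>z :: nat \<Rightarrow> real. z k) \<in> borel_measurable borel" by (rule borel_measurable_continuous_onI)
  have [measurable]: "(\<lambda>x. h x k) \<in> borel_measurable P" by (rule measurable_compose[OF h c])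
  have [measurable]: "(\<lambda>z. z k) \<in> borel_measurable \<tau>" using c measurable_cong_sets[OF \<tau> refl] by blast
  show "(\<lambda>p. h (fst p) k + snd p k) \<in> borel_measurable (P \<Otimes>\<^sub>M \<tau>)" by measurable
qed

lemma add_law_prob:
  assumes "prob_space P" "prob_space \<tau>" "h \<in> P \<rightarrow>\<^sub>M borel" "sets \<tau> = sets borel"
  shows "prob_space (add_law P \<tau> h)" "sets (add_law P \<tau> h) = sets borel"
  using prob_space.prob_space_distr[OF prob_space_pair[OF assms(1,2)] add_law_measurable[OF assms(3,4)]]
  by (simp_all add: add_law_def)

lemma fourier_add_law:
  assumes "prob_space P" "prob_space \<tau>" and h: "h \<in> P \<rightarrow>\<^sub>M borel" and \<tau>: "sets \<tau> = sets borel"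
  shows "fourier (add_law P \<tau> h) (rcomb c) = fourier P (\<lambda>x. rcomb c (h x)) * fourier \<tau> (rcomb c)"
proof -
  have 1: "rcomb c \<in> borel_measurable \<tau>" using rcomb_measurable measurable_cong_sets[OF \<tau> refl] by blast
  have 2: "(\<lambda>x. rcomb c (h x)) \<in> borel_measurable P" by (rule measurable_compose[OF h rcomb_measurable])
  have "fourier (add_law P \<tau> h) (rcomb c) = fourier (P \<Otimes>\<^sub>M \<tau>) (\<lambda>p. rcomb c (h (fst p)) + rcomb c (snd p))"
    unfolding add_law_def fourier_distr[OF add_law_measurable[OF h \<tau>] rcomb_measurable] rcomb_add_arg ..
  also have "\<dots> = fourier P (\<lambda>x. rcomb c (h x)) * fourier \<tau> (rcomb c)"
    using assms 1 2 by (intro fourier_pair) (auto intro: prob_space.finite_measure)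
  finally show ?thesis .
qed

context
  fixes P :: "'x measure" and \<tau> :: "(nat \<Rightarrow> real) measure" and h :: "'x \<Rightarrow> nat \<Rightarrow> real"
  assumes P: "prob_space P" and \<tau>: "prob_space \<tau>" and h: "h \<in> P \<rightarrow>\<^sub>M borel" and s\<tau>: "sets \<tau> = sets borel"
begin

lemma add_law_section:
  assumes B: "B \<in> sets borel"
  shows "(\<lambda>v. measure P {x \<in> space P. (\<lambda>k. h x k + v k) \<in> B}) \<in> borel_measurable \<tau>"
    "measure (add_law P \<tau> h) B = (\<integral>v. measure P {x \<in> space P. (\<lambda>k. h x k + v k) \<in> B} \<partial>\<tau>)"
proof -
  interpret P: prob_space P by (rule P)
  interpret \<tau>: prob_space \<tau> by (rule \<tau>)
  interpret PT: pair_sigma_finite P \<tau> ..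
  note m = add_law_measurable[OF h s\<tau>]
  let ?Q = "(\<lambda>p k. h (fst p) k + snd p k) -` B \<inter> space (P \<Otimes>\<^sub>M \<tau>)"
  have Q: "?Q \<in> sets (P \<Otimes>\<^sub>M \<tau>)" by (rule measurable_sets[OF m B])
  have sec: "(\<lambda>x. (x, v)) -` ?Q = {x \<in> space P. (\<lambda>k. h x k + v k) \<in> B}" if "v \<in> space \<tau>" for v
    using that by (auto simp: space_pair_measure)
  have "(\<lambda>v. emeasure P ((\<lambda>x. (x, v)) -` ?Q)) \<in> borel_measurable \<tau>" by (rule PT.measurable_emeasure_Pair2[OF Q])
  then have "(\<lambda>v. emeasure P {x \<in> space P. (\<lambda>k. h x k + v k) \<in> B}) \<in> borel_measurable \<tau>"
    by (rule measurable_cong[THEN iffD1, rotated]) (simp only: sec)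
  then show m2: "(\<lambda>v. measure P {x \<in> space P. (\<lambda>k. h x k + v k) \<in> B}) \<in> borel_measurable \<tau>"
    unfolding measure_def by (rule borel_measurable_enn2real)
  have "emeasure (add_law P \<tau> h) B = emeasure (P \<Otimes>\<^sub>M \<tau>) ?Q"
    unfolding add_law_def by (rule emeasure_distr[OF m B])
  also have "\<dots> = (\<integral>\<^sup>+v. emeasure P ((\<lambda>x. (x, v)) -` ?Q) \<partial>\<tau>)" by (rule PT.emeasure_pair_measure_alt2[OF Q])
  also have "\<dots> = (\<integral>\<^sup>+v. ennreal (measure P {x \<in> space P. (\<lambda>k. h x k + v k) \<in> B}) \<partial>\<tau>)"
    by (rule nn_integral_cong) (simp only: sec P.emeasure_eq_measure)
  also have "\<dots> = ennreal (\<integral>v. measure P {x \<in> space P. (\<lambda>k. h x k + v k) \<in> B} \<partial>\<tau>)"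
    by (intro nn_integral_eq_integral \<tau>.integrable_bounded_real[of _ 1] m2) auto
  finally show "measure (add_law P \<tau> h) B = (\<integral>v. measure P {x \<in> space P. (\<lambda>k. h x k + v k) \<in> B} \<partial>\<tau>)"
    by (simp add: measure_def integral_nonneg_AE)
qed

text \<open>The mass of \<open>B\<close> is the average over \<open>v\<close> of the masses in
  question, so they cannot all lie below it.\<close>

lemma add_law_pick:
  assumes B: "B \<in> sets borel"
  shows "\<exists>v. measure P {x \<in> space P. (\<lambda>k. h x k + v k) \<in> B} \<ge> measure (add_law P \<tau> h) B"
proof (rule ccontr)
  interpret P: prob_space P by (rule P)
  interpret \<tau>: prob_space \<tau> by (rule \<tau>)
  assume "\<not> ?thesis"
  then have "(\<integral>v. measure P {x \<in> space P. (\<lambda>k. h x k + v k) \<in> B} \<partial>\<tau>) < measure (add_law P \<tau> h) B"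
    by (intro \<tau>.expectation_less \<tau>.integrable_bounded_real[of _ 1] add_law_section B) (auto simp: not_le)
  then show False using add_law_section(2)[OF B] by simp
qed

text \<open>One shift must serve all \<open>B j\<close>. By Markov's inequality the shifts failing
  at level \<open>j\<close> have probability at most
  \<open>(1/8)^(j+1) / (1/2)^(j+1) = (1/4)^(j+1)\<close>, and these bounds add up to 1/3.\<close>

lemma add_law_pick_sequence:
  assumes B: "\<And>j::nat. B j \<in> sets borel" and pr: "\<And>j. measure (add_law P \<tau> h) (B j) \<ge> 1 - (1/8) ^ Suc j"
  shows "\<exists>v. \<forall>j. measure P {x \<in> space P. (\<lambda>k. h x k + v k) \<in> B j} \<ge> 1 - (1/2) ^ Suc j"
proof (rule ccontr)
  interpret P: prob_space P by (rule P)
  interpret \<tau>: prob_space \<tau> by (rule \<tau>)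
  define p where "p j v = measure P {x \<in> space P. (\<lambda>k. h x k + v k) \<in> B j}" for j v
  have m[measurable]: "p j \<in> borel_measurable \<tau>" for j unfolding p_def by (rule add_law_section(1)[OF B])
  have p1: "p j v \<le> 1" "p j v \<ge> 0" for j v unfolding p_def by auto
  have i: "integrable \<tau> (p j)" for j using p1 by (intro \<tau>.integrable_bounded_real[of _ 1]) auto
  have ip: "(\<integral>v. p j v \<partial>\<tau>) \<ge> 1 - (1/8) ^ Suc j" for j
    using pr[of j] add_law_section(2)[OF B, of j] unfolding p_def by simp
  define bad where "bad j = {v \<in> space \<tau>. 1 - p j v \<ge> (1/2) ^ Suc j}" for j
  have bs[measurable]: "bad j \<in> sets \<tau>" for j unfolding bad_def by measurable
  assume n: "\<not> ?thesis"
  have cover: "space \<tau> \<subseteq> (\<Union>j. bad j)"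
  proof
    fix v assume v: "v \<in> space \<tau>"
    obtain j where "\<not> p j v \<ge> 1 - (1/2) ^ Suc j" using n unfolding p_def by blast
    then show "v \<in> (\<Union>j. bad j)" using v unfolding bad_def by (auto intro!: exI[of _ j])
  qed
  have mb: "measure \<tau> (bad j) \<le> (1/4) ^ Suc j" for j
  proof -
    have "(1/2) ^ Suc j * measure \<tau> (bad j) = (\<integral>v. (1/2) ^ Suc j * indicator (bad j) v \<partial>\<tau>)" by simp
    also have "\<dots> \<le> (\<integral>v. 1 - p j v \<partial>\<tau>)"
    proof (rule integral_mono)
      show "integrable \<tau> (\<lambda>v. (1/2) ^ Suc j * indicat_real (bad j) v)"
        by (intro integrable_mult_right integrable_real_indicator) (auto simp: less_top[symmetric])
      show "(1/2) ^ Suc j * indicator (bad j) v \<le> 1 - p j v" for v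
        using p1[of j v] by (auto simp: bad_def indicator_def)
    qed (use i in auto)
    also have "\<dots> \<le> (1/8) ^ Suc j" using ip[of j] i by (simp add: \<tau>.prob_space)
    also have "\<dots> = (1/2) ^ Suc j * (1/4) ^ Suc j" by (simp flip: power_mult_distrib)
    finally show ?thesis by simp
  qed
  have geo: "(\<lambda>j. (1/4::real) ^ Suc j) sums (1 / 3)" using power_half_series sums_mult[OF geometric_sums[of "1/4::real"], of "1/4"] by simp
  have "1 = measure \<tau> (space \<tau>)" by (simp add: \<tau>.prob_space)
  also have "\<dots> \<le> measure \<tau> (\<Union>j. bad j)" using cover by (intro \<tau>.finite_measure_mono) auto
  also have "\<dots> \<le> (\<Sum>j. measure \<tau> (bad j))"
  proof (rule \<tau>.finite_measure_subadditive_countably)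
    show "summable (\<lambda>j. measure \<tau> (bad j))"
      by (rule summable_comparison_test'[OF sums_summable[OF geo]]) (use mb in auto)
  qed auto
  also have "\<dots> \<le> (\<Sum>j. (1/4) ^ Suc j)"
  proof (rule suminf_le[OF mb])
    show "summable (\<lambda>j. measure \<tau> (bad j))"
      by (rule summable_comparison_test'[OF sums_summable[OF geo]]) (use mb in auto)
  qed (rule sums_summable[OF geo])
  also have "\<dots> = 1 / 3" by (rule sums_unique[OF geo, symmetric])
  finally show False by simp
qed

end

section \<open>Limit laws as infinite independent sums\<close>

context disk_levy begin

lemma rcomb_T_measurable [measurable]: "(\<lambda>x. rcomb c (T x)) \<in> borel_measurable borel"
  by (rule dual_space_measurable[OF rcomb_T_dual])

lemma a_sq_le_sq_sum: "ennreal ((a k x)\<^sup>2) \<le> sq_sum x"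
proof -
  have "(\<Sum>k\<in>{k}. ennreal ((a k x)\<^sup>2)) \<le> sq_sum x" unfolding sq_sum_def by (rule sum_le_suminf) auto
  then show ?thesis by simp
qed

text \<open>The independent sum of the centred Poisson exponentials of \<open>R j\<close> converges almost surely
  in every coordinate; its limit need not lie in \<open>T ` UNIV\<close>.\<close>

lemma product_limit:
  assumes R: "\<And>j. on_K (R j)" and small: "\<And>j. (\<integral>\<^sup>+x. sq_sum x \<partial>R (Suc j)) \<le> ennreal ((1/8) ^ Suc j)"
  obtains \<kappa> :: "(nat \<Rightarrow> real) measure" where "prob_space \<kappa>" "sets \<kappa> = sets borel"
    "\<And>c. (\<lambda>n. \<Prod>j<n. fourier (centred_exp (R j)) (\<lambda>x. rcomb c (T x))) \<longlonglongrightarrow> fourier \<kappa> (rcomb c)"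
proof -
  define \<Omega> where "\<Omega> = Pi\<^sub>M UNIV (\<lambda>j. centred_exp (R j))"
  have pe: "prob_space (centred_exp (R j))" for j by (rule centred_exp_prob_space[OF R])
  interpret P: product_prob_space "\<lambda>j. centred_exp (R j)" UNIV
    by (intro product_prob_spaceI pe)
  interpret \<Omega>: prob_space \<Omega> unfolding \<Omega>_def by (rule prob_space_PiM[OF pe])
  have comp: "(\<lambda>\<omega>. \<omega> j) \<in> \<Omega> \<rightarrow>\<^sub>M centred_exp (R j)" for j
    unfolding \<Omega>_def by (rule measurable_component_singleton) simp
  have compd: "distr \<Omega> (centred_exp (R j)) (\<lambda>\<omega>. \<omega> j) = centred_exp (R j)" for j
    unfolding \<Omega>_def by (rule P.PiM_component) simp
  have bm: "(\<lambda>\<omega>. b (\<omega> j)) \<in> borel_measurable \<Omega>" if "b \<in> borel_measurable borel" for b :: "'a \<Rightarrow> real" and j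
    by (rule measurable_compose[OF comp centred_exp_measurable[OF R that]])
  have am[measurable]: "(\<lambda>\<omega>. a k (\<omega> j)) \<in> borel_measurable \<Omega>" for k j by (rule bm[OF a_measurable])
  \<comment> \<open>Where a coordinate series diverges, an event of probability 0,
    \<open>suminf\<close> has an unspecified value.\<close>
  define Y where "Y \<omega> = (\<lambda>k. \<Sum>j. a k (\<omega> j))" for \<omega> :: "nat \<Rightarrow> 'a"
  have Y: "Y \<in> borel_measurable \<Omega>"
    unfolding Y_def by (rule measurable_coordinatewise_then_product) measurable
  have L1: "(\<integral>\<^sup>+\<omega>. ennreal \<bar>a k (\<omega> (Suc j))\<bar> \<partial>\<Omega>) \<le> ennreal ((1/2) ^ Suc j)" for k j
  proof -
    \<comment> \<open>The weights in \<open>\<bar>x\<bar> \<le> ?c * x^2 + ?d\<close> are chosen so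
      that a second moment of at most \<open>(1/8)^(j+1)\<close> gives a first moment of at most
      \<open>(1/2)^(j+1)\<close>, which is summable.\<close>
    let ?c = "2 ^ Suc j / 2 :: real" and ?d = "(1/2) ^ Suc j / 2 :: real" and ?P = "centred_exp (R (Suc j))"
    have [measurable]: "a k \<in> borel_measurable ?P" by (rule centred_exp_measurable[OF R a_measurable])
    have amgm: "\<bar>x\<bar> \<le> ?c * x\<^sup>2 + ?d" for x :: real
    proof -
      have "0 \<le> (2 ^ Suc j * \<bar>x\<bar> - 1)\<^sup>2 * (1/2) ^ Suc j / 2" by simp
      also have "\<dots> = ((2 ^ Suc j)\<^sup>2 * x\<^sup>2 - 2 * (2 ^ Suc j * \<bar>x\<bar>) + 1) * (1/2) ^ Suc j / 2"
        by (simp add: power2_diff power_mult_distrib)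
      also have "\<dots> = ?c * x\<^sup>2 - \<bar>x\<bar> + ?d"
        by (simp add: power_one_over power2_eq_square field_simps)
      finally show ?thesis by simp
    qed
    have "(\<integral>\<^sup>+\<omega>. ennreal \<bar>a k (\<omega> (Suc j))\<bar> \<partial>\<Omega>) = (\<integral>\<^sup>+x. ennreal \<bar>a k x\<bar> \<partial>distr \<Omega> ?P (\<lambda>\<omega>. \<omega> (Suc j)))"
      by (subst nn_integral_distr[OF comp]) auto
    also have "\<dots> = (\<integral>\<^sup>+x. ennreal \<bar>a k x\<bar> \<partial>?P)" by (simp only: compd)
    also have "\<dots> \<le> (\<integral>\<^sup>+x. ennreal ?c * ennreal ((a k x)\<^sup>2) + ennreal ?d \<partial>?P)"
    proof (rule nn_integral_mono)
      fix x
      show "ennreal \<bar>a k x\<bar> \<le> ennreal ?c * ennreal ((a k x)\<^sup>2) + ennreal ?d"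
        using ennreal_leI[OF amgm[of "a k x"]] by (simp add: ennreal_mult[symmetric] ennreal_plus[symmetric] del: ennreal_plus)
    qed
    also have "\<dots> = ennreal ?c * (\<integral>\<^sup>+x. ennreal ((a k x)\<^sup>2) \<partial>?P) + ennreal ?d"
      using prob_space.emeasure_space_1[OF pe[of "Suc j"]] by (simp add: nn_integral_add nn_integral_cmult)
    also have "\<dots> \<le> ennreal ?c * ennreal ((1/8) ^ Suc j) + ennreal ?d"
    proof (intro add_right_mono mult_left_mono)
      have "(\<integral>\<^sup>+x. ennreal ((a k x)\<^sup>2) \<partial>?P) \<le> (\<integral>\<^sup>+x. ennreal ((a k x)\<^sup>2) \<partial>R (Suc j))"
        by (rule centred_exp_second_moment[OF R a_dual])
      also have "\<dots> \<le> (\<integral>\<^sup>+x. sq_sum x \<partial>R (Suc j))"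
        by (intro nn_integral_mono a_sq_le_sq_sum)
      finally show "(\<integral>\<^sup>+x. ennreal ((a k x)\<^sup>2) \<partial>?P) \<le> ennreal ((1/8) ^ Suc j)" using small[of j] by (rule order_trans)
    qed auto
    also have "\<dots> = ennreal (?c * (1/8) ^ Suc j + ?d)" by (simp add: ennreal_mult[symmetric] ennreal_plus[symmetric] del: ennreal_plus)
    also have "\<dots> \<le> ennreal ((1/2) ^ Suc j)"
    proof (rule ennreal_leI)
      have "(2::real) ^ Suc j * (1/8) ^ Suc j = (1/4) ^ Suc j" by (simp flip: power_mult_distrib)
      moreover have "(1/4::real) ^ Suc j \<le> (1/2) ^ Suc j" by (rule power_mono) auto
      ultimately show "?c * (1/8) ^ Suc j + ?d \<le> (1/2) ^ Suc j" by linarith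
    qed
    finally show ?thesis .
  qed
  have sumk: "AE \<omega> in \<Omega>. summable (\<lambda>j. a k (\<omega> j))" for k
  proof -
    have "(\<integral>\<^sup>+\<omega>. (\<Sum>j. ennreal \<bar>a k (\<omega> (Suc j))\<bar>) \<partial>\<Omega>) = (\<Sum>j. \<integral>\<^sup>+\<omega>. ennreal \<bar>a k (\<omega> (Suc j))\<bar> \<partial>\<Omega>)"
      by (rule nn_integral_suminf) measurable
    also have "\<dots> \<le> (\<Sum>j. ennreal ((1/2) ^ Suc j))" by (intro suminf_le L1) auto
    also have "\<dots> = ennreal 1" by (rule suminf_ennreal_eq[OF _ power_half_series]) simp
    finally have "(\<integral>\<^sup>+\<omega>. (\<Sum>j. ennreal \<bar>a k (\<omega> (Suc j))\<bar>) \<partial>\<Omega>) \<noteq> \<infinity>" by (auto simp: top_unique)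
    then have "AE \<omega> in \<Omega>. (\<Sum>j. ennreal \<bar>a k (\<omega> (Suc j))\<bar>) \<noteq> \<infinity>" by (intro nn_integral_noteq_infinite) auto
    then show ?thesis
    proof eventually_elim
      case (elim \<omega>)
      have "summable (\<lambda>j. \<bar>a k (\<omega> (Suc j))\<bar>)" by (rule summable_suminf_not_top) (use elim in auto)
      then have "summable (\<lambda>j. a k (\<omega> (Suc j)))" by (rule summable_rabs_cancel)
      \<comment> \<open>The piece \<open>R 0\<close> is not assumed small; one further term does not
        affect convergence.\<close>
      then show ?case using summable_Suc_iff[of "\<lambda>j. a k (\<omega> j)"] by blast
    qed
  qed
  have lim: "AE \<omega> in \<Omega>. (\<lambda>n. rcomb c (\<lambda>k. \<Sum>j<n. a k (\<omega> j))) \<longlonglongrightarrow> rcomb c (Y \<omega>)" for c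
  proof -
    have "AE \<omega> in \<Omega>. \<forall>k. summable (\<lambda>j. a k (\<omega> j))" using sumk by (simp add: AE_all_countable)
    then show ?thesis
    proof eventually_elim
      case (elim \<omega>)
      then have "(\<lambda>n. \<Sum>j<n. a k (\<omega> j)) \<longlonglongrightarrow> Y \<omega> k" for k unfolding Y_def by (intro summable_LIMSEQ) auto
      then show ?case unfolding rcomb_def by (intro tendsto_sum tendsto_mult tendsto_const)
    qed
  qed
  have rs: "rcomb c (\<lambda>k. \<Sum>j<n. a k (\<omega> j)) = (\<Sum>j<n. rcomb c (T (\<omega> j)))" for c n and \<omega> :: "nat \<Rightarrow> 'a"
    unfolding rcomb_sum T_def ..
  have tm[measurable]: "(\<lambda>\<omega>. rcomb c (T (\<omega> j))) \<in> borel_measurable \<Omega>" for c j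
    by (rule bm[OF rcomb_T_measurable])
  have indep: "\<Omega>.indep_vars (\<lambda>j. centred_exp (R j)) (\<lambda>j \<omega>. \<omega> j) UNIV"
  proof (subst \<Omega>.indep_vars_iff_distr_eq_PiM)
    have "distr \<Omega> (Pi\<^sub>M UNIV (\<lambda>j. centred_exp (R j))) (\<lambda>x. \<lambda>i\<in>UNIV. x i) = distr \<Omega> \<Omega> (\<lambda>x. x)"
      unfolding \<Omega>_def by (intro distr_cong) auto
    also have "\<dots> = Pi\<^sub>M UNIV (\<lambda>j. centred_exp (R j))" by (simp add: distr_id2 \<Omega>_def)
    finally show "distr \<Omega> (Pi\<^sub>M UNIV (\<lambda>j. centred_exp (R j))) (\<lambda>x. \<lambda>i\<in>UNIV. x i) = Pi\<^sub>M UNIV (\<lambda>i. distr \<Omega> (centred_exp (R i)) (\<lambda>\<omega>. \<omega> i))"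
      by (simp add: compd)
  qed (use comp in auto)
  have pf: "fourier \<Omega> (\<lambda>\<omega>. rcomb c (\<lambda>k. \<Sum>j<n. a k (\<omega> j))) = (\<Prod>j<n. fourier (centred_exp (R j)) (\<lambda>x. rcomb c (T x)))" for c n
  proof -
    have "\<Omega>.indep_vars (\<lambda>_. borel) (\<lambda>j \<omega>. iexp (rcomb c (T (\<omega> j)))) UNIV"
    proof (rule \<Omega>.indep_vars_compose2[OF indep])
      fix j
      have [measurable]: "(\<lambda>x. rcomb c (T x)) \<in> borel_measurable (centred_exp (R j))" by (rule centred_exp_measurable[OF R rcomb_T_measurable])
      show "(\<lambda>x. iexp (rcomb c (T x))) \<in> borel_measurable (centred_exp (R j))" by measurable
    qed
    then have ind: "\<Omega>.indep_vars (\<lambda>_. borel) (\<lambda>j \<omega>. iexp (rcomb c (T (\<omega> j)))) {..<n}"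
      by (rule \<Omega>.indep_vars_subset) auto
    have "fourier \<Omega> (\<lambda>\<omega>. rcomb c (\<lambda>k. \<Sum>j<n. a k (\<omega> j))) = (CLINT \<omega>|\<Omega>. (\<Prod>j<n. iexp (rcomb c (T (\<omega> j)))))"
      unfolding fourier_def rs exp_sum_prod ..
    also have "\<dots> = (\<Prod>j<n. CLINT \<omega>|\<Omega>. iexp (rcomb c (T (\<omega> j))))"
      by (rule \<Omega>.indep_vars_lebesgue_integral[OF _ ind]) (auto intro!: \<Omega>.integrable_iexp)
    also have "\<dots> = (\<Prod>j<n. fourier (centred_exp (R j)) (\<lambda>x. rcomb c (T x)))"
    proof (rule prod.cong[OF refl])
      fix j
      have "fourier (distr \<Omega> (centred_exp (R j)) (\<lambda>\<omega>. \<omega> j)) (\<lambda>x. rcomb c (T x)) = fourier \<Omega> (\<lambda>\<omega>. rcomb c (T (\<omega> j)))"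
        by (rule fourier_distr[OF comp centred_exp_measurable[OF R rcomb_T_measurable]])
      then show "(CLINT \<omega>|\<Omega>. iexp (rcomb c (T (\<omega> j)))) = fourier (centred_exp (R j)) (\<lambda>x. rcomb c (T x))"
        unfolding compd fourier_def by simp
    qed
    finally show ?thesis .
  qed
  show thesis
  proof (rule that[of "distr \<Omega> borel Y"])
    show "prob_space (distr \<Omega> borel Y)" by (rule \<Omega>.prob_space_distr[OF Y])
    fix c
    have "(\<lambda>n. fourier \<Omega> (\<lambda>\<omega>. rcomb c (\<lambda>k. \<Sum>j<n. a k (\<omega> j)))) \<longlonglongrightarrow> fourier \<Omega> (\<lambda>\<omega>. rcomb c (Y \<omega>))"
      unfolding fourier_def
    proof (rule integral_dominated_convergence[where w="\<lambda>_. 1"])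
      show "(\<lambda>\<omega>. iexp (rcomb c (Y \<omega>))) \<in> borel_measurable \<Omega>"
        using measurable_compose[OF Y rcomb_measurable] by measurable
      show "(\<lambda>\<omega>. iexp (rcomb c (\<lambda>k. \<Sum>j<n. a k (\<omega> j)))) \<in> borel_measurable \<Omega>" for n
        unfolding rs by measurable
      show "AE \<omega> in \<Omega>. (\<lambda>n. iexp (rcomb c (\<lambda>k. \<Sum>j<n. a k (\<omega> j)))) \<longlonglongrightarrow> iexp (rcomb c (Y \<omega>))"
        using lim by eventually_elim (intro tendsto_intros)
    qed auto
    then show "(\<lambda>n. \<Prod>j<n. fourier (centred_exp (R j)) (\<lambda>x. rcomb c (T x))) \<longlonglongrightarrow> fourier (distr \<Omega> borel Y) (rcomb c)"
      unfolding pf fourier_distr[OF Y rcomb_measurable] .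
  qed simp
qed

lemma \<Lambda>_space: "space \<Lambda> = UNIV"
  using sets_eq_imp_space_eq[OF sets_\<Lambda>] by simp

lemma \<Lambda>_measurable: "b \<in> borel_measurable borel \<Longrightarrow> b \<in> borel_measurable \<Lambda>"
  using measurable_cong_sets[OF sets_\<Lambda> refl] by blast

lemma \<Lambda>_AE: "AE x in \<Lambda>. x \<in> K - {0}"
proof -
  have "emeasure \<Lambda> (- K \<union> {0}) \<le> emeasure \<Lambda> (- K) + emeasure \<Lambda> {0}"
    by (rule emeasure_subadditive) (auto simp: sets_\<Lambda>)
  then have "emeasure \<Lambda> (- K \<union> {0}) = 0" using \<Lambda>_K \<Lambda>_0 by simp
  then show ?thesis by (intro AE_I[of _ _ "- K \<union> {0}"]) (auto simp: sets_\<Lambda>)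
qed

lemma sq_sum_pos: "x \<noteq> 0 \<Longrightarrow> sq_sum x > 0"
proof -
  assume "x \<noteq> 0"
  then obtain k where "a k x \<noteq> a k 0" using a_sep by blast
  then have "a k x \<noteq> 0" using linear_0[OF dual_space_linear[OF a_dual]] by simp
  then have "0 < ennreal ((a k x)\<^sup>2)" by simp
  also have "\<dots> \<le> sq_sum x" by (rule a_sq_le_sq_sum)
  finally show ?thesis .
qed

text \<open>Superlevel sets of \<open>sq_sum\<close> in \<open>K\<close>: they have finite measure
  by Chebyshev's inequality, and they fill \<open>K - {0}\<close>, so the integral of
  \<open>sq_sum\<close> off them tends to 0. A subsequence yields the geometric rate that
  \<open>product_limit\<close> asks for.\<close>

lemma exhaustion:
  obtains C where "incseq C" "\<And>n. C n \<in> sets borel" "\<And>n. C n \<subseteq> K" "\<And>n. emeasure \<Lambda> (C n) < \<infinity>"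
    "\<And>n. (\<integral>\<^sup>+x. sq_sum x * indicator (- C n) x \<partial>\<Lambda>) \<le> ennreal ((1/8) ^ Suc n)" "(\<Union>n. C n) = K - {0}"
proof -
  have [measurable]: "sq_sum \<in> borel_measurable \<Lambda>" by (rule \<Lambda>_measurable[OF sq_sum_measurable])
  have hsi: "(\<integral>\<^sup>+x. sq_sum x \<partial>\<Lambda>) < \<infinity>" using sq_sum_int unfolding sq_sum_def .
  define A where "A m = {x \<in> K. 1 \<le> of_nat (Suc m) * sq_sum x}" for m
  have Ab: "A m \<in> sets borel" for m unfolding A_def by measurable
  have Am: "A m \<subseteq> A n" if "m \<le> n" for m n
  proof
    fix x assume x: "x \<in> A m"
    have "of_nat (Suc m) * sq_sum x \<le> of_nat (Suc n) * sq_sum x" using that by (intro mult_right_mono) auto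
    then show "x \<in> A n" using x by (auto simp: A_def intro: order_trans simp del: of_nat_Suc)
  qed
  have AU: "(\<Union>m. A m) = K - {0}"
  proof
    show "(\<Union>m. A m) \<subseteq> K - {0}"
    proof -
      have "sq_sum 0 = 0" unfolding sq_sum_def using linear_0[OF dual_space_linear[OF a_dual]] by simp
      then show ?thesis by (auto simp: A_def)
    qed
    show "K - {0} \<subseteq> (\<Union>m. A m)"
    proof
      fix x assume x: "x \<in> K - {0}"
      then have "sq_sum x > 0" using sq_sum_pos by auto
      then obtain m :: nat where "1 \<le> of_nat (Suc m) * sq_sum x"
      proof (cases "sq_sum x = \<top>")
        case True
        then show ?thesis using that[of 0] by simp
      next
        case False
        then obtain r where r: "sq_sum x = ennreal r" "r > 0" using \<open>sq_sum x > 0\<close> by (cases "sq_sum x") auto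
        obtain m :: nat where "1 < real m * r" using ex_less_of_nat_mult[OF r(2), of 1] by auto
        then have "1 \<le> real (Suc m) * r" using r(2) by (simp add: distrib_right)
        then have "1 \<le> of_nat (Suc m) * sq_sum x" unfolding r(1)
          by (metis ennreal_1 ennreal_leI ennreal_mult ennreal_of_nat_eq_real_of_nat less_imp_le of_nat_0_le_iff r(2))
        then show ?thesis by (rule that)
      qed
      then show "x \<in> (\<Union>m. A m)" using x by (auto simp: A_def)
    qed
  qed
  have Af: "emeasure \<Lambda> (A m) < \<infinity>" for m
  proof -
    have "emeasure \<Lambda> (A m) = (\<integral>\<^sup>+x. indicator (A m) x \<partial>\<Lambda>)" using Ab by (simp add: sets_\<Lambda>)
    also have "\<dots> \<le> (\<integral>\<^sup>+x. of_nat (Suc m) * sq_sum x \<partial>\<Lambda>)"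
      by (intro nn_integral_mono) (auto simp: A_def indicator_def simp del: of_nat_Suc)
    also have "\<dots> = of_nat (Suc m) * (\<integral>\<^sup>+x. sq_sum x \<partial>\<Lambda>)" by (rule nn_integral_cmult) measurable
    also have "\<dots> < \<infinity>" using hsi by (auto simp: ennreal_mult_less_top of_nat_less_top simp del: of_nat_Suc)
    finally show ?thesis .
  qed
  define \<mu>' where "\<mu>' = density \<Lambda> sq_sum"
  have \<mu>': "emeasure \<mu>' S = (\<integral>\<^sup>+x. sq_sum x * indicator S x \<partial>\<Lambda>)" if "S \<in> sets borel" for S
    unfolding \<mu>'_def using that by (subst emeasure_density) (auto simp: sets_\<Lambda>)
  have "(\<lambda>m. emeasure \<mu>' (- A m)) \<longlonglongrightarrow> emeasure \<mu>' (\<Inter>m. - A m)"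
  proof (rule Lim_emeasure_decseq)
    show "range (\<lambda>m. - A m) \<subseteq> sets \<mu>'" using Ab by (auto simp: \<mu>'_def sets_\<Lambda>)
    show "decseq (\<lambda>m. - A m)" using Am by (auto simp: decseq_def)
    fix m
    have "emeasure \<mu>' (- A m) \<le> (\<integral>\<^sup>+x. sq_sum x \<partial>\<Lambda>)"
      using Ab by (subst \<mu>') (auto intro!: nn_integral_mono simp: indicator_def)
    then show "emeasure \<mu>' (- A m) \<noteq> \<infinity>" using hsi by (auto simp: top_unique)
  qed
  moreover have "emeasure \<mu>' (\<Inter>m. - A m) = 0"
  proof -
    have "(\<Inter>m. - A m) = - (K - {0})" using AU by auto
    moreover have "emeasure \<mu>' (- (K - {0})) = 0"
    proof (subst \<mu>')
      show "(\<integral>\<^sup>+x. sq_sum x * indicator (- (K - {0})) x \<partial>\<Lambda>) = 0"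
      proof (subst nn_integral_0_iff_AE)
        show "(\<lambda>x. sq_sum x * indicator (- (K - {0})) x) \<in> borel_measurable \<Lambda>" by (rule \<Lambda>_measurable) measurable
        show "AE x in \<Lambda>. sq_sum x * indicator (- (K - {0})) x = 0" using \<Lambda>_AE by eventually_elim simp
      qed
    qed auto
    ultimately show ?thesis by simp
  qed
  ultimately have lim: "(\<lambda>m. emeasure \<mu>' (- A m)) \<longlonglongrightarrow> 0" by simp
  have "\<exists>m. emeasure \<mu>' (- A m) \<le> ennreal ((1/8) ^ Suc n)" for n
  proof -
    have "eventually (\<lambda>m. emeasure \<mu>' (- A m) < ennreal ((1/8) ^ Suc n)) sequentially"
      by (rule order_tendstoD(2)[OF lim]) simp
    then show ?thesis unfolding eventually_sequentially by (auto intro: less_imp_le)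
  qed
  then obtain f where f: "\<And>n. emeasure \<mu>' (- A (f n)) \<le> ennreal ((1/8) ^ Suc n)" by metis
  \<comment> \<open>Partial sums make the subsequence monotone and keep it above \<open>f\<close>;
    the summand \<open>n\<close> makes it unbounded.\<close>
  define N where "N n = (\<Sum>i\<le>n. f i) + n" for n
  have N: "mono N" "f n \<le> N n" "n \<le> N n" for n
  proof -
    show "mono N" unfolding mono_iff_le_Suc by (simp add: N_def)
    have "f n \<le> (\<Sum>i\<le>n. f i)" by (rule member_le_sum) auto
    then show "f n \<le> N n" "n \<le> N n" by (auto simp: N_def)
  qed
  show thesis
  proof (rule that[of "\<lambda>n. A (N n)"])
    show "incseq (\<lambda>n. A (N n))" using Am N(1) by (auto simp: incseq_def mono_def)
    show "A (N n) \<in> sets borel" "A (N n) \<subseteq> K" "emeasure \<Lambda> (A (N n)) < \<infinity>" for n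
      using Ab Af by (auto simp: A_def)
    show "(\<integral>\<^sup>+x. sq_sum x * indicator (- A (N n)) x \<partial>\<Lambda>) \<le> ennreal ((1/8) ^ Suc n)" for n
    proof -
      have "(\<integral>\<^sup>+x. sq_sum x * indicator (- A (N n)) x \<partial>\<Lambda>) \<le> (\<integral>\<^sup>+x. sq_sum x * indicator (- A (f n)) x \<partial>\<Lambda>)"
        using Am[OF N(2)[of n]] by (intro nn_integral_mono mult_left_mono) (auto simp: indicator_def)
      then show ?thesis using f[of n] \<mu>'[of "- A (f n)"] Ab by auto
    qed
    have "(\<Union>n. A (N n)) = (\<Union>m. A m)" using Am N(3) by blast
    then show "(\<Union>n. A (N n)) = K - {0}" using AU by simp
  qed
qed

end

section \<open>Finite minorants and their densities\<close>

lemma measure_le_iff: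
  assumes "sets M = sets N"
  shows "M \<le> N \<longleftrightarrow> (\<forall>A\<in>sets M. emeasure M A \<le> emeasure N A)"
proof -
  have "emeasure M \<le> emeasure N \<longleftrightarrow> (\<forall>A\<in>sets M. emeasure M A \<le> emeasure N A)"
    unfolding le_fun_def using assms emeasure_notin_sets by (metis zero_le)
  then show ?thesis using assms sets_eq_imp_space_eq[OF assms] by (simp add: le_measure_iff)
qed

lemma finite_minorants_iff:
  "M \<in> finite_minorants T \<nu> \<longleftrightarrow> sets M = sets (borel_of T) \<and> finite_measure M \<and> sets M = sets \<nu> \<and>
     (\<forall>A\<in>sets M. emeasure M A \<le> emeasure \<nu> A)"
  unfolding finite_minorants_def finite_borel_measures_def using measure_le_iff by blast

lemma LIMSEQ_compose_subseq:
  "(X :: nat \<Rightarrow> 'b::topological_space) \<longlonglongrightarrow> L \<Longrightarrow> strict_mono r \<Longrightarrow> (\<lambda>n. X (r n)) \<longlonglongrightarrow> L"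
  using LIMSEQ_subseq_LIMSEQ[of X L r] by (simp add: o_def)

lemma compact_Pi_intervals:
  fixes W :: "nat \<Rightarrow> real"
  shows "compact {z. \<forall>k. \<bar>z k\<bar> \<le> W k}"
proof -
  have "compactin (product_topology (\<lambda>_. euclidean) UNIV) (PiE UNIV (\<lambda>k. {- W k..W k}))"
    by (subst compactin_PiE) auto
  then have "compact (PiE UNIV (\<lambda>k. {- W k..W k}))" by (simp add: euclidean_product_topology)
  also have "PiE UNIV (\<lambda>k. {- W k..W k}) = {z. \<forall>k. \<bar>z k\<bar> \<le> W k}" by (auto simp: PiE_def Pi_def abs_le_iff minus_le_iff)
  finally show ?thesis .
qed

context disk_levy begin

lemma minorant_sets: "M \<in> finite_minorants euclidean \<Lambda> \<Longrightarrow> sets M = sets borel"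
  by (simp add: finite_minorants_iff)

lemma minorant_le: "M \<in> finite_minorants euclidean \<Lambda> \<Longrightarrow> emeasure M A \<le> emeasure \<Lambda> A"
  using finite_minorants_iff[of M euclidean \<Lambda>] emeasure_notin_sets[of A M] by (cases "A \<in> sets M") auto

lemma minorant_on_K: "M \<in> finite_minorants euclidean \<Lambda> \<Longrightarrow> on_K M"
  using minorant_le[of M "- K"] \<Lambda>_K by (simp add: on_K_def finite_minorants_iff finite_borel_measures_iff sets_\<Lambda>)

lemma density_minorant:
  assumes d: "d \<in> borel_measurable borel" "\<And>x. 0 \<le> d x" "\<And>x. d x \<le> (1::real)"
    and fin: "(\<integral>\<^sup>+x. ennreal (d x) \<partial>\<Lambda>) < \<infinity>"
  shows "density \<Lambda> (\<lambda>x. ennreal (d x)) \<in> finite_minorants euclidean \<Lambda>"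
proof -
  have [measurable]: "d \<in> borel_measurable \<Lambda>" by (rule \<Lambda>_measurable[OF d(1)])
  have e: "emeasure (density \<Lambda> (\<lambda>x. ennreal (d x))) A = (\<integral>\<^sup>+x. ennreal (d x) * indicator A x \<partial>\<Lambda>)" if "A \<in> sets \<Lambda>" for A
    using that by (intro emeasure_density) auto
  have "finite_measure (density \<Lambda> (\<lambda>x. ennreal (d x)))"
    using fin e[of "space \<Lambda>"] by (intro finite_measureI) (auto simp: \<Lambda>_space sets_\<Lambda>)
  moreover have "emeasure (density \<Lambda> (\<lambda>x. ennreal (d x))) A \<le> emeasure \<Lambda> A" if "A \<in> sets \<Lambda>" for A
  proof -
    have "emeasure (density \<Lambda> (\<lambda>x. ennreal (d x))) A \<le> (\<integral>\<^sup>+x. indicator A x \<partial>\<Lambda>)"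
      unfolding e[OF that] using d(3) by (intro nn_integral_mono) (auto simp: indicator_def ennreal_le_1)
    then show ?thesis using that by simp
  qed
  ultimately show ?thesis by (simp add: finite_minorants_iff sets_\<Lambda>)
qed

text \<open>The exhaustion and the null complement of \<open>K - {0}\<close> show that
  \<open>\<Lambda>\<close> is sigma-finite, so the Radon-Nikodym theorem applies. Domination gives a
  density at most 1 almost everywhere, and truncation makes this hold at every point.\<close>

lemma minorant_density:
  assumes M: "M \<in> finite_minorants euclidean \<Lambda>"
  obtains d where "d \<in> borel_measurable borel" "\<And>x. 0 \<le> d x" "\<And>x. d x \<le> (1::real)" "M = density \<Lambda> (\<lambda>x. ennreal (d x))"
proof -
  interpret M: finite_measure M using M by (simp add: finite_minorants_iff)
  obtain C where C: "incseq C" "\<And>n. C n \<in> sets borel" "\<And>n. C n \<subseteq> K" "\<And>n. emeasure \<Lambda> (C n) < \<infinity>"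
    "\<And>n. (\<integral>\<^sup>+x. sq_sum x * indicator (- C n) x \<partial>\<Lambda>) \<le> ennreal ((1/8) ^ Suc n)" "(\<Union>n. C n) = K - {0}"
    by (rule exhaustion) blast
  have nullc: "emeasure \<Lambda> (- (K - {0})) = 0"
    using \<Lambda>_AE C(2) by (intro AE_iff_measurable[THEN iffD1, OF _ _ \<Lambda>_AE]) (auto simp: sets_\<Lambda> \<Lambda>_space)
  interpret \<Lambda>: sigma_finite_measure \<Lambda>
  proof
    show "\<exists>A. countable A \<and> A \<subseteq> sets \<Lambda> \<and> \<Union>A = space \<Lambda> \<and> (\<forall>a\<in>A. emeasure \<Lambda> a \<noteq> \<infinity>)"
      using C nullc
      by (intro exI[of _ "insert (- (K - {0})) (range C)"]) (auto simp: sets_\<Lambda> \<Lambda>_space less_top[symmetric])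
  qed
  have "absolutely_continuous \<Lambda> M"
    unfolding absolutely_continuous_def null_sets_def
    using minorant_le[OF M] minorant_sets[OF M] by (auto simp: sets_\<Lambda>) (metis le_zero_eq)
  then obtain f where f: "f \<in> borel_measurable \<Lambda>" "density \<Lambda> f = M"
    using \<Lambda>.Radon_Nikodym[of M] minorant_sets[OF M] sets_\<Lambda> by auto
  have Mf: "emeasure M A = (\<integral>\<^sup>+x. f x * indicator A x \<partial>\<Lambda>)" if "A \<in> sets \<Lambda>" for A
    using f that by (metis emeasure_density)
  have f1: "AE x in \<Lambda>. f x \<le> 1"
  proof -
    have "AE x in \<Lambda>. x \<in> C n \<longrightarrow> f x \<le> 1" for n
    proof -
      \<comment> \<open>Inside \<open>C n\<close> the set has finite measure, so the integral of
        \<open>f - 1\<close> over it may be split into a difference.\<close>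
      define S where "S = {x \<in> space \<Lambda>. x \<in> C n \<and> 1 < f x}"
      have [measurable]: "C n \<in> sets \<Lambda>" using C(2) by (simp add: sets_\<Lambda>)
      have S[measurable]: "S \<in> sets \<Lambda>" unfolding S_def using f(1) by measurable
      have "emeasure \<Lambda> S \<le> emeasure \<Lambda> (C n)" by (rule emeasure_mono) (auto simp: S_def)
      then have Sf: "emeasure \<Lambda> S \<noteq> \<infinity>" using C(4)[of n] by auto
      have fm[measurable]: "f \<in> borel_measurable \<Lambda>" by (rule f(1))
      have "(\<integral>\<^sup>+x. (f x - 1) * indicator S x \<partial>\<Lambda>) = (\<integral>\<^sup>+x. f x * indicator S x - indicator S x \<partial>\<Lambda>)"
        by (intro nn_integral_cong) (auto simp: indicator_def)
      also have "\<dots> = (\<integral>\<^sup>+x. f x * indicator S x \<partial>\<Lambda>) - (\<integral>\<^sup>+x. indicator S x \<partial>\<Lambda>)"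
      proof (rule nn_integral_diff)
        show "(\<integral>\<^sup>+x. indicator S x \<partial>\<Lambda>) \<noteq> \<infinity>" using Sf by simp
        show "AE x in \<Lambda>. indicator S x \<le> f x * indicator S x"
          by (intro AE_I2) (auto simp: S_def indicator_def)
      qed measurable
      also have "\<dots> = emeasure M S - emeasure \<Lambda> S" using Mf[OF S] by simp
      also have "\<dots> = 0" using minorant_le[OF M, of S] by (intro diff_eq_0_ennreal) (auto simp: Sf less_top[symmetric])
      finally have "AE x in \<Lambda>. (f x - 1) * indicator S x = 0" by (subst (asm) nn_integral_0_iff_AE) auto
      then show ?thesis
      proof (rule AE_mp, intro AE_I2 impI)
        fix x assume x: "x \<in> space \<Lambda>" "(f x - 1) * indicator S x = 0" "x \<in> C n"
        show "f x \<le> 1"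
        proof (rule ccontr)
          assume "\<not> f x \<le> 1"
          then have "x \<in> S" using x by (auto simp: S_def)
          then have "f x - 1 = 0" using x by simp
          then show False using \<open>\<not> f x \<le> 1\<close> by (simp add: ennreal_minus_eq_0)
        qed
      qed
    qed
    then have "AE x in \<Lambda>. \<forall>n. x \<in> C n \<longrightarrow> f x \<le> 1" unfolding AE_all_countable by blast
    with \<Lambda>_AE show ?thesis
    proof eventually_elim
      case (elim x)
      then obtain n where "x \<in> C n" using C(6) by blast
      then show ?case using elim by blast
    qed
  qed
  define d where "d x = enn2real (min 1 (f x))" for x
  have fb: "f \<in> borel_measurable borel" using f(1) measurable_cong_sets[OF sets_\<Lambda> refl] by blast
  show thesis
  proof (rule that[of d])
    show "d \<in> borel_measurable borel" unfolding d_def[abs_def] using fb by measurable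
    show "0 \<le> d x" for x by (simp add: d_def)
    show "d x \<le> 1" for x unfolding d_def by (rule enn2real_leI) auto
    have "density \<Lambda> f = density \<Lambda> (\<lambda>x. ennreal (d x))"
    proof (rule density_cong)
      show "AE x in \<Lambda>. f x = ennreal (d x)" using f1
      proof eventually_elim
        case (elim x)
        then have "min 1 (f x) = f x" "f x < \<top>" by (auto simp: min_def order.strict_trans1[OF elim])
        then show ?case by (simp add: d_def)
      qed
    qed (use f(1) fb \<Lambda>_measurable in \<open>auto simp: d_def[abs_def]\<close>)
    then show "M = density \<Lambda> (\<lambda>x. ennreal (d x))" using f(2) by simp
  qed
qed

lemma levy_integrable:
  assumes b: "b \<in> dual_space" shows "integrable \<Lambda> (\<lambda>x. levy_kernel (b x))"
proof (rule integrableI_bounded)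
  have [measurable]: "b \<in> borel_measurable \<Lambda>" by (rule \<Lambda>_measurable[OF dual_space_measurable[OF b]])
  show "(\<lambda>x. levy_kernel (b x)) \<in> borel_measurable \<Lambda>" by measurable
  have "(\<integral>\<^sup>+x. ennreal (norm (levy_kernel (b x))) \<partial>\<Lambda>) \<le> (\<integral>\<^sup>+x. ennreal ((b x)\<^sup>2) \<partial>\<Lambda>)"
  proof (intro nn_integral_mono ennreal_leI)
    show "norm (levy_kernel (b x)) \<le> (b x)\<^sup>2" for x
      using norm_levy_kernel[of "b x"] zero_le_power2[of "b x"] by linarith
  qed
  then show "(\<integral>\<^sup>+x. ennreal (norm (levy_kernel (b x))) \<partial>\<Lambda>) < \<infinity>" using sq_int[OF b] by (rule order.strict_trans1)
qed

lemma density_levy_integral: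
  assumes d: "d \<in> borel_measurable borel" "\<And>x. 0 \<le> d x" and b: "b \<in> dual_space"
  shows "(\<integral>x. levy_kernel (b x) \<partial>density \<Lambda> (\<lambda>x. ennreal (d x))) = (\<integral>x. d x *\<^sub>R levy_kernel (b x) \<partial>\<Lambda>)"
proof (rule integral_density)
  have [measurable]: "b \<in> borel_measurable \<Lambda>" by (rule \<Lambda>_measurable[OF dual_space_measurable[OF b]])
  show "(\<lambda>x. levy_kernel (b x)) \<in> borel_measurable \<Lambda>" by measurable
qed (use d \<Lambda>_measurable in auto)

lemma weighted_levy_integrable:
  assumes d: "d \<in> borel_measurable borel" "\<And>x. \<bar>d x\<bar> \<le> 1" and b: "b \<in> dual_space"
  shows "integrable \<Lambda> (\<lambda>x. d x *\<^sub>R levy_kernel (b x))"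
proof (rule Bochner_Integration.integrable_bound[OF levy_integrable[OF b]])
  have [measurable]: "b \<in> borel_measurable \<Lambda>" "d \<in> borel_measurable \<Lambda>"
    using \<Lambda>_measurable[OF dual_space_measurable[OF b]] \<Lambda>_measurable[OF d(1)] by auto
  show "(\<lambda>x. d x *\<^sub>R levy_kernel (b x)) \<in> borel_measurable \<Lambda>" by measurable
  show "AE x in \<Lambda>. norm (d x *\<^sub>R levy_kernel (b x)) \<le> norm (levy_kernel (b x))"
    using d(2) by (intro AE_I2) (simp add: mult_left_le_one_le)
qed

lemma weighted_levy_tendsto:
  assumes d: "\<And>n::nat. d n \<in> borel_measurable borel" "\<And>n x. \<bar>d n x\<bar> \<le> 1" and e: "e \<in> borel_measurable borel"
    and lim: "AE x in \<Lambda>. (\<lambda>n. d n x) \<longlonglongrightarrow> e x" and b: "b \<in> dual_space"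
  shows "(\<lambda>n. \<integral>x. d n x *\<^sub>R levy_kernel (b x) \<partial>\<Lambda>) \<longlonglongrightarrow> (\<integral>x. e x *\<^sub>R levy_kernel (b x) \<partial>\<Lambda>)"
proof (rule integral_dominated_convergence[where w="\<lambda>x. norm (levy_kernel (b x))"])
  have [measurable]: "b \<in> borel_measurable \<Lambda>" "d n \<in> borel_measurable \<Lambda>" "e \<in> borel_measurable \<Lambda>" for n
    using \<Lambda>_measurable[OF dual_space_measurable[OF b]] \<Lambda>_measurable[OF d(1)] \<Lambda>_measurable[OF e] by auto
  show "(\<lambda>x. e x *\<^sub>R levy_kernel (b x)) \<in> borel_measurable \<Lambda>" by measurable
  show "(\<lambda>x. d n x *\<^sub>R levy_kernel (b x)) \<in> borel_measurable \<Lambda>" for n by measurable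
  show "integrable \<Lambda> (\<lambda>x. norm (levy_kernel (b x)))" using levy_integrable[OF b] by (rule integrable_norm)
  show "AE x in \<Lambda>. (\<lambda>n. d n x *\<^sub>R levy_kernel (b x)) \<longlonglongrightarrow> e x *\<^sub>R levy_kernel (b x)"
    using lim by eventually_elim (intro tendsto_scaleR tendsto_const)
  show "AE x in \<Lambda>. norm (d n x *\<^sub>R levy_kernel (b x)) \<le> norm (levy_kernel (b x))" for n
    using d(2) by (intro AE_I2) (simp add: mult_left_le_one_le)
qed

text \<open>\<open>\<Lambda>\<close>, weighted by \<open>d\<close>, is cut along the differences of
  the exhausting sets into finite pieces whose centred exponentials are summed independently. No
  tightness is involved: the law exists on the sequence space in any case, and the question is only
  where it is concentrated.\<close>

lemma limit_law:
  assumes d: "d \<in> borel_measurable borel" "\<And>x. 0 \<le> d x" "\<And>x. d x \<le> (1::real)"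
  obtains \<kappa> :: "(nat \<Rightarrow> real) measure" where "prob_space \<kappa>" "sets \<kappa> = sets borel"
    "\<And>c. fourier \<kappa> (rcomb c) = exp (\<integral>x. d x *\<^sub>R levy_kernel (rcomb c (T x)) \<partial>\<Lambda>)"
proof -
  obtain C where C: "incseq C" "\<And>n. C n \<in> sets borel" "\<And>n. C n \<subseteq> K" "\<And>n. emeasure \<Lambda> (C n) < \<infinity>"
    "\<And>n. (\<integral>\<^sup>+x. sq_sum x * indicator (- C n) x \<partial>\<Lambda>) \<le> ennreal ((1/8) ^ Suc n)" "(\<Union>n. C n) = K - {0}"
    by (rule exhaustion) blast
  define B where "B = disjointed C"
  have BC: "B n \<subseteq> C n" for n unfolding B_def by (rule disjointed_subset)
  have "range (disjointed C) \<subseteq> sets borel" by (rule sets.range_disjointed_sets) (use C(2) in blast)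
  then have Bb: "B n \<in> sets borel" for n unfolding B_def by blast
  have Bdisj: "disjoint_family B" unfolding B_def by (rule disjoint_family_disjointed)
  have BU: "(\<Union>n. B n) = K - {0}" unfolding B_def UN_disjointed_eq C(6) ..
  define w where "w j x = d x * indicator (B j) x" for j x
  have w: "w j \<in> borel_measurable borel" "0 \<le> w j x" "w j x \<le> 1" for j x
    unfolding w_def using d Bb[of j] by (auto intro!: borel_measurable_times simp: indicator_def)
  define R where "R j = density \<Lambda> (\<lambda>x. ennreal (w j x))" for j
  have wle: "ennreal (w j x) \<le> indicator (B j) x" for j x
    using d by (auto simp: w_def indicator_def ennreal_le_1)
  have Rm: "R j \<in> finite_minorants euclidean \<Lambda>" for j
    unfolding R_def
  proof (rule density_minorant[OF w])
    have "(\<integral>\<^sup>+x. ennreal (w j x) \<partial>\<Lambda>) \<le> (\<integral>\<^sup>+x. indicator (B j) x \<partial>\<Lambda>)" by (intro nn_integral_mono wle)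
    also have "\<dots> \<le> emeasure \<Lambda> (C j)" using Bb BC C(2) by (simp add: sets_\<Lambda> emeasure_mono)
    finally show "(\<integral>\<^sup>+x. ennreal (w j x) \<partial>\<Lambda>) < \<infinity>" using C(4)[of j] by (rule order.strict_trans1)
  qed
  have RK: "on_K (R j)" for j by (rule minorant_on_K[OF Rm])
  have small: "(\<integral>\<^sup>+x. sq_sum x \<partial>R (Suc j)) \<le> ennreal ((1/8) ^ Suc j)" for j
  proof -
    have "(\<integral>\<^sup>+x. sq_sum x \<partial>R (Suc j)) = (\<integral>\<^sup>+x. ennreal (w (Suc j) x) * sq_sum x \<partial>\<Lambda>)"
      unfolding R_def using \<Lambda>_measurable[OF w(1)] \<Lambda>_measurable[OF sq_sum_measurable] by (intro nn_integral_density) auto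
    also have "\<dots> \<le> (\<integral>\<^sup>+x. sq_sum x * indicator (- C j) x \<partial>\<Lambda>)"
    proof (rule nn_integral_mono)
      fix x
      \<comment> \<open>The shift of the index in \<open>small\<close> comes from this inclusion;
        the first piece is finite but not small.\<close>
      have "B (Suc j) \<subseteq> - C j" unfolding B_def disjointed_def by auto
      then have "indicator (B (Suc j)) x \<le> (indicator (- C j) x :: ennreal)" by (auto simp: indicator_def)
      then have "ennreal (w (Suc j) x) \<le> indicator (- C j) x" using wle order_trans by blast
      then show "ennreal (w (Suc j) x) * sq_sum x \<le> sq_sum x * indicator (- C j) x" by (simp add: mult.commute mult_left_mono)
    qed
    finally show ?thesis using C(5)[of j] by (rule order_trans)
  qed
  obtain \<kappa> :: "(nat \<Rightarrow> real) measure" where \<kappa>: "prob_space \<kappa>" "sets \<kappa> = sets borel"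
    "\<And>c. (\<lambda>n. \<Prod>j<n. fourier (centred_exp (R j)) (\<lambda>x. rcomb c (T x))) \<longlonglongrightarrow> fourier \<kappa> (rcomb c)"
    by (rule product_limit[OF RK small]) blast
  show thesis
  proof (rule that[OF \<kappa>(1,2)])
    fix c
    let ?b = "\<lambda>x. rcomb c (T x)"
    define s where "s n x = (\<Sum>j<n. w j x)" for n :: nat and x
    have s_eq: "s n x = d x * indicator (\<Union>j<n. B j) x" for n x
    proof -
      have "(\<Sum>j<n. indicator (B j) x) = (indicator (\<Union>j<n. B j) x :: real)"
        using Bdisj by (intro indicator_UN_disjoint[symmetric]) (auto intro: disjoint_family_on_mono)
      then show ?thesis by (simp add: s_def w_def sum_distrib_left[symmetric])
    qed
    have "(\<Prod>j<n. fourier (centred_exp (R j)) ?b) = exp (\<integral>x. s n x *\<^sub>R levy_kernel (?b x) \<partial>\<Lambda>)" for n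
    proof -
      have "(\<integral>x. s n x *\<^sub>R levy_kernel (?b x) \<partial>\<Lambda>) = (\<Sum>j<n. \<integral>x. w j x *\<^sub>R levy_kernel (?b x) \<partial>\<Lambda>)"
        unfolding s_def scaleR_sum_left using w
        by (intro Bochner_Integration.integral_sum weighted_levy_integrable rcomb_T_dual) auto
      moreover have "fourier (centred_exp (R j)) ?b = exp (\<integral>x. w j x *\<^sub>R levy_kernel (?b x) \<partial>\<Lambda>)" for j
        unfolding fourier_centred_exp[OF RK rcomb_T_dual] unfolding R_def density_levy_integral[OF w(1,2) rcomb_T_dual] ..
      ultimately show ?thesis by (simp add: exp_sum)
    qed
    moreover have "(\<lambda>n. exp (\<integral>x. s n x *\<^sub>R levy_kernel (?b x) \<partial>\<Lambda>)) \<longlonglongrightarrow> exp (\<integral>x. d x *\<^sub>R levy_kernel (?b x) \<partial>\<Lambda>)"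
    proof (intro tendsto_exp weighted_levy_tendsto rcomb_T_dual d)
      show "s n \<in> borel_measurable borel" for n unfolding s_def[abs_def] using w by (intro borel_measurable_sum) auto
      show "\<bar>s n x\<bar> \<le> 1" for n x unfolding s_eq using d(2)[of x] d(3)[of x] by (auto simp: indicator_def)
      show "AE x in \<Lambda>. (\<lambda>n. s n x) \<longlonglongrightarrow> d x" using \<Lambda>_AE
      proof eventually_elim
        case (elim x)
        then obtain j where j: "x \<in> B j" using BU by blast
        have "s n x = d x" if "n \<ge> Suc j" for n using that j unfolding s_eq by (auto simp: indicator_def)
        then show ?case by (intro tendsto_eventually eventually_sequentiallyI[of "Suc j"])
      qed
    qed
    ultimately show "fourier \<kappa> (rcomb c) = exp (\<integral>x. d x *\<^sub>R levy_kernel (?b x) \<partial>\<Lambda>)"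
      using LIMSEQ_unique[OF \<kappa>(3)] by simp
  qed
qed

section \<open>Tightness on multiples of the disk\<close>

lemma T_image_compact: "compact S \<Longrightarrow> compact (T ` S)"
  by (rule compact_continuous_image[OF continuous_on_subset[OF T_cont]]) auto

lemma T_image_borel: "compact S \<Longrightarrow> T ` S \<in> sets borel"
  by (rule borel_closed[OF compact_imp_closed[OF T_image_compact]])

lemma T_add: "T (x + y) = (\<lambda>k. T x k + T y k)"
  unfolding T_def using linear_add[OF dual_space_linear[OF a_dual]] by blast

lemma T_diff: "T (x - y) = (\<lambda>k. T x k - T y k)"
  unfolding T_def using linear_diff[OF dual_space_linear[OF a_dual]] by blast

lemma T_mem: "T x \<in> T ` S \<longleftrightarrow> x \<in> S"
  using T_inj by (auto dest: injD)

lemma scaled_mono: "0 \<le> r \<Longrightarrow> r \<le> s \<Longrightarrow> (*\<^sub>R) r ` K \<subseteq> (*\<^sub>R) s ` K"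
  using absolutely_convex_scale_le[OF K(1)] by blast

lemma D_union: "disk_span K = (\<Union>n. (*\<^sub>R) (real n) ` K)"
  by (simp add: disk_span_def)

lemma TD_borel: "T ` disk_span K \<in> sets borel"
  unfolding D_union image_UN by (intro sets.countable_UN) (auto intro: T_image_borel compact_scaled)

text \<open>In contrast to the assertion with freely chosen shifts (\<open>A6\<close>), the shifts
  are prescribed by the barycentres; \<open>disk_tight_iff\<close> closes the gap.\<close>

definition disk_tight :: bool where
  "disk_tight \<longleftrightarrow> (\<forall>\<epsilon>>0. \<exists>n::nat. \<forall>M\<in>finite_minorants euclidean \<Lambda>. measure (centred_exp M) ((*\<^sub>R) (real n) ` K) > 1 - \<epsilon>)"

text \<open>For a finite minorant \<open>M\<close>, the complementary factor need only live on the
  sequence space.\<close>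

lemma centred_exp_factor:
  assumes M: "M \<in> finite_minorants euclidean \<Lambda>"
    and \<sigma>: "prob_space \<sigma>" "sets \<sigma> = sets (borel :: (nat \<Rightarrow> real) measure)"
    and \<theta>: "prob_space \<theta>" "sets \<theta> = sets (borel :: (nat \<Rightarrow> real) measure)"
    and FT: "\<And>c. fourier \<sigma> (rcomb c) = exp (\<integral>x. levy_kernel (rcomb c (T x)) \<partial>\<Lambda>) * fourier \<theta> (rcomb c)"
  obtains \<tau> where "prob_space \<tau>" "sets \<tau> = sets (borel :: (nat \<Rightarrow> real) measure)" "add_law (centred_exp M) \<tau> T = \<sigma>"
proof -
  obtain d where d: "d \<in> borel_measurable borel" "\<And>x. 0 \<le> d x" "\<And>x. d x \<le> (1::real)" "M = density \<Lambda> (\<lambda>x. ennreal (d x))"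
    by (rule minorant_density[OF M]) blast
  have MK: "on_K M" by (rule minorant_on_K[OF M])
  have "(\<lambda>x. 1 - d x) \<in> borel_measurable borel" "\<And>x. 0 \<le> 1 - d x" "\<And>x. 1 - d x \<le> 1" using d by auto
  then obtain \<kappa> :: "(nat \<Rightarrow> real) measure" where \<kappa>: "prob_space \<kappa>" "sets \<kappa> = sets borel"
    "\<And>c. fourier \<kappa> (rcomb c) = exp (\<integral>x. (1 - d x) *\<^sub>R levy_kernel (rcomb c (T x)) \<partial>\<Lambda>)"
    by (rule limit_law) blast
  have id: "(\<lambda>v::nat \<Rightarrow> real. v) \<in> \<kappa> \<rightarrow>\<^sub>M borel" using \<kappa>(2) by (simp add: measurable_ident_sets)
  \<comment> \<open>\<open>\<kappa>\<close> belongs to the part of \<open>\<Lambda>\<close> with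
    density \<open>1 - d\<close> that \<open>M\<close> leaves over; \<open>\<theta>\<close> is the
    factor that \<open>\<sigma>\<close> has in addition.\<close>
  define \<tau> where "\<tau> = add_law \<kappa> \<theta> (\<lambda>v. v)"
  have \<tau>: "prob_space \<tau>" "sets \<tau> = sets borel" unfolding \<tau>_def by (rule add_law_prob[OF \<kappa>(1) \<theta>(1) id \<theta>(2)])+
  have TM: "T \<in> centred_exp M \<rightarrow>\<^sub>M borel" using T_measurable measurable_cong_sets[OF centred_exp_sets[OF MK] refl] by blast
  have eM: "prob_space (centred_exp M)" by (rule centred_exp_prob_space[OF MK])
  have "add_law (centred_exp M) \<tau> T = \<sigma>"
  proof (rule fourier_inject)
    show "sets (add_law (centred_exp M) \<tau> T) = sets borel" "finite_measure (add_law (centred_exp M) \<tau> T)"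
      using add_law_prob[OF eM \<tau>(1) TM \<tau>(2)] by (auto intro: prob_space.finite_measure)
    show "finite_measure \<sigma>" by (rule prob_space.finite_measure[OF \<sigma>(1)])
    fix c
    let ?l = "\<lambda>x. levy_kernel (rcomb c (T x))"
    have "fourier (add_law (centred_exp M) \<tau> T) (rcomb c)
      = exp (\<integral>x. d x *\<^sub>R ?l x \<partial>\<Lambda>) * (exp (\<integral>x. (1 - d x) *\<^sub>R ?l x \<partial>\<Lambda>) * fourier \<theta> (rcomb c))"
      unfolding fourier_add_law[OF eM \<tau>(1) TM \<tau>(2)] unfolding \<tau>_def fourier_add_law[OF \<kappa>(1) \<theta>(1) id \<theta>(2)]
        \<kappa>(3) fourier_centred_exp[OF MK rcomb_T_dual] unfolding d(4) density_levy_integral[OF d(1,2) rcomb_T_dual] ..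
    also have "\<dots> = exp ((\<integral>x. d x *\<^sub>R ?l x \<partial>\<Lambda>) + (\<integral>x. (1 - d x) *\<^sub>R ?l x \<partial>\<Lambda>)) * fourier \<theta> (rcomb c)"
      by (simp add: exp_add)
    also have "(\<integral>x. d x *\<^sub>R ?l x \<partial>\<Lambda>) + (\<integral>x. (1 - d x) *\<^sub>R ?l x \<partial>\<Lambda>) = (\<integral>x. d x *\<^sub>R ?l x + (1 - d x) *\<^sub>R ?l x \<partial>\<Lambda>)"
      using d by (intro Bochner_Integration.integral_add[symmetric] weighted_levy_integrable rcomb_T_dual) auto
    also have "\<dots> = (\<integral>x. ?l x \<partial>\<Lambda>)" by (simp add: scaleR_add_left[symmetric])
    finally show "fourier (add_law (centred_exp M) \<tau> T) (rcomb c) = fourier \<sigma> (rcomb c)" unfolding FT .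
  qed (rule \<sigma>(2))
  with \<tau> show thesis by (rule that)
qed

text \<open>Averaging over the complementary factor yields a good shift \<open>v\<close>, a mere
  sequence. Since the shifted set is nonempty, \<open>v\<close> is a difference
  \<open>T k0 - T x0\<close>, hence comes from a vector of \<open>E\<close>, and the bound on shifts
  trades it for the factor 65.\<close>

lemma disk_mass_from_limit:
  assumes M: "M \<in> finite_minorants euclidean \<Lambda>"
    and \<sigma>: "prob_space \<sigma>" "sets \<sigma> = sets (borel :: (nat \<Rightarrow> real) measure)"
    and \<theta>: "prob_space \<theta>" "sets \<theta> = sets (borel :: (nat \<Rightarrow> real) measure)"
    and FT: "\<And>c. fourier \<sigma> (rcomb c) = exp (\<integral>x. levy_kernel (rcomb c (T x)) \<partial>\<Lambda>) * fourier \<theta> (rcomb c)"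
    and n: "n \<ge> 1" and m: "measure \<sigma> (T ` (*\<^sub>R) (real n) ` K) \<ge> 15/16"
  shows "measure (centred_exp M) ((*\<^sub>R) (65 * real n) ` K) \<ge> measure \<sigma> (T ` (*\<^sub>R) (real n) ` K)"
proof -
  let ?B = "T ` (*\<^sub>R) (real n) ` K"
  have MK: "on_K M" by (rule minorant_on_K[OF M])
  have TM: "T \<in> centred_exp M \<rightarrow>\<^sub>M borel" using T_measurable measurable_cong_sets[OF centred_exp_sets[OF MK] refl] by blast
  have eM: "prob_space (centred_exp M)" by (rule centred_exp_prob_space[OF MK])
  obtain \<tau> where \<tau>: "prob_space \<tau>" "sets \<tau> = sets (borel :: (nat \<Rightarrow> real) measure)" and eq: "add_law (centred_exp M) \<tau> T = \<sigma>"
    by (rule centred_exp_factor[OF M \<sigma> \<theta> FT])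
  have "\<exists>v. measure (centred_exp M) {x \<in> space (centred_exp M). (\<lambda>k. T x k + v k) \<in> ?B} \<ge> measure \<sigma> ?B"
    using add_law_pick[OF eM \<tau>(1) TM \<tau>(2) T_image_borel[OF compact_scaled]] unfolding eq .
  then obtain v where v: "measure (centred_exp M) {x \<in> space (centred_exp M). (\<lambda>k. T x k + v k) \<in> ?B} \<ge> measure \<sigma> ?B" by blast
  then have v': "measure (centred_exp M) {x. (\<lambda>k. T x k + v k) \<in> ?B} \<ge> measure \<sigma> ?B" by (simp add: centred_exp_space[OF MK])
  have "{x. (\<lambda>k. T x k + v k) \<in> ?B} \<noteq> {}"
  proof
    assume "{x. (\<lambda>k. T x k + v k) \<in> ?B} = {}"
    then show False using v' m by simp
  qed
  then obtain x0 k0 where x0: "(\<lambda>k. T x0 k + v k) = T k0" by auto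
  define y where "y = k0 - x0"
  have vy: "v = T y"
  proof
    fix k
    have "T x0 k + v k = T k0 k" using fun_cong[OF x0, of k] .
    then show "v k = T y k" unfolding y_def T_diff by simp
  qed
  have "{x. (\<lambda>k. T x k + v k) \<in> ?B} = {x. x + y \<in> (*\<^sub>R) (real n) ` K}"
    unfolding vy T_add[symmetric] T_mem ..
  then show ?thesis using v' m n by (intro centred_exp_disk_mass[OF MK]) auto
qed

lemma measure_limit_disk:
  assumes "prob_space \<sigma>" "sets \<sigma> = sets (borel :: (nat \<Rightarrow> real) measure)" "measure \<sigma> (T ` disk_span K) = 1" "e > 0"
  shows "\<exists>n::nat. n \<ge> 1 \<and> measure \<sigma> (T ` (*\<^sub>R) (real n) ` K) > 1 - e"
proof -
  interpret prob_space \<sigma> by fact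
  have "(\<lambda>n. measure \<sigma> (T ` (*\<^sub>R) (real n) ` K)) \<longlonglongrightarrow> measure \<sigma> (\<Union>n. T ` (*\<^sub>R) (real n) ` K)"
  proof (rule finite_Lim_measure_incseq)
    show "range (\<lambda>n. T ` (*\<^sub>R) (real n) ` K) \<subseteq> sets \<sigma>" using T_image_borel[OF compact_scaled] assms(2) by auto
    show "incseq (\<lambda>n. T ` (*\<^sub>R) (real n) ` K)" unfolding incseq_def by (intro allI impI image_mono scaled_mono) auto
  qed
  moreover have "(\<Union>n. T ` (*\<^sub>R) (real n) ` K) = T ` disk_span K" by (auto simp: D_union)
  ultimately have "(\<lambda>n. measure \<sigma> (T ` (*\<^sub>R) (real n) ` K)) \<longlonglongrightarrow> 1" using assms(3) by simp
  from order_tendstoD(1)[OF this, of "1 - e"] assms(4)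
  have "eventually (\<lambda>n. 1 - e < measure \<sigma> (T ` (*\<^sub>R) (real n) ` K)) sequentially" by simp
  then obtain N where "\<And>n. n \<ge> N \<Longrightarrow> 1 - e < measure \<sigma> (T ` (*\<^sub>R) (real n) ` K)" unfolding eventually_sequentially by blast
  then show ?thesis by (intro exI[of _ "max 1 N"]) simp
qed

text \<open>Concentration of a single law on the image of \<open>disk_span K\<close> bounds all
  minorants at once. The factor \<open>\<theta>\<close> is a point mass when \<open>\<sigma>\<close>
  belongs to a translated law, and the law of the jumps in \<open>disk_span K - K\<close> for the
  assertion on Fourier transforms (\<open>A3\<close>). The cap \<open>1 / 16\<close> on
  \<open>e'\<close> is there because the shift bound asks for mass \<open>15 / 16\<close>.\<close>

lemma disk_tightI:
  assumes \<sigma>: "prob_space \<sigma>" "sets \<sigma> = sets (borel :: (nat \<Rightarrow> real) measure)"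
    and \<theta>: "prob_space \<theta>" "sets \<theta> = sets (borel :: (nat \<Rightarrow> real) measure)"
    and FT: "\<And>c. fourier \<sigma> (rcomb c) = exp (\<integral>x. levy_kernel (rcomb c (T x)) \<partial>\<Lambda>) * fourier \<theta> (rcomb c)"
    and D: "measure \<sigma> (T ` disk_span K) = 1"
  shows disk_tight
  unfolding disk_tight_def
proof (intro allI impI)
  fix e :: real assume e: "e > 0"
  define e' where "e' = min e (1/16)"
  have e': "e' > 0" "e' \<le> e" "e' \<le> 1/16" using e by (auto simp: e'_def)
  obtain n :: nat where n: "n \<ge> 1" "measure \<sigma> (T ` (*\<^sub>R) (real n) ` K) > 1 - e'"
    using measure_limit_disk[OF \<sigma> D e'(1)] by blast
  have "measure (centred_exp M) ((*\<^sub>R) (real (65 * n)) ` K) > 1 - e" if M: "M \<in> finite_minorants euclidean \<Lambda>" for M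
    using disk_mass_from_limit[OF M \<sigma> \<theta> FT n(1)] n(2) e' by simp
  then show "\<exists>n::nat. \<forall>M\<in>finite_minorants euclidean \<Lambda>. measure (centred_exp M) ((*\<^sub>R) (real n) ` K) > 1 - e" by blast
qed

lemma measure_translate_E:
  assumes P: "P \<in> prob_borel_measures euclidean" and A: "A \<in> sets borel"
  shows "measure (translate_meas euclidean P (x :: 'a)) A = measure P {y. y + x \<in> A}"
  using measure_translate_meas[OF additive_space_E prob_borel_imp_finite[OF P], of x A] A by simp

lemma translate_centred_exp:
  assumes M: "on_K M" and A: "A \<in> sets borel"
  shows "measure (translate_meas euclidean (poisson_exp euclidean M) x) A = measure (centred_exp M) {y. y + (x + barycentre M) \<in> A}"
proof -
  have "{y. y + (x + barycentre M) \<in> A} \<in> sets borel"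
  proof -
    have "(\<lambda>y. (y, x + barycentre M)) \<in> borel \<rightarrow>\<^sub>M borel \<Otimes>\<^sub>M borel" by measurable
    from measurable_sets[OF measurable_compose[OF this add_meas] A] show ?thesis by (simp add: vimage_def)
  qed
  then show ?thesis
    unfolding centred_exp_def by (simp add: measure_translate_E[OF poisson_prob[OF M]] A add.assoc)
qed

text \<open>Relative to the centred law the shift is \<open>x \<rho> + barycentre \<rho>\<close>. By
  \<open>centred_exp_disk_mass\<close> any shift can be removed at the price of a larger multiple of
  \<open>K\<close>, provided the mass is at least \<open>15 / 16\<close>; hence the cap on
  \<open>e'\<close>.\<close>

lemma disk_tight_iff:
  "disk_tight \<longleftrightarrow> (\<exists>x. \<forall>\<epsilon>>0. \<exists>n::nat. \<forall>\<rho>\<in>finite_minorants euclidean \<Lambda>.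
     measure (translate_meas euclidean (poisson_exp euclidean \<rho>) (x \<rho>)) ((*\<^sub>R) (real n) ` K) > 1 - \<epsilon>)"
proof
  assume disk_tight
  then show "\<exists>x. \<forall>\<epsilon>>0. \<exists>n::nat. \<forall>\<rho>\<in>finite_minorants euclidean \<Lambda>.
     measure (translate_meas euclidean (poisson_exp euclidean \<rho>) (x \<rho>)) ((*\<^sub>R) (real n) ` K) > 1 - \<epsilon>"
    unfolding disk_tight_def centred_exp_def by (intro exI[of _ "\<lambda>M. - barycentre M"])
next
  assume "\<exists>x. \<forall>\<epsilon>>0. \<exists>n::nat. \<forall>\<rho>\<in>finite_minorants euclidean \<Lambda>.
     measure (translate_meas euclidean (poisson_exp euclidean \<rho>) (x \<rho>)) ((*\<^sub>R) (real n) ` K) > 1 - \<epsilon>"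
  then obtain x where x: "\<And>\<epsilon>. \<epsilon> > 0 \<Longrightarrow> \<exists>n::nat. \<forall>\<rho>\<in>finite_minorants euclidean \<Lambda>.
     measure (translate_meas euclidean (poisson_exp euclidean \<rho>) (x \<rho>)) ((*\<^sub>R) (real n) ` K) > 1 - \<epsilon>" by blast
  show disk_tight
    unfolding disk_tight_def
  proof (intro allI impI)
    fix e :: real assume e: "e > 0"
    define e' where "e' = min e (1/16)"
    have e': "e' > 0" "e' \<le> e" "e' \<le> 1/16" using e by (auto simp: e'_def)
    obtain n :: nat where n: "\<And>M. M \<in> finite_minorants euclidean \<Lambda> \<Longrightarrow>
        measure (translate_meas euclidean (poisson_exp euclidean M) (x M)) ((*\<^sub>R) (real n) ` K) > 1 - e'"
      using x[OF e'(1)] by blast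
    define m where "m = max 1 n"
    have "measure (centred_exp M) ((*\<^sub>R) (real (65 * m)) ` K) > 1 - e" if M: "M \<in> finite_minorants euclidean \<Lambda>" for M
    proof -
      have MK: "on_K M" by (rule minorant_on_K[OF M])
      let ?Q = "translate_meas euclidean (poisson_exp euclidean M) (x M)"
      have Q: "?Q \<in> prob_borel_measures euclidean" by (rule translate_prob[OF poisson_prob[OF MK]])
      then interpret Q: prob_space ?Q by (simp add: prob_borel_measures_iff)
      have sQ: "sets ?Q = sets borel" using Q by (simp add: prob_borel_measures_iff)
      have "measure ?Q ((*\<^sub>R) (real n) ` K) \<le> measure ?Q ((*\<^sub>R) (real m) ` K)"
        using scaled_mono[of "real n" "real m"] by (intro Q.finite_measure_mono) (auto simp: m_def sQ)
      then have "measure ?Q ((*\<^sub>R) (real m) ` K) > 1 - e'" using n[OF M] by linarith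
      then have *: "measure (centred_exp M) {y. y + (x M + barycentre M) \<in> (*\<^sub>R) (real m) ` K} > 1 - e'"
        unfolding translate_centred_exp[OF MK scaled_borel] .
      have "measure (centred_exp M) ((*\<^sub>R) (65 * real m) ` K) \<ge> measure (centred_exp M) {y. y + (x M + barycentre M) \<in> (*\<^sub>R) (real m) ` K}"
        using * e' by (intro centred_exp_disk_mass[OF MK _ order_refl]) (auto simp: m_def)
      then show ?thesis using * e' by simp
    qed
    then show "\<exists>n::nat. \<forall>M\<in>finite_minorants euclidean \<Lambda>. measure (centred_exp M) ((*\<^sub>R) (real n) ` K) > 1 - e" by blast
  qed
qed

end

section \<open>Sequences of minorants and their weak limits\<close>

lemma topology_generated_eventually:
  assumes "openin (topology_generated_by S) U" "x \<in> U"
    and "\<And>V. V \<in> S \<Longrightarrow> x \<in> V \<Longrightarrow> eventually (\<lambda>n. X n \<in> V) F"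
  shows "eventually (\<lambda>n. X n \<in> U) F"
proof -
  have "generate_topology_on S U" using assms(1) by (simp add: openin_topology_generated_by_iff)
  then show ?thesis using assms(2)
  proof induction
    case (UN k)
    then obtain V where V: "V \<in> k" "x \<in> V" by blast
    have "eventually (\<lambda>n. X n \<in> V) F" by (rule UN.IH[OF V])
    then show ?case by (rule eventually_mono) (use V in blast)
  qed (use assms(3) in \<open>auto intro: eventually_conj\<close>)
qed

text \<open>Subbasic neighbourhoods suffice, and each of them involves a single bounded continuous
  function.\<close>

lemma weak_topology_eventually:
  assumes U: "openin (weak_topology T) U" "\<rho> \<in> U"
    and X: "\<And>n. X n \<in> finite_borel_measures T"
    and lim: "\<And>f. continuous_map T euclideanreal f \<Longrightarrow> bounded (f ` topspace T) \<Longrightarrow>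
       ((\<lambda>n. \<integral>x. f x \<partial>X n) \<longlongrightarrow> (\<integral>x. f x \<partial>\<rho>)) F"
  shows "eventually (\<lambda>n. X n \<in> U) F"
proof (rule topology_generated_eventually[OF U[unfolded weak_topology_def]])
  fix V assume V: "V \<in> {{M \<in> finite_borel_measures T. (\<integral>x. f x \<partial>M) \<in> U} | f U.
        continuous_map T euclideanreal f \<and> bounded (f ` topspace T) \<and> open U}" "\<rho> \<in> V"
  then obtain f W where f: "continuous_map T euclideanreal f" "bounded (f ` topspace T)" "open W"
    "V = {M \<in> finite_borel_measures T. (\<integral>x. f x \<partial>M) \<in> W}" by blast
  have "eventually (\<lambda>n. (\<integral>x. f x \<partial>X n) \<in> W) F"
    using V(2) f by (intro topological_tendstoD[OF lim[OF f(1,2)] f(3)]) auto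
  then show "eventually (\<lambda>n. X n \<in> V) F" by eventually_elim (use X f(4) in auto)
qed

lemma weak_topology_openin_basic:
  assumes "continuous_map T euclideanreal f" "bounded (f ` topspace T)" "open U"
  shows "openin (weak_topology T) {M \<in> finite_borel_measures T. (\<integral>x. f x \<partial>M) \<in> U}"
  unfolding weak_topology_def by (rule topology_generated_by_Basis) (use assms in blast)

context disk_levy begin

definition cut :: "'a set \<Rightarrow> 'a measure" where "cut S = density \<Lambda> (\<lambda>x. ennreal (indicator S x))"

lemma cut_minorant:
  assumes "S \<in> sets borel" "emeasure \<Lambda> S < \<infinity>" shows "cut S \<in> finite_minorants euclidean \<Lambda>"
  unfolding cut_def
proof (rule density_minorant)
  show "(\<integral>\<^sup>+x. ennreal (indicator S x) \<partial>\<Lambda>) < \<infinity>"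
    using assms by (simp add: ennreal_indicator sets_\<Lambda>)
qed (use assms in \<open>auto simp: indicator_def\<close>)

lemma cut_emeasure: "S \<in> sets borel \<Longrightarrow> A \<in> sets borel \<Longrightarrow> emeasure (cut S) A = emeasure \<Lambda> (S \<inter> A)"
  unfolding cut_def ennreal_indicator using \<Lambda>_measurable[OF borel_measurable_indicator, of S]
  by (subst emeasure_density) (auto simp: sets_\<Lambda> simp flip: indicator_inter_arith)

lemma cut_nn_integral:
  assumes "S \<in> sets borel" "f \<in> borel_measurable borel"
  shows "(\<integral>\<^sup>+x. f x \<partial>cut S) = (\<integral>\<^sup>+x. f x * indicator S x \<partial>\<Lambda>)"
  unfolding cut_def ennreal_indicator using assms \<Lambda>_measurable[OF assms(2)] \<Lambda>_measurable[OF borel_measurable_indicator[OF assms(1)]]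
  by (subst nn_integral_density) (auto simp: sets_\<Lambda> mult.commute)

text \<open>A sequence standing in for the net of all finite minorants. It is used in three ways:
  through the integrals of \<open>sq_sum\<close>, which identify limits; through Fourier transforms
  at every dual functional; and setwise, as the directed family in the definition of a Levy
  measure.\<close>

lemma exhausting_minorants:
  obtains C where "incseq C" "\<And>n. C n \<in> sets borel" "\<And>n. cut (C n) \<in> finite_minorants euclidean \<Lambda>"
    "(\<lambda>n. \<integral>\<^sup>+x. sq_sum x \<partial>cut (C n)) \<longlonglongrightarrow> (\<integral>\<^sup>+x. sq_sum x \<partial>\<Lambda>)"
    "\<And>b. b \<in> dual_space \<Longrightarrow> (\<lambda>n. fourier (centred_exp (cut (C n))) b) \<longlonglongrightarrow> exp (\<integral>x. levy_kernel (b x) \<partial>\<Lambda>)"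
    "\<And>A. A \<in> sets borel \<Longrightarrow> emeasure \<Lambda> A = (SUP n. emeasure (cut (C n)) A)"
    "\<And>m n. m \<le> n \<Longrightarrow> cut (C m) \<le> cut (C n)"
proof -
  obtain C where C: "incseq C" "\<And>n. C n \<in> sets borel" "\<And>n. C n \<subseteq> K" "\<And>n. emeasure \<Lambda> (C n) < \<infinity>"
    "\<And>n. (\<integral>\<^sup>+x. sq_sum x * indicator (- C n) x \<partial>\<Lambda>) \<le> ennreal ((1/8) ^ Suc n)" "(\<Union>n. C n) = K - {0}"
    by (rule exhaustion) blast
  have Im: "cut (C n) \<in> finite_minorants euclidean \<Lambda>" for n by (rule cut_minorant[OF C(2,4)])
  have ind: "(\<lambda>n. indicator (C n) x) \<longlonglongrightarrow> (indicator (K - {0}) x :: real)" for x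
    using LIMSEQ_indicator_incseq[OF C(1)] unfolding C(6) .
  have AEK: "AE x in \<Lambda>. indicator (K - {0}) x = (1 :: real)" using \<Lambda>_AE by eventually_elim simp
  show thesis
  proof (rule that[OF C(1) C(2) Im])
    show "(\<lambda>n. \<integral>\<^sup>+x. sq_sum x \<partial>cut (C n)) \<longlonglongrightarrow> (\<integral>\<^sup>+x. sq_sum x \<partial>\<Lambda>)"
    proof -
      have "(\<lambda>n. \<integral>\<^sup>+x. sq_sum x * indicator (C n) x \<partial>\<Lambda>) \<longlonglongrightarrow> (\<integral>\<^sup>+x. sq_sum x * indicator (K - {0}) x \<partial>\<Lambda>)"
      proof -
        have "emeasure (density \<Lambda> sq_sum) (C n) = (\<integral>\<^sup>+x. sq_sum x * indicator (C n) x \<partial>\<Lambda>)" for n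
          using C(2) \<Lambda>_measurable[OF sq_sum_measurable] by (intro emeasure_density) (auto simp: sets_\<Lambda>)
        moreover have "emeasure (density \<Lambda> sq_sum) (\<Union>n. C n) = (\<integral>\<^sup>+x. sq_sum x * indicator (\<Union>n. C n) x \<partial>\<Lambda>)"
          using C(2) \<Lambda>_measurable[OF sq_sum_measurable] by (intro emeasure_density) (auto simp: sets_\<Lambda>)
        moreover have "(\<lambda>n. emeasure (density \<Lambda> sq_sum) (C n)) \<longlonglongrightarrow> emeasure (density \<Lambda> sq_sum) (\<Union>n. C n)"
          using C(1,2) by (intro Lim_emeasure_incseq) (auto simp: sets_\<Lambda>)
        ultimately show ?thesis unfolding C(6) by simp
      qed
      moreover have "(\<integral>\<^sup>+x. sq_sum x * indicator (K - {0}) x \<partial>\<Lambda>) = (\<integral>\<^sup>+x. sq_sum x \<partial>\<Lambda>)"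
      proof (rule nn_integral_cong_AE)
        show "AE x in \<Lambda>. sq_sum x * indicator (K - {0}) x = sq_sum x" using \<Lambda>_AE by eventually_elim simp
      qed
      ultimately show ?thesis by (simp add: cut_nn_integral[OF C(2) sq_sum_measurable])
    qed
    show "(\<lambda>n. fourier (centred_exp (cut (C n))) b) \<longlonglongrightarrow> exp (\<integral>x. levy_kernel (b x) \<partial>\<Lambda>)" if b: "b \<in> dual_space" for b
    proof -
      have "(\<lambda>n. \<integral>x. indicator (C n) x *\<^sub>R levy_kernel (b x) \<partial>\<Lambda>) \<longlonglongrightarrow> (\<integral>x. 1 *\<^sub>R levy_kernel (b x) \<partial>\<Lambda>)"
      proof (rule weighted_levy_tendsto[OF _ _ _ _ b])
        show "AE x in \<Lambda>. (\<lambda>n. indicator (C n) x) \<longlonglongrightarrow> (1::real)"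
          using AEK by eventually_elim (use ind in metis)
      qed (use C(2) in \<open>auto simp: indicator_def\<close>)
      moreover have "fourier (centred_exp (cut (C n))) b = exp (\<integral>x. indicator (C n) x *\<^sub>R levy_kernel (b x) \<partial>\<Lambda>)" for n
        unfolding fourier_centred_exp[OF minorant_on_K[OF Im] b] unfolding cut_def
        using C(2) by (subst density_levy_integral[OF _ _ b]) auto
      ultimately show ?thesis by (simp add: tendsto_exp)
    qed
    show "emeasure \<Lambda> A = (SUP n. emeasure (cut (C n)) A)" if A: "A \<in> sets borel" for A
    proof -
      have "(SUP n. emeasure (cut (C n)) A) = (SUP n. emeasure \<Lambda> (C n \<inter> A))"
        by (simp add: cut_emeasure[OF C(2) A])
      also have "\<dots> = emeasure \<Lambda> (\<Union>n. C n \<inter> A)"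
        using C(1,2) A by (intro SUP_emeasure_incseq) (auto simp: sets_\<Lambda> incseq_def)
      also have "(\<Union>n. C n \<inter> A) = (K - {0}) \<inter> A" using C(6) by blast
      also have "emeasure \<Lambda> \<dots> = emeasure \<Lambda> A"
      proof (rule emeasure_eq_AE)
        show "AE x in \<Lambda>. x \<in> (K - {0}) \<inter> A \<longleftrightarrow> x \<in> A" using \<Lambda>_AE by eventually_elim simp
      qed (use A in \<open>auto simp: sets_\<Lambda>\<close>)
      finally show ?thesis by simp
    qed
    show "cut (C m) \<le> cut (C n)" if "m \<le> n" for m n
    proof -
      have s: "sets (cut (C m)) = sets (cut (C n))" by (simp add: cut_def)
      have "emeasure \<Lambda> (C m \<inter> A) \<le> emeasure \<Lambda> (C n \<inter> A)" if "A \<in> sets borel" for A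
        using C(1,2) \<open>m \<le> n\<close> that by (intro emeasure_mono) (auto simp: incseq_def sets_\<Lambda>)
      then show ?thesis unfolding measure_le_iff[OF s] by (auto simp: cut_emeasure[OF C(2)] cut_def sets_\<Lambda>)
        (metis cut_def cut_emeasure[OF C(2)])
    qed
  qed
qed

text \<open>If \<open>N n\<close> has density \<open>d n\<close>, the exponents differ by the
  integral of \<open>(1 - d n) * levy_kernel\<close>, which is at most a constant times the
  \<open>sq_sum\<close>-mass that \<open>N n\<close> misses. One scalar limit thus governs all
  characters, for sequences that may be neither monotone nor cut-offs.\<close>

lemma fourier_centred_exp_tendsto:
  assumes N: "\<And>n::nat. N n \<in> finite_minorants euclidean \<Lambda>"
    and lim: "(\<lambda>n. \<integral>\<^sup>+x. sq_sum x \<partial>N n) \<longlonglongrightarrow> (\<integral>\<^sup>+x. sq_sum x \<partial>\<Lambda>)"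
  shows "(\<lambda>n. fourier (centred_exp (N n)) (\<lambda>x. rcomb c (T x))) \<longlonglongrightarrow> exp (\<integral>x. levy_kernel (rcomb c (T x)) \<partial>\<Lambda>)"
proof -
  let ?b = "\<lambda>x. rcomb c (T x)"
  have hsi: "(\<integral>\<^sup>+x. sq_sum x \<partial>\<Lambda>) \<noteq> \<top>" using sq_sum_int unfolding sq_sum_def by simp
  have hsm[measurable]: "sq_sum \<in> borel_measurable \<Lambda>" by (rule \<Lambda>_measurable[OF sq_sum_measurable])
  obtain Q where Q: "Q \<ge> 0" "\<And>x. ennreal ((rcomb c (T x))\<^sup>2) \<le> ennreal Q * sq_sum x" using rcomb_T_sq[of c] by blast
  have "\<exists>d. d \<in> borel_measurable borel \<and> (\<forall>x. 0 \<le> d x \<and> d x \<le> (1::real)) \<and> N n = density \<Lambda> (\<lambda>x. ennreal (d x))" for n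
    by (rule minorant_density[OF N[of n]]) blast
  then obtain d where d: "\<And>n. d n \<in> borel_measurable borel" "\<And>n x. 0 \<le> d n x" "\<And>n x. d n x \<le> (1::real)"
    "\<And>n. N n = density \<Lambda> (\<lambda>x. ennreal (d n x))" by metis
  have dm[measurable]: "d n \<in> borel_measurable \<Lambda>" for n by (rule \<Lambda>_measurable[OF d(1)])
  have bm[measurable]: "?b \<in> borel_measurable \<Lambda>" by (rule \<Lambda>_measurable[OF rcomb_T_measurable])
  define \<delta> where "\<delta> n = (\<integral>\<^sup>+x. ennreal (1 - d n x) * sq_sum x \<partial>\<Lambda>)" for n
  have split: "\<delta> n + (\<integral>\<^sup>+x. sq_sum x \<partial>N n) = (\<integral>\<^sup>+x. sq_sum x \<partial>\<Lambda>)" for n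
  proof -
    have "(\<integral>\<^sup>+x. sq_sum x \<partial>N n) = (\<integral>\<^sup>+x. ennreal (d n x) * sq_sum x \<partial>\<Lambda>)"
      unfolding d(4) by (intro nn_integral_density) auto
    then have "\<delta> n + (\<integral>\<^sup>+x. sq_sum x \<partial>N n) = (\<integral>\<^sup>+x. ennreal (1 - d n x) * sq_sum x + ennreal (d n x) * sq_sum x \<partial>\<Lambda>)"
      unfolding \<delta>_def by (subst nn_integral_add) auto
    also have "\<dots> = (\<integral>\<^sup>+x. sq_sum x \<partial>\<Lambda>)"
    proof (rule nn_integral_cong)
      fix x
      have "ennreal (1 - d n x) + ennreal (d n x) = 1" using d(2,3)[of n x] by (subst ennreal_plus[symmetric]) auto
      then show "ennreal (1 - d n x) * sq_sum x + ennreal (d n x) * sq_sum x = sq_sum x" by (simp add: distrib_right[symmetric])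
    qed
    finally show ?thesis .
  qed
  have Nfin: "(\<integral>\<^sup>+x. sq_sum x \<partial>N n) \<noteq> \<top>" for n
  proof
    assume "(\<integral>\<^sup>+x. sq_sum x \<partial>N n) = \<top>"
    then show False using split[of n] hsi by simp
  qed
  have "\<delta> n = (\<integral>\<^sup>+x. sq_sum x \<partial>\<Lambda>) - (\<integral>\<^sup>+x. sq_sum x \<partial>N n)" for n
    unfolding split[of n, symmetric] using Nfin[of n] by (simp add: ennreal_add_diff_cancel_right)
  then have "\<delta> \<longlonglongrightarrow> (\<integral>\<^sup>+x. sq_sum x \<partial>\<Lambda>) - (\<integral>\<^sup>+x. sq_sum x \<partial>\<Lambda>)"
    using tendsto_diff_ennreal[OF tendsto_const lim hsi hsi] by presburger
  then have \<delta>0: "\<delta> \<longlonglongrightarrow> 0" using hsi by (simp add: ennreal_minus_cancel_iff)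
  have "(\<lambda>n. ennreal Q * \<delta> n) \<longlonglongrightarrow> ennreal Q * 0" by (rule ennreal_tendsto_cmult[OF _ \<delta>0]) simp
  then have Q\<delta>: "(\<lambda>n. ennreal Q * \<delta> n) \<longlonglongrightarrow> 0" by simp
  let ?I = "\<integral>x. levy_kernel (?b x) \<partial>\<Lambda>"
  let ?J = "\<lambda>n. \<integral>x. d n x *\<^sub>R levy_kernel (?b x) \<partial>\<Lambda>"
  have bound: "ennreal (norm (?I - ?J n)) \<le> ennreal Q * \<delta> n" for n
  proof -
    have i: "integrable \<Lambda> (\<lambda>x. d n x *\<^sub>R levy_kernel (?b x))"
      using d by (intro weighted_levy_integrable rcomb_T_dual) auto
    have "?I - ?J n = (\<integral>x. levy_kernel (?b x) - d n x *\<^sub>R levy_kernel (?b x) \<partial>\<Lambda>)"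
      by (rule Bochner_Integration.integral_diff[OF levy_integrable[OF rcomb_T_dual] i, symmetric])
    also have "ennreal (norm \<dots>) \<le> (\<integral>\<^sup>+x. ennreal (norm (levy_kernel (?b x) - d n x *\<^sub>R levy_kernel (?b x))) \<partial>\<Lambda>)"
      by (rule integral_norm_bound_ennreal[OF Bochner_Integration.integrable_diff[OF levy_integrable[OF rcomb_T_dual] i]])
    also have "\<dots> \<le> (\<integral>\<^sup>+x. ennreal Q * (ennreal (1 - d n x) * sq_sum x) \<partial>\<Lambda>)"
    proof (rule nn_integral_mono)
      fix x
      have "levy_kernel (?b x) - d n x *\<^sub>R levy_kernel (?b x) = (1 - d n x) *\<^sub>R levy_kernel (?b x)" by (simp add: scaleR_diff_left)
      then have "norm (levy_kernel (?b x) - d n x *\<^sub>R levy_kernel (?b x)) = (1 - d n x) * norm (levy_kernel (?b x))"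
        using d(3)[of n x] by simp
      also have "\<dots> \<le> (1 - d n x) * (?b x)\<^sup>2"
        using d(3)[of n x] norm_levy_kernel[of "?b x"] zero_le_power2[of "?b x"] by (intro mult_left_mono) linarith+
      finally have "ennreal (norm (levy_kernel (?b x) - d n x *\<^sub>R levy_kernel (?b x))) \<le> ennreal ((1 - d n x) * (?b x)\<^sup>2)"
        by (rule ennreal_leI)
      also have "\<dots> = ennreal (1 - d n x) * ennreal ((?b x)\<^sup>2)" using d(3)[of n x] by (simp add: ennreal_mult)
      also have "\<dots> \<le> ennreal (1 - d n x) * (ennreal Q * sq_sum x)" by (intro mult_left_mono Q(2)) simp
      finally show "ennreal (norm (levy_kernel (?b x) - d n x *\<^sub>R levy_kernel (?b x))) \<le> ennreal Q * (ennreal (1 - d n x) * sq_sum x)"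
        by (simp add: mult_ac)
    qed
    also have "\<dots> = ennreal Q * \<delta> n" unfolding \<delta>_def by (rule nn_integral_cmult) measurable
    finally show ?thesis .
  qed
  have "(\<lambda>n. ennreal (norm (?I - ?J n))) \<longlonglongrightarrow> 0"
    by (rule tendsto_sandwich[OF _ _ tendsto_const Q\<delta>]) (use bound in auto)
  then have "(\<lambda>n. norm (?I - ?J n)) \<longlonglongrightarrow> 0" by (subst (asm) ennreal_tendsto_0_iff) auto
  then have "?J \<longlonglongrightarrow> ?I" by (subst (asm) norm_minus_commute) (simp add: tendsto_norm_zero_iff LIM_zero_iff)
  moreover have "fourier (centred_exp (N n)) ?b = exp (?J n)" for n
    unfolding fourier_centred_exp[OF minorant_on_K[OF N] rcomb_T_dual] unfolding d(4) density_levy_integral[OF d(1,2) rcomb_T_dual] ..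
  ultimately show ?thesis by (simp add: tendsto_exp)
qed

text \<open>The value 0 off the image of \<open>disk_span K\<close> is a default; the law it is
  applied to is concentrated on that image.\<close>

definition T_inv :: "(nat \<Rightarrow> real) \<Rightarrow> 'a" where
  "T_inv z = (if z \<in> T ` disk_span K then inv T z else 0)"

lemma T_inv_T: "x \<in> disk_span K \<Longrightarrow> T_inv (T x) = x"
  using T_inj by (simp add: T_inv_def)

lemma T_T_inv: "z \<in> T ` disk_span K \<Longrightarrow> T (T_inv z) = z"
  by (auto simp: T_inv_T)

text \<open>Up to the default value, the preimage of a closed set is a countable union of images
  under \<open>T\<close> of compact sets, namely of its intersections with the multiples of
  \<open>K\<close>.\<close>

lemma T_inv_measurable: "T_inv \<in> borel \<rightarrow>\<^sub>M borel"
proof (rule borel_measurableI)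
  fix S :: "'a set" assume S: "open S"
  have 1: "T_inv -` (- S) = (\<Union>n. T ` ((*\<^sub>R) (real n) ` K \<inter> - S)) \<union> (if 0 \<in> S then {} else - T ` disk_span K)"
  proof (intro set_eqI iffI)
    fix z assume z: "z \<in> T_inv -` (- S)"
    show "z \<in> (\<Union>n. T ` ((*\<^sub>R) (real n) ` K \<inter> - S)) \<union> (if 0 \<in> S then {} else - T ` disk_span K)"
    proof (cases "z \<in> T ` disk_span K")
      case True
      then obtain x where x: "x \<in> disk_span K" "z = T x" by blast
      then obtain n where "x \<in> (*\<^sub>R) (real n) ` K" using D_union by blast
      then show ?thesis using x z T_inv_T[OF x(1)] by auto
    next
      case False
      then show ?thesis using z by (auto simp: T_inv_def)
    qed
  next
    fix z assume z: "z \<in> (\<Union>n. T ` ((*\<^sub>R) (real n) ` K \<inter> - S)) \<union> (if 0 \<in> S then {} else - T ` disk_span K)"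
    show "z \<in> T_inv -` (- S)"
    proof (cases "z \<in> (\<Union>n. T ` ((*\<^sub>R) (real n) ` K \<inter> - S))")
      case True
      then obtain n x where x: "x \<in> (*\<^sub>R) (real n) ` K" "x \<notin> S" "z = T x" by auto
      then have "x \<in> disk_span K" using D_union by blast
      then show ?thesis using x T_inv_T by simp
    next
      case False
      then show ?thesis using z by (auto simp: T_inv_def split: if_splits)
    qed
  qed
  have "T ` ((*\<^sub>R) (real n) ` K \<inter> - S) \<in> sets borel" for n
    using S by (intro T_image_borel compact_Int_closed compact_scaled) auto
  then have "T_inv -` (- S) \<in> sets borel" unfolding 1 using TD_borel by auto
  then have "- (T_inv -` (- S)) \<in> sets borel" by (rule borel_comp)
  moreover have "- (T_inv -` (- S)) = T_inv -` S" by auto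
  ultimately show "T_inv -` S \<inter> space borel \<in> sets borel" by simp
qed

lemma centred_exp_scaled_tight:
  assumes disk_tight "e > 0"
  obtains n :: nat where "\<And>M. M \<in> finite_minorants euclidean \<Lambda> \<Longrightarrow> measure (centred_exp M) (- (*\<^sub>R) (real n) ` K) < e"
proof -
  obtain n :: nat where n: "\<And>M. M \<in> finite_minorants euclidean \<Lambda> \<Longrightarrow> measure (centred_exp M) ((*\<^sub>R) (real n) ` K) > 1 - e"
    using assms unfolding disk_tight_def by blast
  show thesis
  proof (rule that)
    fix M assume M: "M \<in> finite_minorants euclidean \<Lambda>"
    have MK: "on_K M" by (rule minorant_on_K[OF M])
    have "measure (centred_exp M) (UNIV - (*\<^sub>R) (real n) ` K) = 1 - measure (centred_exp M) ((*\<^sub>R) (real n) ` K)"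
      using prob_space.prob_compl[OF centred_exp_prob_space[OF MK], of "(*\<^sub>R) (real n) ` K"] centred_exp_space[OF MK] centred_exp_sets[OF MK] by simp
    then show "measure (centred_exp M) (- (*\<^sub>R) (real n) ` K) < e" using n[OF M] by (simp add: Compl_eq_Diff_UNIV)
  qed
qed

lemma distr_T_centred_exp:
  assumes "on_K M"
  shows "prob_space (distr (centred_exp M) borel T)" "sets (distr (centred_exp M) borel T) = sets borel"
    "fourier (distr (centred_exp M) borel T) (rcomb c) = fourier (centred_exp M) (\<lambda>x. rcomb c (T x))"
proof -
  have m: "T \<in> centred_exp M \<rightarrow>\<^sub>M borel" using T_measurable measurable_cong_sets[OF centred_exp_sets[OF assms] refl] by blast
  show "prob_space (distr (centred_exp M) borel T)" by (rule prob_space.prob_space_distr[OF centred_exp_prob_space[OF assms] m])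
  show "fourier (distr (centred_exp M) borel T) (rcomb c) = fourier (centred_exp M) (\<lambda>x. rcomb c (T x))"
    by (rule fourier_distr[OF m rcomb_measurable])
qed simp

lemma measure_distr_T:
  assumes P: "sets P = sets borel" and S: "compact S"
  shows "measure (distr P borel T) (T ` S) = measure P S" "measure (distr P borel T) (- T ` S) = measure P (- S)"
proof -
  have m: "T \<in> P \<rightarrow>\<^sub>M borel" using T_measurable measurable_cong_sets[OF P refl] by blast
  have sp: "space P = UNIV" using sets_eq_imp_space_eq[OF P] by simp
  have "T -` (T ` S) = S" "T -` (- T ` S) = - S" using T_mem by auto
  then show "measure (distr P borel T) (T ` S) = measure P S" "measure (distr P borel T) (- T ` S) = measure P (- S)"
    using T_image_borel[OF S] by (simp_all add: measure_distr[OF m] sp)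
qed

text \<open>The law from \<open>limit_law\<close> keeps the mass that the approximating laws give to
  the images of multiples of \<open>K\<close>, so it is concentrated on the image of
  \<open>disk_span K\<close> and can be pulled back by \<open>T_inv\<close>. The last clause covers
  every sequence of minorants that satisfies the scalar criterion, because cluster points are tested
  along such sequences.\<close>

lemma limit_measure:
  assumes tight: disk_tight
  obtains \<rho> where "\<rho> \<in> prob_borel_measures euclidean" "measure \<rho> (disk_span K) = 1"
    "\<And>b. b \<in> dual_space \<Longrightarrow> fourier \<rho> b = exp (\<integral>x. levy_kernel (b x) \<partial>\<Lambda>)"
    "\<And>N f B. (\<And>n::nat. N n \<in> finite_minorants euclidean \<Lambda>) \<Longrightarrow>
       (\<lambda>n. \<integral>\<^sup>+x. sq_sum x \<partial>N n) \<longlonglongrightarrow> (\<integral>\<^sup>+x. sq_sum x \<partial>\<Lambda>) \<Longrightarrow>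
       continuous_on UNIV f \<Longrightarrow> (\<And>x. \<bar>f x\<bar> \<le> (B :: real)) \<Longrightarrow>
       (\<lambda>n. \<integral>x. f x \<partial>centred_exp (N n)) \<longlonglongrightarrow> (\<integral>x. f x \<partial>\<rho>)"
proof -
  have one: "(\<lambda>_::'a. 1::real) \<in> borel_measurable borel" "\<And>x::'a. (0::real) \<le> 1" "\<And>x::'a. (1::real) \<le> 1" by auto
  obtain \<kappa> :: "(nat \<Rightarrow> real) measure" where \<kappa>: "prob_space \<kappa>" "sets \<kappa> = sets borel"
    "\<And>c. fourier \<kappa> (rcomb c) = exp (\<integral>x. 1 *\<^sub>R levy_kernel (rcomb c (T x)) \<partial>\<Lambda>)"
    by (rule limit_law[OF one]) blast
  interpret \<kappa>: prob_space \<kappa> by (rule \<kappa>(1))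
  have \<kappa>sp: "space \<kappa> = UNIV" using sets_eq_imp_space_eq[OF \<kappa>(2)] by simp
  obtain C where C: "incseq C" "\<And>n. C n \<in> sets borel" "\<And>n. cut (C n) \<in> finite_minorants euclidean \<Lambda>"
    "(\<lambda>n. \<integral>\<^sup>+x. sq_sum x \<partial>cut (C n)) \<longlonglongrightarrow> (\<integral>\<^sup>+x. sq_sum x \<partial>\<Lambda>)"
    "\<And>b. b \<in> dual_space \<Longrightarrow> (\<lambda>n. fourier (centred_exp (cut (C n))) b) \<longlonglongrightarrow> exp (\<integral>x. levy_kernel (b x) \<partial>\<Lambda>)"
    by (rule exhausting_minorants) blast
  have CK: "on_K (cut (C n))" for n by (rule minorant_on_K[OF C(3)])
  define \<mu> where "\<mu> n = distr (centred_exp (cut (C n))) borel T" for n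
  have mass: "measure (\<mu> n) UNIV \<le> 1" for n using prob_space.prob_le_1[OF distr_T_centred_exp(1)[OF CK]] unfolding \<mu>_def .
  have tight\<mu>: "\<exists>S. compact S \<and> (\<forall>n. measure (\<mu> n) (- S) \<le> e)" if e: "e > 0" for e
  proof -
    obtain m :: nat where m: "\<And>M. M \<in> finite_minorants euclidean \<Lambda> \<Longrightarrow> measure (centred_exp M) (- (*\<^sub>R) (real m) ` K) < e"
      using centred_exp_scaled_tight[OF tight e] by blast
    show ?thesis
      using m[OF C(3)] unfolding \<mu>_def
      by (intro exI[of _ "T ` (*\<^sub>R) (real m) ` K"])
         (auto simp: measure_distr_T[OF centred_exp_sets[OF CK] compact_scaled] intro: less_imp_le T_image_compact compact_scaled)
  qed
  have \<kappa>mass: "1 - e \<le> measure \<kappa> (T ` (*\<^sub>R) (real m) ` K)"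
    if m: "\<And>M. M \<in> finite_minorants euclidean \<Lambda> \<Longrightarrow> measure (centred_exp M) (- (*\<^sub>R) (real m) ` K) < e" for e and m :: nat
  proof (rule fourier_limit_compact[where T="\<lambda>z. z" and \<mu>=\<mu>, OF _ _ _ _ \<kappa>.finite_measure_axioms \<kappa>(2) _ mass tight\<mu>])
    show "finite_measure (\<mu> n)" "sets (\<mu> n) = sets borel" for n
      unfolding \<mu>_def using distr_T_centred_exp[OF CK] by (auto intro: prob_space.finite_measure)
    show "(\<lambda>n. fourier (\<mu> n) (\<lambda>z. rcomb c z)) \<longlonglongrightarrow> fourier \<kappa> (\<lambda>z. rcomb c z)" for c
      using C(5)[OF rcomb_T_dual[of c]] unfolding \<mu>_def distr_T_centred_exp(3)[OF CK] \<kappa>(3) by simp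
    show "compact (T ` (*\<^sub>R) (real m) ` K)" by (rule T_image_compact[OF compact_scaled])
    show "1 - e \<le> measure (\<mu> n) (T ` (*\<^sub>R) (real m) ` K)" for n
      using m[OF C(3)[of n]] prob_space.prob_compl[OF centred_exp_prob_space[OF CK], of "(*\<^sub>R) (real m) ` K" n]
      unfolding \<mu>_def measure_distr_T[OF centred_exp_sets[OF CK] compact_scaled]
      by (simp add: centred_exp_sets[OF CK] centred_exp_space[OF CK] Compl_eq_Diff_UNIV)
  qed (auto intro!: continuous_intros injI)
  define \<rho> where "\<rho> = distr \<kappa> borel T_inv"
  have Tm: "T_inv \<in> \<kappa> \<rightarrow>\<^sub>M borel" using T_inv_measurable measurable_cong_sets[OF \<kappa>(2) refl] by blast
  have \<rho>p: "prob_space \<rho>" and \<rho>s: "sets \<rho> = sets borel" unfolding \<rho>_def by (auto intro: \<kappa>.prob_space_distr[OF Tm])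
  interpret \<rho>: prob_space \<rho> by (rule \<rho>p)
  have \<rho>P: "\<rho> \<in> prob_borel_measures euclidean" using \<rho>p \<rho>s by (simp add: prob_borel_measures_iff)
  have \<rho>mass: "1 - e \<le> measure \<rho> ((*\<^sub>R) (real m) ` K)"
    if m: "\<And>M. M \<in> finite_minorants euclidean \<Lambda> \<Longrightarrow> measure (centred_exp M) (- (*\<^sub>R) (real m) ` K) < e" for e and m :: nat
  proof -
    have "measure \<rho> ((*\<^sub>R) (real m) ` K) = measure \<kappa> (T_inv -` ((*\<^sub>R) (real m) ` K))"
      unfolding \<rho>_def by (subst measure_distr[OF Tm]) (auto simp: \<kappa>sp)
    also have "\<dots> \<ge> measure \<kappa> (T ` (*\<^sub>R) (real m) ` K)"
    proof (rule \<kappa>.finite_measure_mono)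
      have "(*\<^sub>R) (real m) ` K \<subseteq> disk_span K" by (auto simp: D_union)
      then show "T ` (*\<^sub>R) (real m) ` K \<subseteq> T_inv -` ((*\<^sub>R) (real m) ` K)" using T_inv_T by auto
      show "T_inv -` ((*\<^sub>R) (real m) ` K) \<in> sets \<kappa>" using measurable_sets[OF Tm scaled_borel[of "real m"]] by (simp add: \<kappa>sp)
    qed
    finally show ?thesis using \<kappa>mass[OF m] by linarith
  qed
  have D1: "measure \<rho> (disk_span K) = 1"
  proof (rule antisym)
    show "1 \<le> measure \<rho> (disk_span K)"
    proof (rule field_le_epsilon)
      fix e :: real assume e: "e > 0"
      obtain m :: nat where m: "\<And>M. M \<in> finite_minorants euclidean \<Lambda> \<Longrightarrow> measure (centred_exp M) (- (*\<^sub>R) (real m) ` K) < e"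
        using centred_exp_scaled_tight[OF tight e] by blast
      have "measure \<rho> ((*\<^sub>R) (real m) ` K) \<le> measure \<rho> (disk_span K)"
        by (intro \<rho>.finite_measure_mono) (auto simp: D_union \<rho>s)
      then show "1 \<le> measure \<rho> (disk_span K) + e" using \<rho>mass[OF m] by linarith
    qed
  qed simp
  have \<kappa>D: "AE z in \<kappa>. z \<in> T ` disk_span K"
  proof -
    have "measure \<kappa> (T ` disk_span K) = 1"
    proof (rule antisym)
      show "1 \<le> measure \<kappa> (T ` disk_span K)"
      proof (rule field_le_epsilon)
        fix e :: real assume e: "e > 0"
        obtain m :: nat where m: "\<And>M. M \<in> finite_minorants euclidean \<Lambda> \<Longrightarrow> measure (centred_exp M) (- (*\<^sub>R) (real m) ` K) < e"
          using centred_exp_scaled_tight[OF tight e] by blast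
        have "measure \<kappa> (T ` (*\<^sub>R) (real m) ` K) \<le> measure \<kappa> (T ` disk_span K)"
          using TD_borel by (intro \<kappa>.finite_measure_mono image_mono) (auto simp: D_union \<kappa>(2))
        then show "1 \<le> measure \<kappa> (T ` disk_span K) + e" using \<kappa>mass[OF m] by linarith
      qed
    qed simp
    then show ?thesis using TD_borel by (subst \<kappa>.AE_in_set_eq_1) (auto simp: \<kappa>(2))
  qed
  have FTr: "fourier \<rho> (\<lambda>x. rcomb c (T x)) = exp (\<integral>x. levy_kernel (rcomb c (T x)) \<partial>\<Lambda>)" for c
  proof -
    have "fourier \<rho> (\<lambda>x. rcomb c (T x)) = fourier \<kappa> (\<lambda>z. rcomb c (T (T_inv z)))"
      unfolding \<rho>_def by (rule fourier_distr[OF Tm rcomb_T_measurable])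
    also have "\<dots> = fourier \<kappa> (rcomb c)"
      unfolding fourier_def
    proof (rule integral_cong_AE)
      show "AE z in \<kappa>. iexp (rcomb c (T (T_inv z))) = iexp (rcomb c z)" using \<kappa>D by eventually_elim (simp add: T_T_inv)
      have [measurable]: "(\<lambda>z. rcomb c (T (T_inv z))) \<in> borel_measurable \<kappa>" by (rule measurable_compose[OF Tm rcomb_T_measurable])
      have [measurable]: "rcomb c \<in> borel_measurable \<kappa>" using rcomb_measurable measurable_cong_sets[OF \<kappa>(2) refl] by blast
      show "(\<lambda>z. iexp (rcomb c (T (T_inv z)))) \<in> borel_measurable \<kappa>" "(\<lambda>z. iexp (rcomb c z)) \<in> borel_measurable \<kappa>" by measurable
    qed
    finally show ?thesis unfolding \<kappa>(3) by simp
  qed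
  have weak: "(\<lambda>n. \<integral>x. f x \<partial>centred_exp (N n)) \<longlonglongrightarrow> (\<integral>x. f x \<partial>\<rho>)"
    if N: "\<And>n::nat. N n \<in> finite_minorants euclidean \<Lambda>"
      and lim: "\<And>c. (\<lambda>n. fourier (centred_exp (N n)) (\<lambda>x. rcomb c (T x))) \<longlonglongrightarrow> exp (\<integral>x. levy_kernel (rcomb c (T x)) \<partial>\<Lambda>)"
      and f: "continuous_on UNIV f" "\<And>x. \<bar>f x\<bar> \<le> (B :: real)" for N f B
  proof (rule rcomb_fourier_weak[OF T_cont T_inj])
    have NK: "on_K (N n)" for n by (rule minorant_on_K[OF N])
    show "finite_measure (centred_exp (N n))" "sets (centred_exp (N n)) = sets borel" for n
      using centred_exp_sets[OF NK] prob_space.finite_measure[OF centred_exp_prob_space[OF NK]] by auto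
    show "measure (centred_exp (N n)) UNIV \<le> 1" for n using prob_space.prob_le_1[OF centred_exp_prob_space[OF NK]] .
    show "\<exists>S. compact S \<and> (\<forall>n. measure (centred_exp (N n)) (- S) \<le> e) \<and> measure \<rho> (- S) \<le> e" if e: "e > 0" for e
    proof -
      obtain m :: nat where m: "\<And>M. M \<in> finite_minorants euclidean \<Lambda> \<Longrightarrow> measure (centred_exp M) (- (*\<^sub>R) (real m) ` K) < e"
        using centred_exp_scaled_tight[OF tight e] by blast
      have "measure \<rho> (- (*\<^sub>R) (real m) ` K) \<le> e"
        using \<rho>mass[OF m] \<rho>.prob_compl[of "(*\<^sub>R) (real m) ` K"] sets_eq_imp_space_eq[OF \<rho>s]
        by (simp add: \<rho>s Compl_eq_Diff_UNIV)
      then show ?thesis using m[OF N] compact_scaled by (intro exI[of _ "(*\<^sub>R) (real m) ` K"]) (auto intro: less_imp_le)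
    qed
    show "(\<lambda>n. fourier (centred_exp (N n)) (\<lambda>x. rcomb c (T x))) \<longlonglongrightarrow> fourier \<rho> (\<lambda>x. rcomb c (T x))" for c
      unfolding FTr by (rule lim)
  qed (use f \<rho>.finite_measure_axioms \<rho>s in auto)
  show thesis
  proof (rule that[OF \<rho>P D1])
    \<comment> \<open>So far the formula is known for rational combinations of the
      \<open>a k\<close> only; weak convergence tested on \<open>cos b\<close> and
      \<open>sin b\<close> extends it to all dual functionals.\<close>
    fix b :: "'a \<Rightarrow> real" assume b: "b \<in> dual_space"
    have cb: "continuous_on UNIV b" by (rule dual_space_continuous[OF b])
    have bm: "b \<in> borel_measurable M" if "sets M = sets borel" for M
      by (rule borel_measurable_continuous_sets[OF that cb])
    have "(\<lambda>n. \<integral>x. cos (b x) \<partial>centred_exp (cut (C n))) \<longlonglongrightarrow> (\<integral>x. cos (b x) \<partial>\<rho>)"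
      by (rule weak[OF C(3) C(5)[OF rcomb_T_dual], of _ 1]) (auto intro!: continuous_intros cb)
    moreover have "(\<lambda>n. \<integral>x. sin (b x) \<partial>centred_exp (cut (C n))) \<longlonglongrightarrow> (\<integral>x. sin (b x) \<partial>\<rho>)"
      by (rule weak[OF C(3) C(5)[OF rcomb_T_dual], of _ 1]) (auto intro!: continuous_intros cb)
    ultimately have "(\<lambda>n. fourier (centred_exp (cut (C n))) b) \<longlonglongrightarrow> fourier \<rho> b"
      unfolding tendsto_complex_iff
      using Re_fourier[OF prob_space.finite_measure[OF centred_exp_prob_space[OF CK]] bm[OF centred_exp_sets[OF CK]]]
        Im_fourier[OF prob_space.finite_measure[OF centred_exp_prob_space[OF CK]] bm[OF centred_exp_sets[OF CK]]]
        Re_fourier[OF \<rho>.finite_measure_axioms bm[OF \<rho>s]] Im_fourier[OF \<rho>.finite_measure_axioms bm[OF \<rho>s]] by simp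
    then show "fourier \<rho> b = exp (\<integral>x. levy_kernel (b x) \<partial>\<Lambda>)" using C(5)[OF b] LIMSEQ_unique by blast
  next
    fix N :: "nat \<Rightarrow> 'a measure" and f :: "'a \<Rightarrow> real" and B
    assume N: "\<And>n. N n \<in> finite_minorants euclidean \<Lambda>" and "(\<lambda>n. \<integral>\<^sup>+x. sq_sum x \<partial>N n) \<longlonglongrightarrow> (\<integral>\<^sup>+x. sq_sum x \<partial>\<Lambda>)"
      and f: "continuous_on UNIV f" "\<And>x. \<bar>f x\<bar> \<le> B"
    then show "(\<lambda>n. \<integral>x. f x \<partial>centred_exp (N n)) \<longlonglongrightarrow> (\<integral>x. f x \<partial>\<rho>)"
      by (intro weak[OF N fourier_centred_exp_tendsto[OF N] f])
  qed
qed

section \<open>Generalised Poisson exponentials\<close>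

lemma fourier_translate_poisson:
  assumes M: "on_K M" and b: "b \<in> dual_space"
  shows "fourier (translate_meas euclidean (poisson_exp euclidean M) x) b = fourier (centred_exp M) b * iexp (b (x + barycentre M))"
proof -
  have P: "poisson_exp euclidean M \<in> finite_borel_measures euclidean" by (rule prob_borel_imp_finite[OF poisson_prob[OF M]])
  have t: "fourier (translate_meas euclidean (poisson_exp euclidean M) y) b = fourier (poisson_exp euclidean M) b * iexp (b y)" for y
    by (rule fourier_translate_meas[OF additive_space_E P]) (use dual_space_measurable[OF b] additive_map_dual[OF b] in auto)
  have "b (x + barycentre M) = b x + b (barycentre M)" "b (- barycentre M) = - b (barycentre M)"
    using linear_add[OF dual_space_linear[OF b]] linear_neg[OF dual_space_linear[OF b]] by auto
  then show ?thesis unfolding centred_exp_def t by (simp add: distrib_left exp_add exp_minus)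
qed

text \<open>No compactness for the shifts is at hand in \<open>E\<close>. Coordinatewise the
  one-dimensional bound applies, and a product of intervals is compact, so a subsequence of the
  images under \<open>T\<close> converges; the limit need not be the image of a vector.\<close>

lemma bounded_shifts:
  assumes N: "\<And>n::nat. on_K (N n)" and C: "compact C"
    and m: "\<And>n. measure (centred_exp (N n)) {y. y + w n \<in> C} \<ge> 15/16"
  obtains r :: "nat \<Rightarrow> nat" and z where "strict_mono r" "(\<lambda>n. T (w (r n))) \<longlonglongrightarrow> z"
proof -
  have "\<exists>W. \<forall>n. \<bar>a k (w n)\<bar> \<le> W" for k
  proof -
    obtain B where B: "B > 0" "\<And>x. x \<in> K \<Longrightarrow> \<bar>a k x\<bar> \<le> B" using dual_bounded_K[OF a_dual] by blast
    have "compact (a k ` C)" by (rule compact_continuous_image[OF dual_space_continuous[OF a_dual] C])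
    then have "bounded (a k ` C)" by (rule compact_imp_bounded)
    then obtain R where R: "\<And>x. x \<in> C \<Longrightarrow> \<bar>a k x\<bar> \<le> R" unfolding bounded_iff by auto
    let ?b = "\<lambda>x. (1 / B) * a k x"
    have bd: "?b \<in> dual_space" by (rule dual_space_scale[OF a_dual])
    have b1: "\<bar>?b x\<bar> \<le> 1" if "x \<in> K" for x using B(2)[OF that] B(1) by (simp add: abs_mult)
    define R' where "R' = max 1 (R / B)"
    have "\<bar>?b (w n)\<bar> \<le> 64 * R'" for n
    proof (rule centred_exp_shift_bound[OF N _ bd b1])
      interpret prob_space "centred_exp (N n)" by (rule centred_exp_prob_space[OF N])
      have bm: "?b \<in> borel_measurable (centred_exp (N n))" by (rule centred_exp_measurable[OF N dual_space_measurable[OF bd]])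
      have "measure (centred_exp (N n)) {y. y + w n \<in> C} \<le> measure (centred_exp (N n)) {x \<in> space (centred_exp (N n)). \<bar>?b x + ?b (w n)\<bar> \<le> R'}"
      proof (rule finite_measure_mono)
        show "{y. y + w n \<in> C} \<subseteq> {x \<in> space (centred_exp (N n)). \<bar>?b x + ?b (w n)\<bar> \<le> R'}"
        proof
          fix y assume "y \<in> {y. y + w n \<in> C}"
          then have "\<bar>a k (y + w n)\<bar> \<le> R" using R by auto
          then have "\<bar>?b (y + w n)\<bar> \<le> R / B" using B(1) by (simp add: abs_mult field_simps)
          moreover have "?b (y + w n) = ?b y + ?b (w n)" using linear_add[OF dual_space_linear[OF bd]] .
          ultimately have "\<bar>?b y + ?b (w n)\<bar> \<le> R / B" by (simp only:)
          also have "\<dots> \<le> R'" by (simp add: R'_def)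
          finally show "y \<in> {x \<in> space (centred_exp (N n)). \<bar>?b x + ?b (w n)\<bar> \<le> R'}"
            by (simp add: centred_exp_space[OF N])
        qed
        show "{x \<in> space (centred_exp (N n)). \<bar>?b x + ?b (w n)\<bar> \<le> R'} \<in> events" using bm by measurable
      qed
      then show "15 / 16 \<le> measure (centred_exp (N n)) {x. \<bar>?b x + ?b (w n)\<bar> \<le> R'}" using m[of n] by (simp add: centred_exp_space[OF N])
    qed (simp add: R'_def)
    then have "\<bar>a k (w n)\<bar> \<le> 64 * R' * B" for n using B(1) by (simp add: abs_mult field_simps)
    then show ?thesis by blast
  qed
  then obtain W where W: "\<And>k n. \<bar>a k (w n)\<bar> \<le> W k" by metis
  have "seq_compact {z. \<forall>k. \<bar>z k\<bar> \<le> W k}" by (rule compact_imp_seq_compact[OF compact_Pi_intervals])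
  moreover have "\<forall>n. T (w n) \<in> {z. \<forall>k. \<bar>z k\<bar> \<le> W k}" using W by (simp add: T_def)
  ultimately obtain z r where "strict_mono (r :: nat \<Rightarrow> nat)" "((\<lambda>n. T (w n)) \<circ> r) \<longlonglongrightarrow> z"
    by (rule seq_compactE) blast
  then show thesis using that by (simp add: o_def)
qed

lemma rcomb_tendsto: "z \<longlonglongrightarrow> (l :: nat \<Rightarrow> real) \<Longrightarrow> (\<lambda>n. rcomb c (z n)) \<longlonglongrightarrow> rcomb c l"
  using continuous_on_tendsto_compose[OF rcomb_continuous, of z l sequentially c] by simp

lemma translate_poisson_limit:
  assumes N: "\<And>n::nat. N n \<in> finite_minorants euclidean \<Lambda>"
    and lim: "(\<lambda>n. \<integral>\<^sup>+x. sq_sum x \<partial>N n) \<longlonglongrightarrow> (\<integral>\<^sup>+x. sq_sum x \<partial>\<Lambda>)"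
    and C: "compact C" and m: "\<And>n. measure (translate_meas euclidean (poisson_exp euclidean (N n)) (x n)) C \<ge> 15/16"
  obtains r :: "nat \<Rightarrow> nat" and z where "strict_mono r"
    "\<And>c. (\<lambda>n. fourier (translate_meas euclidean (poisson_exp euclidean (N (r n))) (x (r n))) (\<lambda>y. rcomb c (T y)))
        \<longlonglongrightarrow> exp (\<integral>x. levy_kernel (rcomb c (T x)) \<partial>\<Lambda>) * iexp (rcomb c z)"
proof -
  have NK: "on_K (N n)" for n by (rule minorant_on_K[OF N])
  have m': "measure (centred_exp (N n)) {y. y + (x n + barycentre (N n)) \<in> C} \<ge> 15/16" for n
    using m[of n] unfolding translate_centred_exp[OF NK borel_closed[OF compact_imp_closed[OF C]]] .
  obtain r :: "nat \<Rightarrow> nat" and z where r: "strict_mono r" "(\<lambda>n. T (x (r n) + barycentre (N (r n)))) \<longlonglongrightarrow> z"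
    by (rule bounded_shifts[of N C "\<lambda>n. x n + barycentre (N n)", OF NK C m']) blast
  show thesis
  proof (rule that[OF r(1)])
    fix c
    have "(\<lambda>n. fourier (centred_exp (N (r n))) (\<lambda>y. rcomb c (T y))) \<longlonglongrightarrow> exp (\<integral>x. levy_kernel (rcomb c (T x)) \<partial>\<Lambda>)"
      by (rule LIMSEQ_compose_subseq[OF fourier_centred_exp_tendsto[OF N lim] r(1)])
    moreover have "(\<lambda>n. iexp (rcomb c (T (x (r n) + barycentre (N (r n)))))) \<longlonglongrightarrow> iexp (rcomb c z)"
      by (intro tendsto_intros rcomb_tendsto r(2))
    ultimately show "(\<lambda>n. fourier (translate_meas euclidean (poisson_exp euclidean (N (r n))) (x (r n))) (\<lambda>y. rcomb c (T y)))
        \<longlonglongrightarrow> exp (\<integral>x. levy_kernel (rcomb c (T x)) \<partial>\<Lambda>) * iexp (rcomb c z)"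
      unfolding fourier_translate_poisson[OF NK rcomb_T_dual] by (rule tendsto_mult)
  qed
qed

lemma return_sequence_space: "prob_space (return (borel :: (nat \<Rightarrow> real) measure) z)" "sets (return (borel :: (nat \<Rightarrow> real) measure) z) = sets borel"
  "fourier (return (borel :: (nat \<Rightarrow> real) measure) z) (rcomb c) = iexp (rcomb c z)"
  by (auto intro: prob_space_return fourier_return)

text \<open>Along a subsequence the translated laws converge to \<open>\<kappa>\<close> shifted by
  some sequence \<open>z\<close>. The compact sets may be arbitrary subsets of
  \<open>disk_span K\<close>; through them the limit is concentrated on the image of
  \<open>disk_span K\<close>, and only then do multiples of \<open>K\<close> come in, by continuity
  from below.\<close>

lemma disk_tight_if_translates:
  assumes N: "\<And>n::nat. N n \<in> finite_minorants euclidean \<Lambda>"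
    and lim: "(\<lambda>n. \<integral>\<^sup>+x. sq_sum x \<partial>N n) \<longlonglongrightarrow> (\<integral>\<^sup>+x. sq_sum x \<partial>\<Lambda>)"
    and tight: "\<And>e. e > 0 \<Longrightarrow> \<exists>C. compact C \<and> C \<subseteq> disk_span K \<and>
        (\<forall>n. measure (translate_meas euclidean (poisson_exp euclidean (N n)) (x n)) (- C) < e)"
  shows disk_tight
proof -
  define Q where "Q n = translate_meas euclidean (poisson_exp euclidean (N n)) (x n)" for n
  have NK: "on_K (N n)" for n by (rule minorant_on_K[OF N])
  have Q: "Q n \<in> prob_borel_measures euclidean" for n unfolding Q_def by (rule translate_prob[OF poisson_prob[OF NK]])
  have Qs: "sets (Q n) = sets borel" and Qp: "prob_space (Q n)" for n using Q[of n] by (auto simp: prob_borel_measures_iff)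
  have Qc: "measure (Q n) C = 1 - measure (Q n) (- C)" if "compact C" for n C
  proof -
    have "C \<in> sets (Q n)" using compact_imp_closed[OF that] Qs by auto
    from prob_space.prob_compl[OF Qp this] show ?thesis
      using sets_eq_imp_space_eq[OF Qs] by (simp add: Compl_eq_Diff_UNIV)
  qed
  obtain C0 where C0: "compact C0" "\<And>n. measure (Q n) (- C0) < 1/16" using tight[of "1/16"] unfolding Q_def by auto
  have C0m: "measure (Q n) C0 \<ge> 15/16" for n using Qc[OF C0(1), of n] C0(2)[of n] by linarith
  obtain r :: "nat \<Rightarrow> nat" and z where r: "strict_mono r"
    "\<And>c. (\<lambda>n. fourier (Q (r n)) (\<lambda>y. rcomb c (T y))) \<longlonglongrightarrow> exp (\<integral>x. levy_kernel (rcomb c (T x)) \<partial>\<Lambda>) * iexp (rcomb c z)"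
    by (rule translate_poisson_limit[OF N lim C0(1) C0m[unfolded Q_def], folded Q_def]) blast
  have one: "(\<lambda>_::'a. 1::real) \<in> borel_measurable borel" "\<And>x::'a. (0::real) \<le> 1" "\<And>x::'a. (1::real) \<le> 1" by auto
  obtain \<kappa> :: "(nat \<Rightarrow> real) measure" where \<kappa>: "prob_space \<kappa>" "sets \<kappa> = sets borel"
    "\<And>c. fourier \<kappa> (rcomb c) = exp (\<integral>x. 1 *\<^sub>R levy_kernel (rcomb c (T x)) \<partial>\<Lambda>)"
    by (rule limit_law[OF one]) blast
  have id: "(\<lambda>v::nat \<Rightarrow> real. v) \<in> \<kappa> \<rightarrow>\<^sub>M borel" using \<kappa>(2) by (simp add: measurable_ident_sets)
  define \<sigma> where "\<sigma> = add_law \<kappa> (return borel z) (\<lambda>v. v)"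
  have \<sigma>: "prob_space \<sigma>" "sets \<sigma> = sets borel" unfolding \<sigma>_def by (rule add_law_prob[OF \<kappa>(1) return_sequence_space(1) id return_sequence_space(2)])+
  have FT\<sigma>: "fourier \<sigma> (rcomb c) = exp (\<integral>x. levy_kernel (rcomb c (T x)) \<partial>\<Lambda>) * fourier (return borel z) (rcomb c)" for c
    unfolding \<sigma>_def fourier_add_law[OF \<kappa>(1) return_sequence_space(1) id return_sequence_space(2)] \<kappa>(3) by simp
  interpret \<sigma>: prob_space \<sigma> by (rule \<sigma>(1))
  define \<mu> where "\<mu> n = distr (Q (r n)) borel T" for n
  have TQ: "T \<in> Q n \<rightarrow>\<^sub>M borel" for n using T_measurable measurable_cong_sets[OF Qs refl] by blast
  have \<mu>p: "prob_space (\<mu> n)" for n unfolding \<mu>_def by (rule prob_space.prob_space_distr[OF Qp TQ])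
  have \<sigma>C: "1 - e \<le> measure \<sigma> (T ` C)" if C: "compact C" "\<And>n. measure (Q n) (- C) < e" for C e
  proof (rule fourier_limit_compact[where T="\<lambda>z. z" and \<mu>=\<mu>, OF _ _ _ _ \<sigma>.finite_measure_axioms \<sigma>(2)])
    show "finite_measure (\<mu> n)" "measure (\<mu> n) UNIV \<le> 1" for n
      using prob_space.finite_measure[OF \<mu>p] prob_space.prob_le_1[OF \<mu>p] by auto
    show "(\<lambda>n. fourier (\<mu> n) (\<lambda>z. rcomb c z)) \<longlonglongrightarrow> fourier \<sigma> (\<lambda>z. rcomb c z)" for c
      using r(2)[of c] FT\<sigma>[of c] unfolding \<mu>_def return_sequence_space(3) fourier_distr[OF TQ rcomb_measurable] by simp
    show "compact (T ` C)" by (rule T_image_compact[OF C(1)])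
    show "1 - e \<le> measure (\<mu> n) (T ` C)" for n
      using C(2)[of "r n"] Qc[OF C(1), of "r n"] unfolding \<mu>_def measure_distr_T[OF Qs C(1)] by linarith
    show "\<exists>S. compact S \<and> (\<forall>n. measure (\<mu> n) (- S) \<le> e)" if e: "e > 0" for e
    proof -
      obtain S where "compact S" "\<And>n. measure (Q n) (- S) < e" using tight[OF e] unfolding Q_def by blast
      then show ?thesis unfolding \<mu>_def
        by (intro exI[of _ "T ` S"]) (auto simp: measure_distr_T[OF Qs] intro: less_imp_le T_image_compact)
    qed
  qed (auto intro!: continuous_intros injI simp: \<mu>_def)
  have "measure \<sigma> (T ` disk_span K) = 1"
  proof (rule antisym)
    show "1 \<le> measure \<sigma> (T ` disk_span K)"
    proof (rule field_le_epsilon)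
      fix e :: real assume e: "e > 0"
      obtain C where C: "compact C" "C \<subseteq> disk_span K" "\<And>n. measure (Q n) (- C) < e" using tight[OF e] unfolding Q_def by blast
      have "measure \<sigma> (T ` C) \<le> measure \<sigma> (T ` disk_span K)"
        using TD_borel C(2) by (intro \<sigma>.finite_measure_mono image_mono) (auto simp: \<sigma>(2))
      then show "1 \<le> measure \<sigma> (T ` disk_span K) + e" using \<sigma>C[OF C(1,3)] by linarith
    qed
  qed simp
  then show ?thesis by (rule disk_tightI[OF \<sigma> return_sequence_space(1,2) FT\<sigma>])
qed

text \<open>A cluster point of a net is converted into a limit of a sequence: the neighbourhoods
  test countably many characters with growing precision, and each \<open>N n\<close> lies above the
  \<open>n\<close>-th cut-off, so the integrals of \<open>sq_sum\<close> converge by sandwiching.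
  The transform of \<open>\<rho>\<close> is then the one belonging to \<open>\<Lambda>\<close>, up
  to a shift.\<close>

lemma disk_tight_if_gen_poisson_exp:
  assumes g: "gen_poisson_exp euclidean \<Lambda> \<rho>" and D: "emeasure \<rho> (disk_span K) = 1"
  shows disk_tight
proof -
  let ?FM = "finite_minorants euclidean \<Lambda>"
  note g' = g[unfolded gen_poisson_exp_def]
  have \<rho>: "\<rho> \<in> finite_borel_measures euclidean" by (rule g'[THEN conjunct2, THEN conjunct1])
  obtain x where x: "(\<forall>M\<in>?FM. x M \<in> topspace euclidean) \<and>
        uniformly_tight euclidean ((\<lambda>M. translate_meas euclidean (poisson_exp euclidean M) (x M)) ` ?FM) \<and>
        (\<forall>U. openin (weak_topology euclidean) U \<and> \<rho> \<in> U \<longrightarrow>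
           (\<forall>M\<in>?FM. \<exists>N\<in>?FM. M \<le> N \<and> translate_meas euclidean (poisson_exp euclidean N) (x N) \<in> U))"
    by (rule exE[OF g'[THEN conjunct2, THEN conjunct2]])
  note ut = x[THEN conjunct2, THEN conjunct1]
  have cl: "\<exists>N\<in>?FM. M \<le> N \<and> translate_meas euclidean (poisson_exp euclidean N) (x N) \<in> U"
    if U: "openin (weak_topology euclidean) U" "\<rho> \<in> U" and M: "M \<in> ?FM" for U M
    by (rule x[THEN conjunct2, THEN conjunct2, rule_format, OF conjI[OF U] M])
  define Q where "Q M = translate_meas euclidean (poisson_exp euclidean M) (x M)" for M
  have \<rho>f: "finite_measure \<rho>" and \<rho>s: "sets \<rho> = sets borel" using \<rho> by (auto simp: finite_borel_measures_iff)
  interpret \<rho>: finite_measure \<rho> by (rule \<rho>f)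
  have \<rho>sp: "space \<rho> = UNIV" using sets_eq_imp_space_eq[OF \<rho>s] by simp
  have Qp: "prob_space (Q M)" "sets (Q M) = sets borel" if "M \<in> ?FM" for M
    using translate_prob[OF poisson_prob[OF minorant_on_K[OF that]]] unfolding Q_def by (auto simp: prob_borel_measures_iff)
  obtain C where C: "incseq C" "\<And>n. C n \<in> sets borel" "\<And>n. cut (C n) \<in> ?FM"
    "(\<lambda>n. \<integral>\<^sup>+x. sq_sum x \<partial>cut (C n)) \<longlonglongrightarrow> (\<integral>\<^sup>+x. sq_sum x \<partial>\<Lambda>)"
    by (rule exhausting_minorants) blast
  define c where "c = (from_nat :: nat \<Rightarrow> rat list)"
  define co where "co j = (\<lambda>y. cos (rcomb (c j) (T y)))" for j
  define si where "si j = (\<lambda>y. sin (rcomb (c j) (T y)))" for j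
  have cont: "continuous_map euclidean euclideanreal (co j)" "continuous_map euclidean euclideanreal (si j)" for j
    unfolding co_def si_def using rcomb_continuous_comp[OF T_cont, of "c j"]
    by (auto simp: intro!: continuous_intros)
  have bdd: "bounded (range (co j))" "bounded (range (si j))" for j
    unfolding co_def si_def bounded_iff by (auto intro!: exI[of _ 1])
  \<comment> \<open>The first \<open>n + 1\<close> pairs of cosine and sine integrals are fixed up
    to \<open>1 / (n + 1)\<close>; \<open>c\<close> runs through all coefficient lists, so every
    character is tested from some \<open>n\<close> on.\<close>
  define U where "U n = (\<Inter>j\<in>{..n}. {M \<in> finite_borel_measures euclidean. (\<integral>y. co j y \<partial>M) \<in> ball (\<integral>y. co j y \<partial>\<rho>) (1 / Suc n)}
     \<inter> {M \<in> finite_borel_measures euclidean. (\<integral>y. si j y \<partial>M) \<in> ball (\<integral>y. si j y \<partial>\<rho>) (1 / Suc n)})" for n :: nat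
  have Uo: "openin (weak_topology euclidean) (U n)" for n
    unfolding U_def using cont bdd by (intro openin_INT2 openin_Int weak_topology_openin_basic) auto
  have \<rho>U: "\<rho> \<in> U n" for n using \<rho> by (simp add: U_def)
  have "\<exists>N\<in>?FM. cut (C n) \<le> N \<and> Q N \<in> U n" for n unfolding Q_def by (rule cl[OF Uo \<rho>U C(3)])
  then obtain N where N: "\<And>n. N n \<in> ?FM" "\<And>n. cut (C n) \<le> N n" "\<And>n. Q (N n) \<in> U n" by metis
  have lim: "(\<lambda>n. \<integral>\<^sup>+x. sq_sum x \<partial>N n) \<longlonglongrightarrow> (\<integral>\<^sup>+x. sq_sum x \<partial>\<Lambda>)"
  proof (rule tendsto_sandwich[OF _ _ C(4) tendsto_const])
    have "(\<integral>\<^sup>+x. sq_sum x \<partial>cut (C n)) \<le> (\<integral>\<^sup>+x. sq_sum x \<partial>N n)" for n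
      using minorant_sets[OF C(3)] minorant_sets[OF N(1)] by (intro nn_integral_mono_measure N(2)) auto
    then show "eventually (\<lambda>n. (\<integral>\<^sup>+x. sq_sum x \<partial>cut (C n)) \<le> (\<integral>\<^sup>+x. sq_sum x \<partial>N n)) sequentially" by simp
    have "(\<integral>\<^sup>+x. sq_sum x \<partial>N n) \<le> (\<integral>\<^sup>+x. sq_sum x \<partial>\<Lambda>)" for n
      using N(1)[of n] by (intro nn_integral_mono_measure) (auto simp: finite_minorants_def)
    then show "eventually (\<lambda>n. (\<integral>\<^sup>+x. sq_sum x \<partial>N n) \<le> (\<integral>\<^sup>+x. sq_sum x \<partial>\<Lambda>)) sequentially" by simp
  qed
  have bm: "(\<lambda>y. rcomb d (T y)) \<in> borel_measurable M" if "sets M = sets borel" for M d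
    using rcomb_T_measurable measurable_cong_sets[OF that refl] by blast
  have FTlim: "(\<lambda>n. fourier (Q (N n)) (\<lambda>y. rcomb d (T y))) \<longlonglongrightarrow> fourier \<rho> (\<lambda>y. rcomb d (T y))" for d
  proof -
    define j where "j = (to_nat d :: nat)"
    have cj: "c j = d" by (simp add: c_def j_def)
    have close: "dist (\<integral>y. co j y \<partial>\<rho>) (\<integral>y. co j y \<partial>Q (N n)) < 1 / Suc n" "dist (\<integral>y. si j y \<partial>\<rho>) (\<integral>y. si j y \<partial>Q (N n)) < 1 / Suc n"
      if "n \<ge> j" for n using N(3)[of n] that by (auto simp: U_def)
    have conv: "X \<longlonglongrightarrow> l" if X: "\<And>n. n \<ge> j \<Longrightarrow> dist l (X n) < 1 / Suc n" for X and l :: real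
    proof (rule metric_tendsto_imp_tendsto[OF LIMSEQ_inverse_real_of_nat])
      show "eventually (\<lambda>n. dist (X n) l \<le> dist (inverse (real (Suc n))) 0) sequentially"
        using X by (intro eventually_sequentiallyI[of j]) (auto simp: dist_commute inverse_eq_divide intro: less_imp_le)
    qed
    have 1: "(\<lambda>n. \<integral>y. co j y \<partial>Q (N n)) \<longlonglongrightarrow> (\<integral>y. co j y \<partial>\<rho>)" by (rule conv[OF close(1)])
    have 2: "(\<lambda>n. \<integral>y. si j y \<partial>Q (N n)) \<longlonglongrightarrow> (\<integral>y. si j y \<partial>\<rho>)" by (rule conv[OF close(2)])
    show ?thesis
      unfolding tendsto_complex_iff
      using 1 2 Re_fourier[OF prob_space.finite_measure[OF Qp(1)[OF N(1)]] bm[OF Qp(2)[OF N(1)]]]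
        Im_fourier[OF prob_space.finite_measure[OF Qp(1)[OF N(1)]] bm[OF Qp(2)[OF N(1)]]]
        Re_fourier[OF \<rho>f bm[OF \<rho>s]] Im_fourier[OF \<rho>f bm[OF \<rho>s]]
      by (simp add: co_def si_def cj)
  qed
  obtain S where S: "compact S" "\<And>M. M \<in> ?FM \<Longrightarrow> measure (Q M) (- S) < 1/16"
  proof -
    have "\<forall>\<epsilon>>0. \<exists>S. compactin euclidean S \<and> (\<forall>M\<in>(\<lambda>M. translate_meas euclidean (poisson_exp euclidean M) (x M)) ` ?FM. measure M (topspace euclidean - S) < \<epsilon>)"
      using ut unfolding uniformly_tight_def by blast
    from this[rule_format, of "1/16"] show ?thesis using that unfolding Q_def by (auto simp: Compl_eq_Diff_UNIV)
  qed
  have Sm: "measure (Q (N n)) S \<ge> 15/16" for n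
  proof -
    have "S \<in> sets (Q (N n))" using compact_imp_closed[OF S(1)] Qp(2)[OF N(1)] by auto
    from prob_space.prob_compl[OF Qp(1)[OF N(1)] this] show ?thesis
      using S(2)[OF N(1)[of n]] sets_eq_imp_space_eq[OF Qp(2)[OF N(1)[of n]]] by (simp add: Compl_eq_Diff_UNIV)
  qed
  obtain r :: "nat \<Rightarrow> nat" and z where r: "strict_mono r"
    "\<And>c. (\<lambda>n. fourier (Q (N (r n))) (\<lambda>y. rcomb c (T y))) \<longlonglongrightarrow> exp (\<integral>x. levy_kernel (rcomb c (T x)) \<partial>\<Lambda>) * iexp (rcomb c z)"
    by (rule translate_poisson_limit[OF N(1) lim S(1), of "\<lambda>n. x (N n)", OF Sm[unfolded Q_def], folded Q_def]) blast
  have FT: "fourier \<rho> (\<lambda>y. rcomb d (T y)) = exp (\<integral>x. levy_kernel (rcomb d (T x)) \<partial>\<Lambda>) * iexp (rcomb d z)" for d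
    by (rule LIMSEQ_unique[OF LIMSEQ_compose_subseq[OF FTlim r(1)] r(2)])
  have m: "T \<in> \<rho> \<rightarrow>\<^sub>M borel" using T_measurable measurable_cong_sets[OF \<rho>s refl] by blast
  \<comment> \<open>The cluster point was only known to be a finite measure. The empty coefficient
    list gives the constant character, which determines the total mass.\<close>
  have \<rho>1: "measure \<rho> UNIV = 1"
  proof -
    have "fourier \<rho> (\<lambda>y. rcomb [] (T y)) = 1" unfolding FT by simp
    then show ?thesis by (simp add: fourier_def \<rho>sp scaleR_conv_of_real)
  qed
  have \<rho>p: "prob_space \<rho>" by (rule prob_spaceI) (simp add: \<rho>sp \<rho>.emeasure_eq_measure \<rho>1)
  show ?thesis
  proof (rule disk_tightI)
    show "prob_space (distr \<rho> borel T)" by (rule prob_space.prob_space_distr[OF \<rho>p m])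
    show "fourier (distr \<rho> borel T) (rcomb c) = exp (\<integral>x. levy_kernel (rcomb c (T x)) \<partial>\<Lambda>) * fourier (return borel z) (rcomb c)" for c
      unfolding fourier_distr[OF m rcomb_measurable] FT return_sequence_space(3) ..
    have "T -` (T ` disk_span K) = disk_span K" using T_mem by auto
    then show "measure (distr \<rho> borel T) (T ` disk_span K) = 1"
      using D TD_borel by (subst measure_distr[OF m]) (auto simp: \<rho>sp measure_def)
  qed (auto intro: return_sequence_space)
qed

lemma centred_exp_uniformly_tight:
  assumes tight: disk_tight and F: "F \<subseteq> finite_minorants euclidean \<Lambda>"
  shows "uniformly_tight euclidean (centred_exp ` F)"
  unfolding uniformly_tight_def
proof (intro conjI allI impI)
  have P: "centred_exp M \<in> prob_borel_measures euclidean" if "M \<in> F" for M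
    using F that by (auto intro: centred_exp_prob minorant_on_K)
  show "centred_exp ` F \<subseteq> finite_borel_measures euclidean" using P prob_borel_imp_finite by blast
  show "\<exists>c. \<forall>M\<in>centred_exp ` F. measure M (topspace euclidean) \<le> c"
    using prob_borel_measures_measure[OF P] by (intro exI[of _ 1]) auto
  fix e :: real assume e: "e > 0"
  obtain n :: nat where n: "\<And>M. M \<in> finite_minorants euclidean \<Lambda> \<Longrightarrow> measure (centred_exp M) (- (*\<^sub>R) (real n) ` K) < e"
    using centred_exp_scaled_tight[OF tight e] by blast
  show "\<exists>C. compactin euclidean C \<and> (\<forall>M\<in>centred_exp ` F. measure M (topspace euclidean - C) < e)"
    using n F compact_scaled[of "real n"] by (intro exI[of _ "(*\<^sub>R) (real n) ` K"]) (auto simp: Compl_eq_Diff_UNIV)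
qed

lemma levy_measure_\<Lambda>:
  assumes tight: disk_tight shows "levy_measure euclidean \<Lambda>"
proof -
  obtain C where C: "incseq C" "\<And>n. C n \<in> sets borel" "\<And>n. cut (C n) \<in> finite_minorants euclidean \<Lambda>"
    "\<And>A. A \<in> sets borel \<Longrightarrow> emeasure \<Lambda> A = (SUP n. emeasure (cut (C n)) A)"
    "\<And>m n. m \<le> n \<Longrightarrow> cut (C m) \<le> cut (C n)"
    by (rule exhausting_minorants) blast
  define F where "F = range (\<lambda>n. cut (C n))"
  have F: "F \<subseteq> finite_minorants euclidean \<Lambda>" using C(3) by (auto simp: F_def)
  have "shift_tight euclidean (poisson_exp euclidean ` F)"
    unfolding shift_tight_def
  proof (intro exI conjI ballI)
    \<comment> \<open>\<open>shift_tight\<close> attaches shifts to the exponentials, not to the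
      minorants; any minorant with the given exponential provides one.\<close>
    define s where "s P = (SOME M. M \<in> F \<and> P = poisson_exp euclidean M)" for P
    have s: "s P \<in> F \<and> P = poisson_exp euclidean (s P)" if "P \<in> poisson_exp euclidean ` F" for P
      unfolding s_def by (rule someI_ex) (use that in blast)
    let ?x = "\<lambda>P. - barycentre (s P)"
    have sub: "(\<lambda>M. translate_meas euclidean M (?x M)) ` poisson_exp euclidean ` F \<subseteq> centred_exp ` F"
    proof
      fix Q assume "Q \<in> (\<lambda>M. translate_meas euclidean M (?x M)) ` poisson_exp euclidean ` F"
      then obtain P where P: "P \<in> poisson_exp euclidean ` F" "Q = translate_meas euclidean P (?x P)" by blast
      have "P = poisson_exp euclidean (s P)" "s P \<in> F" using s[OF P(1)] by auto
      then have "Q = centred_exp (s P)" unfolding P(2) centred_exp_def by simp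
      then show "Q \<in> centred_exp ` F" using \<open>s P \<in> F\<close> by blast
    qed
    from centred_exp_uniformly_tight[OF tight F]
    show "uniformly_tight euclidean ((\<lambda>M. translate_meas euclidean M (?x M)) ` poisson_exp euclidean ` F)"
      unfolding uniformly_tight_def using sub by (meson order_trans subsetD)
  qed simp
  moreover have "\<forall>M\<in>F. \<forall>N\<in>F. \<exists>L\<in>F. M \<le> L \<and> N \<le> L"
  proof (intro ballI)
    fix M N assume "M \<in> F" "N \<in> F"
    then obtain m n where mn: "M = cut (C m)" "N = cut (C n)" by (auto simp: F_def)
    show "\<exists>L\<in>F. M \<le> L \<and> N \<le> L"
      unfolding mn using C(5) by (intro bexI[of _ "cut (C (max m n))"]) (auto simp: F_def)
  qed
  moreover have "\<forall>A\<in>sets \<Lambda>. emeasure \<Lambda> A = (SUP M\<in>F. emeasure M A)"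
    using C(4) by (simp add: F_def sets_\<Lambda> image_image)
  moreover have "F \<noteq> {}" by (auto simp: F_def)
  ultimately show ?thesis
    unfolding levy_measure_def using F sets_\<Lambda> \<Lambda>_0 by (auto intro!: exI[of _ F])
qed

text \<open>The maximum of the two densities. Cluster points are tested beyond an arbitrary
  minorant, whereas convergence is known along the cut-offs; this supplies members above
  both.\<close>

lemma minorant_join:
  assumes M: "M \<in> finite_minorants euclidean \<Lambda>" and C: "C \<in> sets borel" "cut C \<in> finite_minorants euclidean \<Lambda>"
  obtains N where "N \<in> finite_minorants euclidean \<Lambda>" "M \<le> N" "cut C \<le> N"
proof -
  obtain d where d: "d \<in> borel_measurable borel" "\<And>x. 0 \<le> d x" "\<And>x. d x \<le> (1::real)" "M = density \<Lambda> (\<lambda>x. ennreal (d x))"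
    by (rule minorant_density[OF M]) blast
  define e where "e x = max (d x) (indicator C x)" for x
  have e: "e \<in> borel_measurable borel" "0 \<le> e x" "e x \<le> 1" for x
    unfolding e_def using d(1) C d(2)[of x] d(3)[of x] by (auto simp: indicator_def)
  have dm[measurable]: "d \<in> borel_measurable \<Lambda>" "e \<in> borel_measurable \<Lambda>" "C \<in> sets \<Lambda>"
    using \<Lambda>_measurable[OF d(1)] \<Lambda>_measurable[OF e(1)] C(1) by (auto simp: sets_\<Lambda>)
  define N where "N = density \<Lambda> (\<lambda>x. ennreal (e x))"
  have fin: "(\<integral>\<^sup>+x. ennreal (e x) \<partial>\<Lambda>) < \<infinity>"
  proof -
    have "(\<integral>\<^sup>+x. ennreal (e x) \<partial>\<Lambda>) \<le> (\<integral>\<^sup>+x. ennreal (d x) + indicator C x \<partial>\<Lambda>)"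
    proof (rule nn_integral_mono)
      show "ennreal (e x) \<le> ennreal (d x) + indicator C x" for x
        unfolding e_def by (auto simp: indicator_def max_def ennreal_1[symmetric] simp del: ennreal_1)
    qed
    also have "\<dots> = (\<integral>\<^sup>+x. ennreal (d x) \<partial>\<Lambda>) + emeasure \<Lambda> C" by (subst nn_integral_add) auto
    also have "(\<integral>\<^sup>+x. ennreal (d x) \<partial>\<Lambda>) = emeasure M (space \<Lambda>)"
      unfolding d(4) by (subst emeasure_density) (auto simp: \<Lambda>_space sets_\<Lambda>)
    also have "emeasure \<Lambda> C = emeasure (cut C) UNIV" using cut_emeasure[OF C(1), of UNIV] by simp
    also have "emeasure M (space \<Lambda>) + emeasure (cut C) UNIV < \<infinity>"
      using finite_measure.emeasure_finite[OF on_K_finite[OF minorant_on_K[OF M]], of "space \<Lambda>"]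
        finite_measure.emeasure_finite[OF on_K_finite[OF minorant_on_K[OF C(2)]], of UNIV] by (simp add: less_top[symmetric])
    finally show ?thesis .
  qed
  have le: "density \<Lambda> f \<le> N" if "f \<in> borel_measurable \<Lambda>" "\<And>x. f x \<le> ennreal (e x)" for f
  proof -
    have "(\<integral>\<^sup>+x. f x * indicator A x \<partial>\<Lambda>) \<le> (\<integral>\<^sup>+x. ennreal (e x) * indicator A x \<partial>\<Lambda>)" for A
      using that(2) by (intro nn_integral_mono mult_right_mono) auto
    then show ?thesis unfolding N_def using that(1) by (subst measure_le_iff) (auto simp: emeasure_density)
  qed
  show thesis
  proof (rule that[of N])
    show "N \<in> finite_minorants euclidean \<Lambda>" unfolding N_def by (rule density_minorant[OF e fin])
    show "M \<le> N" unfolding d(4) by (rule le) (auto simp: e_def intro!: ennreal_leI)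
    show "cut C \<le> N" unfolding cut_def by (rule le) (auto simp: e_def intro!: ennreal_leI)
  qed
qed

text \<open>Beyond a given minorant \<open>M\<close>, the joins of \<open>M\<close> with the
  cut-offs still fulfil the scalar criterion, so their centred exponentials converge weakly to
  \<open>\<rho>\<close> and enter every neighbourhood of it.\<close>

lemma gen_poisson_exp_if_disk_tight:
  assumes tight: disk_tight
  shows "\<exists>\<rho>. gen_poisson_exp euclidean \<Lambda> \<rho> \<and> emeasure \<rho> (disk_span K) = 1"
proof -
  let ?FM = "finite_minorants euclidean \<Lambda>"
  obtain \<rho> where \<rho>: "\<rho> \<in> prob_borel_measures euclidean" "measure \<rho> (disk_span K) = 1"
    "\<And>N f B. (\<And>n::nat. N n \<in> ?FM) \<Longrightarrow> (\<lambda>n. \<integral>\<^sup>+x. sq_sum x \<partial>N n) \<longlonglongrightarrow> (\<integral>\<^sup>+x. sq_sum x \<partial>\<Lambda>) \<Longrightarrow>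
       continuous_on UNIV f \<Longrightarrow> (\<And>x. \<bar>f x\<bar> \<le> (B :: real)) \<Longrightarrow> (\<lambda>n. \<integral>x. f x \<partial>centred_exp (N n)) \<longlonglongrightarrow> (\<integral>x. f x \<partial>\<rho>)"
    by (rule limit_measure[OF tight]) blast
  obtain C where C: "\<And>n. C n \<in> sets borel" "\<And>n. cut (C n) \<in> ?FM"
    "(\<lambda>n. \<integral>\<^sup>+x. sq_sum x \<partial>cut (C n)) \<longlonglongrightarrow> (\<integral>\<^sup>+x. sq_sum x \<partial>\<Lambda>)"
    by (rule exhausting_minorants) blast
  have esx: "translate_meas euclidean (poisson_exp euclidean M) (- barycentre M) = centred_exp M" for M by (simp add: centred_exp_def)
  have cluster: "\<exists>N\<in>?FM. M \<le> N \<and> centred_exp N \<in> U" if U: "openin (weak_topology euclidean) U" "\<rho> \<in> U" and M: "M \<in> ?FM" for U M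
  proof -
    have "\<exists>N. N \<in> ?FM \<and> M \<le> N \<and> cut (C n) \<le> N" for n
      by (rule minorant_join[OF M C(1) C(2)]) blast
    then obtain N where N: "\<And>n. N n \<in> ?FM" "\<And>n. M \<le> N n" "\<And>n. cut (C n) \<le> N n" by metis
    have lim: "(\<lambda>n. \<integral>\<^sup>+x. sq_sum x \<partial>N n) \<longlonglongrightarrow> (\<integral>\<^sup>+x. sq_sum x \<partial>\<Lambda>)"
    proof (rule tendsto_sandwich[OF _ _ C(3) tendsto_const])
      have "(\<integral>\<^sup>+x. sq_sum x \<partial>cut (C n)) \<le> (\<integral>\<^sup>+x. sq_sum x \<partial>N n)" for n
        using minorant_sets[OF C(2)] minorant_sets[OF N(1)] by (intro nn_integral_mono_measure N(3)) auto
      then show "eventually (\<lambda>n. (\<integral>\<^sup>+x. sq_sum x \<partial>cut (C n)) \<le> (\<integral>\<^sup>+x. sq_sum x \<partial>N n)) sequentially" by simp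
      have "(\<integral>\<^sup>+x. sq_sum x \<partial>N n) \<le> (\<integral>\<^sup>+x. sq_sum x \<partial>\<Lambda>)" for n
        using N(1)[of n] by (intro nn_integral_mono_measure) (auto simp: finite_minorants_def)
      then show "eventually (\<lambda>n. (\<integral>\<^sup>+x. sq_sum x \<partial>N n) \<le> (\<integral>\<^sup>+x. sq_sum x \<partial>\<Lambda>)) sequentially" by simp
    qed
    have "eventually (\<lambda>n. centred_exp (N n) \<in> U) sequentially"
    proof (rule weak_topology_eventually[OF U])
      show "centred_exp (N n) \<in> finite_borel_measures euclidean" for n
        by (rule prob_borel_imp_finite[OF centred_exp_prob[OF minorant_on_K[OF N(1)]]])
      fix f :: "'a \<Rightarrow> real" assume f: "continuous_map euclidean euclideanreal f" "bounded (f ` topspace euclidean)"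
      obtain B where B: "\<And>x. \<bar>f x\<bar> \<le> B" using f(2) unfolding bounded_iff by auto
      show "(\<lambda>n. \<integral>x. f x \<partial>centred_exp (N n)) \<longlonglongrightarrow> (\<integral>x. f x \<partial>\<rho>)"
        by (rule \<rho>(3)[OF N(1) lim _ B]) (use f(1) in simp)
    qed
    then obtain n where "centred_exp (N n) \<in> U" unfolding eventually_sequentially by blast
    then show ?thesis using N by blast
  qed
  have "gen_poisson_exp euclidean \<Lambda> \<rho>"
    unfolding gen_poisson_exp_def
  proof (intro conjI exI[of _ "\<lambda>M. - barycentre M"])
    show "uniformly_tight euclidean ((\<lambda>M. translate_meas euclidean (poisson_exp euclidean M) (- barycentre M)) ` ?FM)"
      unfolding esx by (rule centred_exp_uniformly_tight[OF tight order_refl])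
    show "\<forall>U. openin (weak_topology euclidean) U \<and> \<rho> \<in> U \<longrightarrow>
       (\<forall>M\<in>?FM. \<exists>N\<in>?FM. M \<le> N \<and> translate_meas euclidean (poisson_exp euclidean N) (- barycentre N) \<in> U)"
      unfolding esx using cluster by blast
  qed (use levy_measure_\<Lambda>[OF tight] prob_borel_imp_finite[OF \<rho>(1)] in auto)
  moreover have "emeasure \<rho> (disk_span K) = 1"
    using \<rho>(1,2) finite_measure.emeasure_eq_measure[OF prob_space.finite_measure, of \<rho> "disk_span K"]
    by (simp add: prob_borel_measures_iff)
  ultimately show ?thesis by blast
qed

theorem disk_tight_iff_gen_poisson_exp:
  "disk_tight \<longleftrightarrow> (\<exists>\<rho>. gen_poisson_exp euclidean \<Lambda> \<rho> \<and> emeasure \<rho> (disk_span K) = 1)"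
  using gen_poisson_exp_if_disk_tight disk_tight_if_gen_poisson_exp by blast

end

section \<open>The gauge norm\<close>

lemma borel_of_eqI:
  assumes "sets (borel_of T) = sets (borel_of T')"
  shows "borel_of T = borel_of T'"
  using assms by (intro measure_eqI) (simp_all add: borel_of_def emeasure_sigma)

lemma conv_meas_borel_cong: "borel_of T = borel_of T' \<Longrightarrow> conv_meas T = conv_meas T'"
  by (intro ext) (simp add: conv_meas_def)

lemma conv_power_borel_cong:
  assumes "borel_of T = borel_of T'" shows "conv_power T M n = conv_power T' M n"
  by (induction n) (simp_all add: assms conv_meas_borel_cong[OF assms])

text \<open>Convolutions and exponentials see a topology only through its Borel sets, which will be
  the same for the gauge norm and the induced topology; results are thereby shared by both.\<close>

lemma poisson_exp_borel_cong:
  assumes "borel_of T = borel_of T'" shows "poisson_exp T = poisson_exp T'"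
proof -
  have "topspace T = topspace T'" using arg_cong[OF assms, of space] by simp
  then show ?thesis by (intro ext) (simp add: poisson_exp_def assms conv_power_borel_cong[OF assms])
qed

lemma translate_meas_borel_cong: "borel_of T = borel_of T' \<Longrightarrow> translate_meas T = translate_meas T'"
  by (intro ext) (simp add: translate_meas_def conv_meas_borel_cong[of T T'])

lemma finite_borel_measures_cong: "borel_of T = borel_of T' \<Longrightarrow> finite_borel_measures T = finite_borel_measures T'"
  by (simp add: finite_borel_measures_def)

text \<open>With the Borel sets fixed, the topology enters the definition only through the compact
  sets in uniform tightness, and \<open>T'\<close> has at least as many of them.\<close>

lemma levy_measure_coarser:
  assumes B: "borel_of T = borel_of T'" and c: "\<And>C. compactin T C \<Longrightarrow> compactin T' C"
    and l: "levy_measure T \<nu>"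
  shows "levy_measure T' \<nu>"
proof -
  have ts: "topspace T = topspace T'" using arg_cong[OF B, of space] by simp
  have ut: "uniformly_tight T F \<Longrightarrow> uniformly_tight T' F" for F
    unfolding uniformly_tight_def finite_borel_measures_cong[OF B] ts using c by meson
  have st: "shift_tight T F \<Longrightarrow> shift_tight T' F" for F
    unfolding shift_tight_def translate_meas_borel_cong[OF B] ts using ut by meson
  have fm: "finite_minorants T \<nu> = finite_minorants T' \<nu>"
    by (simp add: finite_minorants_def finite_borel_measures_cong[OF B])
  note l' = l[unfolded levy_measure_def]
  obtain F where F: "F \<noteq> {} \<and> F \<subseteq> finite_minorants T \<nu> \<and>
        (\<forall>M\<in>F. \<forall>N\<in>F. \<exists>L\<in>F. M \<le> L \<and> N \<le> L) \<and>
        (\<forall>A\<in>sets \<nu>. emeasure \<nu> A = (SUP M\<in>F. emeasure M A)) \<and> shift_tight T (poisson_exp T ` F)"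
    by (rule exE[OF l'[THEN conjunct2, THEN conjunct2]])
  have "shift_tight T' (poisson_exp T' ` F)"
    using st[of "poisson_exp T ` F"] F unfolding poisson_exp_borel_cong[OF B] by blast
  with F have F': "F \<noteq> {} \<and> F \<subseteq> finite_minorants T' \<nu> \<and>
        (\<forall>M\<in>F. \<forall>N\<in>F. \<exists>L\<in>F. M \<le> L \<and> N \<le> L) \<and>
        (\<forall>A\<in>sets \<nu>. emeasure \<nu> A = (SUP M\<in>F. emeasure M A)) \<and> shift_tight T' (poisson_exp T' ` F)"
    unfolding fm by (elim conjE) (intro conjI)
  show ?thesis unfolding levy_measure_def
    by (intro conjI exI[of _ F] F' l'[THEN conjunct1, unfolded B] l'[THEN conjunct2, THEN conjunct1])
qed

text \<open>Induction on the measurable function. Directedness is used for sums, where two members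
  have to be dominated by one; monotone limits only exchange two suprema.\<close>

lemma nn_integral_directed_SUP:
  assumes F: "F \<noteq> {}" "\<And>M. M \<in> F \<Longrightarrow> sets M = sets \<nu>"
    and dir: "\<And>M N. M \<in> F \<Longrightarrow> N \<in> F \<Longrightarrow> \<exists>L\<in>F. M \<le> L \<and> N \<le> L"
    and sup: "\<And>A. A \<in> sets \<nu> \<Longrightarrow> emeasure \<nu> A = (SUP M\<in>F. emeasure M A)"
    and f: "f \<in> borel_measurable \<nu>"
  shows "(\<integral>\<^sup>+x. f x \<partial>\<nu>) = (SUP M\<in>F. \<integral>\<^sup>+x. f x \<partial>M)"
  using f
proof (induction rule: borel_measurable_induct)
  case (cong f g)
  have sp: "space M = space \<nu>" if "M \<in> F" for M using sets_eq_imp_space_eq[OF F(2)[OF that]] .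
  have "(\<integral>\<^sup>+x. f x \<partial>M) = (\<integral>\<^sup>+x. g x \<partial>M)" if "space M = space \<nu>" for M
    using cong(3) that by (intro nn_integral_cong) auto
  then show ?case using cong(4) sp by (auto cong: SUP_cong)
next
  case (set A)
  then show ?case using sup[OF set] F(2) by (auto intro!: SUP_cong)
next
  case (mult u c)
  have "(\<integral>\<^sup>+x. c * u x \<partial>M) = c * (\<integral>\<^sup>+x. u x \<partial>M)" if "M \<in> F" for M
    using mult(2) measurable_cong_sets[OF F(2)[OF that] refl] by (intro nn_integral_cmult) blast
  then have "(SUP M\<in>F. \<integral>\<^sup>+x. c * u x \<partial>M) = c * (SUP M\<in>F. \<integral>\<^sup>+x. u x \<partial>M)"
    unfolding SUP_mult_left_ennreal by (intro SUP_cong) auto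
  then show ?case using mult by (simp add: nn_integral_cmult)
next
  case (add u v)
  have "(\<integral>\<^sup>+x. v x + u x \<partial>M) = (\<integral>\<^sup>+x. v x \<partial>M) + (\<integral>\<^sup>+x. u x \<partial>M)" if "M \<in> F" for M
    using add(1,3) add(4) measurable_cong_sets[OF F(2)[OF that] refl] by (intro nn_integral_add) blast+
  then have "(SUP M\<in>F. \<integral>\<^sup>+x. v x + u x \<partial>M) = (SUP M\<in>F. (\<integral>\<^sup>+x. v x \<partial>M) + (\<integral>\<^sup>+x. u x \<partial>M))"
    by (intro SUP_cong) auto
  also have "\<dots> = (SUP M\<in>F. \<integral>\<^sup>+x. v x \<partial>M) + (SUP M\<in>F. \<integral>\<^sup>+x. u x \<partial>M)"
  proof (rule SUP_add_directed_ennreal)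
    fix M N assume MN: "M \<in> F" "N \<in> F"
    then obtain L where L: "L \<in> F" "M \<le> L" "N \<le> L" using dir by blast
    have "(\<integral>\<^sup>+x. v x \<partial>M) \<le> (\<integral>\<^sup>+x. v x \<partial>L)" "(\<integral>\<^sup>+x. u x \<partial>N) \<le> (\<integral>\<^sup>+x. u x \<partial>L)"
      using F(2) MN L by (auto intro!: nn_integral_mono_measure)
    then show "\<exists>k\<in>F. (\<integral>\<^sup>+x. v x \<partial>M) + (\<integral>\<^sup>+x. u x \<partial>N) \<le> (\<integral>\<^sup>+x. v x \<partial>k) + (\<integral>\<^sup>+x. u x \<partial>k)"
      using L(1) add_mono by blast
  qed
  finally show ?case using add by (simp add: nn_integral_add)
next
  case (seq U)
  have Um: "U i \<in> borel_measurable M" if "M \<in> F" for M i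
    using seq(1)[of i] measurable_cong_sets[OF F(2)[OF that] refl] by blast
  have "(\<integral>\<^sup>+x. (SUP i. U i) x \<partial>\<nu>) = (SUP i. \<integral>\<^sup>+x. U i x \<partial>\<nu>)"
    unfolding SUP_apply using seq(1,3) by (intro nn_integral_monotone_convergence_SUP) auto
  also have "\<dots> = (SUP i. SUP M\<in>F. \<integral>\<^sup>+x. U i x \<partial>M)" using seq by simp
  also have "\<dots> = (SUP M\<in>F. SUP i. \<integral>\<^sup>+x. U i x \<partial>M)" by (rule SUP_commute)
  also have "\<dots> = (SUP M\<in>F. \<integral>\<^sup>+x. (SUP i. U i) x \<partial>M)"
    unfolding SUP_apply using seq(3) Um by (intro SUP_cong refl nn_integral_monotone_convergence_SUP[symmetric]) auto
  finally show ?case by simp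
qed

section \<open>The separable Banach space spanned by the disk\<close>

locale disk_levy_gauge = disk_levy +
  assumes bounded_K: "tvs_bounded K" and separable_K: "separable_space (gauge_topology K)"
begin

abbreviation "D \<equiv> disk_span K"
abbreviation "E\<^sub>G \<equiv> gauge_topology K"
abbreviation "E\<^sub>S \<equiv> subtopology euclidean D"

lemmas D_props = disk_span_0[OF K(1)] disk_span_add[OF K(1)] disk_span_diff[OF K(1)] disk_span_minus[OF K(1)]

text \<open>The memberships for \<open>r + 1 / (n + 1)\<close> pass to the limit because
  \<open>K\<close> is closed.\<close>

lemma gauge_le_iff:
  assumes x: "x \<in> D" and r: "r > 0"
  shows "gauge_norm K x \<le> r \<longleftrightarrow> x \<in> (*\<^sub>R) r ` K"
proof
  assume le: "gauge_norm K x \<le> r"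
  have "(1 / (r + 1 / real (Suc n))) *\<^sub>R x \<in> K" for n
  proof -
    have p: "r + 1 / real (Suc n) > 0" using r by (simp add: add_pos_pos)
    have "gauge_norm K x < r + 1 / real (Suc n)" using le by (simp add: add_strict_increasing2 le_less_trans)
    then have "x \<in> (*\<^sub>R) (r + 1 / real (Suc n)) ` K" by (rule gauge_norm_less[OF K(1) x])
    then show ?thesis using p by auto
  qed
  moreover have "(\<lambda>n. (1 / (r + 1 / real (Suc n))) *\<^sub>R x) \<longlonglongrightarrow> (1 / r) *\<^sub>R x"
  proof (intro tendsto_scaleR_lc tendsto_const)
    have "(\<lambda>n. 1 / (r + 1 / real (Suc n))) \<longlonglongrightarrow> 1 / (r + 0)"
      using r LIMSEQ_inverse_real_of_nat by (intro tendsto_intros) (auto simp: inverse_eq_divide)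
    then show "(\<lambda>n. 1 / (r + 1 / real (Suc n))) \<longlonglongrightarrow> 1 / r" by simp
  qed
  ultimately have "(1 / r) *\<^sub>R x \<in> K" by (rule closed_sequentially[OF compact_imp_closed[OF K(2)]])
  then have "r *\<^sub>R ((1 / r) *\<^sub>R x) \<in> (*\<^sub>R) r ` K" by blast
  then show "x \<in> (*\<^sub>R) r ` K" using r by simp
qed (rule gauge_norm_lower[OF r _ K(1)])

lemma gauge_zero_iff: "x \<in> D \<Longrightarrow> gauge_norm K x = 0 \<longleftrightarrow> x = 0"
proof
  assume x: "x \<in> D" and g: "gauge_norm K x = 0"
  show "x = 0"
  proof (rule ccontr)
    assume "x \<noteq> 0"
    then obtain k where "a k x \<noteq> a k 0" using a_sep by blast
    then have k: "a k x \<noteq> 0" using linear_0[OF dual_space_linear[OF a_dual]] by simp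
    obtain B where B: "B > 0" "\<And>x. x \<in> K \<Longrightarrow> \<bar>a k x\<bar> \<le> B" using dual_bounded_K[OF a_dual] by blast
    define r where "r = \<bar>a k x\<bar> / (2 * B)"
    have r: "r > 0" using k B by (simp add: r_def)
    then have "x \<in> (*\<^sub>R) r ` K" using gauge_le_iff[OF x r] g by simp
    then obtain y where y: "y \<in> K" "x = r *\<^sub>R y" by blast
    have "\<bar>a k x\<bar> = r * \<bar>a k y\<bar>" unfolding y(2) using r linear_scale[OF dual_space_linear[OF a_dual], of k r y] by (simp add: abs_mult)
    also have "\<dots> \<le> r * B" using r B(2)[OF y(1)] by simp
    also have "\<dots> = \<bar>a k x\<bar> / 2" using B(1) by (simp add: r_def)
    finally show False using k by simp
  qed
qed (simp add: gauge_norm_0[OF K(1)])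

lemma gauge_minus: "x \<in> D \<Longrightarrow> y \<in> D \<Longrightarrow> gauge_norm K (x - y) = gauge_norm K (y - x)"
  using gauge_norm_scale[OF K(1) D_props(3)[of y x], of "-1"] by simp

sublocale G: Metric_space D "\<lambda>x y. gauge_norm K (x - y)"
proof
  show "0 \<le> gauge_norm K (x - y)" for x y by (rule gauge_norm_nonneg[OF K(1)])
  show "gauge_norm K (x - y) = gauge_norm K (y - x)" for x y
  proof (cases "x - y \<in> D")
    case True
    then show ?thesis using gauge_norm_scale[OF K(1) True, of "-1"] by simp
  next
    case False
    moreover have "y - x \<notin> D" using False D_props(4)[of "y - x"] by auto
    ultimately show ?thesis by (simp add: gauge_norm_def)
  qed
  show "gauge_norm K (x - y) = 0 \<longleftrightarrow> x = y" if "x \<in> D" "y \<in> D" for x y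
    using gauge_zero_iff[OF D_props(3)[OF that]] by simp
  show "gauge_norm K (x - z) \<le> gauge_norm K (x - y) + gauge_norm K (y - z)" if "x \<in> D" "y \<in> D" "z \<in> D" for x y z
    using gauge_norm_triangle[OF K(1) D_props(3)[OF that(1,2)] D_props(3)[OF that(2,3)]] by simp
qed

lemma gauge_topology_eq: "E\<^sub>G = G.mtopology"
  by (simp add: gauge_topology_def)

lemma topspace_gauge: "topspace E\<^sub>G = D"
  by (simp add: gauge_topology_eq)

lemma mcball_eq: "x \<in> D \<Longrightarrow> r > 0 \<Longrightarrow> G.mcball x r = (+) x ` (*\<^sub>R) r ` K"
proof (intro set_eqI iffI)
  fix y assume x: "x \<in> D" and r: "r > 0" and "y \<in> G.mcball x r"
  then have y: "y \<in> D" "gauge_norm K (y - x) \<le> r" using gauge_minus[of x y] by auto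
  then have "y - x \<in> (*\<^sub>R) r ` K" using gauge_le_iff[OF D_props(3)[OF y(1) x] r] by simp
  then have "x + (y - x) \<in> (+) x ` (*\<^sub>R) r ` K" by (rule imageI)
  then show "y \<in> (+) x ` (*\<^sub>R) r ` K" by simp
next
  fix y assume x: "x \<in> D" and r: "r > 0" and "y \<in> (+) x ` (*\<^sub>R) r ` K"
  then obtain u where u: "u \<in> (*\<^sub>R) r ` K" "y = x + u" by blast
  then have uD: "u \<in> D" using disk_span_iff[OF K(1)] r by blast
  then have "gauge_norm K (y - x) \<le> r" using u gauge_le_iff[OF uD r] by simp
  then show "y \<in> G.mcball x r" using x u uD D_props(2)[OF x uD] gauge_minus[of x y] by auto
qed

text \<open>Closed gauge balls are translates of multiples of \<open>K\<close>, so they are compact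
  for the topology of \<open>E\<close>. Their Borel measurability there and the completeness of the
  gauge norm both rest on this.\<close>

lemma compact_mcball: "x \<in> D \<Longrightarrow> r > 0 \<Longrightarrow> compact (G.mcball x r)"
  unfolding mcball_eq by (intro compact_continuous_image compact_scaled continuous_intros)

text \<open>Boundedness of \<open>K\<close> says that each neighbourhood of 0 contains a multiple of
  \<open>K\<close>, that is, a gauge ball.\<close>

lemma gauge_finer:
  assumes S: "open S" shows "openin E\<^sub>G (D \<inter> S)"
  unfolding gauge_topology_eq G.openin_mtopology_mcball
proof (intro conjI allI impI)
  fix x assume x: "x \<in> D \<inter> S"
  have "open {y. 1 *\<^sub>R y + x \<in> S}" by (rule open_scaled_preimage[OF S])
  moreover have "0 \<in> {y. 1 *\<^sub>R y + x \<in> S}" using x by simp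
  ultimately obtain t where t: "t > 0" "\<And>s. s \<ge> t \<Longrightarrow> K \<subseteq> (*\<^sub>R) s ` {y. 1 *\<^sub>R y + x \<in> S}"
    using bounded_K unfolding tvs_bounded_def by blast
  have "G.mcball x (1 / t) \<subseteq> S"
  proof -
    have xD: "x \<in> D" using x by simp
    show ?thesis
    proof
      fix y assume "y \<in> G.mcball x (1 / t)"
      then have "y \<in> (+) x ` (*\<^sub>R) (1 / t) ` K" using t(1) by (simp only: mcball_eq[OF xD] zero_less_divide_1_iff)
      then obtain k where k: "k \<in> K" "y = x + (1 / t) *\<^sub>R k" by blast
      obtain u where u: "1 *\<^sub>R u + x \<in> S" "k = t *\<^sub>R u" using t(2)[of t] k(1) by blast
      then show "y \<in> S" using k t(1) by (simp add: add.commute)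
    qed
  qed
  then show "\<exists>r>0. G.mcball x r \<subseteq> D \<inter> S" using t(1) by (intro exI[of _ "1 / t"]) auto
qed simp

lemma gauge_dense:
  obtains X where "countable X" "X \<subseteq> D" "\<And>x r. x \<in> D \<Longrightarrow> r > 0 \<Longrightarrow> \<exists>d\<in>X. gauge_norm K (x - d) < r"
proof -
  obtain X where X: "countable X" "X \<subseteq> D" "G.mtopology closure_of X = D"
    using separable_K unfolding separable_space_def gauge_topology_eq G.topspace_mtopology by blast
  show thesis
  proof (rule that[OF X(1,2)])
    fix x and r :: real assume x: "x \<in> D" and r: "r > 0"
    then have "x \<in> G.mtopology closure_of X" using X(3) by simp
    then obtain d where d: "d \<in> X" "d \<in> G.mball x r"
      unfolding G.metric_closure_of using r by blast
    then show "\<exists>d\<in>X. gauge_norm K (x - d) < r" by auto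
  qed
qed

text \<open>By separability a gauge-open set is a countable union of closed balls around points of a
  dense set, and these are compact, hence Borel, in \<open>E\<close>.\<close>

lemma gauge_open_borel:
  assumes W: "openin E\<^sub>G W" shows "W \<in> sets borel"
proof -
  obtain X where X: "countable X" "X \<subseteq> D" "\<And>x r. x \<in> D \<Longrightarrow> r > 0 \<Longrightarrow> \<exists>d\<in>X. gauge_norm K (x - d) < r"
    by (rule gauge_dense) blast
  define I where "I = {p \<in> X \<times> (UNIV :: nat set). G.mcball (fst p) (1 / Suc (snd p)) \<subseteq> W}"
  have "I \<subseteq> X \<times> UNIV" unfolding I_def by blast
  then have "countable I" by (rule countable_subset) (intro countable_SIGMA X(1) countableI_type)
  have WD: "W \<subseteq> D" using openin_subset[OF W] topspace_gauge by simp
  have W': "\<exists>r>0. G.mball x r \<subseteq> W" if "x \<in> W" for x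
    using W that by (simp add: gauge_topology_eq G.openin_mtopology)
  have "W = (\<Union>p\<in>I. G.mcball (fst p) (1 / Suc (snd p)))"
  proof
    show "W \<subseteq> (\<Union>p\<in>I. G.mcball (fst p) (1 / Suc (snd p)))"
    proof
      fix x assume x: "x \<in> W"
      then obtain r where r: "r > 0" "G.mball x r \<subseteq> W" using W'[OF x] by blast
      obtain n :: nat where n: "1 / Suc n < r / 2" using nat_approx_posE[of "r / 2"] r(1) by auto
      obtain d where d: "d \<in> X" "gauge_norm K (x - d) < 1 / Suc n" using X(3)[of x "1 / Suc n"] x WD by auto
      have dD: "d \<in> D" and xD: "x \<in> D" using d X x WD by auto
      have "G.mcball d (1 / Suc n) \<subseteq> W"
      proof
        fix y assume y: "y \<in> G.mcball d (1 / Suc n)"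
        then have yD: "y \<in> D" "gauge_norm K (d - y) \<le> 1 / Suc n" by auto
        have "gauge_norm K (x - y) \<le> gauge_norm K (x - d) + gauge_norm K (d - y)" by (rule G.triangle[OF xD dD yD(1)])
        also have "\<dots> < r" using d yD n by simp
        finally show "y \<in> W" using r xD yD by auto
      qed
      moreover have "x \<in> G.mcball d (1 / Suc n)" using d(2) dD xD gauge_minus[of x d] by auto
      ultimately show "x \<in> (\<Union>p\<in>I. G.mcball (fst p) (1 / Suc (snd p)))"
        using d(1) by (intro UN_I[of "(d, n)"]) (auto simp: I_def)
    qed
  qed (auto simp: I_def)
  moreover have "G.mcball (fst p) (1 / Suc (snd p)) \<in> sets borel" if "p \<in> I" for p
    using that X(2) by (intro borel_closed compact_imp_closed compact_mcball) (auto simp: I_def)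
  ultimately show ?thesis using \<open>countable I\<close> by (auto intro!: sets.countable_UN')
qed

text \<open>Formulated for a variable topology, so that the Borel sets of the gauge topology and of
  the induced topology are both identified with the trace of the Borel sets of \<open>E\<close>,
  hence with each other.\<close>

lemma sets_borel_of_D:
  assumes fine: "\<And>S. open S \<Longrightarrow> openin \<T> (D \<inter> S)" and borel: "\<And>W. openin \<T> W \<Longrightarrow> W \<in> sets borel"
    and ts: "topspace \<T> = D"
  shows "sets (borel_of \<T>) = sets (restrict_space borel D)"
proof
  show "sets (borel_of \<T>) \<subseteq> sets (restrict_space borel D)"
  proof -
    have "{U. openin \<T> U} \<subseteq> Pow (topspace \<T>)" using openin_subset by auto
    moreover have "{U. openin \<T> U} \<subseteq> sets (restrict_space borel D)"
    proof
      fix U assume "U \<in> {U. openin \<T> U}"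
      then have "U \<in> sets borel" "U \<subseteq> D" using borel openin_subset[of \<T> U] ts by auto
      then show "U \<in> sets (restrict_space borel D)" by (auto simp: sets_restrict_space)
    qed
    moreover have "space (restrict_space borel D) = topspace \<T>" by (simp add: space_restrict_space ts)
    ultimately show ?thesis
      unfolding borel_of_def by (metis sets.sigma_sets_subset sets_measure_of)
  qed
  show "sets (restrict_space borel D) \<subseteq> sets (borel_of \<T>)"
  proof -
    have op: "openin \<T> U \<Longrightarrow> U \<in> sets (borel_of \<T>)" for U
      unfolding borel_of_def using openin_subset by (subst sets_measure_of) auto
    have m: "(\<lambda>x. x) \<in> borel_of \<T> \<rightarrow>\<^sub>M borel"
    proof (rule borel_measurableI)
      fix S :: "'a set" assume S: "open S"
      have "(\<lambda>x. x) -` S \<inter> space (borel_of \<T>) = D \<inter> S" by (auto simp: ts)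
      then show "(\<lambda>x. x) -` S \<inter> space (borel_of \<T>) \<in> sets (borel_of \<T>)" using op[OF fine[OF S]] by simp
    qed
    show ?thesis
    proof
      fix A assume "A \<in> sets (restrict_space borel D)"
      then obtain B where "B \<in> sets borel" "A = D \<inter> B" by (auto simp: sets_restrict_space)
      then show "A \<in> sets (borel_of \<T>)" using measurable_sets[OF m, of B] by (simp add: ts Int_commute)
    qed
  qed
qed

lemma sets_borel_of_gauge: "sets (borel_of E\<^sub>G) = sets (restrict_space borel D)"
  by (rule sets_borel_of_D[OF gauge_finer gauge_open_borel topspace_gauge])

lemma sets_borel_of_sub: "sets (borel_of E\<^sub>S) = sets (restrict_space borel D)"
  by (rule sets_borel_of_D) (auto simp: openin_subtopology)

lemma borel_of_gauge_eq: "borel_of E\<^sub>G = borel_of E\<^sub>S"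
  by (rule borel_of_eqI) (simp add: sets_borel_of_gauge sets_borel_of_sub)

lemma compactin_gauge_imp_sub: "compactin E\<^sub>G C \<Longrightarrow> compactin E\<^sub>S C"
proof -
  assume C: "compactin E\<^sub>G C"
  have "continuous_map E\<^sub>G E\<^sub>S (\<lambda>x. x)"
    unfolding continuous_map_def
  proof (intro conjI allI impI)
    fix U assume "openin E\<^sub>S U"
    then obtain S where "open S" "U = D \<inter> S" by (auto simp: openin_subtopology Int_commute)
    moreover have "{x \<in> topspace E\<^sub>G. x \<in> D \<inter> S} = D \<inter> S" for S by (auto simp: topspace_gauge)
    ultimately show "openin E\<^sub>G {x \<in> topspace E\<^sub>G. x \<in> U}" using gauge_finer by simp
  qed (simp add: topspace_gauge)
  from image_compactin[OF C this] show ?thesis by simp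
qed

text \<open>The closed balls of radius \<open>1 / (j + 1)\<close> around suitable terms are compact
  in \<open>E\<close> and have the finite intersection property; a common point is the
  limit.\<close>

lemma gauge_complete: "G.mcomplete"
  unfolding G.mcomplete_def
proof (intro allI impI)
  fix \<sigma> :: "nat \<Rightarrow> 'a" assume c: "G.MCauchy \<sigma>"
  then have \<sigma>D: "\<sigma> n \<in> D" for n by (auto simp: G.MCauchy_def)
  have "\<exists>N. \<forall>n n'. N \<le> n \<longrightarrow> N \<le> n' \<longrightarrow> gauge_norm K (\<sigma> n - \<sigma> n') < 1 / real (Suc j)" for j
    using c unfolding G.MCauchy_def by (meson of_nat_0_less_iff zero_less_Suc zero_less_divide_1_iff)
  then obtain N where N: "\<And>j n n'. N j \<le> n \<Longrightarrow> N j \<le> n' \<Longrightarrow> gauge_norm K (\<sigma> n - \<sigma> n') < 1 / real (Suc j)" by metis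
  define B where "B j = G.mcball (\<sigma> (N j)) (1 / real (Suc j))" for j
  have Bc: "compact (B j)" for j unfolding B_def by (intro compact_mcball \<sigma>D) simp
  have "B 0 \<inter> (\<Inter>j\<in>UNIV. B j) \<noteq> {}"
  proof (rule compact_imp_fip_image[OF Bc])
    show "closed (B j)" for j by (rule compact_imp_closed[OF Bc])
    fix I :: "nat set" assume I: "finite I"
    \<comment> \<open>The inserted 0 accounts for the base set \<open>B 0\<close> of the
      intersection.\<close>
    define n where "n = Max (N ` insert 0 I)"
    have "\<sigma> n \<in> B j" if "j \<in> insert 0 I" for j
    proof -
      have "N j \<le> n" unfolding n_def using I that by (intro Max_ge) auto
      then have "gauge_norm K (\<sigma> (N j) - \<sigma> n) < 1 / real (Suc j)" by (intro N) auto
      then show ?thesis using \<sigma>D by (auto simp: B_def)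
    qed
    then show "B 0 \<inter> (\<Inter>j\<in>I. B j) \<noteq> {}" by blast
  qed
  then obtain x where x: "\<And>j. x \<in> B j" by blast
  have xD: "x \<in> D" using x[of 0] by (simp add: B_def)
  have "limitin G.mtopology \<sigma> x sequentially"
    unfolding G.limitin_metric
  proof (intro conjI allI impI)
    fix e :: real assume e: "e > 0"
    obtain j :: nat where j: "1 / Suc j < e / 2" using nat_approx_posE[of "e / 2"] e by auto
    have "gauge_norm K (\<sigma> n - x) < e" if "n \<ge> N j" for n
    proof -
      have "gauge_norm K (\<sigma> n - x) \<le> gauge_norm K (\<sigma> n - \<sigma> (N j)) + gauge_norm K (\<sigma> (N j) - x)"
        by (rule G.triangle[OF \<sigma>D \<sigma>D xD])
      moreover have "gauge_norm K (\<sigma> n - \<sigma> (N j)) < 1 / Suc j" using N[OF that order_refl] by simp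
      moreover have "gauge_norm K (\<sigma> (N j) - x) \<le> 1 / Suc j" using x[of j] by (simp add: B_def)
      ultimately show ?thesis using j by linarith
    qed
    then show "eventually (\<lambda>n. \<sigma> n \<in> D \<and> gauge_norm K (\<sigma> n - x) < e) sequentially"
      using \<sigma>D by (intro eventually_sequentiallyI[of "N j"]) auto
  qed (rule xD)
  then show "\<exists>x. limitin G.mtopology \<sigma> x sequentially" by blast
qed

text \<open>Ulam's argument: the gauge norm is complete and separable, and its balls are Borel sets of \<open>E\<close>.\<close>

lemma gauge_tight:
  assumes \<rho>: "prob_space \<rho>" "sets \<rho> = sets borel" "measure \<rho> D = 1" and e: "e > 0"
  obtains C where "compactin E\<^sub>G C" "measure \<rho> C \<ge> 1 - e"
proof -
  interpret prob_space \<rho> by (rule \<rho>(1))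
  obtain X where X: "countable X" "X \<subseteq> D" "\<And>x r. x \<in> D \<Longrightarrow> r > 0 \<Longrightarrow> \<exists>d\<in>X. gauge_norm K (x - d) < r"
    by (rule gauge_dense) blast
  have Xne: "X \<noteq> {}" using X(3)[OF D_props(1), of 1] by auto
  define d where "d = from_nat_into X"
  have dX: "d i \<in> D" for i unfolding d_def using from_nat_into[OF Xne] X(2) by blast
  define B where "B j i = G.mcball (d i) (1 / real (Suc j))" for j i
  have Bc: "compact (B j i)" for j i unfolding B_def by (intro compact_mcball dX) simp
  have Bs: "B j i \<in> sets \<rho>" for j i unfolding \<rho>(2) by (rule borel_closed[OF compact_imp_closed[OF Bc]])
  have DB: "(\<Union>i. B j i) = D" for j
  proof
    show "D \<subseteq> (\<Union>i. B j i)"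
    proof
      fix x assume x: "x \<in> D"
      obtain y where y: "y \<in> X" "gauge_norm K (x - y) < 1 / real (Suc j)" using X(3)[OF x, of "1 / real (Suc j)"] by auto
      obtain i where i: "y = d i" unfolding d_def using from_nat_into_surj[OF X(1) y(1)] by metis
      show "x \<in> (\<Union>i. B j i)" using x y(2) dX[of i] gauge_minus[of x "d i"] unfolding i by (auto simp: B_def intro!: exI[of _ i])
    qed
  qed (auto simp: B_def)
  have "\<exists>n. measure \<rho> (D - (\<Union>i\<le>n. B j i)) < e * (1/2) ^ Suc j" for j
  proof -
    have "(\<lambda>n. measure \<rho> (\<Union>i\<le>n. B j i)) \<longlonglongrightarrow> measure \<rho> (\<Union>n. \<Union>i\<le>n. B j i)"
      using Bs by (intro finite_Lim_measure_incseq) (auto simp: incseq_def intro: order_trans)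
    moreover have "(\<Union>n. \<Union>i\<le>n. B j i) = D" using DB[of j] by auto
    ultimately have "(\<lambda>n. measure \<rho> (\<Union>i\<le>n. B j i)) \<longlonglongrightarrow> 1" using \<rho>(3) by simp
    from order_tendstoD(1)[OF this, of "1 - e * (1/2) ^ Suc j"] e
    obtain n where n: "measure \<rho> (\<Union>i\<le>n. B j i) > 1 - e * (1/2) ^ Suc j" unfolding eventually_sequentially by auto
    have "measure \<rho> (D - (\<Union>i\<le>n. B j i)) = measure \<rho> D - measure \<rho> (\<Union>i\<le>n. B j i)"
      using DB[of j] Bs by (intro finite_measure_Diff) (auto simp: \<rho>(2))
    then show ?thesis using n \<rho>(3) by (intro exI[of _ n]) simp
  qed
  then obtain n where n: "\<And>j. measure \<rho> (D - (\<Union>i\<le>n j. B j i)) < e * (1/2) ^ Suc j" by metis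
  define C where "C = (\<Inter>j. \<Union>i\<le>n j. B j i)"
  have CD: "C \<subseteq> D" using DB unfolding C_def by blast
  have tb: "G.mtotally_bounded C"
    unfolding G.mtotally_bounded_def
  proof (intro allI impI)
    fix r :: real assume r: "r > 0"
    obtain j :: nat where j: "1 / Suc j < r / 2" using nat_approx_posE[of "r / 2"] r by auto
    \<comment> \<open>Total boundedness asks for centres inside \<open>C\<close>, whereas the
      \<open>d i\<close> may lie outside. A point of \<open>C\<close> in each ball replaces them,
      which doubles the radius and explains \<open>r / 2\<close>.\<close>
    define pick where "pick i = (SOME x. x \<in> C \<inter> B j i)" for i
    define Y where "Y = pick ` {i. i \<le> n j \<and> C \<inter> B j i \<noteq> {}}"
    have pick: "pick i \<in> C \<inter> B j i" if ne: "C \<inter> B j i \<noteq> {}" for i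
    proof -
      have "\<exists>x. x \<in> C \<inter> B j i" using ne by blast
      then show ?thesis unfolding pick_def by (rule someI_ex)
    qed
    have "C \<subseteq> (\<Union>x\<in>Y. G.mball x r)"
    proof
      fix x assume x: "x \<in> C"
      then obtain i where i: "i \<le> n j" "x \<in> B j i" unfolding C_def by blast
      then have p: "pick i \<in> B j i" "pick i \<in> Y" using pick[of i] x by (auto simp: Y_def)
      have D: "pick i \<in> D" "x \<in> D" using p i by (auto simp: B_def)
      have "gauge_norm K (pick i - x) \<le> gauge_norm K (pick i - d i) + gauge_norm K (d i - x)"
        by (rule G.triangle[OF D(1) dX D(2)])
      also have "\<dots> < r" using p(1) i(2) j gauge_minus[OF D(1) dX[of i]] by (auto simp: B_def)
      finally show "x \<in> (\<Union>x\<in>Y. G.mball x r)" using p(2) D by (auto intro!: bexI[of _ "pick i"])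
    qed
    moreover have "finite Y" "Y \<subseteq> C" using pick by (auto simp: Y_def)
    ultimately show "\<exists>S. finite S \<and> S \<subseteq> C \<and> C \<subseteq> (\<Union>x\<in>S. G.mball x r)" by blast
  qed
  have cl: "closedin G.mtopology C"
  proof -
    have "closedin G.mtopology (\<Union>i\<le>n j. B j i)" for j
      unfolding B_def by (intro closedin_Union) (auto simp: G.closedin_mcball)
    then show ?thesis unfolding C_def by (intro closedin_Inter) auto
  qed
  have comp: "compactin E\<^sub>G C"
    unfolding gauge_topology_eq
    using G.mtotally_bounded_eq_compact_closure_of[OF gauge_complete, of C] tb closure_of_closedin[OF cl] by simp
  have Cs: "C \<in> sets \<rho>" unfolding C_def using Bs by (intro sets.countable_INT) auto
  have geo: "(\<lambda>j. e * (1/2) ^ Suc j) sums e" using sums_mult[OF power_half_series, of e] by simp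
  have "measure \<rho> (D - C) \<le> e"
  proof -
    have "D - C = (\<Union>j. D - (\<Union>i\<le>n j. B j i))" unfolding C_def by blast
    also have "measure \<rho> \<dots> \<le> (\<Sum>j. measure \<rho> (D - (\<Union>i\<le>n j. B j i)))"
    proof (rule finite_measure_subadditive_countably)
      show "range (\<lambda>j. D - (\<Union>i\<le>n j. B j i)) \<subseteq> sets \<rho>" using Bs by (auto simp: \<rho>(2))
      show "summable (\<lambda>j. measure \<rho> (D - (\<Union>i\<le>n j. B j i)))"
        by (rule summable_comparison_test'[OF sums_summable[OF geo]]) (use n in \<open>auto intro: less_imp_le\<close>)
    qed
    also have "\<dots> \<le> (\<Sum>j. e * (1/2) ^ Suc j)"
    proof (rule suminf_le[OF less_imp_le[OF n]])
      show "summable (\<lambda>j. measure \<rho> (D - (\<Union>i\<le>n j. B j i)))"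
        by (rule summable_comparison_test'[OF sums_summable[OF geo]]) (use n in \<open>auto intro: less_imp_le\<close>)
    qed (rule sums_summable[OF geo])
    also have "\<dots> = e" by (rule sums_unique[OF geo, symmetric])
    finally show ?thesis .
  qed
  moreover have "measure \<rho> (D - C) = measure \<rho> D - measure \<rho> C" using Cs CD by (intro finite_measure_Diff) (auto simp: \<rho>(2))
  ultimately show thesis using comp \<rho>(3) by (intro that[of C]) auto
qed

section \<open>Measures on the span of the disk and on the whole space\<close>

lemma sets_restrict_D: "sets M = sets borel \<Longrightarrow> sets (restrict_space M D) = sets (borel_of E\<^sub>S)"
  unfolding sets_borel_of_sub by (rule sets_restrict_space_cong)

lemma id_sub_measurable: "(\<lambda>x. x) \<in> borel_of E\<^sub>S \<rightarrow>\<^sub>M borel"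
proof -
  have "(\<lambda>x. x) \<in> restrict_space borel D \<rightarrow>\<^sub>M borel" by (rule measurable_restrict_space1) simp
  then show ?thesis using measurable_cong_sets[OF sets_borel_of_sub refl] by blast
qed

lemma additive_space_sub: "additive_space E\<^sub>S"
  unfolding additive_space_def
proof
  show "0 \<in> topspace E\<^sub>S" using D_props(1) by simp
  let ?R = "borel_of E\<^sub>S"
  have "(\<lambda>p. (fst p, snd p)) \<in> ?R \<Otimes>\<^sub>M ?R \<rightarrow>\<^sub>M borel \<Otimes>\<^sub>M borel"
    using measurable_compose[OF measurable_fst id_sub_measurable] measurable_compose[OF measurable_snd id_sub_measurable]
    by (intro measurable_Pair)
  from measurable_compose[OF this add_meas]
  have "(\<lambda>(x, y). x + y) \<in> ?R \<Otimes>\<^sub>M ?R \<rightarrow>\<^sub>M borel" by (simp add: case_prod_beta)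
  then have "(\<lambda>(x, y). x + y) \<in> ?R \<Otimes>\<^sub>M ?R \<rightarrow>\<^sub>M restrict_space borel D"
    using D_props(2) by (intro measurable_restrict_space2) (auto simp: space_pair_measure)
  then show "(\<lambda>(x, y). x + y) \<in> ?R \<Otimes>\<^sub>M ?R \<rightarrow>\<^sub>M ?R"
    using measurable_cong_sets[OF refl sets_borel_of_sub] by blast
qed

text \<open>Undoes \<open>restrict_space\<close> for measures without mass off \<open>D\<close>.
  Being the image under an additive measurable map, it commutes with exponentials and
  translations.\<close>

definition extend :: "'a measure \<Rightarrow> 'a measure" where "extend N = distr N borel (\<lambda>x. x)"

lemma inclusion_hom: "(\<lambda>x. x) \<in> borel_of E\<^sub>S \<rightarrow>\<^sub>M borel_of euclidean" "additive_map E\<^sub>S (\<lambda>x. x)"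
  using id_sub_measurable by (auto simp: additive_map_def)

lemma extend_finite: "N \<in> finite_borel_measures E\<^sub>S \<Longrightarrow> extend N \<in> finite_borel_measures euclidean"
  using distr_hom_finite[OF additive_space_sub additive_space_E inclusion_hom] by (simp add: extend_def)

lemma extend_poisson: "N \<in> finite_borel_measures E\<^sub>S \<Longrightarrow> extend (poisson_exp E\<^sub>S N) = poisson_exp euclidean (extend N)"
  using distr_hom_poisson_exp[OF additive_space_sub additive_space_E inclusion_hom] by (simp add: extend_def)

lemma extend_translate:
  "N \<in> finite_borel_measures E\<^sub>S \<Longrightarrow> x \<in> D \<Longrightarrow> extend (translate_meas E\<^sub>S N x) = translate_meas euclidean (extend N) x"
  using distr_hom_translate_meas[OF additive_space_sub additive_space_E inclusion_hom, of N x] by (simp add: extend_def)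

lemma extend_emeasure:
  assumes N: "N \<in> finite_borel_measures E\<^sub>S" and A: "A \<in> sets borel"
  shows "emeasure (extend N) A = emeasure N (A \<inter> D)"
proof -
  have "(\<lambda>x. x) \<in> N \<rightarrow>\<^sub>M borel"
    using id_sub_measurable N measurable_cong_sets[of N "borel_of E\<^sub>S" borel borel] by (auto simp: finite_borel_measures_iff)
  then show ?thesis unfolding extend_def using A finite_borel_measures_space[OF N] by (subst emeasure_distr) auto
qed

lemma restrict_emeasure:
  assumes "sets M = sets borel" "A \<in> sets borel" "A \<subseteq> D"
  shows "emeasure (restrict_space M D) A = emeasure M A"
  using assms sets_eq_imp_space_eq[OF assms(1)] by (intro emeasure_restrict_space) auto

lemma restrict_finite:
  assumes "M \<in> finite_borel_measures euclidean" shows "restrict_space M D \<in> finite_borel_measures E\<^sub>S"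
proof -
  have M: "sets M = sets borel" "finite_measure M" using assms by (auto simp: finite_borel_measures_iff)
  have "emeasure (restrict_space M D) (space (restrict_space M D)) = emeasure M D"
    using M sets_eq_imp_space_eq[OF M(1)] by (subst restrict_emeasure) (auto simp: space_restrict_space)
  then have "finite_measure (restrict_space M D)"
    using finite_measure.emeasure_finite[OF M(2), of D] by (intro finite_measureI) simp
  then show ?thesis using sets_restrict_D[OF M(1)] by (simp add: finite_borel_measures_iff)
qed

lemma extend_restrict:
  assumes "M \<in> finite_borel_measures euclidean" "emeasure M (- D) = 0" shows "extend (restrict_space M D) = M"
proof (rule measure_eqI)
  have M: "sets M = sets borel" using assms by (auto simp: finite_borel_measures_iff)
  show "sets (extend (restrict_space M D)) = sets M" by (simp add: extend_def M)
  fix A assume "A \<in> sets (extend (restrict_space M D))"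
  then have A: "A \<in> sets borel" by (simp add: extend_def)
  have "emeasure (extend (restrict_space M D)) A = emeasure M (A \<inter> D)"
    unfolding extend_emeasure[OF restrict_finite[OF assms(1)] A] using A by (intro restrict_emeasure M) auto
  also have "\<dots> = emeasure M A"
  proof (rule emeasure_eq_AE)
    have "AE x in M. x \<in> D" using assms(2) by (intro AE_I[of _ _ "- D"]) (auto simp: M)
    then show "AE x in M. x \<in> A \<inter> D \<longleftrightarrow> x \<in> A" by eventually_elim simp
  qed (use A in \<open>auto simp: M\<close>)
  finally show "emeasure (extend (restrict_space M D)) A = emeasure M A" .
qed

lemma null_compl_D: "emeasure M (- K) = 0 \<Longrightarrow> sets M = sets borel \<Longrightarrow> emeasure M (- D) = 0"
  using emeasure_mono[of "- D" "- K" M] subset_disk_span[OF K(1)] by auto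

abbreviation "\<Lambda>\<^sub>D \<equiv> restrict_space \<Lambda> D"

lemma sets_\<Lambda>D: "sets \<Lambda>\<^sub>D = sets (borel_of E\<^sub>S)"
  by (rule sets_restrict_D[OF sets_\<Lambda>])

lemma extend_minorant:
  assumes N: "N \<in> finite_minorants E\<^sub>S \<Lambda>\<^sub>D" shows "extend N \<in> finite_minorants euclidean \<Lambda>"
proof -
  have Nf: "N \<in> finite_borel_measures E\<^sub>S" using N by (simp add: finite_minorants_def)
  have "emeasure (extend N) A \<le> emeasure \<Lambda> A" if A: "A \<in> sets borel" for A
  proof -
    have "A \<inter> D \<in> sets N"
      using N A by (auto simp: finite_minorants_iff sets_borel_of_sub sets_restrict_space)
    then have "emeasure N (A \<inter> D) \<le> emeasure \<Lambda>\<^sub>D (A \<inter> D)" using N by (auto simp: finite_minorants_iff)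
    also have "\<dots> = emeasure \<Lambda> (A \<inter> D)" using A by (intro restrict_emeasure sets_\<Lambda>) auto
    also have "\<dots> \<le> emeasure \<Lambda> A" using A by (intro emeasure_mono) (auto simp: sets_\<Lambda>)
    finally show ?thesis unfolding extend_emeasure[OF Nf A] .
  qed
  then show ?thesis using extend_finite[OF Nf] by (simp add: finite_minorants_iff finite_borel_measures_iff sets_\<Lambda>)
qed

lemma restrict_minorant:
  assumes M: "M \<in> finite_minorants euclidean \<Lambda>" shows "restrict_space M D \<in> finite_minorants E\<^sub>S \<Lambda>\<^sub>D"
proof -
  have Mf: "M \<in> finite_borel_measures euclidean" using M by (simp add: finite_minorants_def)
  have "emeasure (restrict_space M D) A \<le> emeasure \<Lambda>\<^sub>D A" if "A \<in> sets (borel_of E\<^sub>S)" for A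
  proof -
    have A: "A \<in> sets borel" "A \<subseteq> D" using that by (auto simp: sets_borel_of_sub sets_restrict_space)
    show ?thesis
      unfolding restrict_emeasure[OF sets_\<Lambda> A] restrict_emeasure[OF minorant_sets[OF M] A] by (rule minorant_le[OF M])
  qed
  then show ?thesis using restrict_finite[OF Mf] sets_\<Lambda>D by (auto simp: finite_minorants_iff finite_borel_measures_iff)
qed

text \<open>The directed family may have no cofinal sequence, but the supremum of the integrals of
  \<open>sq_sum\<close> is approached along a sequence of members, and this scalar criterion is what
  \<open>disk_tight_if_translates\<close> asks for. The tightness sets are compact in the induced
  topology, hence compact subsets of \<open>E\<close> inside \<open>D\<close>.\<close>

lemma disk_tight_if_levy_sub:
  assumes l: "levy_measure E\<^sub>S \<Lambda>\<^sub>D" shows disk_tight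
proof -
  note l' = l[unfolded levy_measure_def]
  obtain F where F': "F \<noteq> {} \<and> F \<subseteq> finite_minorants E\<^sub>S \<Lambda>\<^sub>D \<and>
        (\<forall>M\<in>F. \<forall>N\<in>F. \<exists>L\<in>F. M \<le> L \<and> N \<le> L) \<and>
        (\<forall>A\<in>sets \<Lambda>\<^sub>D. emeasure \<Lambda>\<^sub>D A = (SUP M\<in>F. emeasure M A)) \<and> shift_tight E\<^sub>S (poisson_exp E\<^sub>S ` F)"
    by (rule exE[OF l'[THEN conjunct2, THEN conjunct2]])
  then have F: "F \<noteq> {}" "F \<subseteq> finite_minorants E\<^sub>S \<Lambda>\<^sub>D" by simp_all
  have Ff: "M \<in> finite_borel_measures E\<^sub>S" if "M \<in> F" for M using F(2) that by (auto simp: finite_minorants_def)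
  have Fs: "sets M = sets \<Lambda>\<^sub>D" if "M \<in> F" for M using F(2) that by (auto simp: finite_minorants_def)
  have hsR: "sq_sum \<in> borel_measurable N" if "sets N = sets (borel_of E\<^sub>S)" for N
    using measurable_compose[OF id_sub_measurable sq_sum_measurable] measurable_cong_sets[OF that refl] by blast
  have sup: "(\<integral>\<^sup>+x. sq_sum x \<partial>\<Lambda>\<^sub>D) = (SUP M\<in>F. \<integral>\<^sup>+x. sq_sum x \<partial>M)"
  proof (rule nn_integral_directed_SUP[OF F(1) Fs])
    show "\<exists>L\<in>F. M \<le> L \<and> N \<le> L" if "M \<in> F" "N \<in> F" for M N using F' that by blast
    show "emeasure \<Lambda>\<^sub>D A = (SUP M\<in>F. emeasure M A)" if "A \<in> sets \<Lambda>\<^sub>D" for A using F' that by blast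
  qed (auto intro: hsR[OF sets_\<Lambda>D])
  have "(\<integral>\<^sup>+x. sq_sum x \<partial>\<Lambda>\<^sub>D) = (\<integral>\<^sup>+x. sq_sum x * indicator D x \<partial>\<Lambda>)"
    using \<Lambda>_space sets_\<Lambda> by (intro nn_integral_restrict_space) auto
  also have "\<dots> = (\<integral>\<^sup>+x. sq_sum x \<partial>\<Lambda>)"
  proof (rule nn_integral_cong_AE)
    show "AE x in \<Lambda>. sq_sum x * indicator D x = sq_sum x"
      using \<Lambda>_AE by eventually_elim (use subset_disk_span[OF K(1)] in auto)
  qed
  finally have supE: "(\<integral>\<^sup>+x. sq_sum x \<partial>\<Lambda>) = (SUP M\<in>F. \<integral>\<^sup>+x. sq_sum x \<partial>M)" using sup by simp
  obtain f :: "nat \<Rightarrow> ennreal" where f: "incseq f" "range f \<subseteq> (\<lambda>M. \<integral>\<^sup>+x. sq_sum x \<partial>M) ` F" "(SUP M\<in>F. \<integral>\<^sup>+x. sq_sum x \<partial>M) = (SUP i. f i)"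
    using ennreal_Sup_countable_SUP[of "(\<lambda>M. \<integral>\<^sup>+x. sq_sum x \<partial>M) ` F"] F(1) by auto
  have "\<exists>M\<in>F. f n = (\<integral>\<^sup>+x. sq_sum x \<partial>M)" for n using f(2) by blast
  then obtain M where M: "\<And>n. M n \<in> F" "\<And>n. f n = (\<integral>\<^sup>+x. sq_sum x \<partial>M n)" by metis
  define N where "N n = extend (M n)" for n
  have N: "N n \<in> finite_minorants euclidean \<Lambda>" for n unfolding N_def using M(1) F(2) by (intro extend_minorant) blast
  have hsN: "(\<integral>\<^sup>+x. sq_sum x \<partial>N n) = f n" for n
  proof -
    have "(\<lambda>x. x) \<in> M n \<rightarrow>\<^sub>M borel"
      using id_sub_measurable Ff[OF M(1)[of n]] measurable_cong_sets[of "M n" "borel_of E\<^sub>S" borel borel] by (auto simp: finite_borel_measures_iff)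
    then show ?thesis unfolding N_def extend_def M(2) by (subst nn_integral_distr) auto
  qed
  have lim: "(\<lambda>n. \<integral>\<^sup>+x. sq_sum x \<partial>N n) \<longlonglongrightarrow> (\<integral>\<^sup>+x. sq_sum x \<partial>\<Lambda>)"
    unfolding hsN supE f(3) by (rule LIMSEQ_SUP[OF f(1)])
  have "shift_tight E\<^sub>S (poisson_exp E\<^sub>S ` F)" using F' by blast
  then obtain x where x: "\<And>P. P \<in> poisson_exp E\<^sub>S ` F \<Longrightarrow> x P \<in> D"
    and ut: "uniformly_tight E\<^sub>S ((\<lambda>P. translate_meas E\<^sub>S P (x P)) ` poisson_exp E\<^sub>S ` F)"
    unfolding shift_tight_def by auto
  define y where "y n = x (poisson_exp E\<^sub>S (M n))" for n
  have yD: "y n \<in> D" for n unfolding y_def using x M(1) by blast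
  have Pf: "poisson_exp E\<^sub>S (M n) \<in> finite_borel_measures E\<^sub>S" for n
    by (rule prob_borel_imp_finite[OF poisson_exp_prob[OF additive_space_sub Ff[OF M(1)]]])
  have extQ: "extend (translate_meas E\<^sub>S (poisson_exp E\<^sub>S (M n)) (y n)) = translate_meas euclidean (poisson_exp euclidean (N n)) (y n)" for n
    unfolding extend_translate[OF Pf yD] extend_poisson[OF Ff[OF M(1)]] N_def ..
  show ?thesis
  proof (rule disk_tight_if_translates[OF N lim, of y])
    fix e :: real assume e: "e > 0"
    have "\<exists>C. compactin E\<^sub>S C \<and> (\<forall>Q\<in>(\<lambda>P. translate_meas E\<^sub>S P (x P)) ` poisson_exp E\<^sub>S ` F. measure Q (topspace E\<^sub>S - C) < e)"
      using ut e unfolding uniformly_tight_def by blast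
    then obtain C where C: "compactin E\<^sub>S C" "\<And>Q. Q \<in> (\<lambda>P. translate_meas E\<^sub>S P (x P)) ` poisson_exp E\<^sub>S ` F \<Longrightarrow> measure Q (D - C) < e"
      by auto
    have Cc: "compact C" "C \<subseteq> D" using C(1) by (auto simp: compactin_subtopology)
    have "measure (translate_meas euclidean (poisson_exp euclidean (N n)) (y n)) (- C) < e" for n
    proof -
      let ?Q = "translate_meas E\<^sub>S (poisson_exp E\<^sub>S (M n)) (y n)"
      have Q: "?Q \<in> finite_borel_measures E\<^sub>S" using translate_meas_finite[OF additive_space_sub Pf] yD by simp
      have "measure (extend ?Q) (- C) = measure ?Q (- C \<inter> D)"
        using extend_emeasure[OF Q, of "- C"] compact_imp_closed[OF Cc(1)] by (simp add: measure_def)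
      also have "- C \<inter> D = D - C" by blast
      also have "measure ?Q (D - C) < e" using M(1) by (intro C(2)) (auto simp: y_def)
      finally show ?thesis unfolding extQ .
    qed
    then show "\<exists>C. compact C \<and> C \<subseteq> D \<and> (\<forall>n. measure (translate_meas euclidean (poisson_exp euclidean (N n)) (y n)) (- C) < e)"
      using Cc by blast
  qed
qed

lemma compactin_gauge_compact:
  assumes "compactin E\<^sub>G C" shows "compact C" "C \<subseteq> D"
  using compactin_gauge_imp_sub[OF assms] by (auto simp: compactin_subtopology)

text \<open>The limit law is tight for the gauge norm, by sets \<open>S j\<close> of mass at least
  \<open>1 - (1/8)^(j+1)\<close>. A centred exponential, being a factor of it, is tight up to one
  shift common to all \<open>j\<close>, with the weaker masses \<open>1 - (1/2)^(j+1)\<close>. The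
  same \<open>S j\<close> serve every minorant, which is uniform tightness.\<close>

lemma levy_gauge_if_disk_tight:
  assumes tight: disk_tight shows "levy_measure E\<^sub>G \<Lambda>\<^sub>D"
proof -
  obtain \<rho> where \<rho>: "\<rho> \<in> prob_borel_measures euclidean" "measure \<rho> D = 1"
    "\<And>b. b \<in> dual_space \<Longrightarrow> fourier \<rho> b = exp (\<integral>x. levy_kernel (b x) \<partial>\<Lambda>)"
    by (rule limit_measure[OF tight]) blast
  have \<rho>p: "prob_space \<rho>" and \<rho>s: "sets \<rho> = sets borel" using \<rho>(1) by (auto simp: prob_borel_measures_iff)
  have "\<exists>S. compactin E\<^sub>G S \<and> measure \<rho> S \<ge> 1 - (1/8) ^ Suc j" for j
    by (rule gauge_tight[OF \<rho>p \<rho>s \<rho>(2), of "(1/8) ^ Suc j"]) auto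
  then obtain S where S: "\<And>j. compactin E\<^sub>G (S j)" "\<And>j. measure \<rho> (S j) \<ge> 1 - (1/8) ^ Suc j" by metis
  have Sc: "compact (S j)" "S j \<subseteq> D" for j using compactin_gauge_compact[OF S(1)] by auto
  have m: "T \<in> \<rho> \<rightarrow>\<^sub>M borel" using T_measurable measurable_cong_sets[OF \<rho>s refl] by blast
  define \<sigma> where "\<sigma> = distr \<rho> borel T"
  have \<sigma>: "prob_space \<sigma>" "sets \<sigma> = sets borel" unfolding \<sigma>_def by (auto intro: prob_space.prob_space_distr[OF \<rho>p m])
  define z0 where "z0 = (\<lambda>_ :: nat. 0 :: real)"
  have FT: "fourier \<sigma> (rcomb c) = exp (\<integral>x. levy_kernel (rcomb c (T x)) \<partial>\<Lambda>) * fourier (return borel z0) (rcomb c)" for c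
    unfolding \<sigma>_def fourier_distr[OF m rcomb_measurable] \<rho>(3)[OF rcomb_T_dual] return_sequence_space(3) by (simp add: z0_def)
  have shift: "\<exists>z\<in>D. \<forall>j. measure (translate_meas E\<^sub>G (poisson_exp E\<^sub>G (restrict_space M D)) z) (D - S j) \<le> (1/2) ^ Suc j"
    if M: "M \<in> finite_minorants euclidean \<Lambda>" for M
  proof -
    have MK: "on_K M" by (rule minorant_on_K[OF M])
    have eM: "prob_space (centred_exp M)" by (rule centred_exp_prob_space[OF MK])
    interpret P: prob_space "centred_exp M" by (rule eM)
    have TM: "T \<in> centred_exp M \<rightarrow>\<^sub>M borel" using T_measurable measurable_cong_sets[OF centred_exp_sets[OF MK] refl] by blast
    obtain \<tau> where \<tau>: "prob_space \<tau>" "sets \<tau> = sets (borel :: (nat \<Rightarrow> real) measure)" and eq: "add_law (centred_exp M) \<tau> T = \<sigma>"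
      by (rule centred_exp_factor[OF M \<sigma> return_sequence_space(1,2) FT])
    have "\<exists>v. \<forall>j. measure (centred_exp M) {x \<in> space (centred_exp M). (\<lambda>k. T x k + v k) \<in> T ` S j} \<ge> 1 - (1/2) ^ Suc j"
    proof (rule add_law_pick_sequence[OF eM \<tau>(1) TM \<tau>(2)])
      show "T ` S j \<in> sets borel" for j by (rule T_image_borel[OF Sc(1)])
      show "measure (add_law (centred_exp M) \<tau> T) (T ` S j) \<ge> 1 - (1/8) ^ Suc j" for j
        unfolding eq \<sigma>_def measure_distr_T(1)[OF \<rho>s Sc(1)] by (rule S(2))
    qed
    then obtain v where v: "\<And>j. measure (centred_exp M) {x. (\<lambda>k. T x k + v k) \<in> T ` S j} \<ge> 1 - (1/2) ^ Suc j"
      by (auto simp: centred_exp_space[OF MK])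
    \<comment> \<open>A multiple of \<open>K\<close> with mass above \<open>1 / 2\<close> meets the
      set that the shift carries into \<open>S 0\<close>, which has mass at least
      \<open>1 / 2\<close>. A common point exhibits the shift as \<open>T y\<close> with
      \<open>y\<close> in \<open>D\<close>, not merely in \<open>E\<close>.\<close>
    obtain n :: nat where n: "measure (centred_exp M) (- (*\<^sub>R) (real n) ` K) < 1/2"
      using centred_exp_scaled_tight[OF tight, of "1/2"] M by (metis half_gt_zero_iff zero_less_one)
    have "\<not> {x. (\<lambda>k. T x k + v k) \<in> T ` S 0} \<subseteq> - (*\<^sub>R) (real n) ` K"
    proof
      assume "{x. (\<lambda>k. T x k + v k) \<in> T ` S 0} \<subseteq> - (*\<^sub>R) (real n) ` K"
      then have "measure (centred_exp M) {x. (\<lambda>k. T x k + v k) \<in> T ` S 0} \<le> measure (centred_exp M) (- (*\<^sub>R) (real n) ` K)"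
        by (intro P.finite_measure_mono) (auto simp: centred_exp_sets[OF MK])
      then show False using v[of 0] n by simp
    qed
    then obtain x0 k0 where x0: "x0 \<in> (*\<^sub>R) (real n) ` K" "(\<lambda>k. T x0 k + v k) = T k0" "k0 \<in> S 0" by auto
    define y where "y = k0 - x0"
    have x0D: "x0 \<in> D" using x0(1) unfolding D_union by blast
    have k0D: "k0 \<in> D" using x0(3) Sc(2) by blast
    have yD: "y \<in> D" unfolding y_def by (rule D_props(3)[OF k0D x0D])
    have vy: "v = T y"
    proof
      fix k
      have "T x0 k + v k = T k0 k" using fun_cong[OF x0(2), of k] .
      then show "v k = T y k" unfolding y_def T_diff by simp
    qed
    have set_eq: "{x. (\<lambda>k. T x k + v k) \<in> T ` S j} = {x. x + y \<in> S j}" for j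
      unfolding vy T_add[symmetric] T_mem ..
    define z where "z = y - barycentre M"
    have zD: "z \<in> D" unfolding z_def by (rule D_props(3)[OF yD barycentre(1)[OF MK]])
    have Mf: "M \<in> finite_borel_measures euclidean" using M by (simp add: finite_minorants_def)
    have Rf: "restrict_space M D \<in> finite_borel_measures E\<^sub>S" by (rule restrict_finite[OF Mf])
    have extM: "extend (restrict_space M D) = M"
      using MK by (intro extend_restrict[OF Mf] null_compl_D) (auto simp: on_K_def on_K_sets[OF MK])
    have Pf: "poisson_exp E\<^sub>S (restrict_space M D) \<in> finite_borel_measures E\<^sub>S"
      by (rule prob_borel_imp_finite[OF poisson_exp_prob[OF additive_space_sub Rf]])
    let ?Q = "translate_meas E\<^sub>S (poisson_exp E\<^sub>S (restrict_space M D)) z"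
    have Qf: "?Q \<in> finite_borel_measures E\<^sub>S" using translate_meas_finite[OF additive_space_sub Pf] zD by simp
    have extQ: "extend ?Q = translate_meas euclidean (poisson_exp euclidean M) z"
      unfolding extend_translate[OF Pf zD] extend_poisson[OF Rf] extM ..
    have "measure ?Q (D - S j) \<le> (1/2) ^ Suc j" for j
    proof -
      have Sb: "S j \<in> sets borel" by (rule borel_closed[OF compact_imp_closed[OF Sc(1)]])
      let ?P = "translate_meas euclidean (poisson_exp euclidean M) z"
      have P: "?P \<in> prob_borel_measures euclidean" by (rule translate_prob[OF poisson_prob[OF MK]])
      have Ps: "sets ?P = sets borel" "prob_space ?P" using P by (auto simp: prob_borel_measures_iff)
      have "measure ?P (S j) = measure (centred_exp M) {x. x + y \<in> S j}"
        unfolding translate_centred_exp[OF MK Sb] by (simp add: z_def)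
      then have "measure ?P (S j) \<ge> 1 - (1/2) ^ Suc j" using v[of j] unfolding set_eq by simp
      then have "measure ?P (- S j) \<le> (1/2) ^ Suc j"
        using prob_space.prob_compl[OF Ps(2), of "S j"] Sb sets_eq_imp_space_eq[OF Ps(1)] by (simp add: Ps(1) Compl_eq_Diff_UNIV)
      moreover have "measure (extend ?Q) (- S j) = measure ?Q (- S j \<inter> D)"
        using extend_emeasure[OF Qf, of "- S j"] Sb by (simp add: measure_def)
      moreover have "- S j \<inter> D = D - S j" by blast
      ultimately show ?thesis unfolding extQ by simp
    qed
    then show ?thesis
      unfolding translate_meas_borel_cong[OF borel_of_gauge_eq] poisson_exp_borel_cong[OF borel_of_gauge_eq] using zD by blast
  qed
  obtain C :: "nat \<Rightarrow> 'a set" where C: "\<And>n. C n \<in> sets borel" "\<And>n. cut (C n) \<in> finite_minorants euclidean \<Lambda>"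
    "\<And>A. A \<in> sets borel \<Longrightarrow> emeasure \<Lambda> A = (SUP n. emeasure (cut (C n)) A)"
    "\<And>m n. m \<le> n \<Longrightarrow> cut (C m) \<le> cut (C n)"
    by (rule exhausting_minorants) blast
  define R where "R n = restrict_space (cut (C n)) D" for n :: nat
  have RS: "R n \<in> finite_minorants E\<^sub>S \<Lambda>\<^sub>D" for n unfolding R_def by (rule restrict_minorant[OF C(2)])
  have RG: "R n \<in> finite_minorants E\<^sub>G \<Lambda>\<^sub>D" for n
    using RS[of n] unfolding finite_minorants_def finite_borel_measures_cong[OF borel_of_gauge_eq] .
  have Re: "emeasure (R n) A = emeasure (cut (C n)) A" if "A \<in> sets borel" "A \<subseteq> D" for n A
    unfolding R_def by (rule restrict_emeasure[OF minorant_sets[OF C(2)] that])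
  have Dsets: "A \<in> sets borel \<and> A \<subseteq> D" if "A \<in> sets \<Lambda>\<^sub>D" for A
    using that unfolding sets_\<Lambda>D sets_borel_of_sub by (auto simp: sets_restrict_space)
  have Rs: "sets (R n) = sets \<Lambda>\<^sub>D" for n using RS[of n] by (simp add: finite_minorants_def)
  define F where "F = range R"
  have dir: "\<forall>M\<in>F. \<forall>N\<in>F. \<exists>L\<in>F. M \<le> L \<and> N \<le> L"
  proof (intro ballI)
    fix M N assume "M \<in> F" "N \<in> F"
    then obtain m n where mn: "M = R m" "N = R n" by (auto simp: F_def)
    have "R i \<le> R (max m n)" if "i \<le> max m n" for i
    proof -
      have "emeasure (cut (C i)) A \<le> emeasure (cut (C (max m n))) A" if "A \<in> sets borel" for A
        using C(4)[OF \<open>i \<le> max m n\<close>] that minorant_sets[OF C(2)] by (subst (asm) measure_le_iff) auto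
      then show ?thesis using Rs Dsets Re by (subst measure_le_iff) auto
    qed
    then show "\<exists>L\<in>F. M \<le> L \<and> N \<le> L" unfolding mn F_def by (intro bexI[of _ "R (max m n)"]) auto
  qed
  have sup: "\<forall>A\<in>sets \<Lambda>\<^sub>D. emeasure \<Lambda>\<^sub>D A = (SUP M\<in>F. emeasure M A)"
  proof
    fix A assume "A \<in> sets \<Lambda>\<^sub>D"
    then have A: "A \<in> sets borel" "A \<subseteq> D" using Dsets by auto
    show "emeasure \<Lambda>\<^sub>D A = (SUP M\<in>F. emeasure M A)"
      unfolding restrict_emeasure[OF sets_\<Lambda> A] C(3)[OF A(1)] F_def image_image by (simp add: Re[OF A])
  qed
  have st: "shift_tight E\<^sub>G (poisson_exp E\<^sub>G ` F)"
    unfolding shift_tight_def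
  proof (intro exI conjI ballI)
    define x where "x P = (SOME z. z \<in> D \<and> (\<forall>j. measure (translate_meas E\<^sub>G P z) (D - S j) \<le> (1/2) ^ Suc j))" for P
    have x: "x P \<in> D \<and> (\<forall>j. measure (translate_meas E\<^sub>G P (x P)) (D - S j) \<le> (1/2) ^ Suc j)" if P: "P \<in> poisson_exp E\<^sub>G ` F" for P
    proof -
      obtain n where "P = poisson_exp E\<^sub>G (restrict_space (cut (C n)) D)" using P by (auto simp: F_def R_def)
      then have "\<exists>z. z \<in> D \<and> (\<forall>j. measure (translate_meas E\<^sub>G P z) (D - S j) \<le> (1/2) ^ Suc j)" using shift[OF C(2)[of n]] by blast
      then show ?thesis unfolding x_def by (rule someI_ex)
    qed
    show "x P \<in> topspace E\<^sub>G" if "P \<in> poisson_exp E\<^sub>G ` F" for P using x[OF that] topspace_gauge by simp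
    have Q: "translate_meas E\<^sub>G P (x P) \<in> prob_borel_measures E\<^sub>G" if P: "P \<in> poisson_exp E\<^sub>G ` F" for P
    proof -
      obtain n where n: "P = poisson_exp E\<^sub>S (R n)" using P unfolding poisson_exp_borel_cong[OF borel_of_gauge_eq] by (auto simp: F_def)
      have Rf: "R n \<in> finite_borel_measures E\<^sub>S" using RS by (simp add: finite_minorants_def)
      have Pp: "P \<in> prob_borel_measures E\<^sub>S" unfolding n by (rule poisson_exp_prob[OF additive_space_sub Rf])
      have xD: "x P \<in> topspace E\<^sub>S" using x[OF P] by simp
      have "measure (translate_meas E\<^sub>S P (x P)) (topspace E\<^sub>S) = measure P {y \<in> topspace E\<^sub>S. y + x P \<in> topspace E\<^sub>S}"
        using sets.top[of "borel_of E\<^sub>S"] by (intro measure_translate_meas[OF additive_space_sub prob_borel_imp_finite[OF Pp] xD]) simp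
      also have "{y \<in> topspace E\<^sub>S. y + x P \<in> topspace E\<^sub>S} = topspace E\<^sub>S" using xD D_props(2) by auto
      finally have "translate_meas E\<^sub>S P (x P) \<in> prob_borel_measures E\<^sub>S"
        using prob_borel_measures_measure[OF Pp] translate_meas_finite[OF additive_space_sub prob_borel_imp_finite[OF Pp] xD]
        by (intro prob_borel_measuresI) auto
      then show ?thesis unfolding translate_meas_borel_cong[OF borel_of_gauge_eq] by (simp add: prob_borel_measures_def borel_of_gauge_eq)
    qed
    show "uniformly_tight E\<^sub>G ((\<lambda>P. translate_meas E\<^sub>G P (x P)) ` poisson_exp E\<^sub>G ` F)"
      unfolding uniformly_tight_def
    proof (intro conjI allI impI)
      show "(\<lambda>P. translate_meas E\<^sub>G P (x P)) ` poisson_exp E\<^sub>G ` F \<subseteq> finite_borel_measures E\<^sub>G"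
        using Q prob_borel_imp_finite by blast
      show "\<exists>c. \<forall>M\<in>(\<lambda>P. translate_meas E\<^sub>G P (x P)) ` poisson_exp E\<^sub>G ` F. measure M (topspace E\<^sub>G) \<le> c"
        using prob_borel_measures_measure[OF Q] by (intro exI[of _ 1]) auto
      fix e :: real assume e: "e > 0"
      obtain j where j: "(1/2::real) ^ j < e" using real_arch_pow_inv[OF e, of "1/2"] by auto
      have "(1/2::real) ^ Suc j \<le> (1/2) ^ j" by simp
      then have "(1/2::real) ^ Suc j < e" using j by linarith
      then have "measure (translate_meas E\<^sub>G P (x P)) (topspace E\<^sub>G - S j) < e" if "P \<in> poisson_exp E\<^sub>G ` F" for P
        using x[OF that] unfolding topspace_gauge by (meson le_less_trans)
      then show "\<exists>C. compactin E\<^sub>G C \<and> (\<forall>M\<in>(\<lambda>P. translate_meas E\<^sub>G P (x P)) ` poisson_exp E\<^sub>G ` F. measure M (topspace E\<^sub>G - C) < e)"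
        using S(1)[of j] by (intro exI[of _ "S j"]) auto
    qed
  qed
  show ?thesis
    unfolding levy_measure_def
  proof (intro conjI exI[of _ F])
    show "sets \<Lambda>\<^sub>D = sets (borel_of E\<^sub>G)" unfolding sets_\<Lambda>D borel_of_gauge_eq ..
    show "emeasure \<Lambda>\<^sub>D {0} = 0" using \<Lambda>_0 D_props(1) by (subst restrict_emeasure[OF sets_\<Lambda>]) auto
    show "F \<subseteq> finite_minorants E\<^sub>G \<Lambda>\<^sub>D" using RG by (auto simp: F_def)
  qed (use dir sup st in \<open>auto simp: F_def\<close>)
qed

theorem levy_gauge_iff_disk_tight: "levy_measure E\<^sub>G \<Lambda>\<^sub>D \<longleftrightarrow> disk_tight"
  using levy_gauge_if_disk_tight disk_tight_if_levy_sub levy_measure_coarser[OF borel_of_gauge_eq compactin_gauge_imp_sub] by blast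

theorem levy_sub_iff_disk_tight: "levy_measure E\<^sub>S \<Lambda>\<^sub>D \<longleftrightarrow> disk_tight"
  using levy_gauge_if_disk_tight disk_tight_if_levy_sub levy_measure_coarser[OF borel_of_gauge_eq compactin_gauge_imp_sub] by blast

end

section \<open>The Fourier transform on the span of the disk\<close>

lemma meas_restr_integral:
  fixes f :: "'a \<Rightarrow> 'b::{banach, second_countable_topology}"
  assumes "A \<in> sets \<nu>" "f \<in> borel_measurable \<nu>"
  shows "integrable (meas_restr \<nu> A) f \<longleftrightarrow> integrable \<nu> (\<lambda>x. indicator A x *\<^sub>R f x)"
    and "integral\<^sup>L (meas_restr \<nu> A) f = (\<integral>x. indicator A x *\<^sub>R f x \<partial>\<nu>)"
proof -
  have e: "meas_restr \<nu> A = density \<nu> (\<lambda>x. ennreal (indicator A x))"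
    unfolding meas_restr_def by (simp add: ennreal_indicator)
  show "integrable (meas_restr \<nu> A) f \<longleftrightarrow> integrable \<nu> (\<lambda>x. indicator A x *\<^sub>R f x)"
    unfolding e using assms by (intro integrable_density) auto
  show "integral\<^sup>L (meas_restr \<nu> A) f = (\<integral>x. indicator A x *\<^sub>R f x \<partial>\<nu>)"
    unfolding e using assms by (intro integral_density) auto
qed

lemma sets_meas_restr [simp]: "sets (meas_restr \<nu> A) = sets \<nu>"
  by (simp add: meas_restr_def)

context disk_levy_gauge begin

lemma fourier_extend:
  assumes N: "N \<in> finite_borel_measures E\<^sub>S" and b: "b \<in> borel_measurable borel"
  shows "fourier (extend N) b = fourier N b"
proof -
  have "(\<lambda>x. x) \<in> N \<rightarrow>\<^sub>M borel"
    using id_sub_measurable N measurable_cong_sets[of N "borel_of E\<^sub>S" borel borel] by (auto simp: finite_borel_measures_iff)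
  then show ?thesis unfolding extend_def using b by (intro fourier_distr)
qed

lemma poisson_exp_D:
  assumes M: "M \<in> finite_borel_measures euclidean" "emeasure M (- D) = 0"
  shows "emeasure (poisson_exp euclidean M) D = 1"
proof -
  note R = restrict_finite[OF M(1)]
  have P: "poisson_exp E\<^sub>S (restrict_space M D) \<in> prob_borel_measures E\<^sub>S"
    by (rule poisson_exp_prob[OF additive_space_sub R])
  have Pp: "prob_space (poisson_exp E\<^sub>S (restrict_space M D))" using P by (simp add: prob_borel_measures_iff)
  have "emeasure (poisson_exp euclidean M) D = emeasure (extend (poisson_exp E\<^sub>S (restrict_space M D))) D"
    unfolding extend_poisson[OF R] extend_restrict[OF M] ..
  also have "\<dots> = emeasure (poisson_exp E\<^sub>S (restrict_space M D)) (D \<inter> D)"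
    by (rule extend_emeasure[OF prob_borel_imp_finite[OF P] D_borel])
  also have "\<dots> = 1"
    using prob_space.emeasure_space_1[OF Pp] finite_borel_measures_space[OF prob_borel_imp_finite[OF P]] by simp
  finally show ?thesis .
qed

lemma conv_meas_D:
  assumes M: "M \<in> prob_borel_measures euclidean" "emeasure M D = 1"
    and N: "N \<in> prob_borel_measures euclidean" "emeasure N D = 1"
  shows "emeasure (conv_meas euclidean M N) D = 1"
proof -
  have Np: "prob_space N" using N by (auto simp: prob_borel_measures_iff)
  interpret N: prob_space N by (rule Np)
  have "AE y in N. y \<in> D" using N(2) by (intro N.AE_prob_1) (simp add: measure_def)
  then have AE: "AE y in N. emeasure M {x \<in> UNIV. x + y \<in> D} = 1"
  proof eventually_elim
    fix y assume y: "y \<in> D"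
    have "x + y \<in> D \<longleftrightarrow> x \<in> D" for x
      using D_props(2)[of x y] D_props(3)[of "x + y" y] y by auto
    then have "{x \<in> UNIV. x + y \<in> D} = D" by simp
    then show "emeasure M {x \<in> UNIV. x + y \<in> D} = 1" using M(2) by simp
  qed
  have "emeasure (conv_meas euclidean M N) D = (\<integral>\<^sup>+y. emeasure M {x \<in> UNIV. x + y \<in> D} \<partial>N)"
    using emeasure_conv_meas[OF additive_space_E prob_borel_imp_finite[OF M(1)] prob_borel_imp_finite[OF N(1)], of D] by simp
  also have "\<dots> = (\<integral>\<^sup>+y. 1 \<partial>N)" by (rule nn_integral_cong_AE[OF AE])
  also have "\<dots> = 1" by (simp add: N.emeasure_space_1)
  finally show ?thesis .
qed

lemma outer_finite:
  assumes \<nu>: "sets \<nu> = sets borel" "emeasure \<nu> (- K) < \<infinity>"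
  shows "meas_restr \<nu> (D - K) \<in> finite_borel_measures euclidean"
proof -
  have "emeasure (meas_restr \<nu> (D - K)) UNIV = emeasure \<nu> (D - K)"
    by (subst emeasure_meas_restr) (auto simp: \<nu>)
  also have "\<dots> \<le> emeasure \<nu> (- K)" by (rule emeasure_mono) (auto simp: \<nu>)
  finally show ?thesis using \<nu> sets_eq_imp_space_eq[OF \<nu>(1)]
    by (auto simp: finite_borel_measures_iff meas_restr_def top_unique intro!: finite_measureI)
qed

text \<open>The compensator acts on \<open>K\<close> only. Over \<open>K\<close> the integrand is
  \<open>levy_kernel\<close>; over the rest of \<open>disk_span K\<close>, where
  \<open>\<nu>\<close> is finite, it is the exponent of an uncompensated Poisson law.\<close>

lemma compensated_split:
  assumes \<nu>: "sets \<nu> = sets borel" "\<Lambda> = meas_restr \<nu> K" "emeasure \<nu> (- K) < \<infinity>" and b: "b \<in> dual_space"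
  shows "exp (CLINT x:D|\<nu>. compensated K b x)
    = exp (\<integral>x. levy_kernel (b x) \<partial>\<Lambda>) * fourier (poisson_exp euclidean (meas_restr \<nu> (D - K))) b"
proof -
  have [measurable]: "b \<in> borel_measurable \<nu>" using dual_space_measurable[OF b] measurable_cong_sets[OF \<nu>(1) refl] by blast
  have [measurable]: "K \<in> sets \<nu>" "D - K \<in> sets \<nu>" by (simp_all add: \<nu>(1))
  let ?N = "meas_restr \<nu> (D - K)"
  have N: "?N \<in> finite_borel_measures euclidean" by (rule outer_finite[OF \<nu>(1,3)])
  then have Nf: "finite_measure ?N" by (simp add: finite_borel_measures_iff)
  have bN: "b \<in> borel_measurable ?N" unfolding meas_restr_def by measurable
  have i1: "integrable \<nu> (\<lambda>x. indicator K x *\<^sub>R levy_kernel (b x))"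
    using levy_integrable[OF b] unfolding \<nu>(2) by (subst (asm) meas_restr_integral) auto
  have "integrable ?N (\<lambda>x. iexp (b x) - 1)"
    using finite_measure.integrable_iexp[OF Nf bN] finite_measure.integrable_const[OF Nf] by (intro Bochner_Integration.integrable_diff)
  then have i2: "integrable \<nu> (\<lambda>x. indicator (D - K) x *\<^sub>R (iexp (b x) - 1))"
    by (subst (asm) meas_restr_integral) auto
  have "(CLINT x:D|\<nu>. compensated K b x)
     = (\<integral>x. indicator K x *\<^sub>R levy_kernel (b x) + indicator (D - K) x *\<^sub>R (iexp (b x) - 1) \<partial>\<nu>)"
    unfolding set_lebesgue_integral_def
    using subset_disk_span[OF K(1)]
    by (intro Bochner_Integration.integral_cong refl) (auto simp: compensated_def levy_kernel_def indicator_def)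
  also have "\<dots> = (\<integral>x. levy_kernel (b x) \<partial>\<Lambda>) + (\<integral>x. iexp (b x) - 1 \<partial>?N)"
    unfolding Bochner_Integration.integral_add[OF i1 i2] \<nu>(2) by (subst (1 2) meas_restr_integral) auto
  finally show ?thesis unfolding fourier_poisson_E[OF N b] by (simp add: exp_add)
qed

text \<open>The jumps in \<open>D - K\<close> contribute a Poisson law \<open>\<pi>\<close> that is
  itself concentrated on \<open>D\<close>. In one direction it is the extra factor
  \<open>\<theta>\<close> in \<open>disk_tightI\<close>; in the other it is convolved with the limit
  law, and since \<open>D\<close> is a subspace the convolution stays on \<open>D\<close>.\<close>

theorem fourier_disk_iff_disk_tight:
  assumes \<nu>: "sets \<nu> = sets borel" "\<Lambda> = meas_restr \<nu> K" "emeasure \<nu> (- K) < \<infinity>"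
  shows "(\<exists>\<rho>\<in>prob_borel_measures E\<^sub>G. \<forall>a\<in>dual_space. fourier \<rho> a = exp (CLINT x:D|\<nu>. compensated K a x))
    \<longleftrightarrow> disk_tight"
proof -
  have pb: "prob_borel_measures E\<^sub>G = prob_borel_measures E\<^sub>S"
    unfolding prob_borel_measures_def borel_of_gauge_eq ..
  let ?N = "meas_restr \<nu> (D - K)"
  define \<pi> where "\<pi> = poisson_exp euclidean ?N"
  have N: "?N \<in> finite_borel_measures euclidean" by (rule outer_finite[OF \<nu>(1,3)])
  have "(D - K) \<inter> - D = {}" by blast
  then have Nm: "emeasure ?N (- D) = 0" by (subst emeasure_meas_restr) (auto simp: \<nu>(1))
  have \<pi>: "\<pi> \<in> prob_borel_measures euclidean" unfolding \<pi>_def by (rule poisson_exp_prob[OF additive_space_E N])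
  have \<pi>D: "emeasure \<pi> D = 1" unfolding \<pi>_def by (rule poisson_exp_D[OF N Nm])
  note split = compensated_split[OF \<nu>, folded \<pi>_def]
  have Tm: "T \<in> M \<rightarrow>\<^sub>M borel" if "M \<in> prob_borel_measures euclidean" for M
    using T_measurable that measurable_cong_sets[of M borel borel borel] by (auto simp: prob_borel_measures_iff)
  have dp: "prob_space (distr M borel T)" if "M \<in> prob_borel_measures euclidean" for M
    using that by (intro prob_space.prob_space_distr Tm) (simp add: prob_borel_measures_iff)
  show ?thesis
  proof
    assume "\<exists>\<rho>\<in>prob_borel_measures E\<^sub>G. \<forall>a\<in>dual_space. fourier \<rho> a = exp (CLINT x:D|\<nu>. compensated K a x)"
    then obtain \<rho> where \<rho>: "\<rho> \<in> prob_borel_measures E\<^sub>S" "\<And>a. a \<in> dual_space \<Longrightarrow> fourier \<rho> a = exp (CLINT x:D|\<nu>. compensated K a x)"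
      unfolding pb by blast
    note \<rho>f = prob_borel_imp_finite[OF \<rho>(1)]
    have \<rho>p: "prob_space \<rho>" using \<rho>(1) by (simp add: prob_borel_measures_iff)
    have eD: "emeasure (extend \<rho>) (A \<inter> D) = emeasure (extend \<rho>) A" if "A \<in> sets borel" for A
      using that by (simp add: extend_emeasure[OF \<rho>f])
    have "emeasure (extend \<rho>) D = 1"
      unfolding extend_emeasure[OF \<rho>f D_borel] using prob_space.emeasure_space_1[OF \<rho>p] finite_borel_measures_space[OF \<rho>f] by simp
    moreover have "emeasure (extend \<rho>) UNIV = emeasure (extend \<rho>) D" using eD[of UNIV] by simp
    ultimately have e1: "measure (extend \<rho>) D = 1" "measure (extend \<rho>) UNIV = 1" by (simp_all add: measure_def)
    have E: "extend \<rho> \<in> prob_borel_measures euclidean"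
      using extend_finite[OF \<rho>f] e1(2) by (intro prob_borel_measuresI) auto
    show disk_tight
    proof (rule disk_tightI[of "distr (extend \<rho>) borel T" "distr \<pi> borel T"])
      show "fourier (distr (extend \<rho>) borel T) (rcomb c)
          = exp (\<integral>x. levy_kernel (rcomb c (T x)) \<partial>\<Lambda>) * fourier (distr \<pi> borel T) (rcomb c)" for c
        unfolding fourier_distr[OF Tm[OF E] rcomb_measurable] fourier_distr[OF Tm[OF \<pi>] rcomb_measurable]
          fourier_extend[OF \<rho>f dual_space_measurable[OF rcomb_T_dual]] \<rho>(2)[OF rcomb_T_dual] split[OF rcomb_T_dual] ..
      have "T -` (T ` D) \<inter> space (extend \<rho>) = D" using T_inj by (auto simp: extend_def inj_eq)
      then show "measure (distr (extend \<rho>) borel T) (T ` D) = 1"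
        using e1(1) by (subst measure_distr[OF Tm[OF E] TD_borel]) simp
    qed (use dp[OF E] dp[OF \<pi>] in auto)
  next
    assume tight: disk_tight
    obtain \<rho> where \<rho>: "\<rho> \<in> prob_borel_measures euclidean" "measure \<rho> D = 1"
      "\<And>b. b \<in> dual_space \<Longrightarrow> fourier \<rho> b = exp (\<integral>x. levy_kernel (b x) \<partial>\<Lambda>)"
      by (rule limit_measure[OF tight]) blast
    have fin: "finite_measure \<rho>" using prob_borel_imp_finite[OF \<rho>(1)] by (simp add: finite_borel_measures_iff)
    have \<rho>D: "emeasure \<rho> D = 1" using \<rho>(2) by (simp add: finite_measure.emeasure_eq_measure[OF fin])
    note f = prob_borel_imp_finite[OF \<rho>(1)] prob_borel_imp_finite[OF \<pi>]
    define \<eta> where "\<eta> = conv_meas euclidean \<rho> \<pi>"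
    have \<eta>: "\<eta> \<in> finite_borel_measures euclidean" unfolding \<eta>_def by (rule conv_meas_finite[OF additive_space_E f])
    have \<eta>D: "emeasure \<eta> D = 1" unfolding \<eta>_def by (rule conv_meas_D[OF \<rho>(1) \<rho>D \<pi> \<pi>D])
    have s\<eta>: "sets \<eta> = sets borel" "space \<eta> = UNIV" using \<eta> finite_borel_measures_space[OF \<eta>] by (auto simp: finite_borel_measures_iff)
    have "emeasure \<eta> UNIV = (\<integral>\<^sup>+y. emeasure \<rho> {x \<in> UNIV. x + y \<in> UNIV} \<partial>\<pi>)"
      unfolding \<eta>_def using emeasure_conv_meas[OF additive_space_E f, of UNIV] by simp
    also have "\<dots> = 1"
      using \<rho>(1) \<pi> prob_space.emeasure_space_1[of \<rho>] prob_space.emeasure_space_1[of \<pi>]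
        finite_borel_measures_space[OF f(1)] finite_borel_measures_space[OF f(2)] by (simp add: prob_borel_measures_iff)
    finally have \<eta>U: "emeasure \<eta> UNIV = 1" .
    have "emeasure \<eta> (- D) = 0"
      using emeasure_compl[of D \<eta>] \<eta>D \<eta>U s\<eta> by (simp add: Compl_eq_Diff_UNIV)
    from extend_restrict[OF \<eta> this] have er: "extend (restrict_space \<eta> D) = \<eta>" .
    note R = restrict_finite[OF \<eta>]
    have "measure (restrict_space \<eta> D) D = 1"
      using restrict_emeasure[OF s\<eta>(1), of D] \<eta>D by (simp add: measure_def)
    then have "restrict_space \<eta> D \<in> prob_borel_measures E\<^sub>G"
      unfolding pb using R by (intro prob_borel_measuresI) auto
    moreover have "fourier (restrict_space \<eta> D) a = exp (CLINT x:D|\<nu>. compensated K a x)" if a: "a \<in> dual_space" for a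
    proof -
      have am: "a \<in> borel_measurable borel" by (rule dual_space_measurable[OF a])
      have "fourier (restrict_space \<eta> D) a = fourier \<eta> a" using fourier_extend[OF R am] unfolding er by simp
      also have "\<dots> = fourier \<rho> a * fourier \<pi> a"
        unfolding \<eta>_def using am additive_map_dual[OF a] by (intro fourier_conv_meas[OF additive_space_E f]) auto
      finally show ?thesis unfolding split[OF a] \<rho>(3)[OF a] .
    qed
    ultimately show "\<exists>\<rho>\<in>prob_borel_measures E\<^sub>G. \<forall>a\<in>dual_space. fourier \<rho> a = exp (CLINT x:D|\<nu>. compensated K a x)"
      by blast
  qed
qed

end

section \<open>From the Levy-Khinchin representation to the locale\<close>

lemma dual_space_add_scaled:
  assumes "a \<in> dual_space" "b \<in> dual_space" shows "(\<lambda>x. a x + s * b x) \<in> dual_space"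
proof -
  have "linear a" "linear b" using assms by (auto simp: dual_space_def)
  then have "linear (\<lambda>x. a x + s * b x)"
    by (intro linearI) (simp_all add: linear_add linear_scale algebra_simps)
  moreover have "continuous_on UNIV (\<lambda>x. a x + s * b x)"
    using assms by (intro continuous_intros) (auto simp: dual_space_def)
  ultimately show ?thesis by (simp add: dual_space_def)
qed

text \<open>Up to sign this is the real part of the compensated integrand; the compensator is purely
  imaginary, so the choice of \<open>H\<close> has no influence.\<close>

lemma integrable_one_minus_cos:
  assumes "integrable \<nu> (compensated H b)" shows "integrable \<nu> (\<lambda>x. 1 - cos (b x))"
proof -
  have "1 - cos (b x) = - Re (compensated H b x)" for x
    by (simp add: compensated_def Re_exp indicator_def)
  then show ?thesis using assms by simp
qed

text \<open>On \<open>K\<close> a functional is bounded by some \<open>R\<close>, and there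
  \<open>b^2 \<le> 4 * R^2 * (1 - cos (b / R))\<close>; the right-hand side is integrable by the
  representation. From the resulting second moments on \<open>K\<close> the scaling of a separating
  sequence is computed.\<close>

lemma disk_levy_gauge_restriction:
  fixes \<nu> :: "'a::locally_convex_space measure" and g :: "'p::second_countable_topology \<Rightarrow> 'a"
  assumes g: "continuous_on UNIV g" "surj g"
    and \<nu>: "sets \<nu> = sets borel" "emeasure \<nu> {0} = 0"
    and int: "\<And>b. b \<in> dual_space \<Longrightarrow> integrable \<nu> (compensated H b)"
    and K: "K \<in> separable_compact_disks"
  obtains a where "disk_levy_gauge a K (meas_restr \<nu> K)"
proof -
  have K': "absolutely_convex K" "compact K" "tvs_bounded K" "separable_space (gauge_topology K)"
    using K by (auto simp: separable_compact_disks_def disk_def)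
  have Kb: "K \<in> sets borel" by (rule borel_closed[OF compact_imp_closed[OF K'(2)]])
  let ?\<Lambda> = "meas_restr \<nu> K"
  have sq: "(\<integral>\<^sup>+x. ennreal ((b x)\<^sup>2) \<partial>?\<Lambda>) < \<infinity>" if b: "b \<in> dual_space" for b
  proof -
    have bm: "b \<in> borel_measurable \<nu>" using dual_space_measurable[OF b] measurable_cong_sets[OF \<nu>(1) refl] by blast
    have "bounded (b ` K)" using compact_continuous_image[OF dual_space_continuous[OF b] K'(2)] by (rule compact_imp_bounded)
    then obtain B where "\<And>y. y \<in> b ` K \<Longrightarrow> norm y \<le> B" by (auto simp: bounded_iff)
    then have B: "\<bar>b x\<bar> \<le> \<bar>B\<bar> + 1" if "x \<in> K" for x using that by (metis abs_ge_self add_increasing2 image_eqI order_trans real_norm_def zero_le_one)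
    define R where "R = \<bar>B\<bar> + 1"
    have R: "R > 0" unfolding R_def by simp
    have i: "integrable \<nu> (\<lambda>x. 4 * R\<^sup>2 * (1 - cos (inverse R * b x)))"
      by (intro integrable_mult_right integrable_one_minus_cos[OF int[OF dual_space_scale[OF b]]])
    have "(\<integral>\<^sup>+x. ennreal ((b x)\<^sup>2) \<partial>?\<Lambda>) = (\<integral>\<^sup>+x. indicator K x * ennreal ((b x)\<^sup>2) \<partial>\<nu>)"
      unfolding meas_restr_def using Kb bm \<nu>(1) by (intro nn_integral_density) auto
    also have "\<dots> \<le> (\<integral>\<^sup>+x. ennreal (4 * R\<^sup>2 * (1 - cos (inverse R * b x))) \<partial>\<nu>)"
    proof (rule nn_integral_mono)
      fix x
      show "indicator K x * ennreal ((b x)\<^sup>2) \<le> ennreal (4 * R\<^sup>2 * (1 - cos (inverse R * b x)))"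
      proof (cases "x \<in> K")
        case True
        have "\<bar>inverse R * b x\<bar> \<le> 1" using B[OF True, folded R_def] R by (simp add: abs_mult field_simps)
        from one_minus_cos_ge[OF this] have "(b x)\<^sup>2 \<le> 4 * R\<^sup>2 * (1 - cos (inverse R * b x))"
          using R by (simp add: field_simps power2_eq_square)
        then show ?thesis using True by (simp add: ennreal_leI)
      qed simp
    qed
    also have "\<dots> < \<infinity>"
      using integrableD(2)[OF i] by (simp add: top.not_eq_extremum abs_mult)
    finally show ?thesis .
  qed
  obtain \<xi> :: "nat \<Rightarrow> 'a \<Rightarrow> real" where \<xi>: "\<And>k. \<xi> k \<in> dual_space" "\<And>x y. x \<noteq> y \<Longrightarrow> \<exists>k. \<xi> k x \<noteq> \<xi> k y"
    by (rule suslin_separating_sequence[OF g]) blast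
  define r where "r k = enn2real (\<integral>\<^sup>+x. ennreal ((\<xi> k x)\<^sup>2) \<partial>?\<Lambda>)" for k
  have r: "r k \<ge> 0" "(\<integral>\<^sup>+x. ennreal ((\<xi> k x)\<^sup>2) \<partial>?\<Lambda>) = ennreal (r k)" for k
    unfolding r_def using sq[OF \<xi>(1)[of k]] by simp_all
  \<comment> \<open>Then \<open>a k = s k * \<xi> k\<close> has second moment at most
    \<open>(1/2)^k\<close>; the 1 in the denominator avoids division by 0.\<close>
  define s where "s k = sqrt ((1/2) ^ k / (1 + r k))" for k
  have s: "s k > 0" "(s k)\<^sup>2 = (1/2) ^ k / (1 + r k)" for k
    unfolding s_def using r(1)[of k] by (auto intro!: divide_pos_pos)
  define a where "a k x = s k * \<xi> k x" for k x
  have a: "a k \<in> dual_space" for k unfolding a_def[abs_def] by (rule dual_space_scale[OF \<xi>(1)])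
  have am: "a k \<in> borel_measurable ?\<Lambda>" "\<xi> k \<in> borel_measurable ?\<Lambda>" for k
    using dual_space_measurable[OF a[of k]] dual_space_measurable[OF \<xi>(1)[of k]] measurable_cong_sets[of ?\<Lambda> borel borel borel] \<nu>(1) by auto
  have ak: "(\<integral>\<^sup>+x. ennreal ((a k x)\<^sup>2) \<partial>?\<Lambda>) \<le> ennreal ((1/2) ^ k)" for k
  proof -
    have "(\<integral>\<^sup>+x. ennreal ((a k x)\<^sup>2) \<partial>?\<Lambda>) = (\<integral>\<^sup>+x. ennreal ((s k)\<^sup>2) * ennreal ((\<xi> k x)\<^sup>2) \<partial>?\<Lambda>)"
      by (simp add: a_def power_mult_distrib ennreal_mult')
    also have "\<dots> = ennreal ((s k)\<^sup>2 * r k)"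
      using am by (subst nn_integral_cmult) (auto simp: r ennreal_mult')
    also have "\<dots> \<le> ennreal ((1/2) ^ k)"
    proof (rule ennreal_leI)
      have "(1/2) ^ k * (r k / (1 + r k)) \<le> (1/2) ^ k * 1" using r(1)[of k] by (intro mult_left_mono) auto
      then show "(s k)\<^sup>2 * r k \<le> (1/2) ^ k" unfolding s(2) by simp
    qed
    finally show ?thesis .
  qed
  have sq_sum: "(\<integral>\<^sup>+x. (\<Sum>k. ennreal ((a k x)\<^sup>2)) \<partial>?\<Lambda>) < \<infinity>"
  proof -
    have "(\<integral>\<^sup>+x. (\<Sum>k. ennreal ((a k x)\<^sup>2)) \<partial>?\<Lambda>) = (\<Sum>k. \<integral>\<^sup>+x. ennreal ((a k x)\<^sup>2) \<partial>?\<Lambda>)"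
      using am by (intro nn_integral_suminf) auto
    also have "\<dots> \<le> (\<Sum>k. ennreal ((1/2) ^ k))" using ak by (intro suminf_le) auto
    also have "\<dots> = ennreal (\<Sum>k. (1/2) ^ k)" by (intro suminf_ennreal2) auto
    finally show ?thesis by (auto intro: le_less_trans)
  qed
  show thesis
  proof (rule that[of a], unfold_locales)
    show "\<exists>k. a k x \<noteq> a k y" if "x \<noteq> y" for x y
      using \<xi>(2)[OF that] s(1) by (auto simp: a_def) (metis less_irrefl)
    show "(\<lambda>(x, y). x + y :: 'a) \<in> borel \<Otimes>\<^sub>M borel \<rightarrow>\<^sub>M borel" by (rule suslin_add_measurable[OF g])
    show "emeasure ?\<Lambda> (- K) = 0" using Kb \<nu> by (subst emeasure_meas_restr) auto
    have "emeasure ?\<Lambda> {0} = emeasure \<nu> (K \<inter> {0})" using Kb \<nu> by (subst emeasure_meas_restr) auto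
    also have "\<dots> \<le> emeasure \<nu> {0}" using \<nu> by (intro emeasure_mono) auto
    finally show "emeasure ?\<Lambda> {0} = 0" using \<nu>(2) by simp
  qed (use a sq_sum sq K' \<nu> in auto)
qed

text \<open>Compact sets are preimages of their compact images, and a relatively open part of
  \<open>K\<close> is the difference \<open>K - (K - U)\<close> of compact sets; such parts generate
  the Borel sets inside \<open>K\<close>.\<close>

lemma compact_borel_vimage:
  fixes T :: "'a::t2_space \<Rightarrow> 'b::t2_space"
  assumes T: "continuous_on UNIV T" "inj T" and K: "compact K" and B: "B \<in> sets borel"
  obtains C where "C \<in> sets borel" "K \<inter> B = T -` C"
proof -
  let ?S = "vimage_algebra UNIV T borel"
  have c: "L \<in> sets ?S" if "compact L" for L
  proof -
    have "compact (T ` L)" using that T(1) by (meson compact_continuous_image continuous_on_subset subset_UNIV)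
    then have "T ` L \<in> sets borel" by (intro borel_closed compact_imp_closed)
    moreover have "L = T -` (T ` L) \<inter> UNIV" using T(2) by (auto simp: inj_eq)
    ultimately show ?thesis unfolding sets_vimage_algebra2[of T UNIV borel, simplified] by auto
  qed
  have "(\<lambda>x. x) \<in> restrict_space ?S K \<rightarrow>\<^sub>M borel"
  proof (rule borel_measurableI)
    fix U :: "'a set" assume "open U"
    then have "compact (K - U)" using K by (rule compact_diff[rotated])
    then have "K - (K - U) \<in> sets ?S" by (intro sets.Diff c K)
    moreover have "K - (K - U) = K \<inter> U" by blast
    ultimately show "(\<lambda>x. x) -` U \<inter> space (restrict_space ?S K) \<in> sets (restrict_space ?S K)"
      by (auto simp: space_restrict_space sets_restrict_space Int_commute)
  qed
  from measurable_sets[OF this B] have "B \<inter> K \<in> sets (restrict_space ?S K)" by (simp add: space_restrict_space)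
  then obtain C' where "C' \<in> sets ?S" "B \<inter> K = K \<inter> C'" by (auto simp: sets_restrict_space)
  then have "K \<inter> B \<in> sets ?S" using c[OF K] by (simp add: Int_commute)
  then obtain C where "C \<in> sets borel" "K \<inter> B = T -` C" unfolding sets_vimage_algebra2[of T UNIV borel, simplified] by auto
  then show thesis by (rule that)
qed

text \<open>Where \<open>f k\<close> is nonzero a measure is recovered from its weighted version by
  dividing. The sets on which \<open>k\<close> is the first index with \<open>f k \<noteq> 0\<close>
  partition the space up to a null set.\<close>

lemma measure_eqI_densities:
  fixes f :: "nat \<Rightarrow> 'a \<Rightarrow> ennreal"
  assumes s: "sets M = sets N"
    and f: "\<And>k. f k \<in> borel_measurable M" "\<And>k x. f k x < \<infinity>"
    and eq: "\<And>k. density M (f k) = density N (f k)"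
    and null: "emeasure M {x\<in>space M. \<forall>k. f k x = 0} = 0" "emeasure N {x\<in>space M. \<forall>k. f k x = 0} = 0"
  shows "M = N"
proof (rule measure_eqI[OF s])
  fix A assume A: "A \<in> sets M"
  note f(1)[measurable]
  define U where "U k = {x\<in>space M. f k x \<noteq> 0}" for k
  have U: "U k \<in> sets M" for k unfolding U_def by measurable
  have U': "disjointed U k \<in> sets M" for k using sets.range_disjointed_sets[of U M] U by blast
  define Z where "Z = {x\<in>space M. \<forall>k. f k x = 0}"
  have Z: "Z \<in> sets M" unfolding Z_def by measurable
  have part: "emeasure L (A \<inter> disjointed U k) = (\<integral>\<^sup>+x. inverse (f k x) * indicator (A \<inter> disjointed U k) x \<partial>density L (f k))"
    if "sets L = sets M" for L k
  proof -
    have fm: "f k \<in> borel_measurable L" using f(1) measurable_cong_sets[OF that refl] by blast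
    have "(\<integral>\<^sup>+x. inverse (f k x) * indicator (A \<inter> disjointed U k) x \<partial>density L (f k))
        = (\<integral>\<^sup>+x. f k x * (inverse (f k x) * indicator (A \<inter> disjointed U k) x) \<partial>L)"
      using fm A U'[of k] that by (intro nn_integral_density) auto
    also have "\<dots> = (\<integral>\<^sup>+x. indicator (A \<inter> disjointed U k) x \<partial>L)"
    proof (rule nn_integral_cong)
      fix x
      have "f k x * inverse (f k x) = 1" if "x \<in> disjointed U k"
        using that disjointed_subset[of U k] f(2)[of k x] by (auto simp: U_def less_top divide_ennreal_def[symmetric] intro!: ennreal_divide_self)
      then show "f k x * (inverse (f k x) * indicator (A \<inter> disjointed U k) x) = indicator (A \<inter> disjointed U k) x"
        by (auto simp: indicator_def)
    qed
    finally show ?thesis using A U'[of k] that by simp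
  qed
  have whole: "emeasure L A = (\<Sum>k. emeasure L (A \<inter> disjointed U k))" if L: "sets L = sets M" "emeasure L Z = 0" for L
  proof -
    have "(\<Sum>k. emeasure L (A \<inter> disjointed U k)) = emeasure L (\<Union>k. A \<inter> disjointed U k)"
      using A U' disjoint_family_disjointed[of U] L by (intro suminf_emeasure) (auto simp: disjoint_family_on_def)
    also have "(\<Union>k. A \<inter> disjointed U k) = A - Z"
      using UN_disjointed_eq[of U] sets.sets_into_space[OF A] by (auto simp: U_def Z_def)
    also have "emeasure L (A - Z) = emeasure L A"
      using L Z A by (intro emeasure_Diff_null_set) (auto simp: null_sets_def)
    finally show ?thesis ..
  qed
  have "emeasure M (A \<inter> disjointed U k) = emeasure N (A \<inter> disjointed U k)" for k
    unfolding part[OF refl] part[OF s[symmetric]] eq ..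
  then show "emeasure M A = emeasure N A"
    using whole[of M] whole[of N] s null by (simp add: Z_def)
qed

section \<open>Uniqueness of the Levy measure on compact sets\<close>

text \<open>Up to the constant 4, the factor that a symmetric difference of order four puts in front
  of a character. Order two would leave the Gaussian variance as a constant; order four removes it,
  and the factor is still integrable against a Levy measure and vanishes only where \<open>b\<close>
  is a multiple of \<open>2 * pi\<close>.\<close>

abbreviation cos_weight :: "('a \<Rightarrow> real) \<Rightarrow> 'a \<Rightarrow> real" where
  "cos_weight b x \<equiv> (1 - cos (b x))\<^sup>2"

text \<open>With \<open>w = iexp v\<close> the coefficients 1, -4, 6, -4, 1 are those of
  \<open>(1 - w)^4 / w^2 = (w - 2 + 1 / w)^2 = 4 * (1 - cos v)^2\<close>.\<close>

lemma iexp_fourth_difference: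
  "6 * iexp u - 4 * iexp (u + v) - 4 * iexp (u - v) + iexp (u + 2 * v) + iexp (u - 2 * v)
    = 4 * (iexp u * of_real ((1 - cos v)\<^sup>2))"
proof -
  define w w' z where "w = iexp v" and "w' = iexp (- v)" and "z = iexp u"
  have ww: "w * w' = 1" unfolding w_def w'_def by (simp flip: exp_add)
  have c: "complex_of_real (cos v) = (w + w') / 2"
    unfolding w_def w'_def by (simp add: complex_eq_iff Re_exp Im_exp)
  have e: "iexp (u + v) = z * w" "iexp (u - v) = z * w'" "iexp (u + 2 * v) = z * w\<^sup>2" "iexp (u - 2 * v) = z * w'\<^sup>2"
    unfolding w_def w'_def z_def by (simp_all add: power2_eq_square algebra_simps flip: exp_add)
  have "6 * z - 4 * (z * w) - 4 * (z * w') + z * w\<^sup>2 + z * w'\<^sup>2 = 4 * (z * (1 - (w + w') / 2)\<^sup>2) + 2 * z * (1 - w * w')"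
    by (simp add: power2_eq_square field_simps)
  moreover have "complex_of_real ((1 - cos v)\<^sup>2) = (1 - (w + w') / 2)\<^sup>2"
    unfolding of_real_power of_real_diff c by simp
  ultimately show ?thesis unfolding e z_def[symmetric] using ww by simp
qed

lemma cos_weight_finite:
  assumes "sets \<nu> = sets borel" "b \<in> borel_measurable borel" "integrable \<nu> (\<lambda>x. 1 - cos (b x))"
  shows "integrable \<nu> (cos_weight b)" "finite_measure (density \<nu> (\<lambda>x. ennreal (cos_weight b x)))"
proof -
  have [measurable]: "b \<in> borel_measurable \<nu>" using assms(2) measurable_cong_sets[OF assms(1) refl] by blast
  show i: "integrable \<nu> (cos_weight b)"
  proof (rule Bochner_Integration.integrable_bound[OF integrable_mult_right[OF assms(3), of 2]])
    show "AE x in \<nu>. norm (cos_weight b x) \<le> norm (2 * (1 - cos (b x)))"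
    proof (rule AE_I2)
      fix x
      have "(1 - cos (b x)) * (1 - cos (b x)) \<le> 2 * (1 - cos (b x))"
        using cos_ge_minus_one[of "b x"] cos_le_one[of "b x"] by (intro mult_right_mono) auto
      then show "norm (cos_weight b x) \<le> norm (2 * (1 - cos (b x)))" by (simp add: power2_eq_square abs_mult)
    qed
  qed simp
  have "emeasure (density \<nu> (\<lambda>x. ennreal (cos_weight b x))) (space \<nu>) = (\<integral>\<^sup>+x. ennreal (cos_weight b x) \<partial>\<nu>)"
    by (subst emeasure_density) (auto intro!: nn_integral_cong)
  also have "\<dots> < \<infinity>" using integrableD(2)[OF i] by (simp add: top.not_eq_extremum)
  finally show "finite_measure (density \<nu> (\<lambda>x. ennreal (cos_weight b x)))"
    by (intro finite_measureI) simp
qed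

text \<open>The fourth difference in direction \<open>b\<close> removes the drift, the Gaussian part and the compensator,
  and turns the Levy measure into a finite measure.\<close>

lemma levy_exponent_difference:
  fixes \<nu> :: "'a::locally_convex_space measure" and Q :: "('a \<Rightarrow> real) \<Rightarrow> 'a"
  assumes Q: "symmetric_positive Q" and \<nu>: "sets \<nu> = sets borel"
    and int: "\<And>a. a \<in> dual_space \<Longrightarrow> integrable \<nu> (compensated H a)"
    and \<psi>: "\<And>a. \<psi> a = \<i> * of_real (a \<gamma>) - of_real (a (Q a)) / 2 + (CLINT x|\<nu>. compensated H a x)"
    and a: "a \<in> dual_space" and b: "b \<in> dual_space"
  defines "\<phi> s \<equiv> \<psi> (\<lambda>x. a x + s * b x)"
  shows "6 * \<phi> 0 - 4 * \<phi> 1 - 4 * \<phi> (- 1) + \<phi> 2 + \<phi> (- 2)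
    = 4 * fourier (density \<nu> (\<lambda>x. ennreal (cos_weight b x))) a"
proof -
  have ms: "a \<in> borel_measurable \<nu>" "b \<in> borel_measurable \<nu>"
    using dual_space_measurable[OF a] dual_space_measurable[OF b] measurable_cong_sets[OF \<nu> refl] by blast+
  note ms[measurable]
  define c where "c s x = compensated H (\<lambda>x. a x + s * b x) x" for s x
  have ic: "integrable \<nu> (c s)" for s
    using int[OF dual_space_add_scaled[OF a b]] by (simp add: c_def[abs_def])
  have q: "(\<lambda>x. a x + s * b x) (Q (\<lambda>x. a x + s * b x)) = a (Q a) + s * (2 * a (Q b)) + s\<^sup>2 * b (Q b)" for s
  proof -
    have sb: "(\<lambda>x. s * b x) \<in> dual_space" by (rule dual_space_scale[OF b])
    have "Q (\<lambda>x. a x + s * b x) = Q a + s *\<^sub>R Q b"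
      using Q a b sb unfolding symmetric_positive_def by simp
    moreover have "b (Q a) = a (Q b)" using Q a b unfolding symmetric_positive_def by blast
    moreover have "linear a" "linear b" using a b by (auto dest: dual_space_linear)
    ultimately show ?thesis by (simp add: linear_add linear_scale power2_eq_square algebra_simps)
  qed
  have \<phi>: "\<phi> s = \<i> * of_real (a \<gamma> + s * b \<gamma>) - of_real (a (Q a) + s * (2 * a (Q b)) + s\<^sup>2 * b (Q b)) / 2 + integral\<^sup>L \<nu> (c s)" for s
    unfolding \<phi>_def \<psi> q c_def[abs_def] ..
  \<comment> \<open>The coefficients sum to 0, and so do their products with \<open>s\<close> and
    with \<open>s^2\<close> over \<open>s = 0, 1, -1, 2, -2\<close>; hence drift, Gaussian part, the
    constant -1 and the compensator all cancel.\<close>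
  have "6 * \<phi> 0 - 4 * \<phi> 1 - 4 * \<phi> (- 1) + \<phi> 2 + \<phi> (- 2)
      = 6 * integral\<^sup>L \<nu> (c 0) - 4 * integral\<^sup>L \<nu> (c 1) - 4 * integral\<^sup>L \<nu> (c (- 1)) + integral\<^sup>L \<nu> (c 2) + integral\<^sup>L \<nu> (c (- 2))"
    unfolding \<phi> by (simp add: field_simps)
  also have "\<dots> = (\<integral>x. 6 * c 0 x - 4 * c 1 x - 4 * c (- 1) x + c 2 x + c (- 2) x \<partial>\<nu>)"
    using ic by simp
  also have "\<dots> = (\<integral>x. 4 * (cos_weight b x *\<^sub>R iexp (a x)) \<partial>\<nu>)"
  proof (intro Bochner_Integration.integral_cong refl)
    fix x
    have "6 * c 0 x - 4 * c 1 x - 4 * c (- 1) x + c 2 x + c (- 2) x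
      = 6 * iexp (a x) - 4 * iexp (a x + b x) - 4 * iexp (a x - b x) + iexp (a x + 2 * b x) + iexp (a x - 2 * b x)"
      unfolding c_def compensated_def by (simp add: algebra_simps)
    also have "\<dots> = 4 * (cos_weight b x *\<^sub>R iexp (a x))" unfolding iexp_fourth_difference by (simp add: scaleR_conv_of_real mult.commute)
    finally show "6 * c 0 x - 4 * c 1 x - 4 * c (- 1) x + c 2 x + c (- 2) x = 4 * (cos_weight b x *\<^sub>R iexp (a x))" .
  qed
  also have "\<dots> = 4 * fourier (density \<nu> (\<lambda>x. ennreal (cos_weight b x))) a"
    unfolding fourier_def integral_mult_right_zero by (subst integral_density) auto
  finally show ?thesis .
qed

lemma fourier_ray_continuous:
  assumes "finite_measure M" "a \<in> borel_measurable M"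
  shows "continuous_on UNIV (\<lambda>t. fourier M (\<lambda>x. t * a x))"
  unfolding continuous_on_sequentially
proof (intro allI ballI impI)
  fix x t assume A: "(\<forall>n. x n \<in> UNIV) \<and> x \<longlonglongrightarrow> (t :: real)"
  have "(\<lambda>n. fourier M (\<lambda>y. x n * a y)) \<longlonglongrightarrow> fourier M (\<lambda>y. t * a y)"
    unfolding fourier_def
  proof (rule integral_dominated_convergence[where w = "\<lambda>_. 1"])
    show "integrable M (\<lambda>_. 1 :: real)" using finite_measure.integrable_const[OF assms(1)] .
    show "AE y in M. (\<lambda>n. iexp (x n * a y)) \<longlonglongrightarrow> iexp (t * a y)"
      using A by (intro AE_I2 tendsto_intros) auto
  qed (use assms in auto)
  then show "((\<lambda>t. fourier M (\<lambda>y. t * a y)) \<circ> x) \<longlonglongrightarrow> fourier M (\<lambda>y. t * a y)" by (simp add: o_def)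
qed

text \<open>The imaginary part is continuous with values in the multiples of \<open>2 * pi\<close>;
  a value different from 0 would force it to pass through \<open>pi\<close> or
  \<open>- pi\<close>.\<close>

lemma exp_eq_1_continuous_const:
  fixes h :: "real \<Rightarrow> complex"
  assumes h: "continuous_on UNIV h" "\<And>t. exp (h t) = 1" and 0: "Im (h 0) = 0"
  shows "h t = 0"
proof -
  have R: "Re (h t) = 0 \<and> (\<exists>n::int. Im (h t) = of_int (2 * n) * pi)" for t
    using h(2)[of t] unfolding exp_eq_1 .
  have c: "continuous_on UNIV (\<lambda>t. Im (h t))" using h(1) by (intro continuous_intros)
  have "\<not> (\<exists>s. Im (h s) \<noteq> 0)"
  proof
    assume "\<exists>s. Im (h s) \<noteq> 0"
    then obtain s where s: "Im (h s) \<noteq> 0" ..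
    have conn: "connected ((\<lambda>t. Im (h t)) ` UNIV)" by (rule connected_continuous_image[OF c connected_UNIV])
    define v where "v = (if Im (h s) > 0 then pi else - pi)"
    obtain n :: int where n: "Im (h s) = of_int (2 * n) * pi" using R[of s] by blast
    have "n \<noteq> 0" using s n by auto
    then have "of_int n \<ge> (1::real) \<or> of_int n \<le> (-1::real)" by linarith
    then have "Im (h s) \<ge> 2 * pi \<or> Im (h s) \<le> - 2 * pi"
    proof
      assume "of_int n \<ge> (1::real)"
      then have "1 * (2 * pi) \<le> of_int n * (2 * pi)" by (intro mult_right_mono) auto
      then show ?thesis using n by simp
    next
      assume "of_int n \<le> (-1::real)"
      then have "of_int n * (2 * pi) \<le> (-1) * (2 * pi)" by (intro mult_right_mono) auto
      then show ?thesis using n by simp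
    qed
    then have v: "(Im (h 0) \<le> v \<and> v \<le> Im (h s)) \<or> (Im (h s) \<le> v \<and> v \<le> Im (h 0))"
      unfolding v_def 0 using pi_gt_zero by auto
    then have "v \<in> (\<lambda>t. Im (h t)) ` UNIV"
      using connected_contains_Icc[OF conn, of "Im (h 0)" "Im (h s)"] connected_contains_Icc[OF conn, of "Im (h s)" "Im (h 0)"] by auto
    then obtain u where "Im (h u) = v" by auto
    then obtain m :: int where "v = of_int (2 * m) * pi" using R[of u] by metis
    then have "v / pi = of_int (2 * m)" by simp
    moreover have "v / pi = 1 \<or> v / pi = - 1" unfolding v_def by simp
    ultimately have "(1::real) = of_int (2 * m) \<or> (-1::real) = of_int (2 * m)" by argo
    then have "2 * m = 1 \<or> 2 * m = - 1" by (metis of_int_1 of_int_eq_iff of_int_minus)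
    then show False by presburger
  qed
  then show ?thesis using R[of t] by (auto simp: complex_eq_iff)
qed

text \<open>The exponential of the fourth difference is a product \<open>E\<close> of powers of
  transforms of \<open>\<mu>\<close>, hence the same for both representations. Along the ray
  \<open>t * a\<close> the difference of the two exponents is continuous with exponential 1, and it
  is real at \<open>t = 0\<close>, where both transforms are total masses.\<close>

lemma corresponding_levy_measure_cos_weight:
  fixes \<mu> \<nu>\<^sub>1 \<nu>\<^sub>2 :: "'a::locally_convex_space measure"
  assumes 1: "corresponding_levy_measure \<mu> \<nu>\<^sub>1" and 2: "corresponding_levy_measure \<mu> \<nu>\<^sub>2"
    and a: "a \<in> dual_space" and b: "b \<in> dual_space"
  shows "fourier (density \<nu>\<^sub>1 (\<lambda>x. ennreal (cos_weight b x))) a = fourier (density \<nu>\<^sub>2 (\<lambda>x. ennreal (cos_weight b x))) a"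
proof -
  define N where "N \<nu> = density \<nu> (\<lambda>x. ennreal (cos_weight b x))" for \<nu> :: "'a measure"
  define E where "E a = fourier \<mu> (\<lambda>x. a x + 0 * b x) ^ 6 * inverse (fourier \<mu> (\<lambda>x. a x + 1 * b x) ^ 4)
    * inverse (fourier \<mu> (\<lambda>x. a x + (-1) * b x) ^ 4) * fourier \<mu> (\<lambda>x. a x + 2 * b x) * fourier \<mu> (\<lambda>x. a x + (-2) * b x)" for a
  have key: "sets \<nu> = sets borel \<and> finite_measure (N \<nu>) \<and> (\<forall>a\<in>dual_space. exp (4 * fourier (N \<nu>) a) = E a)"
    if \<nu>: "corresponding_levy_measure \<mu> \<nu>" for \<nu>
  proof -
    have s: "sets \<nu> = sets borel" using \<nu> by (simp add: corresponding_levy_measure_def levy_measure_def)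
    obtain \<gamma> Q H where R: "symmetric_positive Q"
      "\<And>a. a \<in> dual_space \<Longrightarrow> integrable \<nu> (compensated H a)"
      "\<And>a. a \<in> dual_space \<Longrightarrow> fourier \<mu> a = exp (\<i> * of_real (a \<gamma>) - of_real (a (Q a)) / 2 + (CLINT x|\<nu>. compensated H a x))"
      using \<nu> unfolding corresponding_levy_measure_def by blast
    define \<psi> where "\<psi> a = \<i> * of_real (a \<gamma>) - of_real (a (Q a)) / 2 + (CLINT x|\<nu>. compensated H a x)" for a
    have "exp (4 * fourier (N \<nu>) a) = E a" if a: "a \<in> dual_space" for a
    proof -
      define \<phi> where "\<phi> s = \<psi> (\<lambda>x. a x + s * b x)" for s
      have F: "fourier \<mu> (\<lambda>x. a x + s * b x) = exp (\<phi> s)" for s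
        unfolding \<phi>_def \<psi>_def by (rule R(3)[OF dual_space_add_scaled[OF a b]])
      have d: "6 * \<phi> 0 - 4 * \<phi> 1 - 4 * \<phi> (- 1) + \<phi> 2 + \<phi> (- 2) = 4 * fourier (N \<nu>) a"
        unfolding \<phi>_def N_def by (rule levy_exponent_difference[OF R(1) s R(2) \<psi>_def a b])
      have "exp (6 * \<phi> 0 - 4 * \<phi> 1 - 4 * \<phi> (- 1) + \<phi> 2 + \<phi> (- 2)) = E a"
        unfolding E_def F exp_of_nat_mult[symmetric] exp_minus[symmetric] exp_add[symmetric] by simp
      then show ?thesis unfolding d .
    qed
    moreover have "finite_measure (N \<nu>)"
      unfolding N_def by (rule cos_weight_finite(2)[OF s dual_space_measurable[OF b] integrable_one_minus_cos[OF R(2)[OF b]]])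
    ultimately show ?thesis using s by blast
  qed
  note k1 = key[OF 1] and k2 = key[OF 2]
  have am: "a \<in> borel_measurable (N \<nu>)" if "sets \<nu> = sets borel" for \<nu>
    using dual_space_measurable[OF a] measurable_cong_sets[of "N \<nu>" borel borel borel] that by (simp add: N_def)
  define h where "h t = 4 * fourier (N \<nu>\<^sub>1) (\<lambda>x. t * a x) - 4 * fourier (N \<nu>\<^sub>2) (\<lambda>x. t * a x)" for t
  have "h 1 = 0"
  proof (rule exp_eq_1_continuous_const)
    show "continuous_on UNIV h"
      unfolding h_def using k1 k2 am by (intro continuous_intros fourier_ray_continuous) auto
    have nz: "E a \<noteq> 0" if "a \<in> dual_space" for a using k1 that by (metis exp_not_eq_zero)
    show "exp (h t) = 1" for t
      unfolding h_def exp_diff using k1 k2 nz dual_space_scale[OF a] by simp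
    show "Im (h 0) = 0" unfolding h_def fourier_def by simp
  qed
  then show ?thesis unfolding h_def N_def by simp
qed

text \<open>The weighted images under \<open>T\<close> are finite measures on the sequence space
  with equal Fourier transforms. On the image of \<open>T\<close> the countably many weights vanish
  together only at \<open>T 0\<close>, which carries no mass, so the unweighted images agree. On
  compact sets this is transferred back to \<open>E\<close>, and complements of compact sets are
  preimages of Borel sets as well.\<close>

theorem corresponding_levy_measure_unique_on_compact:
  fixes \<mu> \<nu>\<^sub>1 \<nu>\<^sub>2 :: "'a::locally_convex_space measure" and g :: "'p::second_countable_topology \<Rightarrow> 'a"
  assumes g: "continuous_on UNIV g" "surj g"
    and 1: "corresponding_levy_measure \<mu> \<nu>\<^sub>1" and 2: "corresponding_levy_measure \<mu> \<nu>\<^sub>2" and K: "compact K"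
  shows "meas_restr \<nu>\<^sub>1 K = meas_restr \<nu>\<^sub>2 K" "emeasure \<nu>\<^sub>1 (- K) = emeasure \<nu>\<^sub>2 (- K)"
proof -
  obtain \<xi> :: "nat \<Rightarrow> 'a \<Rightarrow> real" where \<xi>: "\<And>k. \<xi> k \<in> dual_space" "\<And>x y. x \<noteq> y \<Longrightarrow> \<exists>k. \<xi> k x \<noteq> \<xi> k y"
    by (rule suslin_separating_sequence[OF g]) blast
  define T where "T x k = \<xi> k x" for x k
  have T: "continuous_on UNIV T"
    unfolding T_def[abs_def] by (intro continuous_on_coordinatewise_then_product dual_space_continuous \<xi>)
  have Ti: "inj T" using \<xi>(2) by (intro injI) (metis T_def)
  have Tm: "T \<in> borel \<rightarrow>\<^sub>M borel" by (rule borel_measurable_continuous_onI[OF T])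
  have s: "sets \<nu>\<^sub>1 = sets borel" "sets \<nu>\<^sub>2 = sets borel" and z: "emeasure \<nu>\<^sub>1 {0} = 0" "emeasure \<nu>\<^sub>2 {0} = 0"
    using 1 2 by (auto simp: corresponding_levy_measure_def levy_measure_def)
  have Tm': "T \<in> M \<rightarrow>\<^sub>M borel" if "sets M = sets borel" for M
    using Tm measurable_cong_sets[OF that refl] by blast
  have dual: "(\<lambda>x. rcomb c (T x)) \<in> dual_space" for c
  proof -
    have "linear (\<lambda>x. rcomb c (T x))"
      unfolding rcomb_def T_def
      by (intro linear_compose_sum ballI) (use dual_space_linear[OF dual_space_scale[OF \<xi>(1)]] in auto)
    then show ?thesis using rcomb_continuous_comp[OF T] by (simp add: dual_space_def)
  qed
  define f where "f i z = ennreal (cos_weight (rcomb (from_nat i)) z)" for i :: nat and z :: "nat \<Rightarrow> real"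
  have f: "f i \<in> borel_measurable borel" for i unfolding f_def by measurable
  define P where "P M = distr M borel T" for M :: "'a measure"
  have dens: "density (P M) (f i) = distr (density M (\<lambda>x. ennreal (cos_weight (\<lambda>x. rcomb (from_nat i) (T x)) x))) borel T"
    if M: "sets M = sets borel" for M i
  proof (rule measure_eqI)
    fix A assume "A \<in> sets (density (P M) (f i))"
    then have A: "A \<in> sets borel" by (simp add: P_def)
    have fP: "f i \<in> borel_measurable (P M)" using f by (simp add: P_def)
    have "emeasure (density (P M) (f i)) A = (\<integral>\<^sup>+z. f i z * indicator A z \<partial>P M)"
      using A fP by (intro emeasure_density) (simp_all add: P_def)
    also have "\<dots> = (\<integral>\<^sup>+x. f i (T x) * indicator A (T x) \<partial>M)"
      unfolding P_def using f A by (intro nn_integral_distr Tm'[OF M]) simp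
    also have "\<dots> = (\<integral>\<^sup>+x. f i (T x) * indicator (T -` A \<inter> space M) x \<partial>M)"
      by (intro nn_integral_cong) (simp add: indicator_def)
    also have "\<dots> = emeasure (density M (\<lambda>x. f i (T x))) (T -` A \<inter> space M)"
      using measurable_compose[OF Tm'[OF M] f] measurable_sets[OF Tm'[OF M] A] by (intro emeasure_density[symmetric]) auto
    also have "\<dots> = emeasure (distr (density M (\<lambda>x. f i (T x))) borel T) A"
      using Tm'[OF M] A by (subst emeasure_distr) auto
    finally show "emeasure (density (P M) (f i)) A = emeasure (distr (density M (\<lambda>x. ennreal (cos_weight (\<lambda>x. rcomb (from_nat i) (T x)) x))) borel T) A"
      unfolding f_def .
  qed (simp add: P_def)
  have PP: "P \<nu>\<^sub>1 = P \<nu>\<^sub>2"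
  proof (rule measure_eqI_densities)
    show "sets (P \<nu>\<^sub>1) = sets (P \<nu>\<^sub>2)" by (simp add: P_def)
    show "f i \<in> borel_measurable (P \<nu>\<^sub>1)" for i using f by (simp add: P_def)
    show "f i z < \<infinity>" for i z by (simp add: f_def)
    show "density (P \<nu>\<^sub>1) (f i) = density (P \<nu>\<^sub>2) (f i)" for i
    proof -
      let ?b = "\<lambda>x. rcomb (from_nat i) (T x)"
      let ?N = "\<lambda>\<nu>. density \<nu> (\<lambda>x. ennreal (cos_weight ?b x))"
      have TN: "T \<in> ?N \<nu> \<rightarrow>\<^sub>M borel" if "sets \<nu> = sets borel" for \<nu> using Tm'[OF that] by simp
      have fin: "finite_measure (distr (?N \<nu>) borel T)" if \<nu>: "corresponding_levy_measure \<mu> \<nu>" "sets \<nu> = sets borel" for \<nu>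
      proof -
        obtain H where "\<forall>a\<in>dual_space. integrable \<nu> (compensated H a)"
          using \<nu>(1) unfolding corresponding_levy_measure_def by blast
        then have "integrable \<nu> (\<lambda>x. 1 - cos (?b x))"
          by (intro integrable_one_minus_cos) (rule bspec[OF _ dual])
        then show ?thesis
          by (intro finite_measure.finite_measure_distr cos_weight_finite(2)[OF \<nu>(2) dual_space_measurable[OF dual]] TN[OF \<nu>(2)])
      qed
      have "distr (?N \<nu>\<^sub>1) borel T = distr (?N \<nu>\<^sub>2) borel T"
      proof (rule fourier_inject)
        show "fourier (distr (?N \<nu>\<^sub>1) borel T) (rcomb c) = fourier (distr (?N \<nu>\<^sub>2) borel T) (rcomb c)" for c
          unfolding fourier_distr[OF TN[OF s(1)] rcomb_measurable] fourier_distr[OF TN[OF s(2)] rcomb_measurable]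
          by (rule corresponding_levy_measure_cos_weight[OF 1 2 dual dual])
      qed (use fin 1 2 s in auto)
      then show ?thesis unfolding dens[OF s(1)] dens[OF s(2)] .
    qed
    \<comment> \<open>If all weights vanish at \<open>T x\<close>, every character is 1 there,
      whereas the characters separate \<open>T x\<close> from \<open>T 0\<close> when
      \<open>x \<noteq> 0\<close>.\<close>
    have "T -` {z. \<forall>i. f i z = 0} = {0}"
    proof -
      have "x = 0" if x: "\<And>i. f i (T x) = 0" for x
      proof (rule ccontr)
        assume "x \<noteq> 0"
        then have "T x \<noteq> T 0" using Ti by (auto simp: inj_eq)
        from rcomb_separates[OF this] obtain c where c: "iexp (rcomb c (T x)) \<noteq> iexp (rcomb c (T 0))" ..
        have "f (to_nat c) (T x) = 0" by (rule x)
        then have "cos (rcomb c (T x)) = 1" by (simp add: f_def)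
        moreover have "rcomb c (T 0) = 0" using linear_0[OF dual_space_linear[OF dual]] .
        ultimately show False using c cos_one_sin_zero by (auto simp: complex_eq_iff Re_exp Im_exp)
      qed
      moreover have "f i (T 0) = 0" for i
        using linear_0[OF dual_space_linear[OF dual]] by (simp add: f_def)
      ultimately show ?thesis by auto
    qed
    moreover have "{z. \<forall>i. f i z = 0} \<in> sets borel"
    proof -
      have "{z \<in> space borel. \<forall>i. f i z = 0} \<in> sets borel" using f by measurable
      then show ?thesis by simp
    qed
    ultimately have *: "emeasure (P \<nu>) {z. \<forall>i. f i z = 0} = emeasure \<nu> {0}" if "sets \<nu> = sets borel" for \<nu>
      unfolding P_def using Tm'[OF that] sets_eq_imp_space_eq[OF that] by (subst emeasure_distr) auto
    show "emeasure (P \<nu>\<^sub>1) {z\<in>space (P \<nu>\<^sub>1). \<forall>i. f i z = 0} = 0" "emeasure (P \<nu>\<^sub>2) {z\<in>space (P \<nu>\<^sub>1). \<forall>i. f i z = 0} = 0"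
      using *[OF s(1)] *[OF s(2)] z by (simp_all add: P_def)
  qed
  have vim: "emeasure \<nu>\<^sub>1 (T -` C) = emeasure \<nu>\<^sub>2 (T -` C)" if C: "C \<in> sets borel" for C
  proof -
    have "emeasure (P M) C = emeasure M (T -` C)" if "sets M = sets borel" for M
      unfolding P_def using Tm'[OF that] C sets_eq_imp_space_eq[OF that] by (subst emeasure_distr) auto
    then show ?thesis using PP s by metis
  qed
  have Kb: "K \<in> sets borel" by (rule borel_closed[OF compact_imp_closed[OF K]])
  show "meas_restr \<nu>\<^sub>1 K = meas_restr \<nu>\<^sub>2 K"
  proof (rule measure_eqI)
    fix B assume "B \<in> sets (meas_restr \<nu>\<^sub>1 K)"
    then have B: "B \<in> sets borel" by (simp add: s)
    obtain C where C: "C \<in> sets borel" "K \<inter> B = T -` C" by (rule compact_borel_vimage[OF T Ti K B])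
    show "emeasure (meas_restr \<nu>\<^sub>1 K) B = emeasure (meas_restr \<nu>\<^sub>2 K) B"
      using Kb B vim[OF C(1)] by (simp add: emeasure_meas_restr s C(2))
  qed (simp add: s)
  obtain C where C: "C \<in> sets borel" "K \<inter> UNIV = T -` C" by (rule compact_borel_vimage[OF T Ti K, of UNIV]) auto
  then have "- K = T -` (- C)" by auto
  then show "emeasure \<nu>\<^sub>1 (- K) = emeasure \<nu>\<^sub>2 (- K)" using vim[of "- C"] C(1) by simp
qed

section \<open>Equivalence of the assertions\<close>

theorem theorem4p9:
  fixes \<mu> \<nu> :: "'a::{locally_convex_space, complete_uniform_space} measure"
    and g :: "'p::polish_space \<Rightarrow> 'a"
  assumes suslin: "continuous_on UNIV g" "surj g"
    and \<mu>: "\<mu> \<in> infinitely_divisible"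
    and \<nu>: "corresponding_levy_measure \<mu> \<nu>"
  shows
    "let \<K> = {K \<in> separable_compact_disks. emeasure \<nu> (- K) < \<infinity>};
         A2 = (\<lambda>K. \<exists>\<rho>. gen_poisson_exp euclidean (meas_restr \<nu> K) \<rho> \<and> emeasure \<rho> (disk_span K) = 1);
         A3 = (\<lambda>K. \<exists>\<rho>\<in>prob_borel_measures (gauge_topology K). \<forall>a\<in>dual_space.
                 fourier \<rho> a = exp (CLINT x:disk_span K|\<nu>. compensated K a x));
         A4 = (\<lambda>K. levy_measure (gauge_topology K)
                      (restrict_space (meas_restr \<nu> K) (disk_span K)));
         A5 = (\<lambda>K. levy_measure (subtopology euclidean (disk_span K))
                      (restrict_space (meas_restr \<nu> K) (disk_span K)));
         A6 = (\<lambda>K. \<exists>x. \<forall>\<epsilon>>0. \<exists>n::nat. \<forall>\<rho>\<in>finite_minorants euclidean (meas_restr \<nu> K).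
                 measure (translate_meas euclidean (poisson_exp euclidean \<rho>) (x \<rho>))
                   ((*\<^sub>R) (real n) ` K) > 1 - \<epsilon>)
     in (locally_reducible \<mu> \<longleftrightarrow> (\<exists>K\<in>\<K>. A2 K)) \<and>
        (locally_reducible_levy \<nu> \<longleftrightarrow> (\<exists>K\<in>\<K>. A2 K)) \<and>
        (locally_reducible \<mu> \<longleftrightarrow> (\<exists>K\<in>\<K>. A3 K)) \<and>
        (locally_reducible \<mu> \<longleftrightarrow> (\<exists>K\<in>\<K>. A4 K)) \<and>
        (locally_reducible \<mu> \<longleftrightarrow> (\<exists>K\<in>\<K>. A5 K)) \<and>
        (locally_reducible \<mu> \<longleftrightarrow> (\<exists>K\<in>\<K>. A6 K)) \<and>
        (\<forall>K\<in>\<K>. (A2 K \<longleftrightarrow> A3 K) \<and> (A2 K \<longleftrightarrow> A4 K) \<and> (A2 K \<longleftrightarrow> A5 K) \<and> (A2 K \<longleftrightarrow> A6 K))"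
proof -
  have levy: "levy_measure euclidean \<nu>" using \<nu> unfolding corresponding_levy_measure_def by (rule conjunct1)
  have "sets \<nu> = sets (borel_of euclidean) \<and> emeasure \<nu> {0} = 0" using levy unfolding levy_measure_def by blast
  then have sets: "sets \<nu> = sets borel" and z: "emeasure \<nu> {0} = 0" by simp_all
  obtain H where "\<forall>b\<in>dual_space. integrable \<nu> (compensated H b)"
    using \<nu> unfolding corresponding_levy_measure_def by blast
  then have int: "\<And>b. b \<in> dual_space \<Longrightarrow> integrable \<nu> (compensated H b)" by blast
  define \<K> where "\<K> = {K \<in> separable_compact_disks. emeasure \<nu> (- K) < \<infinity>}"
  define A2 where "A2 K \<longleftrightarrow> (\<exists>\<rho>. gen_poisson_exp euclidean (meas_restr \<nu> K) \<rho> \<and> emeasure \<rho> (disk_span K) = 1)" for K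
  define A3 where "A3 K \<longleftrightarrow> (\<exists>\<rho>\<in>prob_borel_measures (gauge_topology K). \<forall>a\<in>dual_space.
                 fourier \<rho> a = exp (CLINT x:disk_span K|\<nu>. compensated K a x))" for K
  define A4 where "A4 K \<longleftrightarrow> levy_measure (gauge_topology K) (restrict_space (meas_restr \<nu> K) (disk_span K))" for K
  define A5 where "A5 K \<longleftrightarrow> levy_measure (subtopology euclidean (disk_span K)) (restrict_space (meas_restr \<nu> K) (disk_span K))" for K
  define A6 where "A6 K \<longleftrightarrow> (\<exists>x. \<forall>\<epsilon>>0. \<exists>n::nat. \<forall>\<rho>\<in>finite_minorants euclidean (meas_restr \<nu> K).
                 measure (translate_meas euclidean (poisson_exp euclidean \<rho>) (x \<rho>)) ((*\<^sub>R) (real n) ` K) > 1 - \<epsilon>)" for K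
  have eq: "(A2 K \<longleftrightarrow> A3 K) \<and> (A2 K \<longleftrightarrow> A4 K) \<and> (A2 K \<longleftrightarrow> A5 K) \<and> (A2 K \<longleftrightarrow> A6 K)" if "K \<in> \<K>" for K
  proof -
    have disk_K: "K \<in> separable_compact_disks" "emeasure \<nu> (- K) < \<infinity>" using that by (auto simp: \<K>_def)
    obtain a where "disk_levy_gauge a K (meas_restr \<nu> K)"
      using disk_levy_gauge_restriction[OF suslin sets z int disk_K(1)] by blast
    then interpret disk_levy_gauge a K "meas_restr \<nu> K" .
    show ?thesis
      unfolding A2_def A3_def A4_def A5_def A6_def disk_tight_iff_gen_poisson_exp[symmetric] disk_tight_iff[symmetric]
        levy_gauge_iff_disk_tight levy_sub_iff_disk_tight fourier_disk_iff_disk_tight[OF sets refl disk_K(2)] by simp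
  qed
  have levy_red: "locally_reducible_levy \<nu> \<longleftrightarrow> (\<exists>K\<in>\<K>. A2 K)"
    using levy by (auto simp: locally_reducible_levy_def \<K>_def A2_def)
  \<comment> \<open>Local reducibility of \<open>\<mu>\<close> may be witnessed by another Levy
    measure \<open>\<nu>'\<close>; the two clauses depend only on its restriction to
    \<open>K\<close> and its mass off \<open>K\<close>, where it agrees with
    \<open>\<nu>\<close>.\<close>
  have red: "locally_reducible \<mu> \<longleftrightarrow> (\<exists>K\<in>\<K>. A2 K)"
  proof
    assume "locally_reducible \<mu>"
    then obtain \<nu>' K where \<nu>': "corresponding_levy_measure \<mu> \<nu>'" and K: "K \<in> separable_compact_disks" "emeasure \<nu>' (- K) < \<infinity>"
      "\<exists>\<rho>. gen_poisson_exp euclidean (meas_restr \<nu>' K) \<rho> \<and> emeasure \<rho> (disk_span K) = 1"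
      unfolding locally_reducible_def locally_reducible_levy_def by blast
    have "compact K" using K(1) by (simp add: separable_compact_disks_def)
    note u = corresponding_levy_measure_unique_on_compact[OF suslin \<nu>' \<nu> this]
    show "\<exists>K\<in>\<K>. A2 K"
      using K unfolding u \<K>_def A2_def by blast
  next
    assume "\<exists>K\<in>\<K>. A2 K"
    then show "locally_reducible \<mu>" using levy_red \<mu> \<nu> by (auto simp: locally_reducible_def)
  qed
  show ?thesis
    unfolding Let_def A2_def[symmetric] A3_def[symmetric] A4_def[symmetric] A5_def[symmetric] A6_def[symmetric] \<K>_def[symmetric]
    using levy_red red eq by blast
qed

end
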